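(* Assume that $(q,\underline Q)$ is separate with respect to every $\underline\mu\in\mathscr P^{\bullet,m}_{n+1}$. Let $\underline\lambda\in\mathscr P^{\bullet,m}_n$ and fix $\mathfrak w\in\mathrm{Std}(\underline\lambda)$. (1) If $d_{\underline\lambda}=0$, then for all $\mathrm S=(\mathfrak s,\alpha',\beta')$, $\mathrm T=(\mathfrak t,\alpha,\beta)\in\mathrm{Tri}(\underline\lambda)$: $$(f_{\mathrm S,\mathrm T})^*=\mathrm{sgn}(\mathfrak s,\widehat{\alpha'})\,\mathrm{sgn}(\mathfrak t,\widehat{\alpha})\,f_{\widehat{\mathrm T},\widehat{\mathrm S}},\qquad (f^{\mathfrak w}_{\mathrm S,\mathrm T})^*=\mathrm{sgn}(\mathfrak s,\widehat{\alpha'})\,\mathrm{sgn}(\mathfrak t,\widehat{\alpha})\,f^{\mathfrak w}_{\widehat{\mathrm T},\widehat{\mathrm S}}.$$ (2) If $d_{\underline\lambda}=1$, then for all $a\in\mathbb Z_2$, $\mathrm S=(\mathfrak s,\alpha',\beta')$, $\mathrm T=(\mathfrak t,\alpha,\beta)\in\mathrm{Tri}_{\bar0}(\underline\lambda)$, with $\mathrm T_a=(\mathfrak t,\alpha_a,\beta)$: $$(f_{\mathrm S,\mathrm T_a})^*=\mathrm{sgn}(\mathfrak s,\widehat{\alpha'_{\bar1}})_{\bar0}\,\mathrm{sgn}(\mathfrak t,\widehat{\alpha_{a+\bar1}})_{a+\bar1}\,f_{\widehat{\mathrm T},\widehat{\mathrm S_a}},\qquad (f^{\mathfrak w}_{\mathrm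 S,\mathrm T_a})^*=\mathrm{sgn}(\mathfrak s,\widehat{\alpha'_{\bar1}})_{\bar0}\,\mathrm{sgn}(\mathfrak t,\widehat{\alpha_{a+\bar1}})_{a+\bar1}\,f^{\mathfrak w}_{\widehat{\mathrm T},\widehat{\mathrm S_a}}.$$
   Context: **Algebra.** $\mathbb K$ is an algebraically closed field of characteristic $\ne2$; for every $a\in\mathbb K$ a square root $\sqrt a$ is fixed once and for all. $n\ge1$, $[n]=\{1,\dots,n\}$; $q\in\mathbb K^*$ with $q^2\ne\pm1$, $\epsilon=q-q^{-1}$. For $\iota\in\mathbb K^*$: $\mathtt q(\iota)=2\frac{q\iota+(q\iota)^{-1}}{q+q^{-1}}$, $\mathtt b_\pm(\iota)=\frac{\mathtt q(\iota)}2\pm\sqrt{\frac{\mathtt q(\iota)^2}4-1}$. $\mathcal H_c(n)$ is the $\mathbb K$-superalgebra with even generators $T_1,\dots,T_{n-1},X_1^{\pm1},\dots,X_n^{\pm1}$, odd generators $C_1,\dots,C_n$ and relations: $T_i^2=\epsilon T_i+1$; $T_iT_j=T_jT_i$ ($|i-j|>1$); $T_iT_{i+1}T_i=T_{i+1}T_iT_{i+1}$; $X_iX_j=X_jX_i$; $X_iX_i^{-1}=X_i^{-1}X_i=1$; $C_i^2=1$; $C_iC_j=-C_jC_i$ ($i\ne j$); $T_iX_i=X_{i+1}T_i-\epsilon(X_{i+1}+C_iC_{i+1}X_i)$; $T_iX_j=X_jT_i$ ($j\ne i,i+1$); $T_iC_i=C_{i+1}T_i$; $T_iC_{i+1}=C_iT_i-\epsilon(C_i-C_{i+1})$;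 $T_iC_j=C_jT_i$ ($j\neq i,i+1$); $X_iC_i=C_iX_i^{-1}$; $X_iC_j=C_jX_i$ ($i\ne j$). Fix $m\ge0$, $\underline Q=(Q_1,\dots,Q_m)\in(\mathbb K^* )^m$, $\bullet\in\{\mathsf 0,\mathsf s,\mathsf{ss}\}$, and $f=g\cdot\prod_{i=1}^m(X_1+X_1^{-1}-\mathtt q(Q_i))$ with $g=1,\ X_1-1,\ (X_1-1)(X_1+1)$ for $\bullet=\mathsf0,\mathsf s,\mathsf{ss}$ respectively. $\mathcal H_c^f(n)$ is the quotient of $\mathcal H_c(n)$ by the two-sided ideal generated by $f$. $*$ is the anti-involution of $\mathcal H_c^f(n)$ (unsigned: $(xy)^*=y^*x^*$) with $T_i^*=T_i+\epsilon C_iC_{i+1}$, $C_j^*=C_j$, $X_j^*=X_j$. **Combinatorics.** $\mathscr P^{\bullet,m}_n$ is the set of tuples $\underline\lambda$ of total size $n$: $(\lambda^{(1)},\dots,\lambda^{(m)})$ for $\bullet=\mathsf0$, $(\lambda^{(0)},\lambda^{(1)},\dots,\lambda^{(m)})$ for $\bullet=\mathsf s$, $(\lambda^{(0_-)},\lambda^{(0_+)},\lambda^{(1)},\dots,\lambda^{(m)})$ for $\bullet=\mathsf{ss}$, where $\lambda^{(1)},\dots,\lambda^{(m)}$ are partitions (Young diagrams) and $\lambda^{(0)},\lambda^{(0_\pm)}$ are strict partitions (shifted Young diagrams: row $i$ starts in column $i$). Boxes are written $(i,j,l)$ (row, column, component). $\mathrm{Std}(\underline\lambda)$ is the set of standard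 tableaux, i.e. bijections $\underline\lambda\to[n]$ increasing along rows and down columns of each component; $\mathfrak S_n$ (simple transpositions $s_i$) acts on tableaux by permuting entries; $\mathfrak t^{\underline\lambda}$ is obtained by inserting $1,\dots,n$ consecutively by rows starting from the first component; $d(\mathfrak s,\mathfrak t)\in\mathfrak S_n$ is the element with $\mathfrak s=d(\mathfrak s,\mathfrak t)\mathfrak t$. $\mathcal D_{\underline\lambda}$ is the set of boxes $(a,a,l)$ of the strict components ($\emptyset$ if $\bullet=\mathsf0$), $t=\#\mathcal D_{\underline\lambda}$, $d_{\underline\lambda}\in\{0,1\}$ is the parity of $t$, $\mathcal D_{\mathfrak t}=\mathfrak t(\mathcal D_{\underline\lambda})$. Write $\mathcal D_{\mathfrak t^{\underline\lambda}}=\{i_1<\dots<i_t\}$ and $x_p(\mathfrak t)=d(\mathfrak t,\mathfrak t^{\underline\lambda})(i_p)$; $\mathcal{OD}_{\mathfrak t}=\{x_p(\mathfrak t): p\text{ odd}\}$. With $Q_0=Q_{0_+}=1$, $Q_{0_-}=-1$, $\mathrm{res}_{\mathfrak t}(k)=Q_lq^{2(j-i)}$ if $\mathfrak t(i,j,l)=k$. $(q,\underline Q)$ is *separate* with respect to $\underline\mu\in\mathscr P^{\bullet,m}_{N}$ if $\mathtt q(\mathrm{res}_{\mathfrak u}(k))\ne\mathtt q(\mathrm{res}_{\mathfrak u}(k+1))$ for all $\mathfrak u\in\mathrm{Std}(\underline\mu)$ and $1\le k\le N-1$. For $\beta\in\mathbb Z_2^n$: $\mathrm{supp}(\beta)=\{k:\beta_k=\bar1\}$,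 $C^\beta=C_1^{\beta_1}\cdots C_n^{\beta_n}$, $|\beta|_{>i}=\sum_{k>i}\beta_k$, $\nu_\beta(k)=(-1)^{\beta_k}$, $e_k$ the standard vectors. For $A\subseteq [n]$, $\mathbb Z_2(A)=\{\beta\in\mathbb Z_2^n:\mathrm{supp}(\beta)\subseteq A\}$. **Idempotents.** $\mathbb Z_2(\mathcal{OD}_{\mathfrak t})_{\bar0}$ (resp. $\mathbb Z_2(\mathcal{OD}_{\mathfrak t})_{\bar1}$) is the set of $\alpha\in\mathbb Z_2(\mathcal{OD}_{\mathfrak t})$ with $x_t(\mathfrak t)\notin\mathrm{supp}(\alpha)$ (resp. $\in$); for $t$ even the first is everything, the second empty. $\mathrm{Tri}_a(\underline\lambda)$, $a\in\mathbb Z_2$, is the set of triples $(\mathfrak t,\alpha,\beta)$ with $\mathfrak t\in\mathrm{Std}(\underline\lambda)$, $\alpha\in\mathbb Z_2(\mathcal{OD}_{\mathfrak t})_a$, $\beta\in\mathbb Z_2([n]\setminus\mathcal D_{\mathfrak t})$; $\mathrm{Tri}(\underline\lambda)=\mathrm{Tri}_{\bar0}(\underline\lambda)\sqcup\mathrm{Tri}_{\bar1}(\underline\lambda)$. If $d_{\underline\lambda}=1$ and $\mathrm T=(\mathfrak t,\alpha,\beta)\in\mathrm{Tri}_{\bar0}(\underline\lambda)$, put $\alpha_{\bar0}=\alpha$, $\alpha_{\bar1}=\alpha+e_{x_t(\mathfrak t)}$, $\mathrm T_a=(\mathfrak t,\alpha_a,\beta)$. Let $\gamma_{\mathfrak t}=2^{-\lfloor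 t/2\rfloor}\prod_{k=1}^{\lfloor t/2\rfloor}(1+\sqrt{-1}\,C_{x_{2k-1}(\mathfrak t)}C_{x_{2k}(\mathfrak t)})$, $\mathtt B(k)=\{\mathtt b_\pm(\mathrm{res}_{\mathfrak s}(k))\mid\mathfrak s\in\mathrm{Std}(\underline\mu),\underline\mu\in\mathscr P^{\bullet,m}_n\}$, and for $\mathrm T=(\mathfrak t,\alpha,\beta)\in\mathrm{Tri}_{\bar0}(\underline\lambda)$ $$F_{\mathrm T}=\bigl(C^{\alpha}\gamma_{\mathfrak t}(C^{\alpha})^{-1}\bigr)\prod_{k=1}^n\ \prod_{\mathtt b\in\mathtt B(k),\,\mathtt b\ne\mathtt b_+(\mathrm{res}_{\mathfrak t}(k))}\frac{X_k^{\nu_\beta(k)}-\mathtt b}{\mathtt b_+(\mathrm{res}_{\mathfrak t}(k))-\mathtt b}.$$ **Intertwiners.** $\mathtt b_{\mathfrak t,i}=\mathtt b_-(\mathrm{res}_{\mathfrak t}(i))$. For $x,y\in\mathbb K^*$, $y\ne x^{\pm1}$: $\Phi_i(x,y)=T_i+\frac{\epsilon}{x^{-1}y-1}-\frac{\epsilon}{xy-1}C_iC_{i+1}$. For $\mathfrak s,\mathfrak t\in\mathrm{Std}(\underline\lambda)$ with reduced expression $d(\mathfrak s,\mathfrak t)=s_{k_p}\cdots s_{k_1}$ and $\mathfrak t_j=s_{k_j}\cdots s_{k_1}\mathfrak t$ (all standard): $\Phi_{\mathfrak s,\mathfrak t}=\Phi_{k_p}(\mathtt b_{\mathfrak t_{p-1},k_p},\mathtt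 b_{\mathfrak t_{p-1},k_p+1})\cdots\Phi_{k_1}(\mathtt b_{\mathfrak t_0,k_1},\mathtt b_{\mathfrak t_0,k_1+1})$ (independent of the reduced expression). **Seminormal elements.** If $d_{\underline\lambda}=0$, for $\mathrm S=(\mathfrak s,\alpha',\beta')$, $\mathrm T=(\mathfrak t,\alpha,\beta)$ in $\mathrm{Tri}(\underline\lambda)$: $f^{\mathfrak w}_{\mathrm S,\mathrm T}=F_{\mathrm S}C^{\beta'}C^{\alpha'}\Phi_{\mathfrak s,\mathfrak w}\Phi_{\mathfrak w,\mathfrak t}(C^\alpha)^{-1}(C^\beta)^{-1}F_{\mathrm T}$ and $f_{\mathrm S,\mathrm T}=F_{\mathrm S}C^{\beta'}C^{\alpha'}\Phi_{\mathfrak s,\mathfrak t}(C^\alpha)^{-1}(C^\beta)^{-1}F_{\mathrm T}$. If $d_{\underline\lambda}=1$, for $\mathrm S=(\mathfrak s,\alpha',\beta')$, $\mathrm T=(\mathfrak t,\alpha,\beta)$ in $\mathrm{Tri}_{\bar0}(\underline\lambda)$ and $a\in\mathbb Z_2$, with $\eta=(-1)^{|\alpha'|_{>x_t(\mathfrak s)}+a|\alpha|_{>x_t(\mathfrak t)}}$: $f^{\mathfrak w}_{\mathrm S,\mathrm T_a}=\eta F_{\mathrm S}C^{\beta'}C^{\alpha'}\Phi_{\mathfrak s,\mathfrak w}\Phi_{\mathfrak w,\mathfrak t}(C^{\alpha_a})^{-1}(C^\beta)^{-1}F_{\mathrm T}$ and $f_{\mathrm S,\mathrm T_a}=\eta F_{\mathrm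 S}C^{\beta'}C^{\alpha'}\Phi_{\mathfrak s,\mathfrak t}(C^{\alpha_a})^{-1}(C^\beta)^{-1}F_{\mathrm T}$. **Hats and signs.** For $\alpha\in\mathbb Z_2(\mathcal{OD}_{\mathfrak t})_{\bar0}$, $\widehat\alpha\in\mathbb Z_2(\mathcal{OD}_{\mathfrak t})_{\bar0}$ is the vector with $\mathrm{supp}(\alpha)\sqcup\mathrm{supp}(\widehat\alpha)=\{x_1(\mathfrak t),x_3(\mathfrak t),\dots,x_{2\lfloor t/2\rfloor-1}(\mathfrak t)\}$; for $t$ odd, $\widehat{\alpha_{\bar1}}=\widehat\alpha+e_{x_t(\mathfrak t)}$. For $\mathrm T=(\mathfrak t,\alpha,\beta)\in\mathrm{Tri}(\underline\lambda)$, $\widehat{\mathrm T}=(\mathfrak t,\widehat\alpha,\beta)$; thus $\widehat{\mathrm S_a}=(\mathfrak s,\widehat{\alpha'_a},\beta')=(\widehat{\mathrm S})_a$. For $r\ge0$ let $N_r(\mathfrak t)=\#\{1\le j'<j\le r: x_{2j'-1}(\mathfrak t)>x_{2j-1}(\mathfrak t)\}$. For $\alpha\in\mathbb Z_2(\mathcal{OD}_{\mathfrak t})$: if $t$ is even, $\mathrm{sgn}(\mathfrak t,\alpha)=(-1)^{\sum_{j=1}^{t/2}|\alpha|_{>x_{2j-1}(\mathfrak t)}+N_{t/2}(\mathfrak t)}$; if $t$ is odd, $\mathrm{sgn}(\mathfrak t,\alpha)_a=(-1)^{\sum_{j=1}^{\lceil t/2\rceil}|\alpha|_{>x_{2j-1}(\mathfrak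 t)}+N_r(\mathfrak t)}$ with $r=\lfloor t/2\rfloor$ for $a=\bar0$ and $r=\lceil t/2\rceil$ for $a=\bar1$. *)

theory Defs
  imports
    "HOL-Library.Poly_Mapping"
    "HOL-Library.FuncSet"
    "HOL-Library.Z2"
    "HOL-Computational_Algebra.Polynomial"
    "HOL-Combinatorics.Transposition"
    "HOL-Algebra.QuotRing"
begin

section \<open>The free algebra on the generators\<close>

datatype 'g fword = Word (letters: "'g list")

instantiation fword :: (type) monoid_add
begin

definition zero_fword :: "'a fword" where "zero_fword = Word []"

definition plus_fword :: "'a fword \<Rightarrow> 'a fword \<Rightarrow> 'a fword" where
  "plus_fword u v = Word (letters u @ letters v)"

instance
  by standard (simp_all add: zero_fword_def plus_fword_def)

end

datatype hc_gen = GT nat | GX nat | GXinv nat | GC nat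

type_synonym 'k hc_free = "hc_gen fword \<Rightarrow>\<^sub>0 'k"

definition fgen :: "hc_gen \<Rightarrow> 'k::field hc_free" where
  "fgen g = Poly_Mapping.single (Word [g]) 1"

definition fscal :: "'k::field \<Rightarrow> 'k hc_free" where
  "fscal c = Poly_Mapping.single 0 c"

abbreviation fT :: "nat \<Rightarrow> 'k::field hc_free" where "fT i \<equiv> fgen (GT i)"
abbreviation fX :: "nat \<Rightarrow> 'k::field hc_free" where "fX i \<equiv> fgen (GX i)"
abbreviation fXi :: "nat \<Rightarrow> 'k::field hc_free" where "fXi i \<equiv> fgen (GXinv i)"
abbreviation fC :: "nat \<Rightarrow> 'k::field hc_free" where "fC i \<equiv> fgen (GC i)"

definition hc_gens :: "nat \<Rightarrow> hc_gen set" where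
  "hc_gens n = GT ` {1..<n} \<union> GX ` {1..n} \<union> GXinv ` {1..n} \<union> GC ` {1..n}"

definition hc_free_ring :: "nat \<Rightarrow> 'k::field hc_free ring" where
  "hc_free_ring n =
     \<lparr>carrier = {p. \<forall>w \<in> Poly_Mapping.keys p. set (letters w) \<subseteq> hc_gens n},
      mult = (*), one = 1, zero = 0, add = (+)\<rparr>"

lemma hc_free_ring_is_ring: "ring (hc_free_ring n :: 'k::field hc_free ring)"
proof -
  let ?P = "\<lambda>p :: 'k hc_free. \<forall>w \<in> Poly_Mapping.keys p. set (letters w) \<subseteq> hc_gens n"
  have add: "?P (p + r)" if "?P p" "?P r" for p r
    using that Poly_Mapping.keys_add[of p r] by blast
  have mult: "?P (p * r)" if "?P p" "?P r" for p r
  proof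
    fix w assume "w \<in> Poly_Mapping.keys (p * r)"
    then obtain u v where w: "w = u + v" and u: "u \<in> Poly_Mapping.keys p"
      and v: "v \<in> Poly_Mapping.keys r"
      using Poly_Mapping.keys_mult[of p r] by blast
    have "letters w = letters u @ letters v" by (simp add: w plus_fword_def)
    with that u v show "set (letters w) \<subseteq> hc_gens n" by simp
  qed
  have uminus: "?P (- p)" if "?P p" for p
    using that by (simp add: in_keys_iff)
  have one: "?P 1"
    by (simp add: zero_fword_def flip: single_one)
  show ?thesis
  proof (rule ringI)
    show "abelian_group (hc_free_ring n :: 'k hc_free ring)"
    proof (rule abelian_groupI)
      fix x :: "'k hc_free" assume "x \<in> carrier (hc_free_ring n)"
      then have "- x \<in> carrier (hc_free_ring n)"
        using uminus[of x] by (simp only: hc_free_ring_def partial_object.simps mem_Collect_eq)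
      moreover have "- x \<oplus>\<^bsub>hc_free_ring n\<^esub> x = \<zero>\<^bsub>hc_free_ring n\<^esub>"
        by (simp add: hc_free_ring_def)
      ultimately show "\<exists>y \<in> carrier (hc_free_ring n).
          y \<oplus>\<^bsub>hc_free_ring n\<^esub> x = \<zero>\<^bsub>hc_free_ring n\<^esub>"
        by blast
    next
      fix x y :: "'k hc_free"
      assume "x \<in> carrier (hc_free_ring n)" "y \<in> carrier (hc_free_ring n)"
      then show "x \<oplus>\<^bsub>hc_free_ring n\<^esub> y \<in> carrier (hc_free_ring n)"
        using add[of x y] by (simp add: hc_free_ring_def)
    qed (simp_all add: hc_free_ring_def ac_simps)
    show "Group.monoid (hc_free_ring n :: 'k hc_free ring)"
    proof (rule monoidI)
      fix x y :: "'k hc_free"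
      assume "x \<in> carrier (hc_free_ring n)" "y \<in> carrier (hc_free_ring n)"
      then show "x \<otimes>\<^bsub>hc_free_ring n\<^esub> y \<in> carrier (hc_free_ring n)"
        using mult[of x y] by (simp add: hc_free_ring_def)
    qed (use one in \<open>simp_all add: hc_free_ring_def mult.assoc\<close>)
  qed (simp_all add: hc_free_ring_def distrib_left distrib_right)
qed


section \<open>The affine Hecke-Clifford algebra and its cyclotomic quotients\<close>

datatype bullet = B0 | Bs | Bss

text \<open>\<open>hsqrt\<close> is the fixed choice of square roots.\<close>

record 'k hc_datum =
  hq :: 'k
  hQ :: "'k list"
  hbul :: bullet
  hsqrt :: "'k \<Rightarrow> 'k"

definition heps :: "'k::field hc_datum \<Rightarrow> 'k" where
  "heps h = hq h - inverse (hq h)"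

definition qq :: "'k::field hc_datum \<Rightarrow> 'k \<Rightarrow> 'k" where
  "qq h x = 2 * ((hq h * x + inverse (hq h * x)) / (hq h + inverse (hq h)))"

definition bplus :: "'k::field hc_datum \<Rightarrow> 'k \<Rightarrow> 'k" where
  "bplus h x = qq h x / 2 + hsqrt h ((qq h x)\<^sup>2 / 4 - 1)"

definition bminus :: "'k::field hc_datum \<Rightarrow> 'k \<Rightarrow> 'k" where
  "bminus h x = qq h x / 2 - hsqrt h ((qq h x)\<^sup>2 / 4 - 1)"

text \<open>\<open>hc_rel n \<epsilon> x y\<close>: the defining relation \<open>x = y\<close>.\<close>

inductive hc_rel :: "nat \<Rightarrow> 'k::field \<Rightarrow> 'k hc_free \<Rightarrow> 'k hc_free \<Rightarrow> bool"
  for n :: nat and \<epsilon> :: 'k where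
  TT: "i \<in> {1..<n} \<Longrightarrow> hc_rel n \<epsilon> (fT i * fT i) (fscal \<epsilon> * fT i + 1)"
| T_comm: "i \<in> {1..<n} \<Longrightarrow> j \<in> {1..<n} \<Longrightarrow> i + 1 < j \<or> j + 1 < i \<Longrightarrow>
    hc_rel n \<epsilon> (fT i * fT j) (fT j * fT i)"
| braid: "1 \<le> i \<Longrightarrow> i + 1 < n \<Longrightarrow>
    hc_rel n \<epsilon> (fT i * fT (i+1) * fT i) (fT (i+1) * fT i * fT (i+1))"
| X_comm: "i \<in> {1..n} \<Longrightarrow> j \<in> {1..n} \<Longrightarrow> hc_rel n \<epsilon> (fX i * fX j) (fX j * fX i)"
| X_Xi: "i \<in> {1..n} \<Longrightarrow> hc_rel n \<epsilon> (fX i * fXi i) 1"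
| Xi_X: "i \<in> {1..n} \<Longrightarrow> hc_rel n \<epsilon> (fXi i * fX i) 1"
| CC: "i \<in> {1..n} \<Longrightarrow> hc_rel n \<epsilon> (fC i * fC i) 1"
| C_anti: "i \<in> {1..n} \<Longrightarrow> j \<in> {1..n} \<Longrightarrow> i \<noteq> j \<Longrightarrow>
    hc_rel n \<epsilon> (fC i * fC j) (- (fC j * fC i))"
| TX: "i \<in> {1..<n} \<Longrightarrow>
    hc_rel n \<epsilon> (fT i * fX i)
      (fX (i+1) * fT i - fscal \<epsilon> * (fX (i+1) + fC i * fC (i+1) * fX i))"
| TX_comm: "i \<in> {1..<n} \<Longrightarrow> j \<in> {1..n} \<Longrightarrow> j \<noteq> i \<Longrightarrow> j \<noteq> i + 1 \<Longrightarrow>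
    hc_rel n \<epsilon> (fT i * fX j) (fX j * fT i)"
| TC: "i \<in> {1..<n} \<Longrightarrow> hc_rel n \<epsilon> (fT i * fC i) (fC (i+1) * fT i)"
| TC': "i \<in> {1..<n} \<Longrightarrow>
    hc_rel n \<epsilon> (fT i * fC (i+1)) (fC i * fT i - fscal \<epsilon> * (fC i - fC (i+1)))"
| TC_comm: "i \<in> {1..<n} \<Longrightarrow> j \<in> {1..n} \<Longrightarrow> j \<noteq> i \<Longrightarrow> j \<noteq> i + 1 \<Longrightarrow>
    hc_rel n \<epsilon> (fT i * fC j) (fC j * fT i)"
| XC: "i \<in> {1..n} \<Longrightarrow> hc_rel n \<epsilon> (fX i * fC i) (fC i * fXi i)"
| XC_comm: "i \<in> {1..n} \<Longrightarrow> j \<in> {1..n} \<Longrightarrow> i \<noteq> j \<Longrightarrow>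
    hc_rel n \<epsilon> (fX i * fC j) (fC j * fX i)"

text \<open>The \<open>\<int>\<^sub>2\<close>-grading plays no role below and is not recorded.\<close>

definition hc_ideal :: "'k::field hc_datum \<Rightarrow> nat \<Rightarrow> 'k hc_free set" where
  "hc_ideal h n = Idl\<^bsub>hc_free_ring n\<^esub> {x - y | x y. hc_rel n (heps h) x y}"

definition hc_affine :: "'k::field hc_datum \<Rightarrow> nat \<Rightarrow> 'k hc_free set ring" where
  "hc_affine h n = hc_free_ring n Quot hc_ideal h n"

definition hc_cls :: "'k::field hc_datum \<Rightarrow> nat \<Rightarrow> 'k hc_free \<Rightarrow> 'k hc_free set" where
  "hc_cls h n x = hc_ideal h n +>\<^bsub>hc_free_ring n\<^esub> x"

definition hc_g :: "bullet \<Rightarrow> 'k::field hc_free" where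
  "hc_g b = (case b of B0 \<Rightarrow> 1 | Bs \<Rightarrow> fX 1 - 1 | Bss \<Rightarrow> (fX 1 - 1) * (fX 1 + 1))"

definition hc_f :: "'k::field hc_datum \<Rightarrow> nat \<Rightarrow> 'k hc_free set" where
  "hc_f h n = hc_cls h n
     (hc_g (hbul h) * prod_list (map (\<lambda>c. fX 1 + fXi 1 - fscal (qq h c)) (hQ h)))"

definition hcf_ideal :: "'k::field hc_datum \<Rightarrow> nat \<Rightarrow> 'k hc_free set set" where
  "hcf_ideal h n = Idl\<^bsub>hc_affine h n\<^esub> {hc_f h n}"

type_synonym 'k hcf_elem = "'k hc_free set set"

definition hcf :: "'k::field hc_datum \<Rightarrow> nat \<Rightarrow> 'k hcf_elem ring" where
  "hcf h n = hc_affine h n Quot hcf_ideal h n"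

definition hcf_cls :: "'k::field hc_datum \<Rightarrow> nat \<Rightarrow> 'k hc_free \<Rightarrow> 'k hcf_elem" where
  "hcf_cls h n x = hcf_ideal h n +>\<^bsub>hc_affine h n\<^esub> hc_cls h n x"

definition hS :: "'k::field hc_datum \<Rightarrow> nat \<Rightarrow> 'k \<Rightarrow> 'k hcf_elem" where
  "hS h n c = hcf_cls h n (fscal c)"
definition hT :: "'k::field hc_datum \<Rightarrow> nat \<Rightarrow> nat \<Rightarrow> 'k hcf_elem" where
  "hT h n i = hcf_cls h n (fT i)"
definition hX :: "'k::field hc_datum \<Rightarrow> nat \<Rightarrow> nat \<Rightarrow> 'k hcf_elem" where
  "hX h n i = hcf_cls h n (fX i)"
definition hXi :: "'k::field hc_datum \<Rightarrow> nat \<Rightarrow> nat \<Rightarrow> 'k hcf_elem" where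
  "hXi h n i = hcf_cls h n (fXi i)"
definition hC :: "'k::field hc_datum \<Rightarrow> nat \<Rightarrow> nat \<Rightarrow> 'k hcf_elem" where
  "hC h n i = hcf_cls h n (fC i)"

text \<open>\<open>hc_star h n \<phi>\<close>: \<open>\<phi>\<close> is the unsigned \<open>\<K>\<close>-linear anti-involution \<open>*\<close>. The values on
  the generators determine it.\<close>

definition hc_star :: "'k::field hc_datum \<Rightarrow> nat \<Rightarrow> ('k hcf_elem \<Rightarrow> 'k hcf_elem) \<Rightarrow> bool" where
  "hc_star h n \<phi> \<longleftrightarrow> (let H = hcf h n in
     \<phi> \<in> carrier H \<rightarrow> carrier H \<and>
     (\<forall>x \<in> carrier H. \<forall>y \<in> carrier H. \<phi> (x \<oplus>\<^bsub>H\<^esub> y) = \<phi> x \<oplus>\<^bsub>H\<^esub> \<phi> y) \<and>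
     (\<forall>c. \<forall>x \<in> carrier H. \<phi> (hS h n c \<otimes>\<^bsub>H\<^esub> x) = hS h n c \<otimes>\<^bsub>H\<^esub> \<phi> x) \<and>
     (\<forall>x \<in> carrier H. \<forall>y \<in> carrier H. \<phi> (x \<otimes>\<^bsub>H\<^esub> y) = \<phi> y \<otimes>\<^bsub>H\<^esub> \<phi> x) \<and>
     (\<forall>x \<in> carrier H. \<phi> (\<phi> x) = x) \<and>
     (\<forall>i \<in> {1..<n}. \<phi> (hT h n i) =
        hT h n i \<oplus>\<^bsub>H\<^esub> hS h n (heps h) \<otimes>\<^bsub>H\<^esub> (hC h n i \<otimes>\<^bsub>H\<^esub> hC h n (i+1))) \<and>
     (\<forall>j \<in> {1..n}. \<phi> (hC h n j) = hC h n j) \<and>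
     (\<forall>j \<in> {1..n}. \<phi> (hX h n j) = hX h n j))"

definition rprod :: "('a, 'b) ring_scheme \<Rightarrow> 'a list \<Rightarrow> 'a" where
  "rprod R xs = foldr (\<lambda>x y. x \<otimes>\<^bsub>R\<^esub> y) xs \<one>\<^bsub>R\<^esub>"

text \<open>Product over a finite set of pairwise commuting factors, taken along an arbitrary
  enumeration (\<open>finprod\<close> is not usable in a noncommutative ring).\<close>

definition rprod_set :: "('a, 'b) ring_scheme \<Rightarrow> ('c \<Rightarrow> 'a) \<Rightarrow> 'c set \<Rightarrow> 'a" where
  "rprod_set R F A = rprod R (map F (SOME xs. distinct xs \<and> set xs = A))"


section \<open>Multipartitions and tableaux\<close>

text \<open>The components of a multipartition are numbered by their position \<open>0, 1, \<dots>\<close> in the tuple;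
  the first \<open>nstrict b\<close> of them (\<open>0\<close>, resp. \<open>0\<^sub>-, 0\<^sub>+\<close>) are strict. A partition is the list of
  its nonzero parts.\<close>

definition nstrict :: "bullet \<Rightarrow> nat" where
  "nstrict b = (case b of B0 \<Rightarrow> 0 | Bs \<Rightarrow> 1 | Bss \<Rightarrow> 2)"

definition Qext :: "'k::field hc_datum \<Rightarrow> 'k list" where
  "Qext h = (case hbul h of B0 \<Rightarrow> [] | Bs \<Rightarrow> [1] | Bss \<Rightarrow> [-1, 1]) @ hQ h"

definition is_partition :: "nat list \<Rightarrow> bool" where
  "is_partition p \<longleftrightarrow> sorted_wrt (\<ge>) p \<and> 0 \<notin> set p"

definition is_strict_partition :: "nat list \<Rightarrow> bool" where
  "is_strict_partition p \<longleftrightarrow> sorted_wrt (>) p \<and> 0 \<notin> set p"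

type_synonym mpart = "nat list list"

definition mp_size :: "mpart \<Rightarrow> nat" where
  "mp_size lam = sum_list (map sum_list lam)"

definition mparts :: "bullet \<Rightarrow> nat \<Rightarrow> nat \<Rightarrow> mpart set" where
  "mparts b m n = {lam. length lam = nstrict b + m \<and> mp_size lam = n \<and>
     (\<forall>l < length lam. if l < nstrict b then is_strict_partition (lam ! l)
                        else is_partition (lam ! l))}"

text \<open>Boxes are \<open>(row, column, component)\<close>, with rows and columns numbered from 1.\<close>

type_synonym box = "nat \<times> nat \<times> nat"
type_synonym tableau = "box \<Rightarrow> nat"

definition boxes :: "bullet \<Rightarrow> mpart \<Rightarrow> box set" where
  "boxes b lam = {(i, j, l). l < length lam \<and> 1 \<le> i \<and> i \<le> length (lam ! l) \<and>
     (if l < nstrict b then i \<le> j \<and> j < i + lam ! l ! (i - 1)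
      else 1 \<le> j \<and> j \<le> lam ! l ! (i - 1))}"

definition Std :: "bullet \<Rightarrow> mpart \<Rightarrow> tableau set" where
  "Std b lam = {t \<in> extensional (boxes b lam).
     bij_betw t (boxes b lam) {1..mp_size lam} \<and>
     (\<forall>i j j' l. (i, j, l) \<in> boxes b lam \<and> (i, j', l) \<in> boxes b lam \<and> j < j' \<longrightarrow>
        t (i, j, l) < t (i, j', l)) \<and>
     (\<forall>i i' j l. (i, j, l) \<in> boxes b lam \<and> (i', j, l) \<in> boxes b lam \<and> i < i' \<longrightarrow>
        t (i, j, l) < t (i', j, l))}"

definition tab_act :: "bullet \<Rightarrow> mpart \<Rightarrow> (nat \<Rightarrow> nat) \<Rightarrow> tableau \<Rightarrow> tableau" where
  "tab_act b lam \<pi> t = restrict (\<pi> \<circ> t) (boxes b lam)"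

definition tab_init :: "bullet \<Rightarrow> mpart \<Rightarrow> tableau" where
  "tab_init b lam = restrict (\<lambda>(i, j, l). card {(i', j', l') \<in> boxes b lam.
       l' < l \<or> l' = l \<and> (i' < i \<or> i' = i \<and> j' \<le> j)}) (boxes b lam)"

definition tab_perm :: "bullet \<Rightarrow> mpart \<Rightarrow> tableau \<Rightarrow> tableau \<Rightarrow> nat \<Rightarrow> nat" where
  "tab_perm b lam s t k =
     (if k \<in> {1..mp_size lam} then s (inv_into (boxes b lam) t k) else k)"

definition diag_boxes :: "bullet \<Rightarrow> mpart \<Rightarrow> box set" where
  "diag_boxes b lam = {(i, j, l) \<in> boxes b lam. l < nstrict b \<and> i = j}"

definition tnum :: "bullet \<Rightarrow> mpart \<Rightarrow> nat" where
  "tnum b lam = card (diag_boxes b lam)"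

definition dlam :: "bullet \<Rightarrow> mpart \<Rightarrow> nat" where
  "dlam b lam = tnum b lam mod 2"

definition Dtab :: "bullet \<Rightarrow> mpart \<Rightarrow> tableau \<Rightarrow> nat set" where
  "Dtab b lam t = t ` diag_boxes b lam"

definition xs_tab :: "bullet \<Rightarrow> mpart \<Rightarrow> tableau \<Rightarrow> nat \<Rightarrow> nat" where
  "xs_tab b lam t p = tab_perm b lam t (tab_init b lam)
     (sorted_list_of_set (Dtab b lam (tab_init b lam)) ! (p - 1))"

definition ODtab :: "bullet \<Rightarrow> mpart \<Rightarrow> tableau \<Rightarrow> nat set" where
  "ODtab b lam t = {xs_tab b lam t p | p. p \<in> {1..tnum b lam} \<and> odd p}"

definition res :: "'k::field hc_datum \<Rightarrow> mpart \<Rightarrow> tableau \<Rightarrow> nat \<Rightarrow> 'k" where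
  "res h lam t k = (case inv_into (boxes (hbul h) lam) t k of
     (i, j, l) \<Rightarrow> Qext h ! l * hq h powi (2 * (int j - int i)))"

definition separate :: "'k::field hc_datum \<Rightarrow> mpart \<Rightarrow> bool" where
  "separate h mu \<longleftrightarrow> (\<forall>u \<in> Std (hbul h) mu. \<forall>k. 1 \<le> k \<and> k + 1 \<le> mp_size mu \<longrightarrow>
     qq h (res h mu u k) \<noteq> qq h (res h mu u (k + 1)))"


section \<open>Vectors over \<open>\<int>\<^sub>2\<close> and triples\<close>

type_synonym zvec = "nat \<Rightarrow> bit"

definition zsupp :: "zvec \<Rightarrow> nat set" where
  "zsupp \<beta> = {k. \<beta> k = 1}"

definition Z2 :: "nat set \<Rightarrow> zvec set" where
  "Z2 A = {\<beta>. zsupp \<beta> \<subseteq> A}"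

definition zcount_gt :: "zvec \<Rightarrow> nat \<Rightarrow> nat" where
  "zcount_gt \<beta> i = card {k \<in> zsupp \<beta>. i < k}"

type_synonym triple = "tableau \<times> zvec \<times> zvec"

definition Z2OD :: "bullet \<Rightarrow> mpart \<Rightarrow> tableau \<Rightarrow> bit \<Rightarrow> zvec set" where
  "Z2OD b lam t a = {\<alpha> \<in> Z2 (ODtab b lam t).
     if even (tnum b lam) then a = 0
     else (xs_tab b lam t (tnum b lam) \<in> zsupp \<alpha> \<longleftrightarrow> a = 1)}"

definition Tri_par :: "bullet \<Rightarrow> mpart \<Rightarrow> bit \<Rightarrow> triple set" where
  "Tri_par b lam a = {(t, \<alpha>, \<beta>). t \<in> Std b lam \<and> \<alpha> \<in> Z2OD b lam t a \<and>
     \<beta> \<in> Z2 ({1..mp_size lam} - Dtab b lam t)}"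

definition Tri :: "bullet \<Rightarrow> mpart \<Rightarrow> triple set" where
  "Tri b lam = Tri_par b lam 0 \<union> Tri_par b lam 1"

text \<open>\<open>\<alpha>\<^sub>a\<close>, for odd \<open>t\<close>.\<close>

definition zext :: "bullet \<Rightarrow> mpart \<Rightarrow> tableau \<Rightarrow> zvec \<Rightarrow> bit \<Rightarrow> zvec" where
  "zext b lam t \<alpha> a = (let x = xs_tab b lam t (tnum b lam) in \<alpha>(x := \<alpha> x + a))"

text \<open>The hat flips the entries at \<open>x\<^sub>1, x\<^sub>3, \<dots>, x\<^bsub>2\<lfloor>t/2\<rfloor>-1\<^esub>\<close> and keeps the others. This is the
  complement of the support inside that set for the vectors of parity \<open>0\<close>, and for odd \<open>t\<close>
  it also gives the convention for \<open>\<alpha>\<^sub>1\<close>, whose entry at \<open>x\<^sub>t\<close> is kept.\<close>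

definition zhat :: "bullet \<Rightarrow> mpart \<Rightarrow> tableau \<Rightarrow> zvec \<Rightarrow> zvec" where
  "zhat b lam t \<alpha> = (\<lambda>k.
     if k \<in> {xs_tab b lam t (2*j - 1) | j. j \<in> {1..tnum b lam div 2}} then \<alpha> k + 1 else \<alpha> k)"

definition tri_hat :: "bullet \<Rightarrow> mpart \<Rightarrow> triple \<Rightarrow> triple" where
  "tri_hat b lam = (\<lambda>(t, \<alpha>, \<beta>). (t, zhat b lam t \<alpha>, \<beta>))"

definition Nr :: "bullet \<Rightarrow> mpart \<Rightarrow> tableau \<Rightarrow> nat \<Rightarrow> nat" where
  "Nr b lam t r = card {(j', j). 1 \<le> j' \<and> j' < j \<and> j \<le> r \<and>
     xs_tab b lam t (2*j' - 1) > xs_tab b lam t (2*j - 1)}"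

definition sgn_even :: "bullet \<Rightarrow> mpart \<Rightarrow> tableau \<Rightarrow> zvec \<Rightarrow> 'k::field" where
  "sgn_even b lam t \<alpha> = (-1) ^
     ((\<Sum>j = 1..tnum b lam div 2. zcount_gt \<alpha> (xs_tab b lam t (2*j - 1)))
      + Nr b lam t (tnum b lam div 2))"

definition sgn_odd :: "bullet \<Rightarrow> mpart \<Rightarrow> tableau \<Rightarrow> zvec \<Rightarrow> bit \<Rightarrow> 'k::field" where
  "sgn_odd b lam t \<alpha> a = (-1) ^
     ((\<Sum>j = 1..(tnum b lam + 1) div 2. zcount_gt \<alpha> (xs_tab b lam t (2*j - 1)))
      + Nr b lam t (if a = 0 then tnum b lam div 2 else (tnum b lam + 1) div 2))"


section \<open>Idempotents, intertwiners and seminormal elements\<close>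

definition Cpow :: "'k::field hc_datum \<Rightarrow> nat \<Rightarrow> zvec \<Rightarrow> 'k hcf_elem" where
  "Cpow h n \<beta> = rprod (hcf h n)
     (map (\<lambda>k. if \<beta> k = 1 then hC h n k else \<one>\<^bsub>hcf h n\<^esub>) [1..<n+1])"

definition gam :: "'k::field hc_datum \<Rightarrow> nat \<Rightarrow> mpart \<Rightarrow> tableau \<Rightarrow> 'k hcf_elem" where
  "gam h n lam t = (let H = hcf h n; x = xs_tab (hbul h) lam t; r = tnum (hbul h) lam div 2 in
     hS h n (inverse (2 ^ r)) \<otimes>\<^bsub>H\<^esub>
     rprod H (map (\<lambda>k. \<one>\<^bsub>H\<^esub> \<oplus>\<^bsub>H\<^esub> hS h n (hsqrt h (-1)) \<otimes>\<^bsub>H\<^esub>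
                        (hC h n (x (2*k - 1)) \<otimes>\<^bsub>H\<^esub> hC h n (x (2*k)))) [1..<r+1]))"

definition Bset :: "'k::field hc_datum \<Rightarrow> nat \<Rightarrow> nat \<Rightarrow> 'k set" where
  "Bset h n k = (\<Union>mu \<in> mparts (hbul h) (length (hQ h)) n. \<Union>s \<in> Std (hbul h) mu.
     {bplus h (res h mu s k), bminus h (res h mu s k)})"

definition Fid :: "'k::field hc_datum \<Rightarrow> nat \<Rightarrow> mpart \<Rightarrow> triple \<Rightarrow> 'k hcf_elem" where
  "Fid h n lam = (\<lambda>(t, \<alpha>, \<beta>). let H = hcf h n in
     (Cpow h n \<alpha> \<otimes>\<^bsub>H\<^esub> gam h n lam t \<otimes>\<^bsub>H\<^esub> inv\<^bsub>H\<^esub> (Cpow h n \<alpha>)) \<otimes>\<^bsub>H\<^esub>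
     rprod H (map (\<lambda>k. let c = bplus h (res h lam t k) in
       rprod_set H
         (\<lambda>b. hS h n (inverse (c - b)) \<otimes>\<^bsub>H\<^esub>
               ((if \<beta> k = 1 then hXi h n k else hX h n k) \<ominus>\<^bsub>H\<^esub> hS h n b))
         (Bset h n k - {c})) [1..<n+1]))"

definition Phi_i :: "'k::field hc_datum \<Rightarrow> nat \<Rightarrow> nat \<Rightarrow> 'k \<Rightarrow> 'k \<Rightarrow> 'k hcf_elem" where
  "Phi_i h n i x y = (let H = hcf h n in
     (hT h n i \<oplus>\<^bsub>H\<^esub> hS h n (heps h / (inverse x * y - 1))) \<ominus>\<^bsub>H\<^esub>
     hS h n (heps h / (x * y - 1)) \<otimes>\<^bsub>H\<^esub> (hC h n i \<otimes>\<^bsub>H\<^esub> hC h n (i+1)))"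

text \<open>The list \<open>[k\<^sub>p, \<dots>, k\<^sub>1]\<close> stands for the word \<open>s\<^bsub>k\<^sub>p\<^esub> \<cdots> s\<^bsub>k\<^sub>1\<^esub>\<close>.\<close>

definition word_perm :: "nat list \<Rightarrow> nat \<Rightarrow> nat" where
  "word_perm ks = foldr (\<lambda>k \<pi>. transpose k (k+1) \<circ> \<pi>) ks id"

definition reduced_expr :: "nat \<Rightarrow> (nat \<Rightarrow> nat) \<Rightarrow> nat list \<Rightarrow> bool" where
  "reduced_expr n \<pi> ks \<longleftrightarrow> set ks \<subseteq> {1..<n} \<and> word_perm ks = \<pi> \<and>
     (\<forall>ks'. set ks' \<subseteq> {1..<n} \<and> word_perm ks' = \<pi> \<longrightarrow> length ks \<le> length ks')"

fun Phi_word :: "'k::field hc_datum \<Rightarrow> nat \<Rightarrow> mpart \<Rightarrow> tableau \<Rightarrow> nat list \<Rightarrow> 'k hcf_elem" where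
  "Phi_word h n lam t [] = \<one>\<^bsub>hcf h n\<^esub>"
| "Phi_word h n lam t (k # ks) =
     (let u = tab_act (hbul h) lam (word_perm ks) t in
      Phi_i h n k (bminus h (res h lam u k)) (bminus h (res h lam u (k+1)))
        \<otimes>\<^bsub>hcf h n\<^esub> Phi_word h n lam t ks)"

text \<open>The value does not depend on the reduced expression chosen.\<close>

definition Phi :: "'k::field hc_datum \<Rightarrow> nat \<Rightarrow> mpart \<Rightarrow> tableau \<Rightarrow> tableau \<Rightarrow> 'k hcf_elem" where
  "Phi h n lam s t =
     Phi_word h n lam t (SOME ks. reduced_expr n (tab_perm (hbul h) lam s t) ks)"

text \<open>\<open>F\<^sub>S C\<^bsup>\<beta>'\<^esup> C\<^bsup>\<alpha>'\<^esup> M (C\<^bsup>\<alpha>1\<^esup>)\<^sup>-\<^sup>1 (C\<^bsup>\<beta>\<^esup>)\<^sup>-\<^sup>1 F\<^sub>T\<close>, where the vector \<open>\<alpha>1\<close> (either \<open>\<alpha>\<close> or \<open>\<alpha>\<^sub>a\<close>) need not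
  be the one belonging to \<open>T = (t, \<alpha>, \<beta>)\<close>.\<close>

definition sandwich :: "'k::field hc_datum \<Rightarrow> nat \<Rightarrow> mpart \<Rightarrow> triple \<Rightarrow> 'k hcf_elem \<Rightarrow>
    zvec \<Rightarrow> triple \<Rightarrow> 'k hcf_elem" where
  "sandwich h n lam = (\<lambda>(s, \<alpha>', \<beta>') M \<alpha>1 (t, \<alpha>, \<beta>). let H = hcf h n in
     rprod H [Fid h n lam (s, \<alpha>', \<beta>'), Cpow h n \<beta>', Cpow h n \<alpha>', M,
       inv\<^bsub>H\<^esub> (Cpow h n \<alpha>1), inv\<^bsub>H\<^esub> (Cpow h n \<beta>), Fid h n lam (t, \<alpha>, \<beta>)])"

definition f_even :: "'k::field hc_datum \<Rightarrow> nat \<Rightarrow> mpart \<Rightarrow> triple \<Rightarrow> triple \<Rightarrow> 'k hcf_elem" where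
  "f_even h n lam = (\<lambda>(s, \<alpha>', \<beta>') (t, \<alpha>, \<beta>).
     sandwich h n lam (s, \<alpha>', \<beta>') (Phi h n lam s t) \<alpha> (t, \<alpha>, \<beta>))"

definition fw_even :: "'k::field hc_datum \<Rightarrow> nat \<Rightarrow> mpart \<Rightarrow> tableau \<Rightarrow> triple \<Rightarrow> triple \<Rightarrow>
    'k hcf_elem" where
  "fw_even h n lam w = (\<lambda>(s, \<alpha>', \<beta>') (t, \<alpha>, \<beta>).
     sandwich h n lam (s, \<alpha>', \<beta>') (Phi h n lam s w \<otimes>\<^bsub>hcf h n\<^esub> Phi h n lam w t) \<alpha> (t, \<alpha>, \<beta>))"

definition eta :: "bullet \<Rightarrow> mpart \<Rightarrow> triple \<Rightarrow> triple \<Rightarrow> bit \<Rightarrow> 'k::field" where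
  "eta b lam = (\<lambda>(s, \<alpha>', \<beta>') (t, \<alpha>, \<beta>) a.
     (-1) ^ (zcount_gt \<alpha>' (xs_tab b lam s (tnum b lam))
              + of_bool (a = 1) * zcount_gt \<alpha> (xs_tab b lam t (tnum b lam))))"

text \<open>\<open>f_odd h n lam S T a\<close> and \<open>fw_odd h n lam w S T a\<close> are the elements indexed by
  \<open>S\<close> and \<open>T\<^sub>a\<close>, for \<open>S, T\<close> of parity \<open>0\<close>.\<close>

definition f_odd :: "'k::field hc_datum \<Rightarrow> nat \<Rightarrow> mpart \<Rightarrow> triple \<Rightarrow> triple \<Rightarrow> bit \<Rightarrow>
    'k hcf_elem" where
  "f_odd h n lam = (\<lambda>(s, \<alpha>', \<beta>') (t, \<alpha>, \<beta>) a.
     hS h n (eta (hbul h) lam (s, \<alpha>', \<beta>') (t, \<alpha>, \<beta>) a) \<otimes>\<^bsub>hcf h n\<^esub>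
     sandwich h n lam (s, \<alpha>', \<beta>') (Phi h n lam s t) (zext (hbul h) lam t \<alpha> a) (t, \<alpha>, \<beta>))"

definition fw_odd :: "'k::field hc_datum \<Rightarrow> nat \<Rightarrow> mpart \<Rightarrow> tableau \<Rightarrow> triple \<Rightarrow> triple \<Rightarrow> bit \<Rightarrow>
    'k hcf_elem" where
  "fw_odd h n lam w = (\<lambda>(s, \<alpha>', \<beta>') (t, \<alpha>, \<beta>) a.
     hS h n (eta (hbul h) lam (s, \<alpha>', \<beta>') (t, \<alpha>, \<beta>) a) \<otimes>\<^bsub>hcf h n\<^esub>
     sandwich h n lam (s, \<alpha>', \<beta>') (Phi h n lam s w \<otimes>\<^bsub>hcf h n\<^esub> Phi h n lam w t)
       (zext (hbul h) lam t \<alpha> a) (t, \<alpha>, \<beta>))"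

end

theory Submission
  imports Defs "HOL-Combinatorics.Permutations"
begin

text \<open>The heart of the matter is that every \<open>X\<^sub>k\<close> satisfies
  \<open>\<Prod>(X\<^sub>k - b) = 0\<close> with \<open>b\<close> running through \<open>B(k)\<close>. A vector on which \<open>X\<^sub>1, \<dots>, X\<^sub>k\<close> act as
  prescribed by a diagram grown box by box is killed by the product of the (quadratic or linear)
  polynomials in \<open>X\<^bsub>k+1\<^esub>\<close> of all its addable boxes: the intertwiner \<open>\<phi>\<^sub>k\<close> confines \<open>X\<^bsub>k+1\<^esub>\<close> to the old
  addable boxes and the neighbours of the last one, separateness makes these polynomials coprime, and
  the braid relation on three strands rules out the neighbours that cannot be added.

  The Lagrange products \<open>E\<^sub>t\<close> are therefore idempotents projecting onto joint eigenvectors, and \<open>\<Phi>\<^bsub>s,t\<^esub> E\<^sub>t\<close> equals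
  a product of factors \<open>E T\<^sub>k E\<close> along a reduced word. By Matsumoto's theorem it depends on the
  permutation only; since \<open>T\<^sub>k\<^sup>*\<close> and \<open>T\<^sub>k\<close> agree between distinct weight spaces, the involution turns it into
  \<open>\<Phi>\<^bsub>t,s\<^esub> E\<^sub>s\<close>. What remains is Clifford algebra: with \<open>\<Theta> = C\<^bsub>x\<^sub>1\<^esub> C\<^bsub>x\<^sub>3\<^esub> \<cdots>\<close> one has \<open>\<Theta> \<gamma>\<^sup>* = \<gamma> \<Theta>\<close>, the monomial
  \<open>C\<^sup>\<alpha>\<close> is a sign times \<open>C\<close> to the power \<open>\<alpha>\<close>-hat times \<open>\<Theta>\<close>, and \<open>\<Phi>\<close> intertwines the elements \<open>\<Theta>\<close> of \<open>s\<close> and \<open>t\<close>.\<close>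

section \<open>Rings with central scalars\<close>

text \<open>The formula for \<open>F_T\<close> can be written down for any numbers b; it projects
  onto a weight space only once the product over B(k) is known to annihilate X_k, and no
  representation is at hand from which this could be read off. It is therefore proved for arbitrary
  elements v of the algebra under left multiplication, without modules, bases or dimensions. The
  delicate place is a diagonal box of a strict component. Its weight is 1 or -1, so its polynomial
  in X must be linear, although the value of X + X^{-1} alone would only give the square of that
  factor. Each argument bounding the weights has a variant that removes this possible nilpotent
  part. The n + 1 in the hypothesis comes from the opposite case: a box of a diagram with n boxes
  that is not diagonal must not have weight 1 or -1, so that its quadratic polynomial has two
  different roots. If it had, its weight would agree with that of a neighbouring box, and to compare
  the two by separateness one more box must be added.\<close>

locale scalars =
  fixes s :: "'k::field \<Rightarrow> 'a::ring"
  assumes s_add: "s (a + b) = s a + s b" and s_mult: "s (a * b) = s a * s b"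
begin

text \<open>The class \<open>ring\<close> has no unit. \<open>alg\<close> is the corner on which
  \<open>s 1\<close> acts as one and the scalars are central; the algebra will be one factor of a
  large product, so that its unit is not a unit of the whole type.\<close>

definition alg :: "'a set" where
  "alg = {x. s 1 * x = x \<and> (\<forall>c. x * s c = s c * x)}"

lemma s_0 [simp]: "s 0 = 0"
  using s_add[of 0 0] by simp

lemma s_uminus: "s (- a) = - s a"
  using s_add[of a "- a"] by (simp add: eq_neg_iff_add_eq_0 add.commute)

lemma s_diff: "s (a - b) = s a - s b"
  using s_add[of a "- b"] by (simp add: s_uminus)

lemma s_alg [simp]: "s c \<in> alg"
  unfolding alg_def by (simp add: s_mult[symmetric] mult.commute)

lemma alg_one [simp]: "x \<in> alg \<Longrightarrow> s 1 * x = x"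
  unfolding alg_def by simp

lemma alg_comm: "x \<in> alg \<Longrightarrow> x * s c = s c * x"
  unfolding alg_def by simp

lemma alg_one_right [simp]: "x \<in> alg \<Longrightarrow> x * s 1 = x"
  by (simp add: alg_comm)

lemma alg_one_left [simp]: "x \<in> alg \<Longrightarrow> s 1 * (x * v) = x * v"
  by (simp add: mult.assoc[symmetric])

lemma alg_one_mid [simp]: "x \<in> alg \<Longrightarrow> x * (s 1 * v) = x * v"
  by (simp add: mult.assoc[symmetric])

lemma s_left: "s a * (s b * v) = s (a * b) * v"
  by (simp add: s_mult mult.assoc)

lemma s_add_left: "s a * v + s b * v = s (a + b) * v"
  by (simp add: s_add distrib_right)

lemma alg_left: "x \<in> alg \<Longrightarrow> x * (s c * v) = s c * (x * v)"
  by (simp add: mult.assoc[symmetric] alg_comm)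

lemma alg_mult [simp]: "x \<in> alg \<Longrightarrow> y \<in> alg \<Longrightarrow> x * y \<in> alg"
proof -
  assume a: "x \<in> alg" "y \<in> alg"
  have "x * y * s c = s c * (x * y)" for c
    using a by (metis alg_comm mult.assoc)
  then show ?thesis
    using a unfolding alg_def by (simp add: mult.assoc[symmetric])
qed

lemma alg_add [simp]: "x \<in> alg \<Longrightarrow> y \<in> alg \<Longrightarrow> x + y \<in> alg"
  unfolding alg_def by (auto simp: distrib_left distrib_right)

lemma alg_uminus [simp]: "x \<in> alg \<Longrightarrow> - x \<in> alg"
  unfolding alg_def by auto

lemma alg_diff [simp]: "x \<in> alg \<Longrightarrow> y \<in> alg \<Longrightarrow> x - y \<in> alg"
  unfolding alg_def by (auto simp: right_diff_distrib left_diff_distrib)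

lemma alg_0 [simp]: "0 \<in> alg"
  unfolding alg_def by simp

lemma s_cancel: "v \<in> alg \<Longrightarrow> c \<noteq> 0 \<Longrightarrow> s c * v = 0 \<Longrightarrow> v = 0"
  by (metis alg_one left_inverse mult_zero_right s_left)

end

context scalars
begin

text \<open>Since (A - x)(A - x^{-1}) annihilates v, the vectors (A - x^{-1})v and (A - x)v are
  eigenvectors of A, and their difference is (x - x^{-1})v. To kill v it suffices to kill such
  eigenvectors. \<open>P\<close> carries side conditions along; they have to survive A - y.\<close>

lemma eig_split:
  assumes A: "A \<in> alg" "Ai \<in> alg" "A * Ai = s 1" "Ai * A = s 1" and v: "v \<in> alg" "A * v + Ai * v = s (x + inverse x) * v"
    and x: "x \<noteq> 0" "inverse x \<noteq> x"
    and P: "\<And>w y. P w \<Longrightarrow> w \<in> alg \<Longrightarrow> P (A * w - s y * w)" "P v"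
    and M: "\<And>w. w \<in> alg \<Longrightarrow> P w \<Longrightarrow> A * w = s x * w \<Longrightarrow> M * w = 0"
      "\<And>w. w \<in> alg \<Longrightarrow> P w \<Longrightarrow> A * w = s (inverse x) * w \<Longrightarrow> M * w = 0" and Ma: "M \<in> alg"
  shows "M * v = 0"
proof -
  have "A * (A * v) + s 1 * v = s (x + inverse x) * (A * v)"
  proof -
    have "A * (A * v + Ai * v) = A * (s (x + inverse x) * v)" using v by simp
    moreover have "A * (Ai * v) = s 1 * v" using A by (simp add: mult.assoc[symmetric])
    ultimately show ?thesis using A by (simp add: distrib_left alg_left)
  qed
  then have q: "A * (A * v) = s x * (A * v) + s (inverse x) * (A * v) - v"
    using v(1) by (simp add: s_add distrib_right eq_diff_eq)
  let ?a = "A * v - s (inverse x) * v" and ?b = "A * v - s x * v"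
  have "A * ?a = s x * ?a" "A * ?b = s (inverse x) * ?b"
    using q A v(1) x by (simp_all add: right_diff_distrib alg_left s_left)
  then have "M * ?a = 0" "M * ?b = 0" using M P v A by simp_all
  then have "M * (s (x - inverse x) * v) = 0" by (simp add: right_diff_distrib s_diff left_diff_distrib)
  then have "s (x - inverse x) * (M * v) = 0" using Ma by (simp add: alg_left)
  then show ?thesis using x v Ma by (rule_tac s_cancel[where c = "x - inverse x"]) auto
qed

end

section \<open>The local relations for two neighbouring strands\<close>

text \<open>Single letters in place of indexed generators turn every identity into a comparison of
  words, with no conditions on indices.\<close>

locale rank2 = scalars s for s :: "'k::field \<Rightarrow> 'a::ring" +
  fixes T X Xi Y Yi C D :: 'a and eps :: 'k
  assumes algs [simp]: "T \<in> alg" "X \<in> alg" "Xi \<in> alg" "Y \<in> alg" "Yi \<in> alg" "C \<in> alg" "D \<in> alg"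
    and TT: "T * T = s eps * T + s 1"
    and X_Xi: "X * Xi = s 1" "Xi * X = s 1" "Y * Yi = s 1" "Yi * Y = s 1"
    and XY: "X * Y = Y * X"
    and CC: "C * C = s 1" "D * D = s 1" and CD: "C * D = - (D * C)"
    and TX: "T * X = Y * T - s eps * (Y + C * D * X)"
    and TC: "T * C = D * T" and TD: "T * D = C * T - s eps * (C - D)"
    and XC: "X * C = C * Xi" "X * D = D * X" "Y * D = D * Yi" "Y * C = C * Y"
begin

text \<open>The rules carry an arbitrary right factor v, so that they apply inside words associated
  to the right. Clifford letters move to the front, the X and Y follow, and T moves to the end;
  \<open>norm\<close> collects the rules and decides identities by this normal form of PBW
  type.\<close>

lemma CCl: "C * (C * v) = s 1 * v" "D * (D * v) = s 1 * v" "D * (C * v) = - (C * (D * v))"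
  using CC CD by (simp_all add: mult.assoc[symmetric])

lemma XXl: "X * (Xi * v) = s 1 * v" "Xi * (X * v) = s 1 * v"
    "Y * (Yi * v) = s 1 * v" "Yi * (Y * v) = s 1 * v"
  by (simp_all add: mult.assoc[symmetric] X_Xi)

lemma inv_comm:
  assumes "A \<in> alg" "A' \<in> alg" "A * A' = s 1" "A' * A = s 1" "B \<in> alg" "B' \<in> alg" "B * B' = s 1" "B' * B = s 1"
    "M \<in> alg" "A * M = M * B"
  shows "A' * M = M * B'"
proof -
  have "A' * M = A' * (M * B) * B'" using assms by (simp add: mult.assoc)
  also have "\<dots> = A' * (A * M) * B'" using assms by simp
  also have "\<dots> = (A' * A) * M * B'" by (simp only: mult.assoc)
  also have "\<dots> = M * B'" using assms by simp
  finally show ?thesis .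
qed

lemma XiC: "Xi * C = C * X" "Xi * D = D * Xi" "Yi * D = D * Y" "Yi * C = C * Yi"
  using inv_comm[of X Xi Xi X C] inv_comm[of X Xi X Xi D] inv_comm[of Y Yi Yi Y D] inv_comm[of Y Yi Y Yi C]
  by (simp_all add: X_Xi XC)

lemma XYi: "Yi * X = X * Yi" "Xi * Y = Y * Xi" "Yi * Xi = Xi * Yi"
proof -
  show a: "Yi * X = X * Yi" and "Xi * Y = Y * Xi"
    using inv_comm[of Y Yi Y Yi X] inv_comm[of X Xi X Xi Y] by (simp_all add: X_Xi XY)
  then show "Yi * Xi = Xi * Yi"
    using inv_comm[of X Xi X Xi Yi] by (simp add: X_Xi)
qed

lemma XCl: "X * (C * v) = C * (Xi * v)" "X * (D * v) = D * (X * v)" "Y * (D * v) = D * (Yi * v)" "Y * (C * v) = C * (Y * v)"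
    "Xi * (C * v) = C * (X * v)" "Xi * (D * v) = D * (Xi * v)" "Yi * (D * v) = D * (Y * v)" "Yi * (C * v) = C * (Yi * v)"
  using XC XiC by (simp_all add: mult.assoc[symmetric])

lemma XYl: "Y * (X * v) = X * (Y * v)" "Yi * (X * v) = X * (Yi * v)" "Y * (Xi * v) = Xi * (Y * v)" "Yi * (Xi * v) = Xi * (Yi * v)"
  using XY XYi by (simp_all add: mult.assoc[symmetric])

lemma TCl: "T * (C * v) = D * (T * v)" "T * (D * v) = C * (T * v) - s eps * (C * v) + s eps * (D * v)"
    "T * (T * v) = s eps * (T * v) + s 1 * v"
    "T * (X * v) = Y * (T * v) - s eps * (Y * v) - s eps * (C * (D * (X * v)))"
  by (simp_all only: mult.assoc[symmetric] TC TD TT TX)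
    (simp_all add: left_diff_distrib right_diff_distrib distrib_right distrib_left mult.assoc)

lemmas scal = alg_left s_left mult.assoc distrib_left distrib_right right_diff_distrib left_diff_distrib
  mult_minus_left mult_minus_right minus_mult_minus s_add s_diff s_uminus

text \<open>Multiplying the relation for T X by T from the right and using the quadratic relation
  expresses Y through X. The relation of T with Y follows from it, those with the inverses by
  conjugation.\<close>

lemma Y_eq: "Y = T * (X * T) + s eps * (C * (D * (X * T)))"
proof -
  have "Y * T = T * X + s eps * Y + s eps * (C * (D * X))"
    by (simp add: TX algebra_simps)
  then have "(Y * T) * T = (T * X + s eps * Y + s eps * (C * (D * X))) * T" by simp
  then show ?thesis by (simp add: scal TT alg_comm)
qed

lemma TY: "T * Y = X * T + s eps * Y - s eps * (C * (D * Y))"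
proof -
  have b: "T * (X * T) = Y - s eps * (C * (D * (X * T)))"
    using Y_eq by simp
  have "T * Y = T * (T * (X * T)) + s eps * (T * (C * (D * (X * T))))"
    by (subst Y_eq) (simp add: scal)
  also have "T * (T * (X * T)) = s eps * (T * (X * T)) + X * T"
    by (subst TCl(3)) simp
  also have "T * (C * (D * (X * T))) = D * (C * (T * (X * T))) - s eps * (D * (C * (X * T))) + s eps * (X * T)"
    by (subst TCl(1), subst TCl(2)) (simp add: scal CCl)
  finally show ?thesis
    unfolding b by (simp add: scal CCl)
qed

lemma TXi: "T * Xi = Yi * T + s eps * Xi + s eps * (C * (D * Y))"
proof -
  have "Yi * (T * X) * Xi = Yi * (Y * T - s eps * (Y + C * D * X)) * Xi" using TX by simp
  then have "Yi * T = T * Xi - s eps * Xi - s eps * (C * (D * Y))"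
    by (simp add: scal XXl X_Xi XCl)
  then show ?thesis by (simp add: algebra_simps)
qed

lemma TYi: "T * Yi = Xi * T - s eps * Xi + s eps * (C * (D * X))"
proof -
  have "Xi * (T * Y) * Yi = Xi * (X * T + s eps * Y - s eps * (C * (D * Y))) * Yi" using TY by simp
  then have "Xi * T = T * Yi + s eps * Xi - s eps * (C * (D * X))"
    by (simp add: scal XXl X_Xi XCl)
  then show ?thesis by (simp add: algebra_simps)
qed

lemma TXl: "T * (Y * v) = X * (T * v) + s eps * (Y * v) - s eps * (C * (D * (Y * v)))"
  "T * (Xi * v) = Yi * (T * v) + s eps * (Xi * v) + s eps * (C * (D * (Y * v)))"
  "T * (Yi * v) = Xi * (T * v) - s eps * (Xi * v) + s eps * (C * (D * (X * v)))"
  by (simp_all only: mult.assoc[symmetric] TY TXi TYi)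
    (simp_all add: left_diff_distrib right_diff_distrib distrib_right distrib_left mult.assoc)

lemmas norm = scal CCl XXl XCl XYl TCl TXl X_Xi

text \<open>Z = X + X^{-1} commutes with the Clifford generators while X does not, so weights are
  read off Z wherever Clifford letters intervene. \<open>G\<close> is the defect of T when it
  exchanges \<open>Z1\<close> and \<open>Z2\<close>; \<open>phi\<close> is the intertwiner with its
  denominators cleared and thus makes sense without any assumption on weights.\<close>

definition Z1 where "Z1 = X + Xi"
definition Z2 where "Z2 = Y + Yi"
definition G where "G = s eps * (Xi - Y + C * (D * (Y - X)))"
definition phi where "phi = T * (Z1 - Z2) - G"

lemma defs_alg [simp]: "Z1 \<in> alg" "Z2 \<in> alg" "G \<in> alg" "phi \<in> alg"
  unfolding Z1_def Z2_def G_def phi_def by simp_all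

lemma TZ1: "T * (Z1 * v) = Z2 * (T * v) + G * v"
  unfolding Z1_def Z2_def G_def by (simp add: norm)

lemma TZ2: "T * (Z2 * v) = Z1 * (T * v) - G * v"
  unfolding Z1_def Z2_def G_def by (simp add: norm)

lemma phi_X: "phi * (X * v) = Y * (phi * v)"
  unfolding Z1_def Z2_def G_def phi_def by (simp add: norm)

lemma phi_Y: "phi * (Y * v) = X * (phi * v)"
  unfolding Z1_def Z2_def G_def phi_def by (simp add: norm)

lemma s_times4: "s (a * 4) = s a + s a + (s a + s a)" "s (a * (b * 4)) = s (a * b) + s (a * b) + (s (a * b) + s (a * b))"
proof -
  have "a * 4 = a + a + (a + a)" for a :: 'k by simp
  then show "s (a * 4) = s a + s a + (s a + s a)" for a by (metis s_add)
  from this[of "a * b"] show "s (a * (b * 4)) = s (a * b) + s (a * b) + (s (a * b) + s (a * b))"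
    by (simp add: mult.assoc)
qed

text \<open>The square is a polynomial in Z1 and Z2. At Z1 = r, Z2 = c it is -(r - c)^2 + eps^2 (r c
  - 4), whose roots in one variable are the values belonging to the two neighbours of a box.\<close>

lemma phi_phi: "phi * (phi * v) = - ((Z1 - Z2) * ((Z1 - Z2) * v)) + s (eps * eps) * (Z1 * (Z2 * v) - s 4 * v)"
  unfolding Z1_def Z2_def G_def phi_def by (simp add: norm s_times4)

text \<open>The left factor is a conjugate of \<open>G\<close> with respect to C D, whose square is
  -1, so the Clifford part cancels in the product. Hence G annihilates no weight vector unless the
  two values of Z have product 4.\<close>

lemma G_conj: "(X - Yi - C * (D * (Y - X))) * (G * v) = s eps * (s 4 * v - Z1 * (Z2 * v))"
  unfolding Z1_def Z2_def G_def by (simp add: norm s_times4)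

end

section \<open>Three neighbouring strands and the braid relation\<close>

locale rank3 = rank2 s T X Xi Y Yi C D eps + S: rank2 s S Y Yi W Wi D F eps
  for s :: "'k::field \<Rightarrow> 'a::ring" and T S X Xi Y Yi W Wi C D F :: 'a and eps :: 'k +
  assumes braid: "T * S * T = S * T * S"
    and XW: "X * W = W * X" and XF: "X * F = F * X" and WC: "W * C = C * W" and CF: "C * F = - (F * C)"
    and TW: "T * W = W * T" and TF: "T * F = F * T" and SX: "S * X = X * S" and SC: "S * C = C * S"
begin

lemma WWi: "T * Wi = Wi * T" "Wi * X = X * Wi" "Wi * C = C * Wi"
    "W * Xi = Xi * W" "Wi * Xi = Xi * Wi" "Xi * F = F * Xi"
  using inv_comm[of W Wi W Wi T] inv_comm[of W Wi W Wi X] inv_comm[of W Wi W Wi C]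
    inv_comm[of X Xi X Xi W] inv_comm[of X Xi X Xi Wi] inv_comm[of X Xi X Xi F]
  by (simp_all add: S.X_Xi X_Xi TW XW XF WC)

lemma norm3:
  "T * (W * v) = W * (T * v)" "T * (Wi * v) = Wi * (T * v)" "T * (F * v) = F * (T * v)"
  "S * (X * v) = X * (S * v)" "S * (C * v) = C * (S * v)"
  "W * (X * v) = X * (W * v)" "Wi * (X * v) = X * (Wi * v)"
  "W * (C * v) = C * (W * v)" "Wi * (C * v) = C * (Wi * v)"
  "W * (Xi * v) = Xi * (W * v)" "Wi * (Xi * v) = Xi * (Wi * v)" "Xi * (F * v) = F * (Xi * v)"
  "X * (F * v) = F * (X * v)" "F * (C * v) = - (C * (F * v))"
proof -
  have fc: "F * C = - (C * F)" using CF by simp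
  show "T * (W * v) = W * (T * v)" "T * (Wi * v) = Wi * (T * v)" "T * (F * v) = F * (T * v)"
  "S * (X * v) = X * (S * v)" "S * (C * v) = C * (S * v)"
  "W * (X * v) = X * (W * v)" "Wi * (X * v) = X * (Wi * v)"
  "W * (C * v) = C * (W * v)" "Wi * (C * v) = C * (Wi * v)"
  "W * (Xi * v) = Xi * (W * v)" "Wi * (Xi * v) = Xi * (Wi * v)" "Xi * (F * v) = F * (Xi * v)"
  "X * (F * v) = F * (X * v)" "F * (C * v) = - (C * (F * v))"
    by (simp_all only: mult.assoc[symmetric] TW TF SX SC WWi WC XW XF fc) (simp_all add: mult.assoc)
qed

lemma braidl: "T * (S * (T * v)) = S * (T * (S * v))"
  using braid by (simp add: mult.assoc[symmetric])

text \<open>On a joint eigenvector of \<open>X\<close> and \<open>Y\<close> killed by both intertwiners, \<open>T\<close> and \<open>S\<close> act through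
  the Clifford algebra, and the braid relation becomes a condition on the third weight.\<close>

definition good :: "'k \<Rightarrow> 'k \<Rightarrow> 'a \<Rightarrow> bool" where
  "good x y v \<longleftrightarrow> v \<in> alg \<and> X * v = s x * v \<and> Y * v = s y * v \<and> phi * v = 0 \<and> S.phi * v = 0"

text \<open>W commutes with X, Y and \<open>phi\<close>, and \<open>S.phi\<close> turns it into Y.
  The third generator therefore preserves the situation and may be treated as the unknown of a
  Laurent polynomial.\<close>

lemma good_W: "good x y v \<Longrightarrow> good x y (W * v)" "good x y v \<Longrightarrow> good x y (Wi * v)"
proof -
  have pw: "phi * (W * v) = W * (phi * v)" "phi * (Wi * v) = Wi * (phi * v)" for v
    unfolding phi_def G_def Z1_def Z2_def by (simp_all add: norm norm3 S.norm)
  have Si: "S.phi * (Wi * v) = Yi * (S.phi * v)" for v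
  proof -
    have "S.phi * v = Y * (S.phi * (Wi * v))"
      using S.phi_Y[of "Wi * v"] by (simp add: S.XXl)
    then show ?thesis by (metis XXl(4) alg_one_left S.defs_alg(4) mult.assoc)
  qed
  assume g: "good x y v"
  have sw: "Y * (W * v) = W * (Y * v)" "Y * (Wi * v) = Wi * (Y * v)" "S.phi * (W * v) = Y * (S.phi * v)"
    by (rule S.XYl[symmetric], rule S.XYl[symmetric], rule S.phi_Y)
  show "good x y (W * v)"
    using g sw unfolding good_def by (simp add: pw norm3(6)[symmetric] alg_left)
  show "good x y (Wi * v)"
    using g sw unfolding good_def by (simp add: pw Si norm3(7)[symmetric] alg_left)
qed

text \<open>N says that phi^2 vanishes at the weights r and c, as it must on a nonzero vector killed
  by \<open>phi\<close>. The coefficients \<open>al\<close> and \<open>be\<close> come from solving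
  T (Z1 - Z2) v = G v for T v.\<close>

context
  fixes x y r c al be :: 'k
  assumes nz: "x \<noteq> 0" "y \<noteq> 0" and r: "r = x + inverse x" and c: "c = y + inverse y" and rc: "r \<noteq> c"
    and N: "(r - c)\<^sup>2 = eps\<^sup>2 * (r * c - 4)"
    and al: "al = eps * (inverse x - y) / (r - c)" and be: "be = eps * (y - x) / (r - c)"
begin

lemma good_inv: assumes "good x y v" shows "Xi * v = s (inverse x) * v" "Yi * v = s (inverse y) * v"
proof -
  have v: "v \<in> alg" "s x * v = X * v" "s y * v = Y * v" using assms unfolding good_def by auto
  have "Xi * (s x * v) = s 1 * v" "Yi * (s y * v) = s 1 * v" by (simp_all add: v(2,3) norm)
  then have "s x * (Xi * v) = v" "s y * (Yi * v) = v" using v(1) by (simp_all add: alg_left)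
  then show "Xi * v = s (inverse x) * v" "Yi * v = s (inverse y) * v"
    using nz by (metis alg_one_left algs s_left left_inverse)+
qed

lemma T_good: assumes g: "good x y v" shows "T * v = s al * v + s be * (C * (D * v))"
proof -
  have v: "v \<in> alg" "X * v = s x * v" "Y * v = s y * v" "phi * v = 0" using g unfolding good_def by auto
  note e = v(2,3) good_inv[OF g]
  have "T * ((Z1 - Z2) * v) = G * v"
    using v(4) unfolding phi_def by (simp add: left_diff_distrib mult.assoc)
  then have 1: "s (r - c) * (T * v) = s (eps * (inverse x - y)) * v + s (eps * (y - x)) * (C * (D * v))"
    unfolding Z1_def Z2_def G_def r c by (simp add: scal e algebra_simps)
  have "s (inverse (r - c)) * (s (r - c) * (T * v)) = T * v"
    using rc by (simp add: s_left)
  then show ?thesis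
    unfolding 1 by (simp add: distrib_left s_left al be divide_inverse mult.commute)
qed

text \<open>W has no eigenvalue yet, so the equation for S v cannot be divided by c - (W + W^{-1}).
  It is kept in the form of \<open>S_good\<close>, with \<open>dl\<close>, \<open>gg\<close> and
  \<open>dd\<close> Laurent polynomials in W.\<close>

definition dl where "dl v = s c * v - W * v - Wi * v"
definition gg where "gg v = s (eps * inverse y) * v - s eps * (W * v)"
definition dd where "dd v = s eps * (W * v) - s (eps * y) * v"

lemma S_good: assumes g: "good x y v" shows "S * dl v = gg v + D * (F * dd v)"
proof -
  have v: "v \<in> alg" "X * v = s x * v" "Y * v = s y * v" "S.phi * v = 0" using g unfolding good_def by auto
  note e = v(2,3) good_inv[OF g]
  have "S * ((S.Z1 - S.Z2) * v) = S.G * v"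
    using v(4) unfolding S.phi_def by (simp add: left_diff_distrib mult.assoc)
  moreover have "(S.Z1 - S.Z2) * v = dl v"
    unfolding S.Z1_def S.Z2_def dl_def by (simp add: scal e c)
  moreover have "S.G * v = gg v + D * (F * dd v)"
    unfolding S.G_def gg_def dd_def by (simp add: scal e)
  ultimately show ?thesis by simp
qed

lemma good_lin: "good x y u \<Longrightarrow> good x y v \<Longrightarrow> good x y (u - v)"
  "good x y v \<Longrightarrow> good x y (s a * v)"
  unfolding good_def by (auto simp: right_diff_distrib alg_left s_left mult.commute)

lemma good_fun: assumes "good x y v" shows "good x y (dl v)" "good x y (gg v)" "good x y (dd v)"
  unfolding dl_def gg_def dd_def by (intro good_lin good_W assms)+

lemma dl_comm: assumes "v \<in> alg" shows "dl (gg v) = gg (dl v)" "dl (dd v) = dd (dl v)"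
  unfolding dl_def gg_def dd_def using assms by (simp_all add: scal S.norm algebra_simps)

text \<open>These are the comparisons, power of W by power of W, that the Clifford components of the
  braid relation require in \<open>rank3_key\<close>, isolated here as scalar consequences of
  N.\<close>

lemma coeffs:
  shows "(al * al) + (be * be) + (eps * be) - (eps * al) = 1"
    "(al * al) * inverse y + ((be * (be + eps)) + (eps * (be + eps))) * y = inverse x"
    "(al * al) * (inverse y + c) + (be * (be + eps)) * (c + y) - 2 * (eps * al) * inverse y + (eps * (be + eps)) * (c - y) = (2 * c - r) + eps\<^sup>2 * c + inverse x"
    "(al * al) * (inverse y * c + 1) + (be * (be + eps)) * (1 + y * c) - (eps * al) * (inverse y)\<^sup>2 - (eps * (be + eps)) * (y\<^sup>2 - 1 - y * c) = 1 + inverse x * ((2 * c - r) + eps\<^sup>2 * c)"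
    "((al - eps) * (al - eps)) * y + (be * be) * inverse y = x"
    "((al - eps) * (al - eps)) * (c + y) + (be * be) * (inverse y + c) + 2 * (eps * be) * inverse y + 2 * (eps * (al - eps)) * y = (2 * c - r) + eps\<^sup>2 * c + x"
    "((al - eps) * (al - eps)) * (1 + y * c) + (be * be) * (inverse y * c + 1) + (eps * be) * (inverse y)\<^sup>2 + (eps * (al - eps)) * y\<^sup>2 = 1 + x * ((2 * c - r) + eps\<^sup>2 * c)"
    "((al - eps) * (be + eps)) * y - (al * be) * inverse y = 0"
    "((al - eps) * (be + eps)) * (c + y) - (al * be) * (inverse y + c) + ((eps * be) - (eps * (al - eps))) * c = 0"
    "(al * be) * (inverse y * c + 1) - ((al - eps) * (be + eps)) * (1 + y * c) - ((eps * be) - (eps * (al - eps))) = 0"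
proof -
  define t where "t = inverse (r - c)"
  define xi where "xi = inverse x"
  define yi where "yi = inverse y"
  define a where "a = xi - y"
  define b where "b = y - x"
  define a2 where "a2 = yi - x"
  define b2 where "b2 = xi - yi"
  \<comment> \<open>E turns each product of two of al, be, eps and their shifts into E times a
    polynomial in x, y and their inverses. N gives E (r c - 4) = 1 and E (r - c)^2 = eps^2, so every
    identity reduces to expressing such a polynomial through r c - 4 and (r - c)^2.\<close>
  define E where "E = eps\<^sup>2 * t\<^sup>2"
  note ab = a_def b_def a2_def b2_def
  have can: "x * xi = 1" "y * yi = 1" "x * (xi * u) = u" "y * (yi * u) = u" for u
    unfolding xi_def yi_def using nz by simp_all
  have 1: "t * (r - c) = 1" "x * xi = 1" "y * yi = 1" unfolding t_def xi_def yi_def using rc nz by simp_all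
  have rr: "r = x + xi" "c = y + yi" using r c unfolding xi_def yi_def by auto
  have A: "al = eps * t * a" and B: "be = eps * t * b"
    unfolding al be t_def xi_def a_def b_def by (simp_all add: divide_inverse)
  \<comment> \<open>In this form eps can be absorbed, and the shifted coefficients al - eps and be +
    eps are again eps t times a difference of weights.\<close>
  have "eps = eps * t * (r - c)" using 1(1) by (simp add: mult.assoc)
  then have A2: "al - eps = eps * t * a2" and B2: "be + eps = eps * t * b2"
    unfolding A B ab rr by (simp_all add: algebra_simps)
  have ep: "eps * (eps * t * u) = E * (u * (r - c))" for u
  proof -
    have "E * (u * (r - c)) = eps * (eps * t * u) * (t * (r - c))"
      unfolding E_def by (simp add: power2_eq_square ac_simps)
    then show ?thesis by (simp only: 1 mult_1_right)
  qed
  have ee: "(eps * t * u) * (eps * t * v) = E * (u * v)" for u v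
    unfolding E_def by (simp add: power2_eq_square ac_simps)
  have q: "al * al = E * (a * a)" "be * be = E * (b * b)" "eps * be = E * (b * (r - c))" "eps * al = E * (a * (r - c))"
    "be * (be + eps) = E * (b * b2)" "eps * (be + eps) = E * (b2 * (r - c))" "(al - eps) * (al - eps) = E * (a2 * a2)"
    "eps * (al - eps) = E * (a2 * (r - c))" "(al - eps) * (be + eps) = E * (a2 * b2)" "al * be = E * (a * b)"
    unfolding A2 B2 unfolding A B by (rule ee ep)+
  have q2: "E * (r * c - 4) = 1" "E * (r - c)\<^sup>2 = eps\<^sup>2" "E * (u * (r * c - 4)) = u" "E * (u * (r - c)\<^sup>2) = u * eps\<^sup>2"
    "E * (u + v) = E * u + E * v" "E * 0 = 0" for u v
  proof -
    have "E * (r - c)\<^sup>2 = eps\<^sup>2 * (t * (r - c))\<^sup>2" unfolding E_def by (simp add: power_mult_distrib)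
    then show e: "E * (r - c)\<^sup>2 = eps\<^sup>2" unfolding 1 by simp
    have "E * (r * c - 4) = t\<^sup>2 * (r - c)\<^sup>2" unfolding N E_def by simp
    then show f: "E * (r * c - 4) = 1" unfolding power_mult_distrib[symmetric] 1 by simp
    have "E * (u * (r * c - 4)) = u * (E * (r * c - 4))" "E * (u * (r - c)\<^sup>2) = u * (E * (r - c)\<^sup>2)" by (simp_all only: ac_simps)
    then show "E * (u * (r * c - 4)) = u" "E * (u * (r - c)\<^sup>2) = u * eps\<^sup>2" unfolding e f by simp_all
  qed (simp_all add: distrib_left)
  note xi_def[symmetric, simp] yi_def[symmetric, simp]
  have p: "a * a + b * b + b * (r - c) - a * (r - c) = r * c - 4"
    unfolding ab rr using 1(2,3) by (simp add: algebra_simps)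
  have "(al * al) + (be * be) + (eps * be) - (eps * al) = E * (a * a + b * b + b * (r - c) - a * (r - c))"
    unfolding q by (simp add: algebra_simps)
  also have "\<dots> = 1"
    unfolding p distrib_right[of _ _ "r * c - 4"] q2 by (simp add: algebra_simps q2)
  finally show "(al * al) + (be * be) + (eps * be) - (eps * al) = 1" by simp
  have p: "a * a * yi + (b * b2 + b2 * (r - c)) * y = xi * (r * c - 4)"
    unfolding ab rr by (simp add: algebra_simps power2_eq_square can)
  have "(al * al) * yi + ((be * (be + eps)) + (eps * (be + eps))) * y = E * (a * a * yi + (b * b2 + b2 * (r - c)) * y)"
    unfolding q by (simp add: algebra_simps)
  also have "\<dots> = xi"
    unfolding p distrib_right[of _ _ "r * c - 4"] q2 by (simp add: algebra_simps q2)
  finally show "(al * al) * inverse y + ((be * (be + eps)) + (eps * (be + eps))) * y = inverse x" by simp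
  have p: "a * a * (yi + c) + b * b2 * (c + y) - 2 * (a * (r - c)) * yi + b2 * (r - c) * (c - y) = ((2 * c - r) + xi) * (r * c - 4) + (r - c)\<^sup>2 * c"
    unfolding ab rr by (simp add: algebra_simps power2_eq_square can)
  have "(al * al) * (yi + c) + (be * (be + eps)) * (c + y) - 2 * (eps * al) * yi + (eps * (be + eps)) * (c - y) = E * (a * a * (yi + c) + b * b2 * (c + y) - 2 * (a * (r - c)) * yi + b2 * (r - c) * (c - y))"
    unfolding q by (simp add: algebra_simps)
  also have "\<dots> = (2 * c - r) + eps\<^sup>2 * c + xi"
    unfolding p distrib_right[of _ _ "r * c - 4"] q2 by (simp add: algebra_simps q2)
  finally show "(al * al) * (inverse y + c) + (be * (be + eps)) * (c + y) - 2 * (eps * al) * inverse y + (eps * (be + eps)) * (c - y) = (2 * c - r) + eps\<^sup>2 * c + inverse x" by simp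
  have p: "a * a * (yi * c + 1) + b * b2 * (1 + y * c) - a * (r - c) * yi\<^sup>2 - b2 * (r - c) * (y\<^sup>2 - 1 - y * c) = (1 + xi * (2 * c - r)) * (r * c - 4) + xi * c * (r - c)\<^sup>2"
    unfolding ab rr by (simp add: algebra_simps power2_eq_square can)
  have "(al * al) * (yi * c + 1) + (be * (be + eps)) * (1 + y * c) - (eps * al) * yi\<^sup>2 - (eps * (be + eps)) * (y\<^sup>2 - 1 - y * c) = E * (a * a * (yi * c + 1) + b * b2 * (1 + y * c) - a * (r - c) * yi\<^sup>2 - b2 * (r - c) * (y\<^sup>2 - 1 - y * c))"
    unfolding q by (simp add: algebra_simps)
  also have "\<dots> = 1 + xi * ((2 * c - r) + eps\<^sup>2 * c)"
    unfolding p distrib_right[of _ _ "r * c - 4"] q2 by (simp add: algebra_simps q2)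
  finally show "(al * al) * (inverse y * c + 1) + (be * (be + eps)) * (1 + y * c) - (eps * al) * (inverse y)\<^sup>2 - (eps * (be + eps)) * (y\<^sup>2 - 1 - y * c) = 1 + inverse x * ((2 * c - r) + eps\<^sup>2 * c)" by simp
  have p: "a2 * a2 * y + b * b * yi = x * (r * c - 4)"
    unfolding ab rr by (simp add: algebra_simps power2_eq_square can)
  have "((al - eps) * (al - eps)) * y + (be * be) * yi = E * (a2 * a2 * y + b * b * yi)"
    unfolding q by (simp add: algebra_simps)
  also have "\<dots> = x"
    unfolding p distrib_right[of _ _ "r * c - 4"] q2 by (simp add: algebra_simps q2)
  finally show "((al - eps) * (al - eps)) * y + (be * be) * inverse y = x" by simp
  have p: "a2 * a2 * (c + y) + b * b * (yi + c) + 2 * (b * (r - c)) * yi + 2 * (a2 * (r - c)) * y = ((2 * c - r) + x) * (r * c - 4) + (r - c)\<^sup>2 * c"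
    unfolding ab rr by (simp add: algebra_simps power2_eq_square can)
  have "((al - eps) * (al - eps)) * (c + y) + (be * be) * (yi + c) + 2 * (eps * be) * yi + 2 * (eps * (al - eps)) * y = E * (a2 * a2 * (c + y) + b * b * (yi + c) + 2 * (b * (r - c)) * yi + 2 * (a2 * (r - c)) * y)"
    unfolding q by (simp add: algebra_simps)
  also have "\<dots> = (2 * c - r) + eps\<^sup>2 * c + x"
    unfolding p distrib_right[of _ _ "r * c - 4"] q2 by (simp add: algebra_simps q2)
  finally show "((al - eps) * (al - eps)) * (c + y) + (be * be) * (inverse y + c) + 2 * (eps * be) * inverse y + 2 * (eps * (al - eps)) * y = (2 * c - r) + eps\<^sup>2 * c + x" by simp
  have p: "a2 * a2 * (1 + y * c) + b * b * (yi * c + 1) + b * (r - c) * yi\<^sup>2 + a2 * (r - c) * y\<^sup>2 = (1 + x * (2 * c - r)) * (r * c - 4) + x * c * (r - c)\<^sup>2"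
    unfolding ab rr by (simp add: algebra_simps power2_eq_square can)
  have "((al - eps) * (al - eps)) * (1 + y * c) + (be * be) * (yi * c + 1) + (eps * be) * yi\<^sup>2 + (eps * (al - eps)) * y\<^sup>2 = E * (a2 * a2 * (1 + y * c) + b * b * (yi * c + 1) + b * (r - c) * yi\<^sup>2 + a2 * (r - c) * y\<^sup>2)"
    unfolding q by (simp add: algebra_simps)
  also have "\<dots> = 1 + x * ((2 * c - r) + eps\<^sup>2 * c)"
    unfolding p distrib_right[of _ _ "r * c - 4"] q2 by (simp add: algebra_simps q2)
  finally show "((al - eps) * (al - eps)) * (1 + y * c) + (be * be) * (inverse y * c + 1) + (eps * be) * (inverse y)\<^sup>2 + (eps * (al - eps)) * y\<^sup>2 = 1 + x * ((2 * c - r) + eps\<^sup>2 * c)" by simp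
  have p: "a2 * b2 * y - a * b * yi = 0"
    unfolding ab rr by (simp add: algebra_simps power2_eq_square can)
  have "((al - eps) * (be + eps)) * y - (al * be) * yi = E * (a2 * b2 * y - a * b * yi)"
    unfolding q by (simp add: algebra_simps)
  also have "\<dots> = 0"
    unfolding p distrib_right[of _ _ "r * c - 4"] q2 by (simp add: algebra_simps q2)
  finally show "((al - eps) * (be + eps)) * y - (al * be) * inverse y = 0" by simp
  have p: "a2 * b2 * (c + y) - a * b * (yi + c) + (b * (r - c) - a2 * (r - c)) * c = 0"
    unfolding ab rr by (simp add: algebra_simps power2_eq_square can)
  have "((al - eps) * (be + eps)) * (c + y) - (al * be) * (yi + c) + ((eps * be) - (eps * (al - eps))) * c = E * (a2 * b2 * (c + y) - a * b * (yi + c) + (b * (r - c) - a2 * (r - c)) * c)"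
    unfolding q by (simp add: algebra_simps)
  also have "\<dots> = 0"
    unfolding p distrib_right[of _ _ "r * c - 4"] q2 by (simp add: algebra_simps q2)
  finally show "((al - eps) * (be + eps)) * (c + y) - (al * be) * (inverse y + c) + ((eps * be) - (eps * (al - eps))) * c = 0" by simp
  have p: "a * b * (yi * c + 1) - a2 * b2 * (1 + y * c) - (b * (r - c) - a2 * (r - c)) = 0"
    unfolding ab rr by (simp add: algebra_simps power2_eq_square can)
  have "(al * be) * (yi * c + 1) - ((al - eps) * (be + eps)) * (1 + y * c) - ((eps * be) - (eps * (al - eps))) = E * (a * b * (yi * c + 1) - a2 * b2 * (1 + y * c) - (b * (r - c) - a2 * (r - c)))"
    unfolding q by (simp add: algebra_simps)
  also have "\<dots> = 0"
    unfolding p distrib_right[of _ _ "r * c - 4"] q2 by (simp add: algebra_simps q2)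
  finally show "(al * be) * (inverse y * c + 1) - ((al - eps) * (be + eps)) * (1 + y * c) - ((eps * be) - (eps * (al - eps))) = 0" by simp
qed

lemma laurent:
  "gg (dl v) = s eps * (W * (W * v)) - s (eps * inverse y + eps * c) * (W * v) + s (eps * inverse y * c + eps) * v - s (eps * inverse y) * (Wi * v)"
  "dd (dl v) = - (s eps * (W * (W * v))) + s (eps * c + eps * y) * (W * v) - s (eps + eps * y * c) * v + s (eps * y) * (Wi * v)"
  "gg (gg v) = s (eps\<^sup>2) * (W * (W * v)) - s (2 * eps\<^sup>2 * inverse y) * (W * v) + s (eps\<^sup>2 * (inverse y)\<^sup>2) * v"
  "dd (dd v) = s (eps\<^sup>2) * (W * (W * v)) - s (2 * eps\<^sup>2 * y) * (W * v) + s (eps\<^sup>2 * y\<^sup>2) * v"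
  "gg (dd v) = - (s (eps\<^sup>2) * (W * (W * v))) + s (eps\<^sup>2 * (inverse y + y)) * (W * v) - s (eps\<^sup>2) * v"
  "dd (gg v) = - (s (eps\<^sup>2) * (W * (W * v))) + s (eps\<^sup>2 * (inverse y + y)) * (W * v) - s (eps\<^sup>2) * v"
  if "v \<in> alg"
proof -
  have two: "s (2 * a) = s a + s a" for a by (simp flip: s_add)
  have y2: "y * (a * inverse y) = a" "inverse y * (a * y) = a" for a using nz by simp_all
  note n = scal S.norm two power2_eq_square ring_distribs ac_simps y2
  show "gg (dl v) = s eps * (W * (W * v)) - s (eps * inverse y + eps * c) * (W * v) + s (eps * inverse y * c + eps) * v - s (eps * inverse y) * (Wi * v)"
    using that unfolding gg_def dl_def by (simp add: scal S.norm algebra_simps)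
  show "dd (dl v) = - (s eps * (W * (W * v))) + s (eps * c + eps * y) * (W * v) - s (eps + eps * y * c) * v + s (eps * y) * (Wi * v)"
    using that unfolding dd_def dl_def by (simp add: scal S.norm algebra_simps)
  show "gg (gg v) = s (eps\<^sup>2) * (W * (W * v)) - s (2 * eps\<^sup>2 * inverse y) * (W * v) + s (eps\<^sup>2 * (inverse y)\<^sup>2) * v"
    using that unfolding gg_def power2_eq_square by (simp add: scal two) (simp add: algebra_simps)
  show "dd (dd v) = s (eps\<^sup>2) * (W * (W * v)) - s (2 * eps\<^sup>2 * y) * (W * v) + s (eps\<^sup>2 * y\<^sup>2) * v"
    using that unfolding dd_def power2_eq_square by (simp add: scal two) (simp add: algebra_simps)
  have yy: "eps * (inverse y * (eps * y)) = eps * eps" "eps * (y * (eps * inverse y)) = eps * eps" using nz by simp_all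
  show "gg (dd v) = - (s (eps\<^sup>2) * (W * (W * v))) + s (eps\<^sup>2 * (inverse y + y)) * (W * v) - s (eps\<^sup>2) * v"
    using that unfolding gg_def dd_def power2_eq_square by (simp add: scal yy) (simp add: algebra_simps)
  show "dd (gg v) = - (s (eps\<^sup>2) * (W * (W * v))) + s (eps\<^sup>2 * (inverse y + y)) * (W * v) - s (eps\<^sup>2) * v"
    using that unfolding gg_def dd_def power2_eq_square by (simp add: scal yy) (simp add: algebra_simps)
qed

text \<open>Both sides of the braid relation are applied to \<open>dl (dl v)\<close>: S occurs twice
  on one side, and each occurrence consumes one \<open>dl\<close>. The four summands are the
  components along 1, C D, D F and C F.\<close>

lemma rank3_braid:
  assumes g: "good x y v"
  defines "g1 \<equiv> gg (dl v)" and "d1 \<equiv> dd (dl v)" and "gg2 \<equiv> gg (gg v)" and "dd2 \<equiv> dd (dd v)" and "gd \<equiv> gg (dd v)"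
  shows "s (al\<^sup>2) * g1 - s (be * (be + eps)) * d1 - s al * gg2 - s (be + eps) * (dd2 + s eps * d1)
    + C * (D * (s (al * be) * g1 + s (al * be - eps * be) * d1 + s be * gd - s (al - eps) * (gd - s eps * d1)))
    + D * (F * (s (al * be + eps * al) * d1 + s (al * be) * g1 - s al * gd - s (be + eps) * (s eps * d1 - gd)))
    + C * (F * (s (al\<^sup>2 - eps * al) * d1 - s (be\<^sup>2) * g1 - s be * gg2 - s (al - eps) * (dd2 + s eps * d1))) = 0"
proof -
  have v: "v \<in> alg" using g unfolding good_def by auto
  note gd1 = good_fun[OF g] good_fun[OF good_fun(1)[OF g]] good_fun[OF good_fun(2)[OF g]] good_fun[OF good_fun(3)[OF g]]
  have va: "g1 \<in> alg" "d1 \<in> alg" "gg2 \<in> alg" "dd2 \<in> alg" "gd \<in> alg"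
    using gd1 unfolding good_def g1_def d1_def gg2_def dd2_def gd_def by auto
  have gd': "dd (gg v) = gd" unfolding gd_def using laurent(5,6)[OF v] by simp
  note n = scal CCl S.CCl norm3 TCl(1,2) S.TCl(1,2)
  have L1: "T * dl (dl v) = s al * dl (dl v) + s be * (C * (D * dl (dl v)))"
    by (rule T_good[OF gd1(4)])
  have L2: "S * dl (dl v) = g1 + D * (F * d1)"
    unfolding g1_def d1_def by (rule S_good[OF gd1(1)])
  have L3: "S * (T * dl (dl v)) = s al * (g1 + D * (F * d1)) + s be * (C * (F * (g1 + D * (F * d1))))"
    unfolding L1 L2[symmetric] by (simp add: n)
  have T2: "T * g1 = s al * g1 + s be * (C * (D * g1))" "T * d1 = s al * d1 + s be * (C * (D * d1))"
    unfolding g1_def d1_def by (rule T_good[OF gd1(5)], rule T_good[OF gd1(6)])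
  have S2: "S * g1 = gg2 + D * (F * gd)" "S * d1 = gd + D * (F * dd2)"
    using S_good[OF gd1(2)] S_good[OF gd1(3)] unfolding gd'
    unfolding g1_def d1_def gg2_def dd2_def gd_def dl_comm[OF v] by simp_all
  have R1: "T * (S * dl (dl v)) = s al * g1 + s be * (C * (D * g1)) + s al * (C * (F * d1)) + s be * (D * (F * d1))
      - s eps * (C * (F * d1)) + s eps * (D * (F * d1))"
    unfolding L2 by (simp add: n T2)
  have "T * (S * (T * dl (dl v))) - S * (T * (S * dl (dl v))) = 0" using braidl by simp
  then show ?thesis
    unfolding L3 R1 using va by (simp add: n T2 S2 power2_eq_square) (simp add: algebra_simps)
qed

text \<open>All Laurent polynomials that occur have exponents from -1 to 2, so identities between
  them become four scalar equations.\<close>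

definition lc where "lc v k2 k1 k0 km = s k2 * (W * (W * v)) + s k1 * (W * v) + s k0 * v + s km * (Wi * v)"

lemma lc_add: "lc v a b c' d + lc v a2 b2 c2 d2 = lc v (a + a2) (b + b2) (c' + c2) (d + d2)"
  "lc v a b c' d - lc v a2 b2 c2 d2 = lc v (a - a2) (b - b2) (c' - c2) (d - d2)"
  "s k * lc v a b c' d = lc v (k * a) (k * b) (k * c') (k * d)"
  unfolding lc_def by (simp_all add: scal algebra_simps)

text \<open>For fixed c the constraint N is quadratic in r with sum of roots (2 + eps^2) c, so the
  number subtracted in \<open>u\<close> is the other root. The components of the braid relation
  along C D and D F vanish identically; from the other two the factor defining \<open>u\<close>
  splits off, leaving W - x^{-1} and W - x.\<close>

lemma rank3_key:
  assumes g: "good x y v" and eps: "eps \<noteq> 0"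
  defines "u \<equiv> W * v + Wi * v - s ((2 + eps\<^sup>2) * c - r) * v"
  shows "(W * u - s (inverse x) * u) - C * (F * (W * u - s x * u)) = 0"
proof -
  define r' where "r' = (2 + eps\<^sup>2) * c - r"
  have r': "(2 * c - r) + eps\<^sup>2 * c = r'" unfolding r'_def by (simp add: algebra_simps)
  note co = coeffs[unfolded r']
  have v: "v \<in> alg" using g unfolding good_def by auto
  have l0: "lc v 0 0 0 0 = 0" unfolding lc_def by simp
  note m = algebra_simps power2_eq_square
  have cy: "c = y + inverse y" by (rule c)
  have l: "gg (dl v) = lc v eps (- (eps * inverse y + eps * c)) (eps * inverse y * c + eps) (- (eps * inverse y))"
    "dd (dl v) = lc v (- eps) (eps * c + eps * y) (- (eps + eps * y * c)) (eps * y)"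
    "gg (gg v) = lc v (eps\<^sup>2) (- (2 * eps\<^sup>2 * inverse y)) (eps\<^sup>2 * (inverse y)\<^sup>2) 0"
    "dd (dd v) = lc v (eps\<^sup>2) (- (2 * eps\<^sup>2 * y)) (eps\<^sup>2 * y\<^sup>2) 0"
    "gg (dd v) = lc v (- (eps\<^sup>2)) (eps\<^sup>2 * (inverse y + y)) (- (eps\<^sup>2)) 0"
    unfolding laurent[OF v] lc_def by (simp_all add: s_uminus s_add s_diff left_diff_distrib distrib_right)
  have uu: "W * u - s k * u = lc v 1 (- (r' + k)) (1 + k * r') (- k)" for k
    unfolding u_def r'_def[symmetric] lc_def using v by (simp add: scal S.norm algebra_simps)
  have lce: "lc v a b c1 d = lc v a' b' c' d'" if "a = a'" "b = b'" "c1 = c'" "d = d'" for a b c1 d a' b' c' d'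
    using that by simp
  have e0: "s (al\<^sup>2) * gg (dl v) - s (be * (be + eps)) * dd (dl v) - s al * gg (gg v) - s (be + eps) * (dd (dd v) + s eps * dd (dl v))
    = s eps * (W * u - s (inverse x) * u)" (is "?e0 = _")
    unfolding l uu lc_add
    apply (rule lce)
    subgoal using arg_cong[OF co(1), of "\<lambda>z. eps * z"] by (simp add: m)
    subgoal using arg_cong[OF co(3), of "\<lambda>z. eps * z"] by (simp add: m)
    subgoal using arg_cong[OF co(4), of "\<lambda>z. eps * z"] by (simp add: m)
    subgoal using arg_cong[OF co(2), of "\<lambda>z. eps * z"] by (simp add: m)
    done
  have e3: "s (al\<^sup>2 - eps * al) * dd (dl v) - s (be\<^sup>2) * gg (dl v) - s be * gg (gg v) - s (al - eps) * (dd (dd v) + s eps * dd (dl v))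
    = s (- eps) * (W * u - s x * u)"
    unfolding l uu lc_add
    apply (rule lce)
    subgoal using arg_cong[OF co(1), of "\<lambda>z. - eps * z"] by (simp add: m)
    subgoal using arg_cong[OF co(6), of "\<lambda>z. - eps * z"] by (simp add: m)
    subgoal using arg_cong[OF co(7), of "\<lambda>z. - eps * z"] by (simp add: m)
    subgoal using arg_cong[OF co(5), of "\<lambda>z. - eps * z"] by (simp add: m)
    done
  have e1: "s (al * be) * gg (dl v) + s (al * be - eps * be) * dd (dl v) + s be * gg (dd v) - s (al - eps) * (gg (dd v) - s eps * dd (dl v)) = 0"
    unfolding l lc_add l0[symmetric]
    apply (rule lce)
    subgoal by (simp add: m)
    subgoal using arg_cong[OF co(9), of "\<lambda>z. eps * z"] by (simp add: m cy)
    subgoal using arg_cong[OF co(10), of "\<lambda>z. eps * z"] by (simp add: m)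
    subgoal using arg_cong[OF co(8), of "\<lambda>z. eps * z"] by (simp add: m)
    done
  have e2: "s (al * be + eps * al) * dd (dl v) + s (al * be) * gg (dl v) - s al * gg (dd v) - s (be + eps) * (s eps * dd (dl v) - gg (dd v)) = 0"
    unfolding l lc_add l0[symmetric]
    apply (rule lce)
    subgoal by (simp add: m)
    subgoal using arg_cong[OF co(9), of "\<lambda>z. eps * z"] by (simp add: m cy)
    subgoal using arg_cong[OF co(10), of "\<lambda>z. eps * z"] by (simp add: m)
    subgoal using arg_cong[OF co(8), of "\<lambda>z. eps * z"] by (simp add: m)
    done
  have ua: "u \<in> alg" using v unfolding u_def by simp
  have "s eps * (W * u - s (inverse x) * u) + C * (F * (s (- eps) * (W * u - s x * u))) = 0"
    using rank3_braid[OF g] unfolding e0 e1 e2 e3 by simp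
  moreover have "C * (F * (s (- eps) * (W * u - s x * u))) = - (s eps * (C * (F * (W * u - s x * u))))"
    unfolding s_uminus by (simp only: alg_left[OF algs(6)] alg_left[OF S.algs(7)] mult_minus_left mult_minus_right)
  ultimately have "s eps * ((W * u - s (inverse x) * u) - C * (F * (W * u - s x * u))) = 0"
    by (simp only: right_diff_distrib[of "s eps"] add_uminus_conv_diff)
  then show ?thesis using eps ua by (rule_tac s_cancel[where c = eps]) simp_all
qed

text \<open>Multiplication by X - W^{-1} - C F (W - X), the conjugate from \<open>G_conj\<close> for
  the first and third strand, removes the Clifford part of \<open>rank3_key\<close>. So the third
  value of Z is the other root or satisfies r Z = 4; that it equals r would require r^2 = 4.\<close>

lemma rank3_good:
  assumes g: "good x y v" and eps: "eps \<noteq> 0"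
  shows "(s 4 - s r * (W + Wi)) * ((W + Wi - s ((2 + eps\<^sup>2) * c - r)) * v) = 0"
proof -
  define u where "u = W * v + Wi * v - s ((2 + eps\<^sup>2) * c - r) * v"
  have gu: "good x y u" unfolding u_def
    using g good_W[OF g] unfolding good_def by (auto simp: right_diff_distrib distrib_left alg_left s_left mult.commute)
  have xu: "X * u = s x * u" "Xi * u = s (inverse x) * u" "u \<in> alg"
    using gu good_inv[OF gu] unfolding good_def by auto
  have "(W * u - Xi * u) - C * (F * (W * u - X * u)) = 0"
    using rank3_key[OF g eps] unfolding u_def[symmetric] xu .
  then have "(X - Wi - C * F * (W - X)) * ((W * u - Xi * u) - C * (F * (W * u - X * u))) = 0" by simp
  then have "s 1 * u + s 1 * u + s 1 * u + s 1 * u - (X + Xi) * ((W + Wi) * u) = 0"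
    using xu(3) by (simp add: norm S.norm norm3) (simp add: algebra_simps)
  moreover have "(X + Xi) * ((W + Wi) * u) = s r * ((W + Wi) * u)"
    by (simp add: r norm3(6,7)[symmetric] norm3(10,11)[symmetric] distrib_left distrib_right xu s_add alg_left)
  moreover have "s 4 * u = s 1 * u + s 1 * u + s 1 * u + s 1 * u"
    by (simp flip: s_add distrib_right)
  ultimately have "(s 4 - s r * (W + Wi)) * u = 0"
    by (simp add: left_diff_distrib mult.assoc)
  then show ?thesis unfolding u_def by (simp add: left_diff_distrib distrib_right)
qed

text \<open>If x is its own inverse, the two factors in \<open>rank3_key\<close> coincide, and z = C
  F z with (C F)^2 = -1 forces 2 z = 0. The result is linear in W, where \<open>rank3_good\<close>
  would only give a square.\<close>

lemma rank3_fixed: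
  assumes g: "good x y v" and eps: "eps \<noteq> 0" and x: "inverse x = x" and two: "(2 :: 'k) \<noteq> 0"
  shows "(W - s x) * ((W + Wi - s ((2 + eps\<^sup>2) * c - r)) * v) = 0"
proof -
  define u where "u = W * v + Wi * v - s ((2 + eps\<^sup>2) * c - r) * v"
  define z where "z = W * u - s x * u"
  have za: "z \<in> alg" using g unfolding z_def u_def good_def by simp
  have 1: "z = C * (F * z)"
    using rank3_key[OF g eps] unfolding u_def[symmetric] x z_def by simp
  have "z = C * (F * (C * (F * z)))" using 1 by simp
  also have "\<dots> = - z" using za by (simp add: CCl S.CCl norm3)
  finally have "s 2 * z = 0" using s_add[of 1 1] za by (simp add: distrib_right eq_neg_iff_add_eq_0)
  then have "z = 0" using two za by (rule_tac s_cancel[of z 2]) simp_all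
  then show ?thesis unfolding z_def u_def by (simp add: left_diff_distrib distrib_right)
qed

end

text \<open>Where \<open>x\<close> or \<open>y\<close> is \<open>\<plusminus>1\<close>, the equation for \<open>X + Xi\<close> or \<open>Y + Yi\<close> alone would allow a nilpotent part.\<close>

lemma good_split:
  assumes v: "v \<in> alg" "phi * v = 0" "S.phi * v = 0" and M: "M \<in> alg"
    and x: "x \<noteq> 0" "(X + Xi) * v = s (x + inverse x) * v" "inverse x \<noteq> x \<or> X * v = s x * v"
    and y: "y \<noteq> 0" "(Y + Yi) * v = s (y + inverse y) * v" "inverse y \<noteq> y \<or> Y * v = s y * v"
    and g: "\<And>w x' y'. good x' y' w \<Longrightarrow> x' \<in> {x, inverse x} \<Longrightarrow> y' \<in> {y, inverse y} \<Longrightarrow> M * w = 0"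
  shows "M * v = 0"
proof -
  have SX: "S.phi * (X * w) = X * (S.phi * w)" for w
    unfolding S.phi_def S.G_def S.Z1_def S.Z2_def by (simp add: norm3 S.norm XYl XCl)
  have ZX: "(Y + Yi) * (X * w) = X * ((Y + Yi) * w)" for w by (simp add: norm)
  have step: "M * w = 0" if w: "w \<in> alg" "phi * w = 0" "S.phi * w = 0" "X * w = s x' * w" "x' \<in> {x, inverse x}"
    "(Y + Yi) * w = s (y + inverse y) * w" "inverse y \<noteq> y \<or> Y * w = s y * w" for w x'
  proof (cases "inverse y = y")
    case True
    then show ?thesis using w by (intro g[of x' y]) (auto simp: good_def)
  next
    case False
    show ?thesis
    proof (rule eig_split[where A = Y and Ai = Yi and x = y and P = "\<lambda>w. phi * w = 0 \<and> S.phi * w = 0 \<and> X * w = s x' * w"])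
      fix u k assume "phi * u = 0 \<and> S.phi * u = 0 \<and> X * u = s x' * u" "u \<in> alg"
      then show "phi * (Y * u - s k * u) = 0 \<and> S.phi * (Y * u - s k * u) = 0 \<and> X * (Y * u - s k * u) = s x' * (Y * u - s k * u)"
        by (simp add: right_diff_distrib phi_Y S.phi_X alg_left XYl(1)[symmetric] s_left mult.commute)
    qed (use w False y(1) g M in \<open>auto simp: X_Xi distrib_right good_def\<close>)
  qed
  show ?thesis
  proof (cases "inverse x = x")
    case True
    then show ?thesis using v x y by (intro step[of v x]) auto
  next
    case False
    show ?thesis
    proof (rule eig_split[where A = X and Ai = Xi and x = x and
          P = "\<lambda>w. phi * w = 0 \<and> S.phi * w = 0 \<and> (Y + Yi) * w = s (y + inverse y) * w \<and> (inverse y \<noteq> y \<or> Y * w = s y * w)"])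
      fix u k assume a: "phi * u = 0 \<and> S.phi * u = 0 \<and> (Y + Yi) * u = s (y + inverse y) * u \<and> (inverse y \<noteq> y \<or> Y * u = s y * u)" "u \<in> alg"
      have "(Y + Yi) * (X * u - s k * u) = s (y + inverse y) * (X * u - s k * u)"
        using a by (simp only: right_diff_distrib ZX alg_left alg_add algs s_left) (simp add: alg_left s_left mult.commute)
      moreover have "inverse y \<noteq> y \<or> Y * (X * u - s k * u) = s y * (X * u - s k * u)"
        using a by (auto simp: right_diff_distrib XYl alg_left s_left mult.commute)
      moreover have "phi * (X * u - s k * u) = 0 \<and> S.phi * (X * u - s k * u) = 0"
        using a by (simp add: right_diff_distrib phi_X SX alg_left)
      ultimately show "phi * (X * u - s k * u) = 0 \<and> S.phi * (X * u - s k * u) = 0 \<and>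
        (Y + Yi) * (X * u - s k * u) = s (y + inverse y) * (X * u - s k * u) \<and> (inverse y \<noteq> y \<or> Y * (X * u - s k * u) = s y * (X * u - s k * u))" by blast
    qed (use v x y False M step[of _ x] step[of _ "inverse x"] in \<open>auto simp: X_Xi distrib_right\<close>)
  qed
qed

end

section \<open>Polynomials evaluated at an element\<close>

text \<open>Coprimality as a Bezout identity: in this form it can be evaluated at an element of a
  noncommutative ring and applied to a vector.\<close>

definition comax :: "'a::comm_ring_1 \<Rightarrow> 'a \<Rightarrow> bool" where
  "comax p q \<longleftrightarrow> (\<exists>a b. a * p + b * q = 1)"

lemma comaxI: "a * p + b * q = 1 \<Longrightarrow> comax p q"
  unfolding comax_def by blast

lemma comax_sym: "comax p q \<Longrightarrow> comax q p"
  unfolding comax_def by (metis add.commute)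

lemma comax_mult: "comax p q \<Longrightarrow> comax p r \<Longrightarrow> comax p (q * r)"
proof -
  assume "comax p q" "comax p r"
  then obtain a b c d where 1: "a * p + b * q = 1" "c * p + d * r = 1" unfolding comax_def by blast
  have "(a * (c * p + d * r) + b * q * c) * p + (b * d) * (q * r) = (a * p + b * q) * (c * p + d * r)"
    by (simp add: algebra_simps)
  then show ?thesis using 1 by (intro comaxI) simp
qed

lemma comax_one [simp]: "comax p 1"
  by (rule comaxI[of 0 _ 1]) simp

lemma comax_prod: "(\<And>x. x \<in> F \<Longrightarrow> comax p (f x)) \<Longrightarrow> comax p (prod f F)"
  by (induction F rule: infinite_finite_induct) (simp_all add: comax_mult)

lemma comax_diff:
  assumes "m * (q - p) = z" "p = 1 + z"
  shows "comax p q"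
proof (rule comaxI)
  have "(1 + m) * p + (- m) * q = p - m * (q - p)" by (simp add: algebra_simps)
  then show "(1 + m) * p + (- m) * q = 1" using assms by simp
qed

lemma comax_rem:
  assumes "k * (q - p * l) = 1"
  shows "comax p q"
  using assms by (intro comaxI[of "- k * l" _ k]) (simp add: algebra_simps)

definition quad :: "'k::field \<Rightarrow> 'k poly" where
  "quad c = [:1, - c, 1:]"

definition lin :: "'k::field \<Rightarrow> 'k poly" where
  "lin b = [:- b, 1:]"

text \<open>Both polynomials are 1 modulo the variable, and their difference is a nonzero multiple
  of the variable.\<close>

lemma comax_quad: assumes "c \<noteq> d" shows "comax (quad c) (quad d)"
proof (rule comax_diff)
  have "quad d - quad c = smult (c - d) [:0, 1:]" unfolding quad_def by simp
  then show "smult (inverse (c - d)) [:- c, 1:] * (quad d - quad c) = [:- c, 1:] * [:0, 1:]"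
    using assms by (simp only: mult_smult_left mult_smult_right smult_smult) simp
  show "quad c = 1 + [:- c, 1:] * [:0, 1:]" unfolding quad_def by (simp add: one_pCons)
qed

lemma comax_lin: assumes "a \<noteq> b" shows "comax (lin a) (lin b)"
proof (rule comaxI)
  have "lin b - lin a = [:a - b:]" unfolding lin_def by simp
  then have "[:inverse (a - b):] * (lin b - lin a) = 1" using assms by (simp add: one_pCons)
  then show "- [:inverse (a - b):] * lin a + [:inverse (a - b):] * lin b = 1" by (simp only: right_diff_distrib) simp
qed

lemma comax_lin_quad: assumes "a * a + 1 \<noteq> c * a" shows "comax (lin a) (quad c)"
proof (rule comax_rem)
  have "quad c - lin a * [:a - c, 1:] = [:a * a + 1 - c * a:]"
    unfolding quad_def lin_def by (simp add: algebra_simps)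
  then show "[:inverse (a * a + 1 - c * a):] * (quad c - lin a * [:a - c, 1:]) = 1"
    using assms by (simp add: one_pCons)
qed

lemma quad_sq: "a * a = 1 \<Longrightarrow> quad (2 * a) = lin a * lin a"
  unfolding quad_def lin_def by simp

lemma quad_factor: "a * b = 1 \<Longrightarrow> quad (a + b) = lin a * lin b"
  unfolding quad_def lin_def by (simp add: mult.commute)

section \<open>Polynomials annihilating a vector\<close>

context scalars
begin

definition ev :: "'a \<Rightarrow> 'k poly \<Rightarrow> 'a" where
  "ev w p = fold_coeffs (\<lambda>a x. s a + w * x) p 0"

lemma ev_0 [simp]: "ev w 0 = 0"
  unfolding ev_def by simp

lemma ev_pCons: "ev w (pCons a p) = s a + w * ev w p"
  unfolding ev_def by (cases "p = 0 \<and> a = 0") auto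

lemma ev_1 [simp]: "ev w 1 = s 1"
  unfolding one_pCons by (simp add: ev_pCons)

lemma ev_add: "ev w (p + q) = ev w p + ev w q"
  by (induction p q rule: poly_induct2) (simp_all add: ev_pCons s_add algebra_simps)

lemma ev_alg [simp]: "w \<in> alg \<Longrightarrow> ev w p \<in> alg"
  by (induction p) (simp_all add: ev_pCons)

lemma ev_smult: "w \<in> alg \<Longrightarrow> ev w (smult a p) = s a * ev w p"
  by (induction p) (simp_all add: ev_pCons s_mult distrib_left alg_left)

lemma ev_mult: "w \<in> alg \<Longrightarrow> ev w (p * q) = ev w p * ev w q"
  by (induction p) (simp_all add: ev_pCons ev_add ev_smult distrib_right mult.assoc)

lemma ev_comm: "w \<in> alg \<Longrightarrow> ev w p * ev w q = ev w q * ev w p"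
  by (simp flip: ev_mult add: mult.commute)

lemma ev_swap: "w \<in> alg \<Longrightarrow> w' \<in> alg \<Longrightarrow> M \<in> alg \<Longrightarrow> M * w = w' * M \<Longrightarrow> M * ev w p = ev w' p * M"
  by (induction p) (simp_all add: ev_pCons distrib_left distrib_right alg_comm mult.assoc[symmetric],
      simp add: mult.assoc)

lemma ev_eig: "w \<in> alg \<Longrightarrow> v \<in> alg \<Longrightarrow> w * v = s a * v \<Longrightarrow> ev w p * v = s (poly p a) * v"
  by (induction p) (simp_all add: ev_pCons s_add distrib_right mult.assoc alg_left s_left mult.commute)

lemma ev_eig_right: "w \<in> alg \<Longrightarrow> v \<in> alg \<Longrightarrow> v * w = s a * v \<Longrightarrow> v * ev w p = s (poly p a) * v"
proof (induction p)
  case (pCons b p)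
  have "v * (w * ev w p) = (v * w) * ev w p" by (simp add: mult.assoc)
  then have "v * (w * ev w p) = s a * (v * ev w p)" using pCons by (simp add: mult.assoc)
  then show ?case using pCons
    by (simp add: ev_pCons s_add distrib_right distrib_left s_left alg_comm mult.assoc)
qed simp

lemma ev_lin: "w \<in> alg \<Longrightarrow> ev w (lin b) = w - s b"
  by (simp add: lin_def ev_pCons s_uminus)

lemma ev_quad: assumes "w \<in> alg" "w' \<in> alg" "w * w' = s 1" shows "ev w (quad c) = w * (w + w' - s c)"
  using assms by (simp add: quad_def ev_pCons s_uminus algebra_simps)

definition kills :: "'a \<Rightarrow> 'k poly \<Rightarrow> 'a \<Rightarrow> bool" where
  "kills w p v \<longleftrightarrow> ev w p * v = 0"

lemma kills_mult: "w \<in> alg \<Longrightarrow> kills w p v \<Longrightarrow> kills w (q * p) v"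
  unfolding kills_def by (simp add: ev_mult mult.assoc)

lemma kills_dvd: "w \<in> alg \<Longrightarrow> kills w p v \<Longrightarrow> p dvd q \<Longrightarrow> kills w q v"
  by (metis dvd_def kills_mult mult.commute)

lemma kills_add: "kills w p v \<Longrightarrow> kills w q v \<Longrightarrow> kills w (p + q) v"
  unfolding kills_def by (simp add: ev_add distrib_right)

lemma kills_one: "v \<in> alg \<Longrightarrow> kills w 1 v \<Longrightarrow> v = 0"
  unfolding kills_def by simp

text \<open>Multiply the Bezout identity by r: a comaximal pair of factors can be cancelled from two
  annihilators.\<close>

lemma kills_comax:
  assumes "w \<in> alg" "comax p q" "kills w (p * r) v" "kills w (q * r) v"
  shows "kills w r v"
proof -
  obtain a b where "a * p + b * q = 1" using assms(2) unfolding comax_def by blast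
  then have "(a * p + b * q) * r = r" by simp
  then have r: "a * (p * r) + b * (q * r) = r" by (simp add: distrib_right mult.assoc)
  have "kills w (a * (p * r) + b * (q * r)) v"
    using kills_add kills_mult[OF assms(1,3)] kills_mult[OF assms(1,4)] by blast
  then show ?thesis unfolding r .
qed

lemma kills_comax0:
  assumes "w \<in> alg" "v \<in> alg" "comax p q" "kills w p v" "kills w q v"
  shows "v = 0"
  using kills_comax[of w p q 1 v] assms by (auto intro: kills_one)

lemma kills_ev: "w \<in> alg \<Longrightarrow> kills w q (ev w p * v) \<longleftrightarrow> kills w (q * p) v"
  unfolding kills_def by (simp add: ev_mult mult.assoc)

text \<open>A decomposition into eigencomponents without denominators: the product over F - {A},
  applied to v, is the component of v belonging to A up to an invertible factor. If all components
  vanish, the factors of the full annihilator can be cancelled one after the other.\<close>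

lemma kills_cover:
  assumes w: "w \<in> alg" and v: "v \<in> alg" and F: "finite F"
    and cm: "\<And>A B. A \<in> F \<Longrightarrow> B \<in> F \<Longrightarrow> A \<noteq> B \<Longrightarrow> comax (f A) (f B)"
    and all: "kills w (prod f F) v" and each: "\<And>A. A \<in> F \<Longrightarrow> kills w (prod f (F - {A})) v"
  shows "v = 0"
proof -
  have "G \<subseteq> F \<Longrightarrow> kills w (prod f (F - G)) v" if "finite G" for G
    using that
  proof (induction G rule: finite_induct)
    case empty
    then show ?case using all by simp
  next
    case (insert A G)
    let ?R = "F - insert A G"
    have fin: "finite G" "finite ?R" using insert F by auto
    have 1: "F - G = insert A ?R" "F - {A} = G \<union> ?R" using insert.hyps insert.prems by auto
    have "kills w (f A * prod f ?R) v"
    proof -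
      have "kills w (prod f (F - G)) v" using insert.IH insert.prems by simp
      then show ?thesis unfolding 1(1) using fin by (simp add: prod.insert)
    qed
    moreover have "kills w (prod f G * prod f ?R) v"
    proof -
      have "prod f (F - {A}) = prod f G * prod f ?R"
        unfolding 1(2) using fin by (intro prod.union_disjoint) auto
      then show ?thesis using each[of A] insert.prems by simp
    qed
    moreover have "comax (f A) (prod f G)"
      using insert cm by (intro comax_prod) auto
    ultimately show ?case using kills_comax w by blast
  qed
  from this[OF F order_refl] show ?thesis using v by (auto intro: kills_one)
qed

end

section \<open>Growing diagrams box by box\<close>

definition vbox :: "bullet \<Rightarrow> nat \<Rightarrow> box \<Rightarrow> bool" where
  "vbox b M = (\<lambda>(i, j, l). l < M \<and> 1 \<le> i \<and> (if l < nstrict b then i \<le> j else 1 \<le> j))"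

text \<open>Only valid positions count as predecessors, so the border of a component and the shifted
  diagonal need no separate treatment in \<open>addable\<close>.\<close>

definition prv :: "bullet \<Rightarrow> nat \<Rightarrow> box \<Rightarrow> box set" where
  "prv b M = (\<lambda>(i, j, l). {B. vbox b M B \<and> (\<exists>i' j'. B = (i', j', l) \<and> (Suc i' = i \<and> j' = j \<or> i' = i \<and> Suc j' = j))})"

definition addable :: "bullet \<Rightarrow> nat \<Rightarrow> box set \<Rightarrow> box set" where
  "addable b M S = {A. vbox b M A \<and> A \<notin> S \<and> prv b M A \<subseteq> S}"

definition removable :: "bullet \<Rightarrow> nat \<Rightarrow> box set \<Rightarrow> box set" where
  "removable b M S = {A \<in> S. \<forall>B \<in> S. A \<notin> prv b M B}"

definition shape :: "bullet \<Rightarrow> nat \<Rightarrow> box set \<Rightarrow> bool" where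
  "shape b M S \<longleftrightarrow> finite S \<and> (\<forall>A \<in> S. vbox b M A \<and> prv b M A \<subseteq> S)"

text \<open>A standard tableau as the list of its boxes in the order of their entries. The induction
  runs over such lists because its basic step is to append one box.\<close>

definition path :: "bullet \<Rightarrow> nat \<Rightarrow> box list \<Rightarrow> bool" where
  "path b M t \<longleftrightarrow> (\<forall>k < length t. t ! k \<in> addable b M (set (take k t)))"

definition diag :: "bullet \<Rightarrow> box \<Rightarrow> bool" where
  "diag b = (\<lambda>(i, j, l). l < nstrict b \<and> i = j)"

definition rightb :: "box \<Rightarrow> box" where "rightb = (\<lambda>(i, j, l). (i, Suc j, l))"
definition downb :: "box \<Rightarrow> box" where "downb = (\<lambda>(i, j, l). (Suc i, j, l))"

lemma path_Nil [simp]: "path b M []"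
  by (simp add: path_def)

lemma path_snoc: "path b M (t @ [A]) \<longleftrightarrow> path b M t \<and> A \<in> addable b M (set t)"
  unfolding path_def by (auto simp: nth_append less_Suc_eq)

lemma path_take: "path b M t \<Longrightarrow> path b M (take k t)"
  unfolding path_def by (auto simp: min_def)

lemma prv_irrefl: "A \<notin> prv b M A"
  unfolding prv_def by auto

lemma addable_insert: "A \<in> addable b M S \<Longrightarrow> B \<in> addable b M S \<Longrightarrow> A \<noteq> B \<Longrightarrow> B \<in> addable b M (insert A S)"
  unfolding addable_def by auto

lemma path_append: "path b M (t @ u) \<longleftrightarrow> path b M t \<and> (\<forall>k < length u. u ! k \<in> addable b M (set t \<union> set (take k u)))"
proof (induction u rule: rev_induct)
  case (snoc A u)
  have "path b M (t @ u @ [A]) \<longleftrightarrow> path b M (t @ u) \<and> A \<in> addable b M (set (t @ u))"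
    using path_snoc[of b M "t @ u" A] by simp
  then show ?case unfolding snoc by (auto simp: nth_append less_Suc_eq)
qed simp

text \<open>If U is not a predecessor of A, then A was already addable before U. Both orders lead to
  the same diagram, so the rest of the list is unaffected.\<close>

lemma path_swap:
  assumes "path b M (t @ U # A # u)" and "U \<notin> prv b M A"
  shows "path b M (t @ A # U # u)" "U \<in> addable b M (set t)" "A \<in> addable b M (set t)"
proof -
  have a: "path b M t" "U \<in> addable b M (set t)" "A \<in> addable b M (insert U (set t))"
    "\<And>k. k < length u \<Longrightarrow> u ! k \<in> addable b M (insert U (insert A (set t)) \<union> set (take k u))"
  proof -
    have "path b M ((t @ [U, A]) @ u)" using assms by simp
    then have *: "path b M (t @ [U, A])" "\<And>k. k < length u \<Longrightarrow> u ! k \<in> addable b M (set (t @ [U, A]) \<union> set (take k u))"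
      unfolding path_append by auto
    then show "\<And>k. k < length u \<Longrightarrow> u ! k \<in> addable b M (insert U (insert A (set t)) \<union> set (take k u))"
      by (simp add: insert_commute)
    have "path b M ((t @ [U]) @ [A])" using * by simp
    then show "path b M t" "U \<in> addable b M (set t)" "A \<in> addable b M (insert U (set t))"
      unfolding path_snoc by auto
  qed
  show A: "A \<in> addable b M (set t)" and U: "U \<in> addable b M (set t)"
    using a assms(2) unfolding addable_def by auto
  have "A \<noteq> U" using a(3) unfolding addable_def by auto
  then have "path b M ((t @ [A]) @ [U])" unfolding path_snoc using a A addable_insert[OF A U] by auto
  then have "path b M ((t @ [A, U]) @ u)" unfolding path_append[of b M "t @ [A, U]" u]
    using a(4) by (simp add: insert_commute)
  then show "path b M (t @ A # U # u)" by simp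
qed

lemma shape_insert: "shape b M S \<Longrightarrow> A \<in> addable b M S \<Longrightarrow> shape b M (insert A S)"
  unfolding shape_def addable_def by auto

lemma shape_remove: "shape b M S \<Longrightarrow> A \<in> removable b M S \<Longrightarrow> shape b M (S - {A}) \<and> A \<in> addable b M (S - {A})"
  unfolding shape_def addable_def removable_def using prv_irrefl by fast

lemma path_shape: "path b M t \<Longrightarrow> shape b M (set t) \<and> distinct t"
proof (induction t rule: rev_induct)
  case Nil
  then show ?case by (simp add: shape_def)
next
  case (snoc A t)
  then show ?case using shape_insert[of b M "set t" A] by (auto simp: path_snoc addable_def)
qed

text \<open>A box with maximal i + j has no successor in S.\<close>

lemma shape_removable_ex: assumes "shape b M S" "S \<noteq> {}" shows "\<exists>A. A \<in> removable b M S"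
proof -
  define f :: "box \<Rightarrow> nat" where "f = (\<lambda>(i, j, l). i + j)"
  have "finite S" using assms by (simp add: shape_def)
  then have "Max (f ` S) \<in> f ` S" using assms(2) by (intro Max_in) auto
  then obtain A where "A \<in> S" "f A = Max (f ` S)" by auto
  then have A: "A \<in> S" "\<And>B. B \<in> S \<Longrightarrow> f B \<le> f A"
    using \<open>finite S\<close> by auto
  have "A \<notin> prv b M B" if "B \<in> S" for B
    using A(2)[OF that] unfolding prv_def f_def by auto
  then have "A \<in> removable b M S" using A(1) unfolding removable_def by blast
  then show ?thesis by blast
qed

lemma shape_path: "shape b M S \<Longrightarrow> \<exists>t. path b M t \<and> set t = S \<and> length t = card S"
proof (induction "card S" arbitrary: S)
  case 0
  then show ?case by (intro exI[of _ "[]"]) (auto simp: shape_def)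
next
  case (Suc n)
  then obtain A where A: "A \<in> removable b M S" using shape_removable_ex by fastforce
  then have AS: "A \<in> S" by (simp add: removable_def)
  have "card (S - {A}) = n" using Suc AS by simp
  then obtain t where "path b M t" "set t = S - {A}" "length t = card (S - {A})"
    using Suc.hyps(1)[of "S - {A}"] shape_remove[OF Suc.prems A] by auto
  then show ?case using shape_remove[OF Suc.prems A] AS Suc.hyps(2) \<open>card (S - {A}) = n\<close>
    by (intro exI[of _ "t @ [A]"]) (auto simp: path_snoc)
qed

lemma prv_right: "vbox b M A \<Longrightarrow> A \<in> prv b M (rightb A)" and prv_down: "vbox b M A \<Longrightarrow> A \<in> prv b M (downb A)"
  unfolding prv_def rightb_def downb_def by (auto split: prod.splits)

lemma prv_only: "A \<in> prv b M B \<Longrightarrow> B = rightb A \<or> B = downb A"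
  unfolding prv_def rightb_def downb_def by (auto split: prod.splits)

lemma addable_after:
  assumes "B \<in> addable b M S"
  shows "addable b M (insert B S) = (addable b M S - {B}) \<union> ({rightb B, downb B} \<inter> addable b M (insert B S))"
proof -
  have "A \<in> addable b M S \<or> A = rightb B \<or> A = downb B" if "A \<in> addable b M (insert B S)" for A
    using that prv_only[of B b M A] unfolding addable_def by auto
  moreover have "B \<notin> addable b M (insert B S)" unfolding addable_def by simp
  ultimately show ?thesis using addable_insert[OF assms] by blast
qed

lemma finite_addable_empty: "finite (addable b M {})"
proof -
  have "addable b M {} \<subseteq> (\<lambda>l. (1, 1, l)) ` {..<M}"
  proof
    fix A assume A: "A \<in> addable b M {}"
    obtain i j l where e: "A = (i, j, l)" by (cases A)
    have v: "vbox b M (i, j, l)" and n: "prv b M (i, j, l) = {}" using A unfolding addable_def e by auto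
    have "(i - 1, j, l) \<notin> prv b M (i, j, l)" "(i, j - 1, l) \<notin> prv b M (i, j, l)" using n by auto
    then have "i = 1" "j = 1" using v unfolding prv_def vbox_def by (auto split: if_splits)
    then show "A \<in> (\<lambda>l. (1, 1, l)) ` {..<M}" using v unfolding e vbox_def by auto
  qed
  then show ?thesis by (rule finite_subset) auto
qed

lemma finite_addable: "path b M t \<Longrightarrow> finite (addable b M (set t))"
proof (induction t rule: rev_induct)
  case Nil
  then show ?case using finite_addable_empty by simp
next
  case (snoc A t)
  then have "A \<in> addable b M (set t)" "finite (addable b M (set t))" by (auto simp: path_snoc)
  then show ?case using addable_after[of A b M "set t"] by (auto intro: finite_subset)
qed

lemma next_not_addable: "B \<in> addable b M S \<Longrightarrow> rightb B \<notin> addable b M S \<and> downb B \<notin> addable b M S"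
  using prv_right[of b M B] prv_down[of b M B] unfolding addable_def by auto

lemma right_neq_down: "rightb B \<noteq> downb B" "rightb B \<noteq> B" "downb B \<noteq> B"
  unfolding rightb_def downb_def by (auto split: prod.splits)

text \<open>What blocks the position right of B is the missing box above that position. Then the box
  U above B has no successor in S, and it lies on the same diagonal as the blocked position: a
  blocked neighbour has the residue of a removable box.\<close>

lemma not_right:
  assumes S: "shape b M S" and B: "B \<in> addable b M S" and R: "rightb B \<notin> addable b M (insert B S)"
  shows "\<exists>U \<in> removable b M S. U \<in> prv b M B \<and> \<not> diag b U \<and> (\<exists>i j l. rightb B = (Suc i, Suc j, l) \<and> U = (i, j, l))"
proof -
  obtain i j l where Be: "B = (i, j, l)" by (cases B)
  have v: "vbox b M B" "B \<notin> S" "prv b M B \<subseteq> S" using B by (auto simp: addable_def)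
  have R': "rightb B \<notin> insert B S"
  proof
    assume "rightb B \<in> insert B S"
    then have "rightb B \<in> S" using right_neq_down by blast
    then have "prv b M (rightb B) \<subseteq> S" using S by (simp add: shape_def)
    then show False using prv_right[OF v(1)] v(2) by auto
  qed
  have "vbox b M (rightb B)" using v(1) unfolding Be vbox_def rightb_def by auto
  then obtain V where V: "V \<in> prv b M (rightb B)" "V \<notin> insert B S" using R R' by (auto simp: addable_def)
  then have Ve: "V = (i - 1, Suc j, l)" "i \<ge> 2"
    unfolding Be prv_def rightb_def vbox_def by auto
  let ?U = "(i - 1, j, l)"
  have U: "?U \<in> prv b M B" using v(1) Ve unfolding Be prv_def vbox_def by auto
  have "?U \<notin> prv b M A" if "A \<in> S" for A
  proof
    assume "?U \<in> prv b M A"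
    then have "A = (i - 1, Suc j, l) \<or> A = (i, j, l)"
      using Ve(2) prv_only[of ?U b M A] unfolding rightb_def downb_def by auto
    then show False using that V Ve v Be by auto
  qed
  then have "?U \<in> removable b M S" using U v unfolding removable_def by auto
  moreover have "\<not> diag b ?U" using v(1) Ve(2) unfolding diag_def vbox_def Be by (auto split: if_splits)
  moreover have "rightb B = (Suc (i - 1), Suc j, l)" using Ve(2) by (simp add: Be rightb_def)
  ultimately show ?thesis using U by blast
qed

lemma not_down:
  assumes S: "shape b M S" and B: "B \<in> addable b M S" and R: "downb B \<notin> addable b M (insert B S)" and nd: "\<not> diag b B"
  shows "\<exists>U \<in> removable b M S. U \<in> prv b M B \<and> \<not> diag b U \<and> (\<exists>i j l. downb B = (Suc i, Suc j, l) \<and> U = (i, j, l))"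
proof -
  obtain i j l where Be: "B = (i, j, l)" by (cases B)
  have v: "vbox b M B" "B \<notin> S" "prv b M B \<subseteq> S" using B by (auto simp: addable_def)
  have R': "downb B \<notin> insert B S"
  proof
    assume "downb B \<in> insert B S"
    then have "downb B \<in> S" using right_neq_down by blast
    then have "prv b M (downb B) \<subseteq> S" using S by (simp add: shape_def)
    then show False using prv_down[OF v(1)] v(2) by auto
  qed
  have "vbox b M (downb B)" using v(1) nd unfolding Be vbox_def downb_def diag_def by auto
  then obtain V where V: "V \<in> prv b M (downb B)" "V \<notin> insert B S" using R R' by (auto simp: addable_def)
  then have Ve: "V = (Suc i, j - 1, l)" "j \<ge> 1" "vbox b M V"
    unfolding Be prv_def downb_def by auto
  let ?U = "(i, j - 1, l)"
  have U: "?U \<in> prv b M B" using v(1) Ve unfolding Be prv_def vbox_def by (auto split: if_splits)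
  have "?U \<notin> prv b M A" if "A \<in> S" for A
  proof
    assume "?U \<in> prv b M A"
    then have "A = (Suc i, j - 1, l) \<or> A = (i, j, l)"
      using Ve(2) prv_only[of ?U b M A] unfolding rightb_def downb_def by auto
    then show False using that V Ve v Be by auto
  qed
  then have "?U \<in> removable b M S" using U v unfolding removable_def by auto
  moreover have "\<not> diag b ?U" using Ve unfolding diag_def vbox_def by (auto split: if_splits)
  moreover have "downb B = (Suc i, Suc (j - 1), l)" using Ve(2) by (simp add: Be downb_def)
  ultimately show ?thesis using U by blast
qed

text \<open>B stands next to the diagonal, so the position below it has nothing valid to its left
  and B is its only predecessor. It is therefore never blocked, although its weight repeats that of
  the box left of B, which is removable from S.\<close>

lemma down_diag:
  assumes S: "shape b M S" and B: "B \<in> addable b M S" and D: "diag b (downb B)"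
  shows "downb B \<in> addable b M (insert B S) \<and>
    (\<exists>U \<in> removable b M S. U \<in> prv b M B \<and> diag b U \<and> snd (snd U) = snd (snd B)) \<and> \<not> diag b B"
proof -
  obtain i l where Be: "B = (i, Suc i, l)" "l < nstrict b" using D unfolding diag_def downb_def by (cases B) auto
  have v: "vbox b M B" "B \<notin> S" "prv b M B \<subseteq> S" using B by (auto simp: addable_def)
  have nS: "downb B \<notin> insert B S"
  proof
    assume "downb B \<in> insert B S"
    then have "downb B \<in> S" using right_neq_down by blast
    then have "prv b M (downb B) \<subseteq> S" using S by (simp add: shape_def)
    then show False using prv_down[OF v(1)] v(2) by auto
  qed
  have 1: "downb B \<in> addable b M (insert B S)"
    using v(1) nS unfolding addable_def Be downb_def prv_def vbox_def using Be(2) by auto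
  let ?U = "(i, i, l)"
  have U: "?U \<in> prv b M B" using v(1) Be(2) unfolding Be prv_def vbox_def by auto
  have "?U \<notin> prv b M A" if "A \<in> S" for A
  proof
    assume "?U \<in> prv b M A"
    then have "A = (i, Suc i, l) \<or> A = (Suc i, i, l)"
      using prv_only[of ?U b M A] unfolding rightb_def downb_def by auto
    moreover have "vbox b M A" using that S by (auto simp: shape_def)
    ultimately show False using that v Be by (auto simp: vbox_def)
  qed
  then have "?U \<in> removable b M S" using U v unfolding removable_def by auto
  then show ?thesis using 1 U Be by (auto simp: diag_def intro!: bexI[of _ ?U])
qed

section \<open>Separateness as inequalities between weights of boxes\<close>

locale residues_sep =
  fixes b :: bullet and M N :: nat and eps :: "'k::field" and c :: "box \<Rightarrow> 'k" and z :: "nat \<Rightarrow> 'k"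
  assumes two: "(2::'k) \<noteq> 0" and eps: "eps \<noteq> 0"
    and c_diag: "c (Suc i, Suc j, l) = c (i, j, l)"
    and c_sum: "c (rightb A) + c (downb A) = (2 + eps\<^sup>2) * c A"
    and c_prod: "c (rightb A) * c (downb A) = (c A)\<^sup>2 + 4 * eps\<^sup>2"
    and c_strict: "l < nstrict b \<Longrightarrow> c (i, i, l) = 2 * z l" and z_sq: "z l * z l = 1"
    and sep: "shape b M S \<Longrightarrow> card S + 2 \<le> N \<Longrightarrow> A \<in> addable b M S \<Longrightarrow> B \<in> addable b M (insert A S) \<Longrightarrow> c A \<noteq> c B"
begin

text \<open>At a diagonal box c = 2 z, and the quadratic polynomial would be the square of
  \<open>lin z\<close>. The linear choice makes X act there by the scalar z, without a nilpotent
  part.\<close>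

definition pol :: "box \<Rightarrow> 'k poly" where
  "pol A = (if diag b A then lin (z (snd (snd A))) else quad (c A))"

lemma c_of_diag: "diag b A \<Longrightarrow> c A = 2 * z (snd (snd A))"
  unfolding diag_def using c_strict by (cases A) auto

lemma c_add_add: "shape b M S \<Longrightarrow> card S + 2 \<le> N \<Longrightarrow> A \<in> addable b M S \<Longrightarrow> B \<in> addable b M S \<Longrightarrow> A \<noteq> B \<Longrightarrow> c A \<noteq> c B"
  by (rule sep[OF _ _ _ addable_insert])

text \<open>Take U away and put it back: U and then A are two boxes added in succession.\<close>

lemma c_rem_add:
  assumes S: "shape b M S" "card S + 1 \<le> N" and U: "U \<in> removable b M S" and A: "A \<in> addable b M S"
  shows "c U \<noteq> c A"
proof -
  have "U \<in> S" using U by (simp add: removable_def)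
  then have "insert U (S - {U}) = S" "card (S - {U}) + 1 = card S"
    using S card_Suc_Diff1[of S U] by (auto simp: shape_def)
  then show ?thesis using sep[of "S - {U}" U A] shape_remove[OF S(1) U] S A by simp
qed

lemma c_rem_rem:
  assumes S: "shape b M S" "card S \<le> N" and U: "U \<in> removable b M S" and V: "V \<in> removable b M S" and "U \<noteq> V"
  shows "c U \<noteq> c V"
proof -
  have UV: "U \<in> S" "V \<in> S" using U V by (auto simp: removable_def)
  have "U \<in> removable b M (S - {V})" using U UV assms(5) by (auto simp: removable_def)
  moreover have "V \<in> addable b M (S - {V})" "shape b M (S - {V})" using shape_remove[OF S(1) V] by auto
  moreover have "card (S - {V}) + 1 \<le> N" using S UV card_Suc_Diff1[of S V] by (simp add: shape_def)
  ultimately show ?thesis using c_rem_add by blast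
qed

text \<open>If the neighbour can be added after B, separateness compares it with A. If it is
  blocked, it has the weight of a removable box by \<open>not_right\<close> or
  \<open>not_down\<close>, and \<open>c_rem_add\<close> applies.\<close>

lemma c_next_add:
  assumes S: "shape b M S" "card S + 3 \<le> N" and B: "B \<in> addable b M S" and A: "A \<in> addable b M S"
  shows "c (rightb B) \<noteq> c A" and "\<not> diag b B \<Longrightarrow> c (downb B) \<noteq> c A"
proof -
  have f: "finite S" "B \<notin> S" using S B by (auto simp: shape_def addable_def)
  have S': "shape b M (insert B S)" "card (insert B S) + 2 \<le> N"
    using shape_insert[OF S(1) B] S(2) f by auto
  have ne: "rightb B \<noteq> A" "downb B \<noteq> A" using next_not_addable[OF B] A by auto
  have 1: "c C \<noteq> c A" if C: "C \<in> addable b M (insert B S)" "C \<noteq> A" for C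
  proof (cases "A = B")
    case True
    then show ?thesis using sep[OF S(1) _ B C(1)] S by auto
  next
    case False
    then show ?thesis using c_add_add[OF S' C(1) addable_insert[OF B A]] C by auto
  qed
  show "c (rightb B) \<noteq> c A"
  proof (cases "rightb B \<in> addable b M (insert B S)")
    case False
    then obtain U i j l where "U \<in> removable b M S" "rightb B = (Suc i, Suc j, l)" "U = (i, j, l)"
      using not_right[OF S(1) B] by blast
    then show ?thesis using c_rem_add[OF S(1) _ _ A] S(2) c_diag by auto
  qed (use 1 ne in auto)
  show "c (downb B) \<noteq> c A" if nd: "\<not> diag b B"
  proof (cases "downb B \<in> addable b M (insert B S)")
    case False
    then obtain U i j l where "U \<in> removable b M S" "downb B = (Suc i, Suc j, l)" "U = (i, j, l)"
      using not_down[OF S(1) B _ nd] by blast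
    then show ?thesis using c_rem_add[OF S(1) _ _ A] S(2) c_diag by auto
  qed (use 1 ne in auto)
qed

text \<open>By \<open>c_sum\<close> and \<open>c_prod\<close> the product of the differences of c B
  with the weights of its two neighbours is -eps^2 ((c B)^2 - 4). If it vanished, B and a neighbour
  would have the same weight, which separateness excludes whether or not that neighbour can be
  added.\<close>

lemma c_not_2:
  assumes S: "shape b M S" "card S + 2 \<le> N" and B: "B \<in> addable b M S" and nd: "\<not> diag b B"
  shows "(c B)\<^sup>2 \<noteq> 4"
proof
  assume "(c B)\<^sup>2 = 4"
  moreover have "(c B - c (rightb B)) * (c B - c (downb B)) = (c B)\<^sup>2 - (c (rightb B) + c (downb B)) * c B + c (rightb B) * c (downb B)"
    by (simp add: algebra_simps power2_eq_square)
  moreover have "\<dots> = - (eps\<^sup>2) * ((c B)\<^sup>2 - 4)"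
    unfolding c_sum c_prod by (simp add: algebra_simps power2_eq_square)
  ultimately have "c B = c (rightb B) \<or> c B = c (downb B)" by simp
  moreover have 1: "c C \<noteq> c B" if C: "C \<in> addable b M (insert B S)" for C
    using sep[OF S(1) _ B C] S by auto
  moreover have "c (rightb B) \<noteq> c B"
  proof (cases "rightb B \<in> addable b M (insert B S)")
    case False
    then obtain U i j l where "U \<in> removable b M S" "rightb B = (Suc i, Suc j, l)" "U = (i, j, l)"
      using not_right[OF S(1) B] by blast
    then show ?thesis using c_rem_add[OF S(1) _ _ B] S(2) c_diag by auto
  qed (use 1 in auto)
  moreover have "c (downb B) \<noteq> c B"
  proof (cases "downb B \<in> addable b M (insert B S)")
    case False
    then obtain U i j l where "U \<in> removable b M S" "downb B = (Suc i, Suc j, l)" "U = (i, j, l)"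
      using not_down[OF S(1) B _ nd] by blast
    then show ?thesis using c_rem_add[OF S(1) _ _ B] S(2) c_diag by auto
  qed (use 1 in auto)
  ultimately show False by auto
qed

text \<open>There is no valid position below a diagonal box, but the weight of the formal box there
  still enters phi^2. As (c B)^2 = 4, one of the two neighbours has the weight of B, and it is not
  the right one.\<close>

lemma downb_diag:
  assumes S: "shape b M S" "card S + 3 \<le> N" and B: "B \<in> addable b M S" and d: "diag b B"
  shows "c (downb B) = c B" "c (rightb B) \<noteq> c B"
proof -
  show ne: "c (rightb B) \<noteq> c B" using c_next_add(1)[OF S B B] .
  have c4: "(c B)\<^sup>2 = 4" using c_of_diag[OF d] z_sq by (simp add: power2_eq_square)
  have "(c B - c (rightb B)) * (c B - c (downb B)) = (c B)\<^sup>2 - (c (rightb B) + c (downb B)) * c B + c (rightb B) * c (downb B)"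
    by (simp add: algebra_simps power2_eq_square)
  also have "\<dots> = eps\<^sup>2 * (4 - (c B)\<^sup>2)"
    unfolding c_sum c_prod by (simp add: algebra_simps power2_eq_square)
  finally show "c (downb B) = c B" using ne c4 by simp
qed

lemma comax_pol: "d \<noteq> c B \<Longrightarrow> comax (quad d) (pol B)" "c A \<noteq> c B \<Longrightarrow> comax (pol A) (pol B)"
proof -
  have 1: "comax (lin (z l)) (quad d)" if "d \<noteq> 2 * z l" for l d
  proof (rule comax_lin_quad)
    show "z l * z l + 1 \<noteq> d * z l"
    proof
      assume "z l * z l + 1 = d * z l"
      then have "(z l * z l) * 2 = d * z l" using z_sq[of l] by simp
      then have "z l * (2 * z l - d) = 0" by (simp add: algebra_simps)
      then show False using that z_sq[of l] by auto
    qed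
  qed
  show "comax (quad d) (pol B)" if "d \<noteq> c B" for d
    unfolding pol_def using that c_of_diag[of B]
    by (auto intro!: comax_quad 1 comax_sym[OF 1])
  show "c A \<noteq> c B \<Longrightarrow> comax (pol A) (pol B)"
    unfolding pol_def using c_of_diag[of A] c_of_diag[of B]
    by (auto intro!: comax_quad comax_lin 1 comax_sym[OF 1])
qed

end

section \<open>The weights of the cyclotomic algebra\<close>

text \<open>Only the affine relations are listed here; the cyclotomic one enters later as the
  assumption \<open>base\<close>.\<close>

locale hc_alg = scalars s for s :: "'k::field \<Rightarrow> 'a::ring" +
  fixes T X Xi C :: "nat \<Rightarrow> 'a" and n :: nat and eps :: 'k
  assumes algs: "i \<in> {1..<n} \<Longrightarrow> T i \<in> alg"
      "i \<in> {1..n} \<Longrightarrow> X i \<in> alg" "i \<in> {1..n} \<Longrightarrow> Xi i \<in> alg" "i \<in> {1..n} \<Longrightarrow> C i \<in> alg"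
    and TT: "i \<in> {1..<n} \<Longrightarrow> T i * T i = s eps * T i + s 1"
    and T_comm: "i \<in> {1..<n} \<Longrightarrow> j \<in> {1..<n} \<Longrightarrow> i + 1 < j \<or> j + 1 < i \<Longrightarrow> T i * T j = T j * T i"
    and braid: "1 \<le> i \<Longrightarrow> Suc i < n \<Longrightarrow> T i * T (Suc i) * T i = T (Suc i) * T i * T (Suc i)"
    and X_comm: "i \<in> {1..n} \<Longrightarrow> j \<in> {1..n} \<Longrightarrow> X i * X j = X j * X i"
    and X_Xi: "i \<in> {1..n} \<Longrightarrow> X i * Xi i = s 1" and Xi_X: "i \<in> {1..n} \<Longrightarrow> Xi i * X i = s 1"
    and CC: "i \<in> {1..n} \<Longrightarrow> C i * C i = s 1"
    and C_anti: "i \<in> {1..n} \<Longrightarrow> j \<in> {1..n} \<Longrightarrow> i \<noteq> j \<Longrightarrow> C i * C j = - (C j * C i)"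
    and TX: "i \<in> {1..<n} \<Longrightarrow> T i * X i = X (Suc i) * T i - s eps * (X (Suc i) + C i * C (Suc i) * X i)"
    and TX_comm: "i \<in> {1..<n} \<Longrightarrow> j \<in> {1..n} \<Longrightarrow> j \<noteq> i \<Longrightarrow> j \<noteq> Suc i \<Longrightarrow> T i * X j = X j * T i"
    and TC: "i \<in> {1..<n} \<Longrightarrow> T i * C i = C (Suc i) * T i"
    and TC': "i \<in> {1..<n} \<Longrightarrow> T i * C (Suc i) = C i * T i - s eps * (C i - C (Suc i))"
    and TC_comm: "i \<in> {1..<n} \<Longrightarrow> j \<in> {1..n} \<Longrightarrow> j \<noteq> i \<Longrightarrow> j \<noteq> Suc i \<Longrightarrow> T i * C j = C j * T i"
    and XC: "i \<in> {1..n} \<Longrightarrow> X i * C i = C i * Xi i"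
    and XC_comm: "i \<in> {1..n} \<Longrightarrow> j \<in> {1..n} \<Longrightarrow> i \<noteq> j \<Longrightarrow> X i * C j = C j * X i"
begin

lemma rank2: "i \<in> {1..<n} \<Longrightarrow> rank2 s (T i) (X i) (Xi i) (X (Suc i)) (Xi (Suc i)) (C i) (C (Suc i)) eps"
proof -
  assume i: "i \<in> {1..<n}"
  have b: "X i * X (Suc i) = X (Suc i) * X i" "C i * C (Suc i) = - (C (Suc i) * C i)"
    using i by (auto intro: X_comm C_anti)
  show ?thesis
    using i by unfold_locales (rule b | simp add: algs TT X_Xi Xi_X CC TX TC TC' XC XC_comm)+
qed

lemma rank3: assumes "1 \<le> i" "Suc i < n"
  shows "rank3 s (T i) (T (Suc i)) (X i) (Xi i) (X (Suc i)) (Xi (Suc i)) (X (Suc (Suc i))) (Xi (Suc (Suc i))) (C i) (C (Suc i)) (C (Suc (Suc i))) eps"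
proof -
  interpret A: rank2 s "T i" "X i" "Xi i" "X (Suc i)" "Xi (Suc i)" "C i" "C (Suc i)" eps
    using assms by (intro rank2) simp
  interpret B: rank2 s "T (Suc i)" "X (Suc i)" "Xi (Suc i)" "X (Suc (Suc i))" "Xi (Suc (Suc i))" "C (Suc i)" "C (Suc (Suc i))" eps
    using assms rank2[of "Suc i"] by simp
  have b: "T i * T (Suc i) * T i = T (Suc i) * T i * T (Suc i)" "C i * C (Suc (Suc i)) = - (C (Suc (Suc i)) * C i)"
    using assms by (auto intro: braid C_anti)
  show ?thesis
    using assms by unfold_locales (rule b | simp add: XC_comm TX_comm TC_comm X_comm)+
qed

definition phi :: "nat \<Rightarrow> 'a" where
  "phi i = rank2.phi s (T i) (X i) (Xi i) (X (Suc i)) (Xi (Suc i)) (C i) (C (Suc i)) eps"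

definition Z :: "nat \<Rightarrow> 'a" where "Z i = X i + Xi i"

lemma phi_alg: "i \<in> {1..<n} \<Longrightarrow> phi i \<in> alg"
  unfolding phi_def using rank2 rank2.defs_alg(4) by blast

lemma Z_alg: "i \<in> {1..n} \<Longrightarrow> Z i \<in> alg"
  unfolding Z_def by (simp add: algs)

lemma phi_X: "i \<in> {1..<n} \<Longrightarrow> phi i * X i = X (Suc i) * phi i" "i \<in> {1..<n} \<Longrightarrow> phi i * X (Suc i) = X i * phi i"
proof -
  assume i: "i \<in> {1..<n}"
  interpret A: rank2 s "T i" "X i" "Xi i" "X (Suc i)" "Xi (Suc i)" "C i" "C (Suc i)" eps using i by (rule rank2)
  show "phi i * X i = X (Suc i) * phi i" "phi i * X (Suc i) = X i * phi i"
    unfolding phi_def using A.phi_X[of "s 1"] A.phi_Y[of "s 1"] A.algs A.defs_alg by simp_all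
qed

lemma phi_X_comm: assumes i: "i \<in> {1..<n}" and j: "j \<in> {1..n}" "j \<noteq> i" "j \<noteq> Suc i"
  shows "phi i * X j = X j * phi i"
proof -
  interpret A: rank2 s "T i" "X i" "Xi i" "X (Suc i)" "Xi (Suc i)" "C i" "C (Suc i)" eps using i by (rule rank2)
  have inv: "Xi k * X j = X j * Xi k" if "k \<in> {1..n}" for k
    using A.inv_comm[of "X k" "Xi k" "X k" "Xi k" "X j"] that j by (simp add: algs X_Xi Xi_X X_comm)
  have *: "X j * (C i * v) = C i * (X j * v)" "X j * (C (Suc i) * v) = C (Suc i) * (X j * v)"
    "X j * (X i * v) = X i * (X j * v)" "X j * (X (Suc i) * v) = X (Suc i) * (X j * v)"
    "X j * (Xi i * v) = Xi i * (X j * v)" "X j * (Xi (Suc i) * v) = Xi (Suc i) * (X j * v)"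
    "X j * (T i * v) = T i * (X j * v)" for v
    using i j inv by (simp_all add: mult.assoc[symmetric] XC_comm X_comm TX_comm)
  have "phi i * (X j * s 1) = X j * (phi i * s 1)"
    unfolding phi_def A.phi_def A.G_def A.Z1_def A.Z2_def
    using j by (simp add: A.scal algs * del: alg_one_right)
  then show ?thesis using j i by (simp add: algs phi_alg)
qed

text \<open>On vectors with Z_i = a the square is a quadratic polynomial in Z_{i+1}. If a is the
  weight of a box, then by \<open>c_sum\<close> and \<open>c_prod\<close> its roots are the weights
  right of and below that box.\<close>

lemma phi_phi: assumes i: "i \<in> {1..<n}" and v: "v \<in> alg" "Z i * v = s a * v"
  shows "phi i * (phi i * v) = - ((Z (Suc i) * (Z (Suc i) * v)) - s ((2 + eps\<^sup>2) * a) * (Z (Suc i) * v) + s (a\<^sup>2 + 4 * eps\<^sup>2) * v)"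
proof -
  interpret A: rank2 s "T i" "X i" "Xi i" "X (Suc i)" "Xi (Suc i)" "C i" "C (Suc i)" eps using i by (rule rank2)
  have Z: "A.Z1 = Z i" "A.Z2 = Z (Suc i)" unfolding A.Z1_def A.Z2_def Z_def by simp_all
  have c: "Z i * (Z (Suc i) * w) = Z (Suc i) * (Z i * w)" for w
    unfolding Z_def by (simp add: A.norm)
  have za: "Z (Suc i) \<in> alg" "Z i \<in> alg" using i by (auto intro: Z_alg)
  have two: "s (2 * k) = s k + s k" "s (k * 2) = s k + s k" for k by (metis mult_2 mult_2_right s_add)+
  have "phi i * (phi i * v) = - ((Z i - Z (Suc i)) * ((Z i - Z (Suc i)) * v)) + s (eps * eps) * (Z i * (Z (Suc i) * v) - s 4 * v)"
    unfolding phi_def A.phi_phi Z by simp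
  also have "\<dots> = - ((Z (Suc i) * (Z (Suc i) * v)) - s ((2 + eps\<^sup>2) * a) * (Z (Suc i) * v) + s (a\<^sup>2 + 4 * eps\<^sup>2) * v)"
    using v(1) za by (simp add: left_diff_distrib right_diff_distrib c v(2) alg_left s_left power2_eq_square
        s_add distrib_right two mult.commute)
      (simp add: algebra_simps s_add two)
  finally show ?thesis .
qed

lemma kills_swap: assumes "i \<in> {1..n}" "j \<in> {1..n}" "F \<in> alg" "F * X i = X j * F" "kills (X i) p v"
  shows "kills (X j) p (F * v)"
proof -
  have "F * ev (X i) p = ev (X j) p * F" using assms by (intro ev_swap) (auto simp: algs)
  then have "ev (X j) p * (F * v) = F * (ev (X i) p * v)" by (simp add: mult.assoc[symmetric])
  then show ?thesis using assms(5) unfolding kills_def by simp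
qed

text \<open>\<open>quad c\<close> at X is X (Z - c), and X is invertible on
  \<open>alg\<close>.\<close>

lemma kills_quad: assumes "i \<in> {1..n}" "v \<in> alg" shows "kills (X i) (quad c) v \<longleftrightarrow> Z i * v = s c * v"
proof -
  have a: "X i \<in> alg" "Xi i \<in> alg" using assms algs by auto
  have e: "ev (X i) (quad c) * v = X i * (Z i * v - s c * v)"
    using ev_quad[of "X i" "Xi i" c] a X_Xi[OF assms(1)] unfolding Z_def by (simp add: mult.assoc left_diff_distrib)
  have "X i * u = 0 \<longleftrightarrow> u = 0" if "u \<in> alg" for u
  proof
    assume "X i * u = 0"
    then have "Xi i * (X i * u) = 0" by simp
    then show "u = 0" using that Xi_X[OF assms(1)] by (simp add: mult.assoc[symmetric])
  qed simp
  then show ?thesis unfolding kills_def e using a assms Z_alg[OF assms(1)] by simp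
qed

lemma kills_lin: assumes "i \<in> {1..n}" shows "kills (X i) (lin c) v \<longleftrightarrow> X i * v = s c * v"
  unfolding kills_def using assms by (simp add: ev_lin algs left_diff_distrib)

lemma kills_quad2: assumes "i \<in> {1..n}" "v \<in> alg"
  shows "kills (X i) (quad c * quad d) v \<longleftrightarrow> Z i * (Z i * v) - s (c + d) * (Z i * v) + s (c * d) * v = 0"
proof -
  have a: "X i \<in> alg" "Xi i \<in> alg" "Z i \<in> alg" using assms algs Z_alg by auto
  have "kills (X i) (quad c * quad d) v \<longleftrightarrow> kills (X i) (quad c) (ev (X i) (quad d) * v)"
    using a by (simp add: kills_ev)
  also have "\<dots> \<longleftrightarrow> Z i * (ev (X i) (quad d) * v) - s c * (ev (X i) (quad d) * v) = 0"
    using a assms by (subst kills_quad) auto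
  also have "\<dots> \<longleftrightarrow> X i * (Z i * (Z i * v) - s (c + d) * (Z i * v) + s (c * d) * v) = 0"
  proof -
    have "Z i * X i = X i * Z i" unfolding Z_def using assms by (simp add: X_Xi Xi_X distrib_left distrib_right)
    then have zx: "Z i * (X i * w) = X i * (Z i * w)" for w by (simp add: mult.assoc[symmetric])
    have e: "ev (X i) (quad d) * v = X i * (Z i * v - s d * v)"
      using ev_quad[of "X i" "Xi i" d] a X_Xi[OF assms(1)] unfolding Z_def by (simp add: mult.assoc left_diff_distrib)
    have "Z i * (ev (X i) (quad d) * v) - s c * (ev (X i) (quad d) * v) = X i * (Z i * (Z i * v) - s (c + d) * (Z i * v) + s (c * d) * v)"
      unfolding e using a by (simp add: zx right_diff_distrib distrib_left alg_left s_left s_add distrib_right)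
    then show ?thesis by simp
  qed
  also have "\<dots> \<longleftrightarrow> Z i * (Z i * v) - s (c + d) * (Z i * v) + s (c * d) * v = 0"
  proof
    let ?u = "Z i * (Z i * v) - s (c + d) * (Z i * v) + s (c * d) * v"
    have u: "?u \<in> alg" using a assms by simp
    assume "X i * ?u = 0"
    then have "Xi i * (X i * ?u) = 0" by simp
    then show "?u = 0" using u Xi_X[OF assms(1)] by (simp only: mult.assoc[symmetric] alg_one)
  qed simp
  finally show ?thesis .
qed

end

lemma sum_inverse_ex:
  fixes r :: "'k::alg_closed_field"
  shows "\<exists>x. x \<noteq> 0 \<and> r = x + inverse x"
proof -
  have "\<exists>x. poly [:1, - r, 1:] x = 0"
    by (rule alg_closed_imp_poly_has_root) simp
  then obtain x where x: "x * x + 1 = r * x" by (auto simp: algebra_simps)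
  then have "x \<noteq> 0" by auto
  moreover have "(x + inverse x) * x = r * x" using x \<open>x \<noteq> 0\<close> by (simp add: algebra_simps)
  ultimately show ?thesis by (metis mult_right_cancel)
qed

lemma inverse_fixed:
  fixes x :: "'k::field"
  assumes "x \<noteq> 0" shows "inverse x = x \<longleftrightarrow> (x + inverse x)\<^sup>2 = 4"
proof -
  have "(x + inverse x)\<^sup>2 - 4 = (x - inverse x)\<^sup>2"
    using assms by (simp add: power2_eq_square algebra_simps)
  then show ?thesis by (metis eq_iff_diff_eq_0 power2_eq_square mult_eq_0_iff)
qed

section \<open>Possible weights, by induction on the number of boxes\<close>

locale weights = hc_alg s T X Xi C n eps + residues_sep b M "n + 1" eps c z
  for s :: "'k::alg_closed_field \<Rightarrow> 'a::ring" and T X Xi C and n and eps and b M c z +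
  assumes n: "n \<ge> 1" and base: "ev (X 1) (\<Prod>A \<in> addable b M {}. pol A) = 0"
begin

definition wt :: "box list \<Rightarrow> 'a \<Rightarrow> bool" where
  "wt t v \<longleftrightarrow> v \<in> alg \<and> (\<forall>j < length t. kills (X (Suc j)) (pol (t ! j)) v)"

text \<open>The induction statement. For the empty list it is the assumption \<open>base\<close>;
  for longer lists it has to be extracted from the affine relations.\<close>

definition next_wt :: "box list \<Rightarrow> bool" where
  "next_wt t \<longleftrightarrow> (\<forall>v. wt t v \<longrightarrow> kills (X (Suc (length t))) (\<Prod>A \<in> addable b M (set t). pol A) v)"

lemma wt_snoc: "wt (t @ [A]) v \<longleftrightarrow> wt t v \<and> kills (X (Suc (length t))) (pol A) v"
  unfolding wt_def by (auto simp: nth_append less_Suc_eq)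

lemma pol_Z: assumes "i \<in> {1..n}" "v \<in> alg" "kills (X i) (pol A) v" shows "Z i * v = s (c A) * v"
proof (cases "diag b A")
  case True
  let ?z = "z (snd (snd A))"
  have "kills (X i) (lin ?z) v" using assms True by (simp add: pol_def)
  then have "kills (X i) (lin ?z * lin ?z) v" using assms by (intro kills_mult) (auto simp: algs)
  then show ?thesis
    using assms kills_quad[of i v "2 * ?z"] by (simp add: quad_sq z_sq c_of_diag[OF True])
qed (use assms kills_quad in \<open>simp add: pol_def\<close>)

lemma wt_comm:
  assumes F: "F \<in> alg" "\<And>j. j < length t \<Longrightarrow> F * X (Suc j) = X (Suc j) * F" and t: "length t \<le> n" and v: "wt t v"
  shows "wt t (F * v)"
  using assms unfolding wt_def by (auto intro!: kills_swap[of "Suc _" "Suc _"])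

lemma wt_ev: assumes "wt t v" "length t < n" shows "wt t (ev (X (Suc (length t))) p * v)"
  using assms by (intro wt_comm) (auto simp: algs intro!: ev_swap[symmetric] X_comm)

lemma wt_phi: assumes "wt (t @ [B]) v" "length t + 1 < n"
  shows "wt t (phi (Suc (length t)) * v)" "kills (X (Suc (Suc (length t)))) (pol B) (phi (Suc (length t)) * v)"
proof -
  let ?k = "Suc (length t)"
  have k: "?k \<in> {1..<n}" using assms by simp
  show "wt t (phi ?k * v)" using assms k unfolding wt_snoc
    by (intro wt_comm) (auto simp: phi_alg intro!: phi_X_comm)
  show "kills (X (Suc ?k)) (pol B) (phi ?k * v)" using assms k unfolding wt_snoc
    by (intro kills_swap[of ?k]) (auto simp: phi_alg phi_X)
qed

lemma wt_T: assumes "wt (t @ [B]) v" "length t + 1 < n"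
  shows "wt t (T (Suc (length t)) * v)"
  using assms unfolding wt_snoc by (intro wt_comm) (auto simp: algs TX_comm)

lemma kills_phi: assumes "k \<in> {1..<n}" "kills (X (Suc k)) p v" shows "kills (X k) p (phi k * v)"
  using assms by (intro kills_swap[of "Suc k"]) (auto simp: phi_alg phi_X)

context
  fixes t :: "box list" and B :: box
  assumes p: "path b M (t @ [B])" and len: "length t + 1 < n" and IH: "next_wt t"
begin

lemma shape_t: "shape b M (set t)" "card (set t) = length t" "B \<in> addable b M (set t)" "finite (addable b M (set t))"
  using p path_shape[of b M t] finite_addable[of b M t] by (auto simp: path_snoc distinct_card)

private abbreviation "k \<equiv> Suc (length t)"

lemma k_range: "k \<in> {1..<n}" "k \<in> {1..n}" "Suc k \<in> {1..n}" "Suc (length t) < n"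
  using len by auto

definition P' where "P' = (\<Prod>A \<in> addable b M (set t) - {B}. pol A)"

lemma P_eq: "(\<Prod>A \<in> addable b M (set t). pol A) = pol B * P'"
  unfolding P'_def using shape_t by (intro prod.remove) auto

lemma comax_P': "comax (pol B) P'"
  unfolding P'_def using c_add_add[OF shape_t(1) _ shape_t(3)] shape_t(2) len
  by (intro comax_prod comax_pol) auto

lemma next_kills: "wt t v \<Longrightarrow> kills (X k) (pol B * P') v"
  using IH unfolding next_wt_def P_eq by simp

text \<open>On \<open>phi k * v\<close> the first strands still have the weights of t, and X_k
  behaves as X_{k+1} did on v. The hypothesis for t bounds X_k there; a second \<open>phi k\<close>
  carries this bound back to X_{k+1}, at the price of phi^2, which is the quadratic polynomial of
  the two neighbours of B.\<close>

lemma relation: assumes "wt (t @ [B]) v"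
  shows "kills (X (Suc k)) (quad (c (rightb B)) * quad (c (downb B)) * (pol B * P')) v"
proof -
  have v: "v \<in> alg" "kills (X k) (pol B) v" using assms by (auto simp: wt_snoc wt_def)
  define w where "w = ev (X (Suc k)) (pol B * P') * v"
  have w: "w \<in> alg" using v k_range algs unfolding w_def by simp
  have wtw: "wt (t @ [B]) w"
    unfolding w_def using wt_ev[of "t @ [B]" v] assms len by simp
  then have zw: "Z k * w = s (c B) * w" using pol_Z[of k w B] k_range w by (simp add: wt_snoc)
  have "kills (X k) (pol B * P') (phi k * v)"
    using wt_phi[OF assms] len by (intro next_kills) simp
  then have "kills (X (Suc k)) (pol B * P') (phi k * (phi k * v))"
    using k_range by (intro kills_swap[of k "Suc k" "phi k"]) (auto simp: phi_alg phi_X)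
  then have "ev (X (Suc k)) (pol B * P') * (phi k * (phi k * v)) = 0" by (simp add: kills_def)
  moreover have "ev (X (Suc k)) (pol B * P') * (phi k * (phi k * v)) = phi k * (phi k * w)"
  proof -
    have e: "phi k * ev (X (Suc k)) q = ev (X k) q * phi k" "phi k * ev (X k) q = ev (X (Suc k)) q * phi k" for q
      using k_range by (auto intro!: ev_swap simp: algs phi_alg phi_X)
    have "ev (X (Suc k)) q * (phi k * u) = phi k * (ev (X k) q * u)" "ev (X k) q * (phi k * u) = phi k * (ev (X (Suc k)) q * u)" for q u
      by (simp_all add: mult.assoc[symmetric] e)
    then show ?thesis unfolding w_def by simp
  qed
  ultimately have "phi k * (phi k * w) = 0" by simp
  then have "Z (Suc k) * (Z (Suc k) * w) - s (c (rightb B) + c (downb B)) * (Z (Suc k) * w) + s (c (rightb B) * c (downb B)) * w = 0"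
    unfolding phi_phi[OF k_range(1) w zw] c_sum c_prod neg_equal_0_iff_equal .
  then have "kills (X (Suc k)) (quad (c (rightb B)) * quad (c (downb B))) w"
    using kills_quad2[OF k_range(3) w] by simp
  then show ?thesis unfolding w_def using k_range algs by (simp add: kills_ev)
qed

text \<open>Two equal consecutive weights cannot occur: the vector moved by \<open>T\<close> would be a proper
  generalised weight vector.\<close>

lemma no_repeat: assumes v: "wt (t @ [B]) v" and nd: "\<not> diag b B" and e: "kills (X (Suc k)) (pol B) v"
  shows "v = 0"
proof -
  interpret A: rank2 s "T k" "X k" "Xi k" "X (Suc k)" "Xi (Suc k)" "C k" "C (Suc k)" eps
    using k_range by (intro rank2) simp
  have va: "v \<in> alg" "kills (X k) (pol B) v" using v by (auto simp: wt_snoc wt_def)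
  have Z: "A.Z1 = Z k" "A.Z2 = Z (Suc k)" unfolding A.Z1_def A.Z2_def Z_def by simp_all
  have z1: "Z k * v = s (c B) * v" and z2: "Z (Suc k) * v = s (c B) * v"
    using pol_Z va e k_range by auto
  let ?w = "T k * v"
  have wa: "?w \<in> alg" using va by simp
  have r: "Z k * ?w - s (c B) * ?w = A.G * v"
    using A.TZ2[of v] unfolding Z z2 by (simp add: alg_left)
  have G: "Z k * (A.G * v) = A.G * (Z k * v)" unfolding A.G_def Z_def by (simp add: A.norm)
  have zz: "Z k * (Z k * ?w) = s (c B) * (Z k * ?w) + s (c B) * (A.G * v)"
  proof -
    have "Z k * (Z k * ?w) = Z k * (s (c B) * ?w + A.G * v)" unfolding r[symmetric] by simp
    then show ?thesis using k_range G z1 by (simp add: distrib_left alg_left Z_alg)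
  qed
  have dbl: "s (2 * a) * u = s a * u + s a * u" for a u by (metis mult_2 s_add_left)
  have "kills (X k) (quad (c B) * quad (c B)) ?w"
    unfolding kills_quad2[OF k_range(2) wa] zz r[symmetric]
    by (simp add: right_diff_distrib s_left dbl)
  \<comment> \<open>T commutes with the X of the strands of t, so T v still has the weights of t and
    the induction hypothesis applies to it; comaximality with \<open>P'\<close> then leaves a single
    quadratic factor.\<close>
  moreover have "kills (X k) (P' * quad (c B)) ?w"
    using next_kills[OF wt_T[OF v len]] nd by (simp add: pol_def mult.commute)
  ultimately have "kills (X k) (quad (c B)) ?w"
    using kills_comax[OF A.algs(2), of "quad (c B)" P'] comax_P' nd by (simp add: pol_def)
  then have "A.G * v = 0" using kills_quad[OF k_range(2) wa] r by simp
  then have "s eps * (s 4 * v - Z k * (Z (Suc k) * v)) = 0" using A.G_conj[of v] unfolding Z by simp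
  then have "s (eps * (4 - (c B)\<^sup>2)) * v = 0"
    using k_range by (simp add: z1 z2 alg_left s_left Z_alg right_diff_distrib s_diff left_diff_distrib power2_eq_square)
  moreover have "eps * (4 - (c B)\<^sup>2) \<noteq> 0" using eps c_not_2[OF shape_t(1) _ shape_t(3) nd] shape_t(2) len by auto
  ultimately show ?thesis using s_cancel[OF va(1)] by blast
qed

text \<open>The same mechanism with linear factors: (X_k - \<zeta>) T v is a multiple of (1 - C D)
  v, which is an eigenvector again. The induction hypothesis forbids such a generalised eigenvector,
  so (1 - C D) v = 0; multiplying by 1 + C D gives 2 v = 0, because (C D)^2 = -1.\<close>

lemma no_repeat_diag: assumes v: "wt (t @ [B]) v" and d: "diag b B" and e: "kills (X (Suc k)) (pol B) v"
  shows "v = 0"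
proof -
  interpret A: rank2 s "T k" "X k" "Xi k" "X (Suc k)" "Xi (Suc k)" "C k" "C (Suc k)" eps
    using k_range by (intro rank2) simp
  have va: "v \<in> alg" "kills (X k) (pol B) v" using v by (auto simp: wt_snoc wt_def)
  define \<zeta> where "\<zeta> = z (snd (snd B))"
  have pB: "pol B = lin \<zeta>" using d by (simp add: pol_def \<zeta>_def)
  have x1: "X k * v = s \<zeta> * v" and x2: "X (Suc k) * v = s \<zeta> * v"
    using va e k_range by (simp_all add: pB kills_lin)
  have zz: "\<zeta> * \<zeta> = 1" unfolding \<zeta>_def by (rule z_sq)
  have xi1: "Xi k * v = s \<zeta> * v"
  proof -
    have "Xi k * (X k * v) = v" using va by (simp add: A.XXl)
    then have "s \<zeta> * (Xi k * v) = v" unfolding x1 by (simp add: alg_left)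
    then have "s \<zeta> * (s \<zeta> * (Xi k * v)) = s \<zeta> * v" by simp
    then show ?thesis by (simp add: s_left zz)
  qed
  let ?w = "T k * v"
  let ?g = "v - C k * (C (Suc k) * v)"
  have wa: "?w \<in> alg" using va by simp
  have r: "X k * ?w = s \<zeta> * ?w - s (eps * \<zeta>) * ?g"
    using A.TXl(1)[of v] unfolding x2 by (simp add: alg_left s_left right_diff_distrib)
  have rg: "X k * ?g = s \<zeta> * ?g" by (simp add: right_diff_distrib A.XCl x1 xi1 alg_left)
  have "kills (X k) (lin \<zeta>) (ev (X k) (lin \<zeta>) * ?w)"
  proof -
    have "ev (X k) (lin \<zeta>) * ?w = - (s (eps * \<zeta>) * ?g)"
      using k_range by (simp add: ev_lin left_diff_distrib r)
    moreover have "X k * - (s (eps * \<zeta>) * ?g) = s \<zeta> * - (s (eps * \<zeta>) * ?g)"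
    proof -
      have "X k * (s (eps * \<zeta>) * ?g) = s (eps * \<zeta>) * (X k * ?g)" by (rule alg_left) simp
      also have "\<dots> = s \<zeta> * (s (eps * \<zeta>) * ?g)" unfolding rg by (simp only: s_left mult.commute)
      finally show ?thesis by (simp only: mult_minus_right)
    qed
    ultimately show ?thesis using kills_lin[OF k_range(2)] by simp
  qed
  then have "kills (X k) (lin \<zeta> * lin \<zeta>) ?w" by (simp add: kills_ev)
  moreover have "kills (X k) (P' * lin \<zeta>) ?w"
    using next_kills[OF wt_T[OF v len]] by (simp add: pB mult.commute)
  ultimately have "kills (X k) (lin \<zeta>) ?w"
    using kills_comax[OF A.algs(2), of "lin \<zeta>" P'] comax_P' by (simp add: pB)
  then have "s (eps * \<zeta>) * ?g = 0" using r k_range by (simp add: kills_lin)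
  moreover have "eps * \<zeta> \<noteq> 0" using eps zz by auto
  moreover have "?g \<in> alg" using va by simp
  ultimately have g: "?g = 0" using s_cancel by blast
  then have "?g + C k * (C (Suc k) * ?g) = 0" by simp
  then have "v + v = 0" using va by (simp add: right_diff_distrib distrib_left A.CCl)
  then have "s 2 * v = 0" using s_add_left[of 1 v 1] va by simp
  then show ?thesis using s_cancel[OF va(1)] two by blast
qed

text \<open>Removes from v the components belonging to the old addable boxes other than B; for
  X_{k+1} there remain only the neighbours of B.\<close>

definition v0 where "v0 v = ev (X (Suc k)) P' * v"

lemma wt_v0: "wt (t @ [B]) v \<Longrightarrow> wt (t @ [B]) (v0 v)"
  unfolding v0_def using wt_ev[of "t @ [B]" v] len by simp

definition Q where "Q = (if diag b B then quad (c (rightb B)) else quad (c (rightb B)) * quad (c (downb B)))"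

lemma downb_diag_t: assumes "diag b B" shows "c (downb B) = c B" "c (rightb B) \<noteq> c B"
  using downb_diag[OF shape_t(1) _ shape_t(3) assms] shape_t(2) len by auto

text \<open>The factor \<open>pol B\<close> in \<open>relation\<close> is dropped because
  consecutive weights do not repeat. At a diagonal B the formal lower neighbour has the weight of B,
  so that three equal linear factors have to be dropped.\<close>

lemma Q_kills: assumes v: "wt (t @ [B]) v" shows "kills (X (Suc k)) Q (v0 v)"
proof (cases "diag b B")
  case False
  let ?q = "quad (c (rightb B)) * quad (c (downb B))"
  have X: "X (Suc k) \<in> alg" using k_range algs by auto
  define u where "u = ev (X (Suc k)) (?q * P') * v"
  have u: "wt (t @ [B]) u" unfolding u_def using wt_ev[of "t @ [B]" v] len v by simp
  have "kills (X (Suc k)) (pol B) u"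
    unfolding u_def using relation[OF v] X by (simp add: kills_ev mult.left_commute mult.assoc)
  then have "u = 0" using no_repeat[OF u False] by simp
  then show ?thesis unfolding u_def Q_def v0_def using False X by (simp add: kills_def ev_mult mult.assoc)
next
  case True
  let ?l = "lin (z (snd (snd B)))" and ?q = "quad (c (rightb B))"
  have X: "X (Suc k) \<in> alg" using k_range algs by auto
  have l: "pol B = ?l" using True by (simp add: pol_def)
  have d: "quad (c (downb B)) = ?l * ?l"
    unfolding downb_diag_t(1)[OF True] c_of_diag[OF True] by (simp add: quad_sq z_sq)
  have drop: "kills (X (Suc k)) r v" if "kills (X (Suc k)) (?l * r) v" for r
  proof -
    have "wt (t @ [B]) (ev (X (Suc k)) r * v)" using wt_ev[of "t @ [B]" v] len v by simp
    then have "ev (X (Suc k)) r * v = 0" using no_repeat_diag[OF _ True] that X unfolding l by (simp add: kills_ev)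
    then show ?thesis by (simp add: kills_def)
  qed
  have "kills (X (Suc k)) (?l * (?l * (?l * (?q * P')))) v"
    using relation[OF v] unfolding l d by (simp add: ac_simps)
  then have "kills (X (Suc k)) (?q * P') v" using drop by blast
  then show ?thesis unfolding v0_def Q_def using True X by (simp add: kills_ev)
qed

lemma comax_Q: "A \<in> addable b M (set t) \<Longrightarrow> comax Q (pol A)"
proof -
  assume A: "A \<in> addable b M (set t)"
  have "c (rightb B) \<noteq> c A" "\<not> diag b B \<Longrightarrow> c (downb B) \<noteq> c A"
    using c_next_add[OF shape_t(1) _ shape_t(3) A] shape_t(2) len by simp_all
  then show ?thesis
    unfolding Q_def by (auto intro!: comax_pol comax_sym[OF comax_mult[OF comax_sym comax_sym]])
qed

text \<open>Two comaximal polynomials in X_k annihilate this vector: \<open>Q\<close>, carried over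
  from X_{k+1} by the intertwiner, and the product over the addable boxes, from the induction
  hypothesis. Vanishing of \<open>phi\<close> is what \<open>good\<close> asks for.\<close>

lemma phi_v0: assumes v: "wt (t @ [B]) v" shows "phi k * v0 v = 0"
proof (rule kills_comax0)
  show "X k \<in> alg" "phi k * v0 v \<in> alg" using k_range algs phi_alg wt_v0[OF v] by (auto simp: wt_def)
  show "kills (X k) Q (phi k * v0 v)" using Q_kills[OF v] k_range by (intro kills_phi) auto
  show "kills (X k) (pol B * P') (phi k * v0 v)"
    using wt_phi(1)[OF wt_v0[OF v]] len by (intro next_kills) simp
  show "comax Q (pol B * P')"
    unfolding P_eq[symmetric] using comax_Q by (intro comax_prod) auto
qed

end

end

section \<open>Excluding blocked neighbours by three strands\<close>

context weights
begin

context
  fixes u :: "box list" and U B :: box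
  assumes p: "path b M ((u @ [U]) @ [B])" and len: "length (u @ [U]) + 1 < n"
    and IH: "next_wt (u @ [U])" and IH': "next_wt u" and UB: "U \<in> prv b M B"
begin

private abbreviation "a \<equiv> Suc (length u)"

lemma u_facts: "path b M (u @ [U])" "shape b M (set u)" "card (set u) = length u" "U \<in> addable b M (set u)"
  "B \<in> addable b M (insert U (set u))" "finite (addable b M (set u))" "B \<notin> addable b M (set u)"
proof -
  show 1: "path b M (u @ [U])" "B \<in> addable b M (insert U (set u))" using p unfolding path_snoc by auto
  then show 2: "shape b M (set u)" "card (set u) = length u" "U \<in> addable b M (set u)" "finite (addable b M (set u))"
    using path_shape[of b M u] finite_addable[of b M u] by (auto simp: path_snoc distinct_card)
  then show "B \<notin> addable b M (set u)" using UB unfolding addable_def by auto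
qed

text \<open>B cannot be added before its predecessor U, so exchanging the last two weights would
  produce one that the hypothesis for u does not allow.\<close>

lemma phi_prev: assumes y: "wt ((u @ [U]) @ [B]) y" shows "phi a * y = 0"
proof (rule kills_comax0)
  have a: "a \<in> {1..<n}" using len by simp
  have yU: "wt (u @ [U]) y" "kills (X (Suc a)) (pol B) y" "y \<in> alg" using y unfolding wt_snoc by (auto simp: wt_def)
  show "X a \<in> alg" "phi a * y \<in> alg" using a algs phi_alg yU by auto
  show "kills (X a) (pol B) (phi a * y)" using a yU by (intro kills_phi)
  show "kills (X a) (\<Prod>A \<in> addable b M (set u). pol A) (phi a * y)"
    using IH' wt_phi(1)[OF yU(1)] len unfolding next_wt_def by simp
  have "c B \<noteq> c A" if A: "A \<in> addable b M (set u)" for A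
  proof (cases "A = U")
    case True
    then show ?thesis using sep[OF u_facts(2) _ u_facts(4,5)] u_facts(3) len by auto
  next
    case False
    have "A \<in> addable b M (insert U (set u))" using addable_insert[OF u_facts(4) A] False by auto
    moreover have "shape b M (insert U (set u))" "card (insert U (set u)) + 2 \<le> n + 1"
      using path_shape[OF u_facts(1)] len distinct_card[of "u @ [U]"] by auto
    ultimately show ?thesis using c_add_add u_facts(5,7) A by metis
  qed
  then show "comax (pol B) (\<Prod>A \<in> addable b M (set u). pol A)"
    by (intro comax_prod comax_pol(2))
qed

lemma c_quadratic: assumes "c U = c (rightb B) \<and> r' = c (downb B) \<or> c U = c (downb B) \<and> r' = c (rightb B)"
  shows "(c U - c B)\<^sup>2 = eps\<^sup>2 * (c U * c B - 4)" "r' = (2 + eps\<^sup>2) * c B - c U" "c U \<noteq> c B"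
proof -
  have "(c U - c (rightb B)) * (c U - c (downb B)) = 0" using assms by auto
  then have "(c U)\<^sup>2 - (c (rightb B) + c (downb B)) * c U + c (rightb B) * c (downb B) = 0"
    by (simp add: algebra_simps power2_eq_square)
  then show "(c U - c B)\<^sup>2 = eps\<^sup>2 * (c U * c B - 4)" unfolding c_sum c_prod
    by (simp add: algebra_simps power2_eq_square)
  have "c U + r' = (2 + eps\<^sup>2) * c B" using assms c_sum[of B] by (auto simp: add.commute)
  then show "r' = (2 + eps\<^sup>2) * c B - c U" by (simp add: algebra_simps)
  show "c U \<noteq> c B" using sep[OF u_facts(2) _ u_facts(4,5)] u_facts(3) len by auto
qed

text \<open>Both intertwiners kill y, so the results on three strands apply as soon as X_a and
  X_{a+1} act by scalars. \<open>good_split\<close> reduces to that case; the roots x and yy are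
  chosen so that they are their own inverses exactly at diagonal boxes, where X acts by a scalar
  already.\<close>

lemma rank3_use:
  fixes v r'
  assumes v: "wt ((u @ [U]) @ [B]) v" and r': "c U = c (rightb B) \<and> r' = c (downb B) \<or> c U = c (downb B) \<and> r' = c (rightb B)"
  defines "y \<equiv> v0 (u @ [U]) B v" and "W \<equiv> Z (Suc (Suc a))"
  shows "\<not> diag b U \<Longrightarrow> (s 4 - s (c U) * W) * ((W - s r') * y) = 0"
    and "diag b U \<Longrightarrow> (X (Suc (Suc a)) - s (z (snd (snd U)))) * ((W - s r') * y) = 0"
proof -
  have rg: "1 \<le> a" "Suc a < n" "a \<in> {1..n}" "Suc a \<in> {1..n}" "Suc (Suc a) \<in> {1..n}" using len by auto
  interpret R: rank3 s "T a" "T (Suc a)" "X a" "Xi a" "X (Suc a)" "Xi (Suc a)" "X (Suc (Suc a))" "Xi (Suc (Suc a))"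
    "C a" "C (Suc a)" "C (Suc (Suc a))" eps
    using rank3[OF rg(1,2)] .
  have wy: "wt ((u @ [U]) @ [B]) y" unfolding y_def using wt_v0[OF p len IH] v by simp
  then have y: "y \<in> alg" "kills (X a) (pol U) y" "kills (X (Suc a)) (pol B) y"
    unfolding wt_snoc by (auto simp: wt_def)
  have ph: "R.phi * y = 0" "R.S.phi * y = 0"
    using phi_prev[OF wy] phi_v0[OF p len IH v] unfolding y_def phi_def by simp_all
  have Z: "(X a + Xi a) * y = s (c U) * y" "(X (Suc a) + Xi (Suc a)) * y = s (c B) * y"
    using pol_Z[OF rg(3) y(1,2)] pol_Z[OF rg(4) y(1,3)] by (simp_all add: Z_def)
  have zz: "inverse (z l) = z l" "z l \<noteq> 0" for l
    using z_sq[of l] by (auto intro: inverse_unique)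
  have ex: "\<exists>x. x \<noteq> 0 \<and> c A = x + inverse x \<and> (inverse x \<noteq> x \<or> X i * y = s x * y) \<and> (diag b A \<longrightarrow> x = z (snd (snd A)))"
    if A: "A \<in> addable b M S" "shape b M S" "card S + 2 \<le> n + 1" "kills (X i) (pol A) y" "i \<in> {1..n}" for A S i
  proof (cases "diag b A")
    case True
    then show ?thesis using A c_of_diag[OF True] zz
      by (intro exI[of _ "z (snd (snd A))"]) (simp add: pol_def kills_lin)
  next
    case False
    obtain x where x: "x \<noteq> 0" "c A = x + inverse x" using sum_inverse_ex[of "c A"] by blast
    then have "inverse x \<noteq> x" using inverse_fixed[of x] c_not_2[OF A(2,3,1) False] by auto
    then show ?thesis using x False by blast
  qed
  have card: "card (insert U (set u)) = Suc (length u)" "shape b M (insert U (set u))"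
    using path_shape[OF u_facts(1)] distinct_card[of "u @ [U]"] by auto
  obtain x where x: "x \<noteq> 0" "c U = x + inverse x" "inverse x \<noteq> x \<or> X a * y = s x * y" "diag b U \<longrightarrow> x = z (snd (snd U))"
    using ex[OF u_facts(4,2) _ y(2) rg(3)] u_facts(3) len by auto
  obtain yy where yy: "yy \<noteq> 0" "c B = yy + inverse yy" "inverse yy \<noteq> yy \<or> X (Suc a) * y = s yy * y"
    using ex[OF u_facts(5) card(2) _ y(3) rg(4)] card(1) len by auto
  note q = c_quadratic[OF r']
  have WZ: "W = X (Suc (Suc a)) + Xi (Suc (Suc a))" unfolding W_def Z_def ..
  have g: "x' \<noteq> 0 \<and> y' \<noteq> 0 \<and> c U = x' + inverse x' \<and> c B = y' + inverse y'" if "x' \<in> {x, inverse x}" "y' \<in> {yy, inverse yy}" for x' y'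
    using that x yy by (auto simp: add.commute)
  note split = R.good_split[OF y(1) ph _ x(1) Z(1)[unfolded x(2)] x(3) yy(1) Z(2)[unfolded yy(2)] yy(3)]
  show "(s 4 - s (c U) * W) * ((W - s r') * y) = 0"
  proof -
    have "((s 4 - s (c U) * W) * (W - s r')) * y = 0"
    proof (rule split)
      show "(s 4 - s (c U) * W) * (W - s r') \<in> alg" unfolding WZ by simp
      fix w x' y' assume w: "R.good x' y' w" "x' \<in> {x, inverse x}" "y' \<in> {yy, inverse yy}"
      have "(s 4 - s (c U) * W) * ((W - s ((2 + eps\<^sup>2) * c B - c U)) * w) = 0"
        unfolding WZ using g[OF w(2,3)] q eps by (intro R.rank3_good[OF _ _ _ _ _ _ refl refl w(1)]) auto
      then show "(s 4 - s (c U) * W) * (W - s r') * w = 0" unfolding q(2)[symmetric] by (simp add: mult.assoc)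
    qed
    then show ?thesis by (simp add: mult.assoc)
  qed
  show "(X (Suc (Suc a)) - s (z (snd (snd U)))) * ((W - s r') * y) = 0" if d: "diag b U"
  proof -
    let ?\<zeta> = "z (snd (snd U))"
    have x\<zeta>: "x = ?\<zeta>" "inverse x = x" using x(4) d zz by auto
    have "((X (Suc (Suc a)) - s ?\<zeta>) * (W - s r')) * y = 0"
    proof (rule split)
      show "(X (Suc (Suc a)) - s ?\<zeta>) * (W - s r') \<in> alg" unfolding WZ by simp
      fix w x' y' assume w: "R.good x' y' w" "x' \<in> {x, inverse x}" "y' \<in> {yy, inverse yy}"
      have x': "x' = ?\<zeta>" using w(2) x\<zeta> by auto
      have "(X (Suc (Suc a)) - s x') * ((W - s ((2 + eps\<^sup>2) * c B - c U)) * w) = 0"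
        unfolding WZ using g[OF w(2,3)] q eps two zz x' by (intro R.rank3_fixed[OF _ _ _ _ _ _ refl refl w(1)]) auto
      then show "(X (Suc (Suc a)) - s ?\<zeta>) * (W - s r') * w = 0" unfolding q(2)[symmetric] x' by (simp add: mult.assoc)
    qed
    then show ?thesis by (simp add: mult.assoc)
  qed
qed

text \<open>If a neighbour of B has the weight of U, the third strand can have this weight only if
  (c U)^2 = 4. So the factor disappears for U off the diagonal; for diagonal U one of its two linear
  factors remains. If B is diagonal, the right neighbour is the only one left in \<open>Q\<close>,
  and excluding it leaves nothing.\<close>

lemma drop:
  fixes v r'
  assumes v: "wt ((u @ [U]) @ [B]) v" and r': "c U = c (rightb B) \<and> r' = c (downb B) \<or> c U = c (downb B) \<and> r' = c (rightb B)"
  shows "diag b U \<Longrightarrow> kills (X (Suc (Suc a))) (lin (z (snd (snd U))) * quad r') (v0 (u @ [U]) B v)"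
    and "\<not> diag b U \<Longrightarrow> \<not> diag b B \<Longrightarrow> kills (X (Suc (Suc a))) (quad r') (v0 (u @ [U]) B v)"
    and "\<not> diag b U \<Longrightarrow> diag b B \<Longrightarrow> c U = c (rightb B) \<Longrightarrow> v0 (u @ [U]) B v = 0"
proof -
  let ?y = "v0 (u @ [U]) B v" and ?X = "X (Suc (Suc a))" and ?W = "Z (Suc (Suc a))"
  have rg: "Suc (Suc a) \<in> {1..n}" using len by auto
  have Xa: "?X \<in> alg" "Xi (Suc (Suc a)) \<in> alg" "?W \<in> alg" "?X * Xi (Suc (Suc a)) = s 1"
    using rg algs Z_alg X_Xi by auto
  have wy: "wt ((u @ [U]) @ [B]) ?y" using wt_v0[OF p len IH] v by simp
  then have y: "?y \<in> alg" by (auto simp: wt_def)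
  define w where "w = (?W - s r') * ?y"
  have wa: "w \<in> alg" using y Xa unfolding w_def by simp
  have eq: "ev ?X (quad r') * ?y = ?X * w"
    using ev_quad[OF Xa(1,2,4), of r'] unfolding w_def Z_def by (simp add: mult.assoc)
  show "kills ?X (lin (z (snd (snd U))) * quad r') ?y" if d: "diag b U"
  proof -
    have "(?X - s (z (snd (snd U)))) * (?X * w) = ?X * ((?X - s (z (snd (snd U)))) * w)"
      using Xa by (simp add: left_diff_distrib right_diff_distrib alg_left)
    also have "\<dots> = 0" using rank3_use(2)[OF v r' d] unfolding w_def by simp
    finally show ?thesis unfolding kills_def using Xa eq by (simp add: ev_mult mult.assoc ev_lin)
  qed
  have Qk: "kills ?X (Q B) ?y" using Q_kills[OF p len IH v] by simp
  have U4: "(c U)\<^sup>2 \<noteq> 4" if nd: "\<not> diag b U"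
    using c_not_2[OF u_facts(2) _ u_facts(4) nd] u_facts(3) len by auto
  have fin: "w = 0" if nd: "\<not> diag b U" and W: "?W * w = s (c U) * w"
  proof -
    have "s 4 * w - s (c U) * (?W * w) = 0"
      using rank3_use(1)[OF v r' nd] unfolding w_def by (simp add: left_diff_distrib mult.assoc)
    then have "s (4 - (c U)\<^sup>2) * w = 0" unfolding W by (simp add: s_left s_diff left_diff_distrib power2_eq_square)
    moreover have "4 - (c U)\<^sup>2 \<noteq> 0" using U4[OF nd] by auto
    ultimately show ?thesis using s_cancel[OF wa] by blast
  qed
  show "kills ?X (quad r') ?y" if nd: "\<not> diag b U" "\<not> diag b B"
  proof -
    have "quad (c (rightb B)) * quad (c (downb B)) = quad (c U) * quad r'"
      using r' by (auto simp: mult.commute)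
    then have "kills ?X (quad (c U) * quad r') ?y" using Qk nd unfolding Q_def[OF p len IH] by simp
    then have k2: "?W * (?W * ?y) - s (c U + r') * (?W * ?y) + s (c U * r') * ?y = 0"
      using kills_quad2[OF rg y] by simp
    have "?W * w - s (c U) * w = ?W * (?W * ?y) - s (c U + r') * (?W * ?y) + s (c U * r') * ?y"
      unfolding w_def using Xa by (simp add: left_diff_distrib right_diff_distrib alg_left s_add distrib_right s_left)
    then have "?W * w = s (c U) * w" using k2 by simp
    then have "w = 0" using fin nd by simp
    then show ?thesis unfolding kills_def eq by simp
  qed
  show "?y = 0" if nd: "\<not> diag b U" "diag b B" "c U = c (rightb B)"
  proof -
    have "kills ?X (quad (c U)) ?y" using Qk nd unfolding Q_def[OF p len IH] by simp
    then have k1: "?W * ?y = s (c U) * ?y" using kills_quad[OF rg y] by simp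
    have "c U \<noteq> r'" using r' downb_diag_t[OF p len IH nd(2)] c_quadratic(3)[OF r'] nd(3) by auto
    then have ne: "c U - r' \<noteq> 0" by simp
    have wy: "w = s (c U - r') * ?y" unfolding w_def by (simp add: left_diff_distrib k1 s_diff)
    have "?W * w = s (c U) * w" unfolding wy using Xa k1 by (simp add: alg_left s_left mult.commute)
    then have "w = 0" using fin nd by simp
    then show ?thesis unfolding wy using s_cancel[OF y ne] by simp
  qed
qed

end

lemma wt_swap:
  assumes v: "wt (t1 @ A # A' # t2) v" and len: "length (t1 @ A # A' # t2) \<le> n"
  shows "wt (t1 @ A' # A # t2) (phi (Suc (length t1)) * v)"
proof -
  let ?i = "length t1"
  have i: "Suc ?i \<in> {1..<n}" using len by simp
  have va: "v \<in> alg" using v by (simp add: wt_def)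
  have k: "kills (X (Suc j)) (pol ((t1 @ A # A' # t2) ! j)) v" if "j < length (t1 @ A # A' # t2)" for j
    using v that unfolding wt_def by blast
  have "kills (X (Suc j)) (pol ((t1 @ A' # A # t2) ! j)) (phi (Suc ?i) * v)" if j: "j < length (t1 @ A' # A # t2)" for j
  proof -
    consider "j = ?i" | "j = Suc ?i" | "j \<noteq> ?i" "j \<noteq> Suc ?i" by blast
    then show ?thesis
    proof cases
      case 1
      then show ?thesis using k[of "Suc ?i"] i by (auto intro!: kills_phi simp: nth_append)
    next
      case 2
      then show ?thesis using k[of ?i] i
        by (auto intro!: kills_swap[of "Suc ?i"] simp: nth_append phi_alg phi_X)
    next
      case 3
      have "(t1 @ A' # A # t2) ! j = (t1 @ A # A' # t2) ! j" using 3 by (auto simp: nth_append nth_Cons split: nat.splits)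
      then show ?thesis using k[of j] i j len 3
        by (auto intro!: kills_swap[of "Suc j" "Suc j"] phi_X_comm simp: phi_alg)
    qed
  qed
  then show ?thesis unfolding wt_def using va i phi_alg by simp
qed

text \<open>\<open>phi\<close> moves v to the list with A and A' exchanged, where q is known to
  annihilate, and a second \<open>phi\<close> moves it back. Both commute with X_m, and phi^2 acts
  on v by the scalar -N, which is nonzero since A' does not have the weight of a neighbour of
  A.\<close>

lemma transport:
  assumes p: "path b M (t1 @ A # A' # t2)" and A: "A \<notin> prv b M A'" and len: "length (t1 @ A # A' # t2) + 1 \<le> n"
    and P: "\<And>v. wt (t1 @ A' # A # t2) v \<Longrightarrow> kills (X (Suc (length (t1 @ A' # A # t2)))) q v"
    and v: "wt (t1 @ A # A' # t2) v"
  shows "kills (X (Suc (length (t1 @ A # A' # t2)))) q v"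
proof -
  let ?i = "Suc (length t1)" and ?m = "Suc (length (t1 @ A # A' # t2))"
  have i: "?i \<in> {1..<n}" and i': "?i \<in> {1..n}" "Suc ?i \<in> {1..n}" and m: "?m \<in> {1..n}" "?m \<noteq> ?i" "?m \<noteq> Suc ?i" using len by auto
  have va: "v \<in> alg" using v by (simp add: wt_def)
  have sw: "A' \<in> addable b M (set t1)" "A \<in> addable b M (set t1)" using path_swap[OF p A] by auto
  have pt: "path b M t1" using p by (simp add: path_append)
  have "A' \<in> addable b M (insert A (set t1))"
  proof -
    have "path b M ((t1 @ [A]) @ [A'])" using path_take[OF p, of "length t1 + 2"] by simp
    then show ?thesis by (simp only: path_snoc) simp
  qed
  then have ne: "A \<noteq> A'" by (auto simp: addable_def)
  have sh: "shape b M (set t1)" "card (set t1) + 3 \<le> n + 1" using path_shape[OF pt] distinct_card[of t1] len by auto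
  have "kills (X ?i) (pol A) v" "kills (X (Suc ?i)) (pol A') v"
  proof -
    have *: "kills (X (Suc j)) (pol ((t1 @ A # A' # t2) ! j)) v" if "j < length (t1 @ A # A' # t2)" for j
      using v that unfolding wt_def by blast
    show "kills (X ?i) (pol A) v" using *[of "length t1"] by simp
    show "kills (X (Suc ?i)) (pol A') v" using *[of "Suc (length t1)"] by (simp add: nth_append)
  qed
  then have za: "Z ?i * v = s (c A) * v" "Z (Suc ?i) * v = s (c A') * v"
    using pol_Z i' va by auto
  have "kills (X ?m) q (phi ?i * v)" using P[OF wt_swap[OF v]] len by simp
  then have "kills (X ?m) q (phi ?i * (phi ?i * v))"
    using i m by (rule_tac kills_swap[of ?m ?m "phi ?i"]) (auto intro: phi_alg phi_X_comm)
  moreover define N where "N = (c A' - c (rightb A)) * (c A' - c (downb A))"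
  have "phi ?i * (phi ?i * v) = s (- N) * v"
  proof -
    have "N = (c A')\<^sup>2 - (c (rightb A) + c (downb A)) * c A' + c (rightb A) * c (downb A)"
      unfolding N_def by (simp add: algebra_simps power2_eq_square)
    then have N: "N = c A' * c A' - (2 + eps\<^sup>2) * c A * c A' + ((c A)\<^sup>2 + 4 * eps\<^sup>2)"
      unfolding c_sum c_prod by (simp add: power2_eq_square)
    show ?thesis unfolding phi_phi[OF i va za(1)] za(2) N using i'
      by (simp add: alg_left Z_alg za(2) s_left s_diff s_add s_uminus left_diff_distrib distrib_right)
  qed
  moreover have "ev (X ?m) q * (s (- N) * v) = s (- N) * (ev (X ?m) q * v)"
    using m algs by (intro alg_left) auto
  ultimately have k0: "s (- N) * (ev (X ?m) q * v) = 0" unfolding kills_def by simp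
  have "N \<noteq> 0"
  proof -
    have 1: "c (rightb A) \<noteq> c A'" using c_next_add(1)[OF sh sw(2,1)] .
    have "c (downb A) \<noteq> c A'"
    proof (cases "diag b A")
      case False
      then show ?thesis using c_next_add(2)[OF sh sw(2,1)] by blast
    next
      case True
      have "c A \<noteq> c A'" using c_add_add[OF sh(1) _ sw(2,1) ne] sh(2) by simp
      moreover have "path b M (t1 @ [A])" using pt sw by (simp add: path_snoc)
      ultimately show ?thesis using downb_diag[OF sh sw(2) True] by simp
    qed
    then show ?thesis unfolding N_def using 1 by auto
  qed
  then have "- N \<noteq> 0" by simp
  then show ?thesis using s_cancel[OF _ _ k0] m algs va unfolding kills_def by auto
qed

text \<open>A removable U precedes none of the later boxes of the diagram, so it can be exchanged
  with each of them in turn until only B follows it; \<open>transport\<close> carries the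
  annihilators along.\<close>

lemma bubble:
  assumes "path b M ((t1 @ U # t2) @ [B])" "U \<in> removable b M (set (t1 @ U # t2))" "length (t1 @ U # t2) + 1 < n"
  shows "\<exists>u. path b M ((u @ [U]) @ [B]) \<and> set (u @ [U]) = set (t1 @ U # t2) \<and> length u = length (t1 @ t2) \<and>
    (\<forall>q. (\<forall>v. wt ((u @ [U]) @ [B]) v \<longrightarrow> kills (X (Suc (Suc (Suc (length u))))) q v) \<longrightarrow>
         (\<forall>v. wt ((t1 @ U # t2) @ [B]) v \<longrightarrow> kills (X (Suc (Suc (Suc (length u))))) q v))"
  using assms
proof (induction t2 arbitrary: t1)
  case Nil
  then show ?case by (intro exI[of _ t1]) auto
next
  case (Cons A t2)
  have p: "path b M (t1 @ U # A # (t2 @ [B]))" using Cons.prems(1) by simp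
  have nU: "U \<notin> prv b M A" using Cons.prems(2) unfolding removable_def by auto
  have p': "path b M (((t1 @ [A]) @ U # t2) @ [B])" using path_swap(1)[OF p nU] by simp
  have s: "set ((t1 @ [A]) @ U # t2) = set (t1 @ U # A # t2)" by auto
  obtain u where u: "path b M ((u @ [U]) @ [B])" "set (u @ [U]) = set ((t1 @ [A]) @ U # t2)" "length u = length ((t1 @ [A]) @ t2)"
    "\<And>q. (\<forall>v. wt ((u @ [U]) @ [B]) v \<longrightarrow> kills (X (Suc (Suc (Suc (length u))))) q v) \<Longrightarrow>
         (\<forall>v. wt (((t1 @ [A]) @ U # t2) @ [B]) v \<longrightarrow> kills (X (Suc (Suc (Suc (length u))))) q v)"
    using Cons.IH[OF p'] Cons.prems(2,3) unfolding s by auto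
  have "kills (X (Suc (Suc (Suc (length u))))) q v"
    if "\<forall>v. wt ((u @ [U]) @ [B]) v \<longrightarrow> kills (X (Suc (Suc (Suc (length u))))) q v" "wt ((t1 @ U # A # t2) @ [B]) v" for q v
    using transport[OF p nU, of q v] u(4)[OF that(1)] that(2) Cons.prems(3) u(3) by simp
  then show ?case using u(1-3) s by (intro exI[of _ u]) auto
qed

text \<open>\<open>PP\<close> collects the old addable boxes. A neighbour of B that can be added
  keeps its factor, a blocked one has to lose it. The blocked one shares its weight with a removable
  box U next to B; rearranging the list so that it ends in U, B makes \<open>drop\<close>
  applicable.\<close>

lemma next_step:
  assumes p: "path b M (t @ [B])" and len: "length t + 1 < n"
    and IH: "\<And>t'. path b M t' \<Longrightarrow> length t' \<le> length t \<Longrightarrow> next_wt t'"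
  shows "next_wt (t @ [B])"
proof -
  let ?S = "set t" and ?m = "Suc (Suc (length t))"
  have pt: "path b M t" "B \<in> addable b M ?S" using p by (auto simp: path_snoc)
  have nt: "next_wt t" using IH pt by simp
  note sh = shape_t[OF p len nt]
  have shN: "card ?S + 3 \<le> n + 1" using sh(2) len by simp
  define PP where "PP = (\<Prod>A \<in> addable b M ?S - {B}. pol A)"
  have PP: "P' t B = PP" unfolding PP_def P'_def[OF p len nt] ..
  have X: "X ?m \<in> alg" using len algs by auto
  have viaU: "diag b U \<Longrightarrow> kills (X ?m) (lin (z (snd (snd U))) * quad r' * PP) v"
    "\<not> diag b U \<Longrightarrow> \<not> diag b B \<Longrightarrow> kills (X ?m) (quad r' * PP) v"
    "\<not> diag b U \<Longrightarrow> diag b B \<Longrightarrow> c U = c (rightb B) \<Longrightarrow> kills (X ?m) PP v"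
    if U: "U \<in> removable b M ?S" "U \<in> prv b M B" and r': "c U = c (rightb B) \<and> r' = c (downb B) \<or> c U = c (downb B) \<and> r' = c (rightb B)"
      and v: "wt (t @ [B]) v" for U r' v
  proof -
    have "U \<in> ?S" using U(1) by (simp add: removable_def)
    then obtain t1 t2 where t: "t = t1 @ U # t2" by (auto simp: in_set_conv_decomp)
    obtain u where u: "path b M ((u @ [U]) @ [B])" "set (u @ [U]) = ?S" "length u = length (t1 @ t2)"
      "\<And>q. (\<forall>v. wt ((u @ [U]) @ [B]) v \<longrightarrow> kills (X (Suc (Suc (Suc (length u))))) q v) \<Longrightarrow>
         (\<forall>v. wt (t @ [B]) v \<longrightarrow> kills (X (Suc (Suc (Suc (length u))))) q v)"
      using bubble[of t1 U t2 B] p U(1) len unfolding t by auto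
    have l: "length u + 1 = length t" "length (u @ [U]) + 1 < n" using u(3) t len by auto
    then have m: "?m = Suc (Suc (Suc (length u)))" by simp
    have pu: "path b M (u @ [U])" "path b M u" using u(1) unfolding path_snoc by auto
    then have nx: "next_wt (u @ [U])" "next_wt u" using IH l by auto
    have PPu: "v0 (u @ [U]) B w = ev (X ?m) PP * w" for w
      unfolding v0_def[OF u(1) l(2) nx(1)] P'_def[OF u(1) l(2) nx(1)] u(2) PP_def m by simp
    note d = drop[OF u(1) l(2) nx U(2) _ r', unfolded PPu m[symmetric]]
    note u4 = u(4)[unfolded m[symmetric], rule_format, OF _ v]
    show "kills (X ?m) (lin (z (snd (snd U))) * quad r' * PP) v" if "diag b U"
      using d(1)[OF _ that] by (intro u4) (simp add: kills_ev[OF X])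
    show "kills (X ?m) (quad r' * PP) v" if "\<not> diag b U" "\<not> diag b B"
      using d(2)[OF _ that] by (intro u4) (simp add: kills_ev[OF X])
    show "kills (X ?m) PP v" if "\<not> diag b U" "diag b B" "c U = c (rightb B)"
      using d(3)[OF _ that] by (intro u4) (simp add: kills_def)
  qed
  have Qk: "kills (X ?m) (Q B * PP) v" if "wt (t @ [B]) v" for v
    using Q_kills[OF p len nt that] unfolding v0_def[OF p len nt] PP by (simp add: kills_ev[OF X])
  have nd: "\<not> diag b (rightb B)"
    using pt(2) unfolding addable_def vbox_def diag_def rightb_def by (auto split: prod.splits)
  have polR: "pol (rightb B) = quad (c (rightb B))" using nd by (simp add: pol_def)
  let ?S' = "set (t @ [B])"
  have S': "?S' = insert B ?S" by simp
  have aft: "addable b M ?S' = (addable b M ?S - {B}) \<union> ({rightb B, downb B} \<inter> addable b M ?S')"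
    using addable_after[OF pt(2)] unfolding S' .
  have split: "(\<Prod>A \<in> addable b M ?S'. pol A) = (\<Prod>A \<in> {rightb B, downb B} \<inter> addable b M ?S'. pol A) * PP"
  proof -
    have "(\<Prod>A \<in> addable b M ?S'. pol A) = PP * (\<Prod>A \<in> {rightb B, downb B} \<inter> addable b M ?S'. pol A)"
      unfolding PP_def using sh(4) next_not_addable[OF pt(2)] by (subst aft, intro prod.union_disjoint) auto
    then show ?thesis by (simp add: mult.commute)
  qed
  have main: "kills (X ?m) ((\<Prod>A \<in> {rightb B, downb B} \<inter> addable b M ?S'. pol A) * PP) v" if v: "wt (t @ [B]) v" for v
  proof (cases "diag b B")
    case True
    have "downb B \<notin> addable b M ?S'"
      using True pt(2) unfolding addable_def vbox_def diag_def downb_def by (auto split: prod.splits)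
    show ?thesis
    proof (cases "rightb B \<in> addable b M ?S'")
      case r: True
      then have "{rightb B, downb B} \<inter> addable b M ?S' = {rightb B}" using \<open>downb B \<notin> _\<close> by auto
      then show ?thesis using Qk[OF v] True unfolding Q_def[OF p len nt] by (simp add: polR)
    next
      case False
      then obtain U i j l where U: "U \<in> removable b M ?S" "U \<in> prv b M B" "\<not> diag b U" "rightb B = (Suc i, Suc j, l)" "U = (i, j, l)"
        using not_right[OF sh(1) pt(2)] False unfolding S' by blast
      then have "c U = c (rightb B)" using c_diag by simp
      then have "kills (X ?m) PP v" using viaU(3)[OF U(1,2) _ v U(3) True] by blast
      moreover have "{rightb B, downb B} \<inter> addable b M ?S' = {}" using False \<open>downb B \<notin> _\<close> by auto
      ultimately show ?thesis by (simp only: prod.empty mult_1)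
    qed
  next
    case nB: False
    have Qe: "kills (X ?m) (quad (c (rightb B)) * quad (c (downb B)) * PP) v"
      using Qk[OF v] nB unfolding Q_def[OF p len nt] by simp
    have R: "kills (X ?m) (quad (c (downb B)) * PP) v \<and> (\<exists>U \<in> removable b M ?S. c U = c (rightb B) \<and> U \<in> prv b M B \<and> \<not> diag b U \<and> (c U)\<^sup>2 \<noteq> 4 \<and> snd (snd U) = snd (snd B))"
      if nR: "rightb B \<notin> addable b M ?S'"
    proof -
      obtain U i j l where U: "U \<in> removable b M ?S" "U \<in> prv b M B" "\<not> diag b U" "rightb B = (Suc i, Suc j, l)" "U = (i, j, l)"
        using not_right[OF sh(1) pt(2)] nR unfolding S' by blast
      then have cU: "c U = c (rightb B)" using c_diag by simp
      have US: "U \<in> ?S" "finite ?S" using U(1) by (auto simp: removable_def)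
      have "card (?S - {U}) + 2 \<le> n + 1" using shN card_Suc_Diff1[OF US(2,1)] by simp
      then have "(c U)\<^sup>2 \<noteq> 4" using c_not_2[of "?S - {U}" U] shape_remove[OF sh(1) U(1)] U(3) by blast
      moreover have "snd (snd U) = snd (snd B)" using U(2) by (auto simp: prv_def split: prod.splits)
      ultimately show ?thesis using viaU(2)[OF U(1,2) _ v U(3) nB] cU U by blast
    qed
    show ?thesis
    proof (cases "diag b (downb B)")
      case True
      let ?l = "lin (z (snd (snd B)))"
      obtain U where U: "U \<in> removable b M ?S" "U \<in> prv b M B" "diag b U" "snd (snd U) = snd (snd B)" and
        D: "downb B \<in> addable b M ?S'"
        using down_diag[OF sh(1) pt(2) True] unfolding S' by blast
      have sD: "snd (snd (downb B)) = snd (snd B)" unfolding downb_def by (cases B) simp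
      have pD: "pol (downb B) = ?l" using True sD by (simp add: pol_def)
      have cD: "c (downb B) = 2 * z (snd (snd B))" using c_of_diag[OF True] sD by simp
      have "c U = c (downb B)" using c_of_diag[OF U(3)] cD U(4) by simp
      \<comment> \<open>The lower neighbour is diagonal here and always addable, though U has the
        same weight. Of \<open>quad (c (downb B))\<close>, the square of \<open>?l\<close>, exactly
        one factor must survive.\<close>
      then have k1: "kills (X ?m) (?l * quad (c (rightb B)) * PP) v"
        using viaU(1)[OF U(1,2) _ v U(3), of "c (rightb B)"] U(4) by simp
      show ?thesis
      proof (cases "rightb B \<in> addable b M ?S'")
        case r: True
        then have "{rightb B, downb B} \<inter> addable b M ?S' = {rightb B, downb B}" using D by auto
        then show ?thesis using k1 right_neq_down[of B] by (simp add: polR pD mult.commute)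
      next
        case False
        then have e: "{rightb B, downb B} \<inter> addable b M ?S' = {downb B}" using D by auto
        \<comment> \<open>There are now two annihilators, \<open>?l\<close> squared times
          \<open>PP\<close> and the quadratic factor of the right neighbour times
          \<open>?l * PP\<close>. The quadratic factor and \<open>?l\<close> are comaximal, which
          leaves \<open>?l * PP\<close>.\<close>
        have "kills (X ?m) (?l * (?l * PP)) v" "c (rightb B) \<noteq> 2 * z (snd (snd B))"
        proof -
          show "kills (X ?m) (?l * (?l * PP)) v"
            using R[OF False] unfolding cD by (simp add: quad_sq z_sq mult.assoc)
          have "(c (rightb B))\<^sup>2 \<noteq> 4" using R[OF False] by auto
          then show "c (rightb B) \<noteq> 2 * z (snd (snd B))" using z_sq[of "snd (snd B)"] by (auto simp: power2_eq_square)
        qed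
        moreover have "kills (X ?m) (quad (c (rightb B)) * (?l * PP)) v" using k1 by (simp add: ac_simps)
        moreover have "comax (quad (c (rightb B))) ?l"
          using comax_pol(1)[of "c (rightb B)" "downb B"] calculation(2) unfolding pD cD by blast
        ultimately have "kills (X ?m) (?l * PP) v" using kills_comax[OF X comax_sym] by blast
        then show ?thesis unfolding e by (simp add: pD)
      qed
    next
      case nD: False
      have polD: "pol (downb B) = quad (c (downb B))" using nD by (simp add: pol_def)
      have Dn: "kills (X ?m) (quad (c (rightb B)) * PP) v \<and> (\<exists>U \<in> removable b M ?S. c U = c (downb B) \<and> U \<in> prv b M B \<and> (\<exists>i j l. downb B = (Suc i, Suc j, l) \<and> U = (i, j, l)))"
        if nD': "downb B \<notin> addable b M ?S'"
      proof -
        obtain U i j l where U: "U \<in> removable b M ?S" "U \<in> prv b M B" "\<not> diag b U" "downb B = (Suc i, Suc j, l)" "U = (i, j, l)"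
          using not_down[OF sh(1) pt(2) _ nB] nD' unfolding S' by blast
        then have cU: "c U = c (downb B)" using c_diag by simp
        then show ?thesis using viaU(2)[OF U(1,2) _ v U(3) nB] U by blast
      qed
      consider "rightb B \<in> addable b M ?S'" "downb B \<in> addable b M ?S'" | "rightb B \<notin> addable b M ?S'" "downb B \<in> addable b M ?S'"
        | "rightb B \<in> addable b M ?S'" "downb B \<notin> addable b M ?S'" | "rightb B \<notin> addable b M ?S'" "downb B \<notin> addable b M ?S'" by blast
      then show ?thesis
      proof cases
        case 1
        then have "{rightb B, downb B} \<inter> addable b M ?S' = {rightb B, downb B}" by auto
        then show ?thesis using Qe right_neq_down[of B] by (simp add: polR polD)
      next
        case 2
        then have "{rightb B, downb B} \<inter> addable b M ?S' = {downb B}" by auto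
        then show ?thesis using R 2 by (simp add: polD)
      next
        case 3
        then have "{rightb B, downb B} \<inter> addable b M ?S' = {rightb B}" by auto
        then show ?thesis using Dn 3 by (simp add: polR)
      next
        case 4
        then have e: "{rightb B, downb B} \<inter> addable b M ?S' = {}" by auto
        obtain U where U: "U \<in> removable b M ?S" "c U = c (rightb B)" "U \<in> prv b M B" using R[OF 4(1)] by blast
        obtain V i j l where V: "V \<in> removable b M ?S" "c V = c (downb B)" "V \<in> prv b M B" "downb B = (Suc i, Suc j, l)" "V = (i, j, l)"
          using Dn[OF 4(2)] by blast
        obtain U' i' j' l' where U': "U' \<in> removable b M ?S" "rightb B = (Suc i', Suc j', l')" "U' = (i', j', l')"
          using not_right[OF sh(1) pt(2)] 4(1) unfolding S' by blast
        have "U' \<noteq> V" using U' V right_neq_down[of B] by auto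
        then have "c U' \<noteq> c V" using c_rem_rem[OF sh(1) _ U'(1) V(1)] shN by simp
        then have "c (rightb B) \<noteq> c (downb B)" using U' V c_diag by simp
        \<comment> \<open>The two neighbours are blocked by different removable boxes, whose weights
          differ; so the two quadratic factors are comaximal and both can be cancelled.\<close>
        then have "kills (X ?m) PP v" using kills_comax[OF X comax_quad] R[OF 4(1)] Dn[OF 4(2)] by blast
        then show ?thesis unfolding e by simp
      qed
    qed
  qed
  show ?thesis unfolding next_wt_def split using main by simp
qed

theorem next_wt: "path b M t \<Longrightarrow> length t < n \<Longrightarrow> next_wt t"
proof (induction "length t" arbitrary: t rule: less_induct)
  case less
  show ?case
  proof (cases t rule: rev_cases)
    case Nil
    then show ?thesis using base unfolding next_wt_def kills_def by simp
  next
    case (snoc t' B)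
    then show ?thesis using less by (auto intro!: next_step)
  qed
qed

text \<open>Induction from complete lists downwards: by \<open>kills_cover\<close> a weight vector
  of t splits into weight vectors of the lists with one more box. Every vector is a weight vector of
  the empty list, in particular \<open>s 1\<close>, and killing \<open>s 1\<close> means vanishing
  of the polynomial.\<close>

theorem kills_all:
  assumes q: "\<And>t v. path b M t \<Longrightarrow> length t = n \<Longrightarrow> kills (X k) (pol (t ! (k - 1))) v \<Longrightarrow> v \<in> alg \<Longrightarrow> kills (X k) q v"
    and k: "k \<in> {1..n}"
  shows "ev (X k) q = 0"
proof -
  have "kills (X k) q v" if "path b M t" "length t \<le> n" "wt t v" for t v
    using that
  proof (induction "n - length t" arbitrary: t v)
    case 0
    then have "length t = n" by simp
    then show ?case using 0 k q[of t v] unfolding wt_def by (auto dest!: spec[of _ "k - 1"])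
  next
    case (Suc m)
    then have l: "length t < n" by simp
    let ?m = "Suc (length t)"
    have m: "?m \<in> {1..n}" "X ?m \<in> alg" "X k \<in> alg" using l k algs by auto
    have v: "v \<in> alg" using Suc.prems by (simp add: wt_def)
    let ?w = "ev (X k) q * v"
    have comm: "ev (X k) q * ev (X ?m) r = ev (X ?m) r * ev (X k) q" for r
      using m k by (intro ev_swap ev_swap[symmetric]) (auto intro: X_comm)
    have "?w = 0"
    proof (rule kills_cover[where w = "X ?m" and F = "addable b M (set t)" and f = pol])
      show "X ?m \<in> alg" by (rule m)
      show "finite (addable b M (set t))" using finite_addable Suc.prems by blast
      show "?w \<in> alg" using m v by simp
      show "comax (pol A) (pol B)" if "A \<in> addable b M (set t)" "B \<in> addable b M (set t)" "A \<noteq> B" for A B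
        using c_add_add[OF _ _ that] path_shape[OF Suc.prems(1)] distinct_card[of t] l by (intro comax_pol) auto
      have "kills (X ?m) (\<Prod>A \<in> addable b M (set t). pol A) v"
        using next_wt[OF Suc.prems(1) l] Suc.prems(3) unfolding next_wt_def by simp
      then show "kills (X ?m) (prod pol (addable b M (set t))) ?w"
        using comm unfolding kills_def by (simp add: mult.assoc[symmetric]) (metis mult.assoc mult_zero_right)
      fix A assume A: "A \<in> addable b M (set t)"
      let ?r = "prod pol (addable b M (set t) - {A})"
      have "wt (t @ [A]) (ev (X ?m) ?r * v)"
      proof -
        have "pol A * ?r = (\<Prod>A \<in> addable b M (set t). pol A)"
          using A finite_addable[OF Suc.prems(1)] by (intro prod.remove[symmetric]) auto
        then have "kills (X ?m) (pol A) (ev (X ?m) ?r * v)"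
          using next_wt[OF Suc.prems(1) l] Suc.prems(3) m unfolding next_wt_def by (simp add: kills_ev)
        then show ?thesis unfolding wt_snoc using wt_ev[OF Suc.prems(3) l] by simp
      qed
      then have "kills (X k) q (ev (X ?m) ?r * v)"
        using Suc.hyps(1)[of "t @ [A]"] Suc.hyps(2) Suc.prems(1) A l by (simp add: path_snoc)
      then show "kills (X ?m) ?r ?w" unfolding kills_def by (simp add: mult.assoc[symmetric] comm)
    qed
    then show ?case by (simp add: kills_def)
  qed
  from this[of "[]" "s 1"] have "kills (X k) q (s 1)" by (simp add: wt_def)
  then show ?thesis using k algs unfolding kills_def by simp
qed

end

section \<open>Standard tableaux as growing diagrams\<close>

text \<open>Decreasing parts put the box above into the diagram. In a strict component each row
  starts one column later, and strict decrease compensates for this shift.\<close>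

lemma boxes_shape:
  assumes lam: "lam \<in> mparts b m N"
  shows "shape b (nstrict b + m) (boxes b lam)"
proof -
  let ?M = "nstrict b + m"
  have len: "length lam = ?M" using lam by (simp add: mparts_def)
  have row: "i < j \<Longrightarrow> j < length (lam ! l) \<Longrightarrow> lam ! l ! j \<le> lam ! l ! i"
    "l < nstrict b \<Longrightarrow> i < j \<Longrightarrow> j < length (lam ! l) \<Longrightarrow> lam ! l ! j < lam ! l ! i" if "l < ?M" for i j l
  proof -
    have "if l < nstrict b then is_strict_partition (lam ! l) else is_partition (lam ! l)"
      using lam that len by (simp add: mparts_def)
    then show "i < j \<Longrightarrow> j < length (lam ! l) \<Longrightarrow> lam ! l ! j \<le> lam ! l ! i"
      "l < nstrict b \<Longrightarrow> i < j \<Longrightarrow> j < length (lam ! l) \<Longrightarrow> lam ! l ! j < lam ! l ! i"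
      by (auto simp: is_strict_partition_def is_partition_def sorted_wrt_iff_nth_less split: if_splits
          dest: less_imp_le)
  qed
  have "finite (boxes b lam)"
  proof (rule finite_subset)
    let ?K = "Suc (Max (insert 0 (\<Union>l < length lam. insert (length (lam ! l)) (set (lam ! l)))))"
    have fin: "finite (insert 0 (\<Union>l < length lam. insert (length (lam ! l)) (set (lam ! l))))" by auto
    have le: "x < ?K" if "x \<in> insert 0 (\<Union>l < length lam. insert (length (lam ! l)) (set (lam ! l)))" for x
      using Max_ge[OF fin that] by simp
    show "boxes b lam \<subseteq> {..?K} \<times> {..?K + ?K} \<times> {..length lam}"
    proof
      fix A assume A: "A \<in> boxes b lam"
      obtain i j l where e: "A = (i, j, l)" by (cases A)
      have a: "l < length lam" "1 \<le> i" "i \<le> length (lam ! l)"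
        "if l < nstrict b then i \<le> j \<and> j < i + lam ! l ! (i - 1) else 1 \<le> j \<and> j \<le> lam ! l ! (i - 1)"
        using A unfolding e boxes_def by auto
      have "length (lam ! l) < ?K" using a(1) by (intro le) auto
      moreover have "lam ! l ! (i - 1) \<in> set (lam ! l)" using a by (intro nth_mem) auto
      then have "lam ! l ! (i - 1) < ?K" using a(1) by (intro le) blast
      ultimately show "A \<in> {..?K} \<times> {..?K + ?K} \<times> {..length lam}" using a unfolding e by (auto split: if_splits)
    qed
  qed auto
  moreover have "vbox b ?M A \<and> prv b ?M A \<subseteq> boxes b lam" if A: "A \<in> boxes b lam" for A
  proof -
    obtain i j l where e: "A = (i, j, l)" by (cases A)
    have a: "l < ?M" "1 \<le> i" "i \<le> length (lam ! l)"
      "if l < nstrict b then i \<le> j \<and> j < i + lam ! l ! (i - 1) else 1 \<le> j \<and> j \<le> lam ! l ! (i - 1)"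
      using A len unfolding e boxes_def by auto
    have "(i - 1, j, l) \<in> boxes b lam" if i2: "vbox b ?M (i - 1, j, l)" "i \<ge> 2"
    proof -
      have "i - 2 < i - 1" "i - 1 < length (lam ! l)" using i2(2) a(2,3) by auto
      then have r: "lam ! l ! (i - 1) \<le> lam ! l ! (i - 2)" "l < nstrict b \<Longrightarrow> lam ! l ! (i - 1) < lam ! l ! (i - 2)"
        using row[OF a(1), of "i - 2" "i - 1"] by auto
      have e2: "i - 2 = i - Suc (Suc 0)" by simp
      show ?thesis using i2 a r[unfolded e2] len unfolding vbox_def boxes_def by (auto split: if_splits)
    qed
    moreover have "(i, j - 1, l) \<in> boxes b lam" if "vbox b ?M (i, j - 1, l)"
      using that a len unfolding vbox_def boxes_def by (auto split: if_splits)
    ultimately show ?thesis using a unfolding e vbox_def prv_def by (auto split: if_splits)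
  qed
  ultimately show ?thesis unfolding shape_def by blast
qed

definition tpath :: "bullet \<Rightarrow> mpart \<Rightarrow> tableau \<Rightarrow> box list" where
  "tpath b lam u = map (inv_into (boxes b lam) u) [1..<mp_size lam + 1]"

lemma length_tpath [simp]: "length (tpath b lam u) = mp_size lam"
  by (simp add: tpath_def)

lemma nth_tpath: "k \<in> {1..mp_size lam} \<Longrightarrow> tpath b lam u ! (k - 1) = inv_into (boxes b lam) u k"
  by (auto simp: tpath_def simp del: upt_Suc)

lemma Std_inv:
  assumes "u \<in> Std b lam" "k \<in> {1..mp_size lam}"
  shows "inv_into (boxes b lam) u k \<in> boxes b lam" "u (inv_into (boxes b lam) u k) = k"
  using assms by (auto simp: Std_def bij_betw_def f_inv_into_f intro!: inv_into_into)

lemma Std_inj: "u \<in> Std b lam \<Longrightarrow> A \<in> boxes b lam \<Longrightarrow> inv_into (boxes b lam) u (u A) = A"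
  by (auto simp: Std_def bij_betw_def)

lemma Std_range: "u \<in> Std b lam \<Longrightarrow> A \<in> boxes b lam \<Longrightarrow> u A \<in> {1..mp_size lam}"
  by (auto simp: Std_def bij_betw_def)

lemma Std_prv: "u \<in> Std b lam \<Longrightarrow> A \<in> boxes b lam \<Longrightarrow> B \<in> prv b M A \<Longrightarrow> B \<in> boxes b lam \<Longrightarrow> u B < u A"
  unfolding prv_def Std_def by (fastforce split: prod.splits)

lemma tpath_path:
  assumes lam: "lam \<in> mparts b m N" and u: "u \<in> Std b lam"
  shows "path b (nstrict b + m) (tpath b lam u)" "set (tpath b lam u) = boxes b lam"
proof -
  let ?I = "inv_into (boxes b lam) u" and ?M = "nstrict b + m"
  have N: "mp_size lam = N" using lam by (simp add: mparts_def)
  have tk: "set (take k (tpath b lam u)) = ?I ` {1..k}" if "k \<le> N" for k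
    using that by (auto simp: tpath_def N take_map min_def simp del: upt_Suc)
  note sh = boxes_shape[OF lam]
  show "path b ?M (tpath b lam u)"
    unfolding path_def
  proof (intro allI impI)
    fix k assume "k < length (tpath b lam u)"
    then have k: "k < N" by (simp add: N)
    let ?A = "?I (Suc k)"
    have A: "?A \<in> boxes b lam" "u ?A = Suc k" using Std_inv[OF u, of "Suc k"] k N by auto
    have nk: "tpath b lam u ! k = ?A" using nth_tpath[of "Suc k" lam b u] k N by simp
    have "B \<in> ?I ` {1..k}" if B: "B \<in> prv b ?M ?A" for B
    proof -
      have Bb: "B \<in> boxes b lam" using sh A(1) B unfolding shape_def by blast
      then have "u B < u ?A" using Std_prv[OF u A(1) B] by simp
      then have "u B \<in> {1..k}" using A(2) Std_range[OF u Bb] by auto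
      then show ?thesis using Std_inj[OF u Bb] by (metis image_eqI)
    qed
    moreover have "?A \<notin> ?I ` {1..k}"
    proof
      assume "?A \<in> ?I ` {1..k}"
      then obtain j where j: "j \<in> {1..k}" "?A = ?I j" by blast
      then have "u ?A = j" using Std_inv(2)[OF u, of j] k N by auto
      then show False using A j by auto
    qed
    ultimately show "tpath b lam u ! k \<in> addable b ?M (set (take k (tpath b lam u)))"
      unfolding nk using tk[of k] k sh A(1) by (auto simp: addable_def shape_def)
  qed
  have "set (tpath b lam u) = ?I ` {1..N}" using tk[of N] by (simp add: N)
  also have "\<dots> = boxes b lam"
    using u N unfolding Std_def by (auto simp: bij_betw_def inv_into_into intro!: inv_into_into)
      (metis (no_types, lifting) imageI inv_into_f_f)
  finally show "set (tpath b lam u) = boxes b lam" .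
qed

lemma sum_list_update_Suc: "i < length p \<Longrightarrow> sum_list (p[i := Suc (p ! i)]) = Suc (sum_list p)"
  by (induction p arbitrary: i) (auto split: nat.splits)

lemma sum_list_map_update: "l < length L \<Longrightarrow> sum_list (p :: nat list) = Suc (sum_list (L ! l)) \<Longrightarrow>
    sum_list (map sum_list (L[l := p])) = Suc (sum_list (map sum_list L))"
  by (induction L arbitrary: l) (auto split: nat.splits)

text \<open>A multipartition stores parts rather than boxes, so an addable box has to be located: it
  stands at the end of an existing row or opens the row after the last one.\<close>

lemma mparts_add_box:
  assumes lam: "lam \<in> mparts b m N" and A: "A \<in> addable b (nstrict b + m) (boxes b lam)"
  shows "\<exists>mu \<in> mparts b m (Suc N). boxes b mu = insert A (boxes b lam)"
proof -
  let ?M = "nstrict b + m"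
  have len: "length lam = ?M" "mp_size lam = N" using lam by (auto simp: mparts_def)
  obtain i j l where e: "A = (i, j, l)" by (cases A)
  have v: "l < ?M" "1 \<le> i" "if l < nstrict b then i \<le> j else 1 \<le> j" and nb: "(i, j, l) \<notin> boxes b lam"
    and pr: "prv b ?M (i, j, l) \<subseteq> boxes b lam" using A unfolding e addable_def vbox_def by auto
  define p where "p = lam ! l"
  define q where "q = (if i \<le> length p then p[i - 1 := Suc (p ! (i - 1))] else p @ [1])"
  have pp: "if l < nstrict b then is_strict_partition p else is_partition p"
    using lam v len unfolding p_def by (simp add: mparts_def)
  have up: "i - 1 \<le> length p" "if l < nstrict b then j < i - 1 + p ! (i - 2) else j \<le> p ! (i - 2)" if "i \<ge> 2"
  proof -
    have "(i - 1, j, l) \<in> prv b ?M (i, j, l)" using that v unfolding prv_def vbox_def by auto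
    then have "(i - 1, j, l) \<in> boxes b lam" using pr by blast
    then show "i - 1 \<le> length p" "if l < nstrict b then j < i - 1 + p ! (i - 2) else j \<le> p ! (i - 2)"
      unfolding boxes_def p_def by (auto simp: numeral_2_eq_2)
  qed
  have left: "i \<le> length p \<and> (if l < nstrict b then j - 1 < i + p ! (i - 1) else j - 1 \<le> p ! (i - 1))"
    if "if l < nstrict b then i \<le> j - 1 else 1 \<le> j - 1"
  proof -
    have "1 \<le> j" using v by (auto split: if_splits)
    then have "(i, j - 1, l) \<in> prv b ?M (i, j, l)" using that v unfolding prv_def vbox_def by (auto split: if_splits)
    then have "(i, j - 1, l) \<in> boxes b lam" using pr by blast
    then show ?thesis unfolding boxes_def p_def by (auto split: if_splits)
  qed
  have nb': "i \<le> length p \<Longrightarrow> if l < nstrict b then i + p ! (i - 1) \<le> j else p ! (i - 1) < j"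
    using nb v len unfolding boxes_def p_def by (auto split: if_splits)
  have il: "i \<le> length p + 1"
    using up(1) by (cases "i \<ge> 2") auto
  \<comment> \<open>The predecessor on the left bounds the column from above, and the box being new
    bounds it from below, so the column is forced.\<close>
  have j: "if i \<le> length p then j = (if l < nstrict b then i + p ! (i - 1) else Suc (p ! (i - 1)))
      else j = (if l < nstrict b then i else 1)"
  proof (cases "i \<le> length p")
    case True
    show ?thesis
    proof (cases "l < nstrict b")
      case st: True
      have "\<not> i + p ! (i - 1) < j"
      proof
        assume h: "i + p ! (i - 1) < j"
        then have "j - 1 < i + p ! (i - 1)" using left st by simp
        then show False using h by simp
      qed
      then show ?thesis using nb'[OF True] st True by simp
    next
      case st: False
      have "\<not> Suc (p ! (i - 1)) < j"
      proof
        assume h: "Suc (p ! (i - 1)) < j"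
        then have "j - 1 \<le> p ! (i - 1)" using left st by simp
        then show False using h by simp
      qed
      then show ?thesis using nb'[OF True] st True by simp
    qed
  next
    case False
    show ?thesis
    proof (cases "l < nstrict b")
      case st: True
      have "\<not> i < j" using left st False by fastforce
      then show ?thesis using v(3) st False by simp
    next
      case st: False
      have "\<not> 1 < j" using left st False by fastforce
      then show ?thesis using v(3) st False by simp
    qed
  qed
  have lq: "length q = (if i \<le> length p then length p else Suc (length p))" unfolding q_def by simp
  have nq: "q ! x = (if x = i - 1 then (if i \<le> length p then Suc (p ! x) else 1) else p ! x)" if "x < length q" for x
  proof (cases "i \<le> length p")
    case True
    then show ?thesis using that v(2) unfolding q_def by (simp add: nth_list_update)
  next
    case False
    then have "i = Suc (length p)" using il by simp
    then show ?thesis using that False unfolding q_def by (simp add: nth_append)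
  qed
  \<comment> \<open>The predecessor above bounds the enlarged part by the part before it; in a
    strict component the shift by one column turns this into a strict inequality.\<close>
  have small: "q ! (i - 1) \<le> p ! x \<and> (l < nstrict b \<longrightarrow> q ! (i - 1) < p ! x)" if "x < i - 1" for x
  proof -
    have i2: "i \<ge> 2" using that by simp
    have lt: "i - 2 < length p" using up(1)[OF i2] i2 by simp
    have "p ! (i - 2) \<le> p ! x \<or> x = i - 2"
      using pp that lt i2 by (cases "x < i - 2")
        (auto simp: is_strict_partition_def is_partition_def sorted_wrt_iff_nth_less less_imp_le split: if_splits)
    moreover have "q ! (i - 1) = (if i \<le> length p then Suc (p ! (i - 1)) else 1)"
      using nq[of "i - 1"] lq v(2) il by (auto split: if_splits)
    moreover have "q ! (i - 1) \<le> p ! (i - 2) \<and> (l < nstrict b \<longrightarrow> q ! (i - 1) < p ! (i - 2))"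
      using up(2)[OF i2] j calculation(2) i2 by (auto split: if_splits)
    ultimately show ?thesis by auto
  qed
  have q0: "0 \<notin> set q"
    using pp unfolding q_def is_partition_def is_strict_partition_def
    by (auto dest: in_set_takeD subsetD[OF set_update_subset_insert] split: if_splits)
  have qp: "if l < nstrict b then is_strict_partition q else is_partition q"
  proof -
    have "q ! y \<le> q ! x \<and> (l < nstrict b \<longrightarrow> q ! y < q ! x)" if xy: "x < y" "y < length q" for x y
    proof (cases "y = i - 1")
      case True
      then show ?thesis using small[of x] nq[of x] xy by auto
    next
      case False
      then have yp: "y < length p" using xy lq il by (auto split: if_splits)
      have "p ! y \<le> p ! x \<and> (l < nstrict b \<longrightarrow> p ! y < p ! x)"
        using pp xy yp by (auto simp: is_strict_partition_def is_partition_def sorted_wrt_iff_nth_less less_imp_le split: if_splits)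
      then show ?thesis using nq[of x] nq[of y] xy False yp by (auto split: if_splits)
    qed
    then show ?thesis using q0 by (auto simp: is_strict_partition_def is_partition_def sorted_wrt_iff_nth_less)
  qed
  define mu where "mu = lam[l := q]"
  have sq: "sum_list q = Suc (sum_list p)"
    unfolding q_def using v(2) by (auto intro: sum_list_update_Suc)
  have "mp_size mu = Suc N"
    using sum_list_map_update[of l lam q] sq v(1) len unfolding mu_def mp_size_def p_def by simp
  moreover have "if l' < nstrict b then is_strict_partition (mu ! l') else is_partition (mu ! l')" if "l' < length mu" for l'
    using that lam qp len unfolding mu_def by (cases "l' = l") (auto simp: mparts_def)
  ultimately have mu: "mu \<in> mparts b m (Suc N)" using len unfolding mparts_def mu_def by simp
  have "(i', j', l') \<in> boxes b mu \<longleftrightarrow> (i', j', l') \<in> insert A (boxes b lam)" for i' j' l'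
  proof (cases "l' = l")
    case False
    then show ?thesis unfolding boxes_def mu_def e by auto
  next
    case l: True
    have mq: "mu ! l = q" using v(1) len unfolding mu_def by simp
    show ?thesis
    proof (cases "i' = i")
      case True
      have "(i, j', l) \<in> boxes b mu \<longleftrightarrow> (if l < nstrict b then i \<le> j' \<and> j' < i + q ! (i - 1) else 1 \<le> j' \<and> j' \<le> q ! (i - 1))"
        using v(1,2) len lq il unfolding boxes_def mq by (auto simp: mu_def mq[unfolded mu_def] split: if_splits)
      moreover have "q ! (i - 1) = (if i \<le> length p then Suc (p ! (i - 1)) else 1)"
        using nq[of "i - 1"] lq v(2) il by (auto split: if_splits)
      moreover have "(i, j', l) \<in> boxes b lam \<longleftrightarrow> i \<le> length p \<and> (if l < nstrict b then i \<le> j' \<and> j' < i + p ! (i - 1) else 1 \<le> j' \<and> j' \<le> p ! (i - 1))"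
        using v(1,2) len unfolding boxes_def p_def by auto
      ultimately show ?thesis unfolding l True e using j v(3) by (auto split: if_splits)
    next
      case False
      have "(i', j', l) \<in> boxes b mu \<longleftrightarrow> 1 \<le> i' \<and> i' \<le> length q \<and> (if l < nstrict b then i' \<le> j' \<and> j' < i' + q ! (i' - 1) else 1 \<le> j' \<and> j' \<le> q ! (i' - 1))"
        using v(1) len unfolding boxes_def by (auto simp: mu_def mq[unfolded mu_def])
      moreover have "(i', j', l) \<in> boxes b lam \<longleftrightarrow> 1 \<le> i' \<and> i' \<le> length p \<and> (if l < nstrict b then i' \<le> j' \<and> j' < i' + p ! (i' - 1) else 1 \<le> j' \<and> j' \<le> p ! (i' - 1))"
        using v(1) len unfolding boxes_def p_def by auto
      moreover have "q ! (i' - 1) = p ! (i' - 1)" if "1 \<le> i'" "i' \<le> length q"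
        using nq[of "i' - 1"] that False v(2) by auto
      moreover have "1 \<le> i' \<and> i' \<le> length q \<longleftrightarrow> 1 \<le> i' \<and> i' \<le> length p" using lq il False by (auto split: if_splits)
      ultimately show ?thesis unfolding l e using False by auto
    qed
  qed
  then have "boxes b mu = insert A (boxes b lam)" by auto
  then show ?thesis using mu by blast
qed

lemma path_mparts:
  "path b (nstrict b + m) t \<Longrightarrow> \<exists>lam \<in> mparts b m (length t). boxes b lam = set t"
proof (induction t rule: rev_induct)
  case Nil
  have "replicate (nstrict b + m) [] \<in> mparts b m 0"
    unfolding mparts_def mp_size_def is_partition_def is_strict_partition_def by (simp add: map_replicate sum_list_replicate)
  moreover have "boxes b (replicate (nstrict b + m) []) = {}" unfolding boxes_def by auto
  ultimately show ?case by auto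
next
  case (snoc A t)
  then obtain lam where lam: "lam \<in> mparts b m (length t)" "boxes b lam = set t" by (auto simp: path_snoc)
  then show ?case using mparts_add_box[OF lam(1), of A] snoc.prems by (auto simp: path_snoc)
qed

text \<open>The boxes are numbered by their places in the list. Monotonicity is given for immediate
  predecessors only and is chained along a row or column by induction on the distance; the boxes in
  between belong to the diagram because it is closed under predecessors.\<close>

lemma path_Std:
  assumes p: "path b (nstrict b + m) t"
  shows "\<exists>lam \<in> mparts b m (length t). \<exists>u \<in> Std b lam. boxes b lam = set t \<and> tpath b lam u = t"
proof -
  let ?M = "nstrict b + m"
  obtain lam where lam: "lam \<in> mparts b m (length t)" "boxes b lam = set t" using path_mparts[OF p] by blast
  have N: "mp_size lam = length t" using lam by (simp add: mparts_def)
  have d: "distinct t" and sh: "shape b ?M (set t)" using path_shape[OF p] by auto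
  define ix where "ix A = (THE k. k < length t \<and> t ! k = A)" for A
  have ix: "ix (t ! k) = k" if "k < length t" for k
    unfolding ix_def using that d by (auto simp: nth_eq_iff_index_eq)
  define u where "u = restrict (\<lambda>A. Suc (ix A)) (set t)"
  have uk: "u (t ! k) = Suc k" if "k < length t" for k using ix[OF that] that by (simp add: u_def)
  have bij: "bij_betw u (set t) {1..length t}"
  proof (rule bij_betwI[where g = "\<lambda>k. t ! (k - 1)"])
    show "u \<in> set t \<rightarrow> {1..length t}"
    proof
      fix A assume "A \<in> set t"
      then obtain k where "k < length t" "t ! k = A" by (auto simp: in_set_conv_nth)
      then show "u A \<in> {1..length t}" using uk[of k] by auto
    qed
    show "(\<lambda>k. t ! (k - 1)) \<in> {1..length t} \<rightarrow> set t" by auto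
    show "t ! (u x - 1) = x" if x: "x \<in> set t" for x
    proof -
      obtain k where "k < length t" "t ! k = x" using x by (auto simp: in_set_conv_nth)
      then show ?thesis using uk[of k] by auto
    qed
    show "u (t ! (k - 1)) = k" if "k \<in> {1..length t}" for k using that uk[of "k - 1"] by auto
  qed
  have prv_less: "u B < u A" if AB: "A \<in> set t" "B \<in> prv b ?M A" for A B
  proof -
    obtain k where k: "k < length t" "t ! k = A" using AB(1) by (auto simp: in_set_conv_nth)
    then have "B \<in> set (take k t)" using p AB(2) unfolding path_def addable_def by blast
    then obtain j where "j < k" "t ! j = B" using k by (auto simp: in_set_conv_nth)
    then show ?thesis using k uk[of k] uk[of j] by auto
  qed
  have row: "(i, j, l) \<in> set t \<Longrightarrow> (i, j + Suc d, l) \<in> set t \<Longrightarrow> u (i, j, l) < u (i, j + Suc d, l)" for i j l d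
  proof (induction d)
    case 0
    have "vbox b ?M (i, j, l)" using 0 sh by (simp add: shape_def)
    then have "(i, j, l) \<in> prv b ?M (i, j + Suc 0, l)" unfolding prv_def by auto
    then show ?case using prv_less 0 by auto
  next
    case (Suc d)
    have "vbox b ?M (i, j, l)" using Suc sh by (simp add: shape_def)
    then have pv: "(i, j + Suc d, l) \<in> prv b ?M (i, j + Suc (Suc d), l)" unfolding prv_def vbox_def by (auto split: if_splits)
    then have "(i, j + Suc d, l) \<in> set t" using sh Suc.prems(2) unfolding shape_def by blast
    then show ?case using prv_less[OF Suc.prems(2) pv] Suc by auto
  qed
  have col: "(i, j, l) \<in> set t \<Longrightarrow> (i + Suc d, j, l) \<in> set t \<Longrightarrow> u (i, j, l) < u (i + Suc d, j, l)" for i j l d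
  proof (induction d)
    case 0
    have "vbox b ?M (i, j, l)" using 0 sh by (simp add: shape_def)
    then have "(i, j, l) \<in> prv b ?M (i + Suc 0, j, l)" unfolding prv_def by auto
    then show ?case using prv_less 0 by auto
  next
    case (Suc d)
    have "vbox b ?M (i, j, l)" "vbox b ?M (i + Suc (Suc d), j, l)" using Suc.prems sh by (auto simp: shape_def)
    then have pv: "(i + Suc d, j, l) \<in> prv b ?M (i + Suc (Suc d), j, l)" unfolding prv_def vbox_def by (auto split: if_splits)
    then have "(i + Suc d, j, l) \<in> set t" using sh Suc.prems(2) unfolding shape_def by blast
    then show ?case using prv_less[OF Suc.prems(2) pv] Suc by auto
  qed
  have Std: "u \<in> Std b lam"
  proof -
    have "u \<in> extensional (set t)" by (simp add: u_def)
    moreover have "u (i, j, l) < u (i, j', l)" if "(i, j, l) \<in> set t" "(i, j', l) \<in> set t" "j < j'" for i j j' l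
      using row[of i j l "j' - Suc j"] that by simp
    moreover have "u (i, j, l) < u (i', j, l)" if "(i, j, l) \<in> set t" "(i', j, l) \<in> set t" "i < i'" for i i' j l
      using col[of i j l "i' - Suc i"] that by simp
    ultimately show ?thesis unfolding Std_def lam(2) N using bij by blast
  qed
  have "tpath b lam u = t"
  proof (rule nth_equalityI)
    show "length (tpath b lam u) = length t" by (simp add: N)
    fix k assume "k < length (tpath b lam u)"
    then have k: "k < length t" by (simp add: N)
    have "tpath b lam u ! k = inv_into (boxes b lam) u (u (t ! k))"
      using nth_tpath[of "Suc k" lam b u] k N uk by simp
    also have "\<dots> = t ! k" using Std_inj[OF Std] k lam by simp
    finally show "tpath b lam u ! k = t ! k" .
  qed
  then show ?thesis using lam Std by blast
qed

text \<open>The first row of the first component can always be prolonged. This completes any short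
  list to the size for which separateness is assumed.\<close>

lemma path_extend1:
  assumes p: "path b M t" and M: "0 < M"
  shows "\<exists>A. path b M (t @ [A])"
proof -
  have sh: "shape b M (set t)" using path_shape[OF p] by simp
  define j where "j = (LEAST j. 1 \<le> j \<and> (1, j, 0) \<notin> set t)"
  have "finite ((\<lambda>(i, j, l). j) ` set t)" by simp
  then obtain j0 where "\<forall>x \<in> (\<lambda>(i, j, l). j) ` set t. x < (j0 :: nat)"
    unfolding finite_nat_set_iff_bounded by blast
  then have "(1, Suc j0, 0) \<notin> set t" by force
  then have j: "1 \<le> j \<and> (1, j, 0) \<notin> set t"
    unfolding j_def by (rule_tac LeastI[of _ "Suc j0"]) simp
  have less: "(1, j', 0) \<in> set t" if "1 \<le> j'" "j' < j" for j'
    using not_less_Least[of j' "\<lambda>j. 1 \<le> j \<and> (1, j, 0) \<notin> set t"] that unfolding j_def by blast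
  have "(1, j, 0) \<in> addable b M (set t)"
    using j M less unfolding addable_def vbox_def prv_def by (auto split: if_splits)
  then show ?thesis using p by (auto simp: path_snoc)
qed

lemma path_extend:
  assumes p: "path b M t" and M: "0 < M"
  shows "\<exists>u. path b M (t @ u) \<and> length u = d"
proof (induction d)
  case (Suc d)
  then obtain u where u: "path b M (t @ u)" "length u = d" by blast
  then obtain A where "path b M ((t @ u) @ [A])" using path_extend1[OF _ M] by blast
  then show ?case using u by (intro exI[of _ "u @ [A]"]) simp
qed (use p in auto)

section \<open>Residues\<close>

text \<open>The residue as a function of the box alone. The value 1 for component numbers out of
  range keeps it nonzero everywhere, so that the identities between weights of neighbours hold for
  all triples.\<close>

definition bres :: "'k::field hc_datum \<Rightarrow> box \<Rightarrow> 'k" where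
  "bres h = (\<lambda>(i, j, l). (if l < length (Qext h) then Qext h ! l else 1) * hq h powi (2 * (int j - int i)))"

lemma length_Qext: "length (Qext h) = nstrict (hbul h) + length (hQ h)"
  unfolding Qext_def nstrict_def by (cases "hbul h") auto

lemma res_bres:
  assumes lam: "lam \<in> mparts (hbul h) (length (hQ h)) N" and u: "u \<in> Std (hbul h) lam" and k: "k \<in> {1..N}"
  shows "res h lam u k = bres h (inv_into (boxes (hbul h) lam) u k)"
proof -
  have N: "mp_size lam = N" "length lam = length (Qext h)" using lam by (auto simp: mparts_def length_Qext)
  have "inv_into (boxes (hbul h) lam) u k \<in> boxes (hbul h) lam" using Std_inv[OF u] k N by auto
  moreover obtain i j l where A: "inv_into (boxes (hbul h) lam) u k = (i, j, l)" by (cases "inv_into (boxes (hbul h) lam) u k")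
  ultimately have "l < length (Qext h)" using N(2) by (simp add: boxes_def)
  then show ?thesis unfolding res_def bres_def A by simp
qed

locale hc_params =
  fixes h :: "'k::alg_closed_field hc_datum" and n :: nat
  assumes char2: "CHAR('k) \<noteq> 2" and n: "n \<ge> 1"
    and q0: "hq h \<noteq> 0" and q1: "(hq h)\<^sup>2 \<noteq> 1" and q2: "(hq h)\<^sup>2 \<noteq> -1"
    and Q0: "\<forall>c \<in> set (hQ h). c \<noteq> 0" and sqrt: "\<forall>a. (hsqrt h a)\<^sup>2 = a"
    and sep: "\<forall>mu \<in> mparts (hbul h) (length (hQ h)) (n + 1). separate h mu"
begin

abbreviation "bb \<equiv> hbul h"
abbreviation "MM \<equiv> nstrict (hbul h) + length (hQ h)"
abbreviation "cc A \<equiv> qq h (bres h A)"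

definition zz :: "nat \<Rightarrow> 'k" where "zz l = (if l < nstrict bb then Qext h ! l else 1)"

lemma two: "(2::'k) \<noteq> 0"
proof
  assume "(2::'k) = 0"
  then have "of_nat 2 = (0::'k)" by simp
  then have d: "CHAR('k) dvd 2" unfolding of_nat_eq_0_iff_char_dvd .
  then have "CHAR('k) \<le> 2" by (rule dvd_imp_le) simp
  moreover have "CHAR('k) \<noteq> 0" using d by (metis dvd_0_left_iff zero_neq_numeral)
  ultimately show False using char2 CHAR_not_1[where 'a = 'k] by linarith
qed

lemma qinv: "hq h + inverse (hq h) \<noteq> 0"
proof
  assume "hq h + inverse (hq h) = 0"
  then have "hq h * (hq h + inverse (hq h)) = 0" by simp
  then have "(hq h)\<^sup>2 + 1 = 0" using q0 by (simp add: distrib_left power2_eq_square)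
  then show False using q2 by (simp add: eq_neg_iff_add_eq_0)
qed

lemma eps0: "heps h \<noteq> 0"
proof
  assume "heps h = 0"
  then have "hq h * (hq h - inverse (hq h)) = 0" by (simp add: heps_def)
  then show False using q0 q1 by (simp add: right_diff_distrib power2_eq_square)
qed

lemma zz_sq: "zz l * zz l = 1"
  unfolding zz_def Qext_def nstrict_def by (cases bb) (auto simp: less_Suc_eq numeral_2_eq_2)

lemma bres_0: "bres h A \<noteq> 0"
proof -
  obtain i j l where A: "A = (i, j, l)" by (cases A)
  have "\<forall>c \<in> set (Qext h). c \<noteq> 0" using Q0 by (cases bb) (auto simp: Qext_def)
  then show ?thesis using q0 unfolding bres_def A by (auto simp: in_set_conv_nth)
qed

lemma bres_right: "bres h (rightb A) = bres h A * (hq h)\<^sup>2" and bres_down: "bres h (downb A) = bres h A * inverse ((hq h)\<^sup>2)"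
proof -
  obtain i j l where A: "A = (i, j, l)" by (cases A)
  have e: "2 * (int (Suc j) - int i) = 2 * (int j - int i) + 2" "2 * (int j - int (Suc i)) = 2 * (int j - int i) - 2"
    by simp_all
  have "hq h powi (2 * (int (Suc j) - int i)) = hq h powi (2 * (int j - int i)) * (hq h)\<^sup>2"
    unfolding e by (subst power_int_add) (use q0 in simp_all)
  moreover have "hq h powi (2 * (int j - int (Suc i))) = hq h powi (2 * (int j - int i)) * inverse ((hq h)\<^sup>2)"
    unfolding e by (subst power_int_diff) (use q0 in \<open>simp_all add: divide_inverse\<close>)
  ultimately show "bres h (rightb A) = bres h A * (hq h)\<^sup>2" "bres h (downb A) = bres h A * inverse ((hq h)\<^sup>2)"
    unfolding bres_def A rightb_def downb_def by (simp_all only: prod.case mult.assoc)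
qed

text \<open>With p = q times the residue, the sum rests on q^2 + q^{-2} = 2 + eps^2 and the product
  on q^2 - q^{-2} = eps (q + q^{-1}). The denominator q + q^{-1} in \<open>qq\<close> is what makes
  the constant term 4 eps^2.\<close>

lemma cc_rel: "cc (rightb A) + cc (downb A) = (2 + (heps h)\<^sup>2) * cc A" "cc (rightb A) * cc (downb A) = (cc A)\<^sup>2 + 4 * (heps h)\<^sup>2"
proof -
  define q where "q = hq h"
  define p where "p = q * bres h A"
  define d where "d = q + inverse q"
  have nz: "q \<noteq> 0" "p \<noteq> 0" "d \<noteq> 0" using q0 bres_0[of A] qinv unfolding q_def p_def d_def by auto
  have dd: "d * q = q * q + 1" "d\<^sup>2 = (q * q + 1)\<^sup>2 / q\<^sup>2"
    unfolding d_def using nz(1) by (simp_all add: field_simps power2_eq_square)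
  have e: "cc A = 2 * ((p + inverse p) / d)" "cc (rightb A) = 2 * ((p * q\<^sup>2 + inverse (p * q\<^sup>2)) / d)"
    "cc (downb A) = 2 * ((p * inverse (q\<^sup>2) + inverse (p * inverse (q\<^sup>2))) / d)"
    unfolding qq_def bres_right bres_down p_def d_def q_def by (simp_all add: mult.assoc)
  have h: "heps h = q - inverse q" by (simp add: heps_def q_def)
  show "cc (rightb A) + cc (downb A) = (2 + (heps h)\<^sup>2) * cc A"
    unfolding e h using nz by (simp add: field_simps power2_eq_square)
  have "(p * q\<^sup>2 + inverse (p * q\<^sup>2)) * (p * inverse (q\<^sup>2) + inverse (p * inverse (q\<^sup>2))) = (p + inverse p)\<^sup>2 + (q - inverse q)\<^sup>2 * d\<^sup>2"
    unfolding d_def using nz by (simp add: field_simps power2_eq_square)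
  moreover have "2 * (x / d) * (2 * (y / d)) = 4 * (x * y) / d\<^sup>2" for x y
    by (simp add: power2_eq_square)
  ultimately have "cc (rightb A) * cc (downb A) = 4 * ((p + inverse p)\<^sup>2 + (q - inverse q)\<^sup>2 * d\<^sup>2) / d\<^sup>2"
    unfolding e by metis
  also have "\<dots> = 4 * (p + inverse p)\<^sup>2 / d\<^sup>2 + 4 * (q - inverse q)\<^sup>2"
    using nz(3) by (simp add: add_divide_distrib distrib_left)
  also have "\<dots> = (cc A)\<^sup>2 + 4 * (heps h)\<^sup>2"
  proof -
    have "(2 * (x / d))\<^sup>2 = 4 * x\<^sup>2 / d\<^sup>2" for x by (simp add: power2_eq_square)
    then show ?thesis unfolding e h by metis
  qed
  finally show "cc (rightb A) * cc (downb A) = (cc A)\<^sup>2 + 4 * (heps h)\<^sup>2" .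
qed

lemma cc_strict: "l < nstrict bb \<Longrightarrow> cc (i, i, l) = 2 * zz l"
proof -
  assume l: "l < nstrict bb"
  then have "bres h (i, i, l) = zz l" unfolding bres_def zz_def by (simp add: length_Qext)
  moreover have "inverse (zz l) = zz l" using zz_sq[of l] by (simp add: inverse_unique)
  ultimately show ?thesis unfolding qq_def using qinv q0
    by (simp add: inverse_mult_distrib flip: distrib_right)
qed

lemma res_tpath:
  assumes "lam \<in> mparts bb (length (hQ h)) N" "u \<in> Std bb lam" "k \<in> {1..N}"
  shows "res h lam u k = bres h (tpath bb lam u ! (k - 1))"
  using res_bres[OF assms] nth_tpath[of k lam bb u] assms by (simp add: mparts_def)

text \<open>\<open>separate\<close> speaks of tableaux with n + 1 boxes. The diagram with A and B
  added is completed to such a tableau, in which A and B carry consecutive entries.\<close>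

lemma sep_path:
  assumes S: "shape bb MM S" "card S + 2 \<le> n + 1" and A: "A \<in> addable bb MM S" and B: "B \<in> addable bb MM (insert A S)"
  shows "cc A \<noteq> cc B"
proof -
  obtain t where t: "path bb MM t" "set t = S" "length t = card S" using shape_path[OF S(1)] by blast
  have p: "path bb MM ((t @ [A]) @ [B])" using t A B by (simp only: path_snoc) simp
  have M: "0 < MM" using A unfolding addable_def vbox_def by auto
  let ?d = "n + 1 - (card S + 2)" and ?k = "Suc (card S)"
  obtain u where u: "path bb MM (((t @ [A]) @ [B]) @ u)" "length u = ?d" using path_extend[OF p M] by blast
  let ?t = "((t @ [A]) @ [B]) @ u"
  have len: "length ?t = n + 1" using u t S(2) by simp
  obtain lam v where lam: "lam \<in> mparts bb (length (hQ h)) (n + 1)" "v \<in> Std bb lam" "tpath bb lam v = ?t"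
    using path_Std[OF u(1)] len by auto
  have N: "mp_size lam = n + 1" using lam by (simp add: mparts_def)
  have "qq h (res h lam v ?k) \<noteq> qq h (res h lam v (?k + 1))"
    using sep lam N S(2) unfolding separate_def by auto
  moreover have "res h lam v ?k = bres h A" "res h lam v (?k + 1) = bres h B"
    using res_tpath[OF lam(1,2)] S(2) t(3) unfolding lam(3) by (simp_all add: nth_append)
  ultimately show ?thesis by simp
qed

sublocale residues_sep bb MM "n + 1" "heps h" "\<lambda>A. cc A" zz
proof
  show "cc (Suc i, Suc j, l) = cc (i, j, l)" for i j l by (simp add: bres_def)
qed (use two eps0 cc_rel cc_strict zz_sq sep_path in auto)

lemma b_sum: "bplus h x + bminus h x = qq h x" and b_prod: "bplus h x * bminus h x = 1"
proof -
  have "qq h x / 2 + qq h x / 2 = qq h x" unfolding mult_2[symmetric] using two by simp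
  moreover have "bplus h x + bminus h x = qq h x / 2 + qq h x / 2" unfolding bplus_def bminus_def by simp
  ultimately show "bplus h x + bminus h x = qq h x" by metis
  have "bplus h x * bminus h x = (qq h x / 2)\<^sup>2 - (hsqrt h ((qq h x)\<^sup>2 / 4 - 1))\<^sup>2"
    unfolding bplus_def bminus_def by (simp add: algebra_simps power2_eq_square)
  also have "(qq h x / 2)\<^sup>2 = (qq h x)\<^sup>2 / 4" by (simp add: power_divide)
  finally show "bplus h x * bminus h x = 1" using sqrt by simp
qed

lemma b_0: "bplus h x \<noteq> 0" "bminus h x \<noteq> 0"
  using b_prod[of x] by auto

lemma b_inv: "inverse (bplus h x) = bminus h x" "inverse (bminus h x) = bplus h x"
  using b_prod[of x] by (auto intro: inverse_unique simp: mult.commute)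

lemma b_diag: "(qq h x)\<^sup>2 = 4 \<Longrightarrow> bplus h x = qq h x / 2 \<and> bminus h x = qq h x / 2"
proof -
  assume q: "(qq h x)\<^sup>2 = 4"
  have "(2::'k) * 2 = 4" by simp
  then have "(4::'k) \<noteq> 0" using two by (metis mult_eq_0_iff)
  then have "(hsqrt h ((qq h x)\<^sup>2 / 4 - 1))\<^sup>2 = 0" using sqrt q by simp
  then have "hsqrt h ((qq h x)\<^sup>2 / 4 - 1) = 0" by simp
  then show ?thesis unfolding bplus_def bminus_def by simp
qed

lemma b_neq: "(qq h x)\<^sup>2 \<noteq> 4 \<Longrightarrow> bplus h x \<noteq> bminus h x"
proof
  assume q: "(qq h x)\<^sup>2 \<noteq> 4" "bplus h x = bminus h x"
  have "(qq h x)\<^sup>2 = (bplus h x + bminus h x)\<^sup>2" using b_sum by simp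
  also have "\<dots> = 4 * (bplus h x * bminus h x)" using q(2) by (simp add: power2_eq_square algebra_simps)
  finally show False using q(1) b_prod[of x] by simp
qed

lemma finite_paths: "finite {t. path bb MM t \<and> length t = k}"
proof (induction k)
  case (Suc k)
  have "{t. path bb MM t \<and> length t = Suc k} \<subseteq> (\<lambda>(t, A). t @ [A]) ` (SIGMA t : {t. path bb MM t \<and> length t = k}. addable bb MM (set t))"
  proof
    fix t assume t: "t \<in> {t. path bb MM t \<and> length t = Suc k}"
    then obtain t' A where "t = t' @ [A]" by (cases t rule: rev_cases) auto
    then show "t \<in> (\<lambda>(t, A). t @ [A]) ` (SIGMA t : {t. path bb MM t \<and> length t = k}. addable bb MM (set t))"
      using t by (auto simp: path_snoc image_iff)
  qed
  then show ?case
    by (rule finite_subset) (use Suc finite_addable in \<open>auto intro!: finite_imageI finite_SigmaI\<close>)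
qed auto

text \<open>B(k) ranges over all tableaux of all shapes of size n, but these are lists of length n,
  each prefix of which has finitely many addable boxes.\<close>

lemma finite_Bset: assumes k: "k \<in> {1..n}" shows "finite (Bset h n k)"
proof (rule finite_subset)
  show "Bset h n k \<subseteq> (\<Union>t \<in> {t. path bb MM t \<and> length t = n}. {bplus h (bres h (t ! (k - 1))), bminus h (bres h (t ! (k - 1)))})"
  proof
    fix x assume "x \<in> Bset h n k"
    then obtain mu s where mu: "mu \<in> mparts bb (length (hQ h)) n" "s \<in> Std bb mu" "x \<in> {bplus h (res h mu s k), bminus h (res h mu s k)}"
      unfolding Bset_def by blast
    have "path bb MM (tpath bb mu s)" "length (tpath bb mu s) = n"
      using tpath_path[OF mu(1,2)] mu(1) by (auto simp: mparts_def)
    then show "x \<in> (\<Union>t \<in> {t. path bb MM t \<and> length t = n}. {bplus h (bres h (t ! (k - 1))), bminus h (bres h (t ! (k - 1)))})"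
      using mu(3) unfolding res_tpath[OF mu(1,2) k] by blast
  qed
qed (use finite_paths in auto)

text \<open>B(k) is a set, so a double root is counted once in the product. Off the diagonal the two
  roots differ by \<open>c_not_2\<close>; on the diagonal just one linear factor is asked for, which
  is why \<open>pol\<close> has to be linear there.\<close>

lemma pol_dvd_Bset:
  assumes t: "path bb MM t" "length t = n" and k: "k \<in> {1..n}"
  shows "pol (t ! (k - 1)) dvd (\<Prod>b \<in> Bset h n k. lin b)"
proof -
  let ?A = "t ! (k - 1)"
  obtain lam u where lam: "lam \<in> mparts bb (length (hQ h)) n" "u \<in> Std bb lam" "tpath bb lam u = t"
    using path_Std[OF t(1)] t(2) by auto
  have r: "res h lam u k = bres h ?A" using res_tpath[OF lam(1,2) k] lam(3) by simp
  have mem: "bplus h (bres h ?A) \<in> Bset h n k" "bminus h (bres h ?A) \<in> Bset h n k"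
    unfolding Bset_def r[symmetric] using lam by blast+
  show ?thesis
  proof (cases "diag bb ?A")
    case True
    let ?z = "zz (snd (snd ?A))"
    have c: "cc ?A = 2 * ?z" using c_of_diag[OF True] .
    then have "(cc ?A)\<^sup>2 = 4" using zz_sq by (simp add: power2_eq_square)
    then have "bplus h (bres h ?A) = cc ?A / 2" using b_diag by blast
    then have "bplus h (bres h ?A) = ?z" using c two by simp
    then show ?thesis using mem(1) finite_Bset[OF k] True unfolding pol_def by (auto intro!: dvd_prodI)
  next
    case False
    have "t ! (k - 1) \<in> addable bb MM (set (take (k - 1) t))" using t k unfolding path_def by auto
    moreover have "shape bb MM (set (take (k - 1) t))" "card (set (take (k - 1) t)) + 2 \<le> n + 1"
      using path_shape[OF path_take[OF t(1)]] distinct_card[of "take (k - 1) t"] t(2) k by auto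
    ultimately have "(cc ?A)\<^sup>2 \<noteq> 4" using c_not_2 False by blast
    then have ne: "bplus h (bres h ?A) \<noteq> bminus h (bres h ?A)" using b_neq by blast
    have "pol ?A = lin (bplus h (bres h ?A)) * lin (bminus h (bres h ?A))"
      using quad_factor[OF b_prod] False unfolding pol_def b_sum by simp
    also have "\<dots> = (\<Prod>b \<in> {bplus h (bres h ?A), bminus h (bres h ?A)}. lin b)" using ne by simp
    also have "\<dots> dvd (\<Prod>b \<in> Bset h n k. lin b)"
      using mem finite_Bset[OF k] by (intro prod_dvd_prod_subset) auto
    finally show ?thesis .
  qed
qed

end

section \<open>Reduced words\<close>

definition inv_pairs :: "nat \<Rightarrow> (nat \<Rightarrow> nat) \<Rightarrow> (nat \<times> nat) set" where
  "inv_pairs n \<pi> = {(i, j). 1 \<le> i \<and> i < j \<and> j \<le> n \<and> \<pi> j < \<pi> i}"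

text \<open>Reducedness by counting inversions: this form passes to the tail of a word and can be
  checked letter by letter.\<close>

definition red :: "nat \<Rightarrow> nat list \<Rightarrow> bool" where
  "red n ks \<longleftrightarrow> set ks \<subseteq> {1..<n} \<and> length ks = card (inv_pairs n (word_perm ks))"

abbreviation pinv :: "(nat \<Rightarrow> nat) \<Rightarrow> nat \<Rightarrow> nat" where "pinv f \<equiv> inv_into UNIV f"

abbreviation sw :: "nat \<Rightarrow> nat \<Rightarrow> nat" where "sw k \<equiv> transpose k (Suc k)"

lemma word_perm_Nil [simp]: "word_perm [] = id"
  and word_perm_Cons: "word_perm (k # ks) = sw k \<circ> word_perm ks"
  by (simp_all add: word_perm_def)

lemma word_perm_append: "word_perm (u @ v) = word_perm u \<circ> word_perm v"
  by (induction u) (simp_all add: word_perm_Cons comp_assoc)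

lemma sw_permutes: "k \<in> {1..<n} \<Longrightarrow> sw k permutes {1..n}"
  by (intro permutes_swap_id) auto

lemma word_perm_permutes: "set ks \<subseteq> {1..<n} \<Longrightarrow> word_perm ks permutes {1..n}"
proof (induction ks)
  case (Cons k ks)
  then show ?case unfolding word_perm_Cons by (intro permutes_compose[OF _ sw_permutes]) auto
qed (simp add: permutes_id[unfolded id_def] id_def)

lemma finite_inv_pairs [simp]: "finite (inv_pairs n \<pi>)"
  by (rule finite_subset[of _ "{..n} \<times> {..n}"]) (auto simp: inv_pairs_def)

lemma sw_less: "x \<noteq> y \<Longrightarrow> sw k x < sw k y \<longleftrightarrow> (x < y \<and> \<not> (x = k \<and> y = Suc k)) \<or> (x = Suc k \<and> y = k)"
  by (auto simp: transpose_def)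

lemma inv_sw: assumes "\<pi> permutes {1..n}" shows "pinv (sw k \<circ> \<pi>) = pinv \<pi> \<circ> sw k"
  using assms by (subst o_inv_distrib) (auto simp: permutes_bij inv_unique_comp)

text \<open>Composition with \<open>sw k\<close> exchanges the values k and k + 1, so the order
  changes only for the pair of places where these values are taken.\<close>

lemma inv_pairs_step:
  assumes p: "\<pi> permutes {1..n}" and k: "k \<in> {1..<n}" and lt: "pinv \<pi> k < pinv \<pi> (Suc k)"
  shows "inv_pairs n (sw k \<circ> \<pi>) = insert (pinv \<pi> k, pinv \<pi> (Suc k)) (inv_pairs n \<pi>)"
    "(pinv \<pi> k, pinv \<pi> (Suc k)) \<notin> inv_pairs n \<pi>"
proof -
  have i: "\<pi> (pinv \<pi> x) = x" "pinv \<pi> (\<pi> x) = x" for x using permutes_inverses[OF p] by auto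
  have ip: "pinv \<pi> x \<in> {1..n}" if "x \<in> {1..n}" for x using that permutes_in_image[OF permutes_inv[OF p]] by auto
  show "(pinv \<pi> k, pinv \<pi> (Suc k)) \<notin> inv_pairs n \<pi>" unfolding inv_pairs_def by (simp add: i)
  have inj: "\<pi> x = \<pi> y \<longleftrightarrow> x = y" for x y using i(2) by metis
  have "(x, y) \<in> inv_pairs n (sw k \<circ> \<pi>) \<longleftrightarrow> (x, y) = (pinv \<pi> k, pinv \<pi> (Suc k)) \<or> (x, y) \<in> inv_pairs n \<pi>" for x y
  proof (cases "1 \<le> x \<and> x < y \<and> y \<le> n")
    case True
    then have ne: "\<pi> y \<noteq> \<pi> x" using inj by auto
    have a: "\<pi> y = Suc k \<and> \<pi> x = k \<longleftrightarrow> (x, y) = (pinv \<pi> k, pinv \<pi> (Suc k))" using i by (metis prod.inject)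
    have b: "\<not> (\<pi> y = k \<and> \<pi> x = Suc k)"
    proof
      assume "\<pi> y = k \<and> \<pi> x = Suc k"
      then have "y = pinv \<pi> k" "x = pinv \<pi> (Suc k)" using i by metis+
      then show False using True lt by simp
    qed
    show ?thesis using True a b unfolding inv_pairs_def by (simp add: sw_less[OF ne]) blast
  next
    case False
    then have "(x, y) \<noteq> (pinv \<pi> k, pinv \<pi> (Suc k))" using lt ip[of k] ip[of "Suc k"] k by auto
    then show ?thesis using False unfolding inv_pairs_def by auto
  qed
  then show "inv_pairs n (sw k \<circ> \<pi>) = insert (pinv \<pi> k, pinv \<pi> (Suc k)) (inv_pairs n \<pi>)" by auto
qed

lemma card_inv_up:
  "\<pi> permutes {1..n} \<Longrightarrow> k \<in> {1..<n} \<Longrightarrow> pinv \<pi> k < pinv \<pi> (Suc k) \<Longrightarrow>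
    card (inv_pairs n (sw k \<circ> \<pi>)) = Suc (card (inv_pairs n \<pi>))"
  using inv_pairs_step by simp

lemma sw_sw [simp]: "sw k \<circ> (sw k \<circ> \<pi>) = \<pi>"
  by (auto simp: fun_eq_iff)

lemma sw_comp_permutes: "\<pi> permutes {1..n} \<Longrightarrow> k \<in> {1..<n} \<Longrightarrow> sw k \<circ> \<pi> permutes {1..n}"
  by (rule permutes_compose[OF _ sw_permutes])

lemma card_inv_down:
  assumes p: "\<pi> permutes {1..n}" and k: "k \<in> {1..<n}" and lt: "pinv \<pi> (Suc k) < pinv \<pi> k"
  shows "card (inv_pairs n \<pi>) = Suc (card (inv_pairs n (sw k \<circ> \<pi>)))"
proof -
  have "pinv (sw k \<circ> \<pi>) k < pinv (sw k \<circ> \<pi>) (Suc k)" unfolding inv_sw[OF p] using lt by simp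
  from card_inv_up[OF sw_comp_permutes[OF p k] k this] show ?thesis by simp
qed

lemma inv_neq: "\<pi> permutes {1..n} \<Longrightarrow> pinv \<pi> k \<noteq> pinv \<pi> (Suc k)"
  by (metis n_not_Suc_n permutes_inverses(1))

lemma card_inv_le: "set ks \<subseteq> {1..<n} \<Longrightarrow> card (inv_pairs n (word_perm ks)) \<le> length ks"
proof (induction ks)
  case Nil
  have "inv_pairs n id = {}" by (auto simp: inv_pairs_def)
  then show ?case unfolding word_perm_Nil by (simp only: card.empty)
next
  case (Cons k ks)
  let ?p = "word_perm ks"
  have p: "?p permutes {1..n}" "k \<in> {1..<n}" using Cons word_perm_permutes by auto
  have "card (inv_pairs n (sw k \<circ> ?p)) \<le> Suc (card (inv_pairs n ?p))"
    using card_inv_up[OF p] card_inv_down[OF p] inv_neq[OF p(1), of k] by linarith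
  moreover have "card (inv_pairs n ?p) \<le> length ks" using Cons by simp
  ultimately show ?case unfolding word_perm_Cons list.size by linarith
qed

lemma permutes_no_descent:
  assumes p: "f permutes {1..n}" and up: "\<And>k. k \<in> {1..<n} \<Longrightarrow> f k < f (Suc k)"
  shows "f = id"
proof -
  have ge: "k \<le> f k" if "1 \<le> k" "k \<le> n" for k
    using that
  proof (induction k rule: dec_induct)
    case base
    have "1 \<in> {1..n}" using base by auto
    then have "f 1 \<in> {1..n}" using permutes_in_image[OF p] by blast
    then show ?case by simp
  next
    case (step m)
    then show ?case using up[of m] by auto
  qed
  have le: "f k \<le> k" if "1 \<le> k" "k \<le> n" for k
    using that(2,1)
  proof (induction k rule: inc_induct)
    case base
    then have "f n \<in> {1..n}" using permutes_in_image[OF p, of n] by auto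
    then show ?case by simp
  next
    case (step m)
    then show ?case using up[of m] by auto
  qed
  have "f k = k" for k
    using ge[of k] le[of k] permutes_not_in[OF p, of k] by (cases "k \<in> {1..n}") auto
  then show ?thesis by auto
qed

lemma red_ex: "\<pi> permutes {1..n} \<Longrightarrow> \<exists>ks. red n ks \<and> word_perm ks = \<pi>"
proof (induction "card (inv_pairs n \<pi>)" arbitrary: \<pi> rule: less_induct)
  case less
  show ?case
  proof (cases "\<pi> = id")
    case True
    have "inv_pairs n id = {}" by (auto simp: inv_pairs_def)
    then show ?thesis using True by (intro exI[of _ "[]"]) (simp add: red_def)
  next
    case False
    then have "pinv \<pi> \<noteq> id" using less.prems by (metis inv_id permutes_inv_inv)
    then obtain k where k: "k \<in> {1..<n}" "\<not> pinv \<pi> k < pinv \<pi> (Suc k)"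
      using permutes_no_descent[OF permutes_inv[OF less.prems]] by blast
    then have "pinv \<pi> (Suc k) < pinv \<pi> k" using inv_neq[OF less.prems, of k] by linarith
    then have c: "card (inv_pairs n \<pi>) = Suc (card (inv_pairs n (sw k \<circ> \<pi>)))"
      using card_inv_down[OF less.prems k(1)] by simp
    then obtain ks where "red n ks" "word_perm ks = sw k \<circ> \<pi>"
      using less.hyps[OF _ sw_comp_permutes[OF less.prems k(1)]] by auto
    then show ?thesis using k c by (intro exI[of _ "k # ks"]) (auto simp: red_def word_perm_Cons)
  qed
qed

text \<open>No word is shorter than the number of inversions, and by \<open>red_ex\<close> some word
  attains it; hence minimal length is the same as \<open>red\<close>.\<close>

lemma reduced_expr_red: assumes "reduced_expr n \<pi> ks" shows "red n ks" "word_perm ks = \<pi>"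
proof -
  have s: "set ks \<subseteq> {1..<n}" "word_perm ks = \<pi>" using assms by (auto simp: reduced_expr_def)
  obtain ks' where "red n ks'" "word_perm ks' = \<pi>" using red_ex[OF word_perm_permutes[OF s(1)]] s(2) by auto
  then have "length ks \<le> card (inv_pairs n \<pi>)" using assms by (auto simp: reduced_expr_def red_def)
  then show "red n ks" "word_perm ks = \<pi>" using s card_inv_le[OF s(1)] by (auto simp: red_def)
qed

lemma reduced_expr_ex: assumes "\<pi> permutes {1..n}" shows "reduced_expr n \<pi> (SOME ks. reduced_expr n \<pi> ks)"
proof -
  obtain ks where "red n ks" "word_perm ks = \<pi>" using red_ex[OF assms] by auto
  then have "reduced_expr n \<pi> ks" unfolding reduced_expr_def red_def using card_inv_le by fastforce
  then show ?thesis by (rule someI)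
qed

lemma red_Cons:
  assumes "red n (k # ks)"
  shows "k \<in> {1..<n}" "red n ks" "word_perm ks permutes {1..n}" "pinv (word_perm ks) k < pinv (word_perm ks) (Suc k)"
    "inv_pairs n (word_perm ks) \<subseteq> inv_pairs n (word_perm (k # ks))"
proof -
  have s: "k \<in> {1..<n}" "set ks \<subseteq> {1..<n}" and l: "Suc (length ks) = card (inv_pairs n (sw k \<circ> word_perm ks))"
    using assms by (auto simp: red_def word_perm_Cons)
  have p: "word_perm ks permutes {1..n}" using word_perm_permutes[OF s(2)] .
  show "k \<in> {1..<n}" "word_perm ks permutes {1..n}" by fact+
  show lt: "pinv (word_perm ks) k < pinv (word_perm ks) (Suc k)"
  proof (rule ccontr)
    assume "\<not> ?thesis"
    then have "card (inv_pairs n (word_perm ks)) = Suc (card (inv_pairs n (sw k \<circ> word_perm ks)))"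
      using card_inv_down[OF p s(1)] inv_neq[OF p, of k] by linarith
    then show False using l card_inv_le[OF s(2)] by simp
  qed
  show "red n ks" using l card_inv_up[OF p s(1) lt] s(2) by (simp add: red_def)
  show "inv_pairs n (word_perm ks) \<subseteq> inv_pairs n (word_perm (k # ks))"
    unfolding word_perm_Cons using inv_pairs_step[OF p s(1) lt] by auto
qed

lemma red_ConsI:
  assumes "red n ks" "k \<in> {1..<n}" "pinv (word_perm ks) k < pinv (word_perm ks) (Suc k)"
  shows "red n (k # ks)"
  using assms card_inv_up[OF word_perm_permutes assms(2,3)] unfolding red_def word_perm_Cons by auto

lemma sw_braid: "sw i \<circ> (sw (Suc i) \<circ> (sw i \<circ> \<pi>)) = sw (Suc i) \<circ> (sw i \<circ> (sw (Suc i) \<circ> \<pi>))"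
  by (auto simp: fun_eq_iff transpose_def)

lemma sw_far: "Suc i < j \<Longrightarrow> sw i \<circ> (sw j \<circ> \<pi>) = sw j \<circ> (sw i \<circ> \<pi>)"
  by (auto simp: fun_eq_iff transpose_def)

text \<open>Matsumoto's theorem. The predicate \<open>P\<close> restricts to words whose partial products are admissible.\<close>

lemma matsumoto:
  fixes W :: "nat list \<Rightarrow> 'b" and P :: "(nat \<Rightarrow> nat) \<Rightarrow> bool"
  assumes Pc: "\<And>k u. red n (k # u) \<Longrightarrow> P (word_perm (k # u)) \<Longrightarrow> P (word_perm u)"
    and cong: "\<And>k u v. word_perm u = word_perm v \<Longrightarrow> W u = W v \<Longrightarrow> W (k # u) = W (k # v)"
    and far: "\<And>i j u. red n (i # j # u) \<Longrightarrow> red n (j # i # u) \<Longrightarrow> P (word_perm (i # j # u)) \<Longrightarrow> Suc i < j \<Longrightarrow> W (i # j # u) = W (j # i # u)"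
    and br: "\<And>i u. red n (i # Suc i # i # u) \<Longrightarrow> red n (Suc i # i # Suc i # u) \<Longrightarrow> P (word_perm (i # Suc i # i # u)) \<Longrightarrow>
      W (i # Suc i # i # u) = W (Suc i # i # Suc i # u)"
  shows "red n u \<Longrightarrow> red n v \<Longrightarrow> word_perm u = word_perm v \<Longrightarrow> P (word_perm u) \<Longrightarrow> W u = W v"
proof (induction "length u" arbitrary: u v rule: less_induct)
  case less
  have len: "length v = length u" using less.prems by (simp add: red_def)
  show ?case
  proof (cases u)
    case Nil
    then show ?thesis using len by simp
  next
    case (Cons i u')
    then obtain j v' where v: "v = j # v'" using len by (cases v) auto
    note u = Cons
    have IH: "W x = W y" if "red n x" "red n y" "word_perm x = word_perm y" "P (word_perm x)" "length x < length u" for x y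
      using less.hyps that by blast
    \<comment> \<open>Both first letters are left descents of the common permutation w, so w also
      has reduced words beginning with either side of the braid relation of i and j. By induction
      the two given words are compared with these.\<close>
    have key: "W (i # u') = W (j # v')" if ij: "i < j" and ru: "red n (i # u')" and rv: "red n (j # v')"
      and w: "word_perm (i # u') = word_perm (j # v')" and Pw: "P (word_perm (i # u'))" and l: "length u = Suc (length u')" "length u = Suc (length v')"
    for i j u' v'
    proof -
      define w where "w = word_perm (i # u')"
      define f where "f = pinv w"
      have wp: "w permutes {1..n}" unfolding w_def using ru by (intro word_perm_permutes) (simp add: red_def)
      have Pw': "P w" using Pw unfolding w_def .
      have r: "i \<in> {1..<n}" "j \<in> {1..<n}" using red_Cons(1) ru rv by auto
      have u'p: "word_perm u' = sw i \<circ> w" "word_perm v' = sw j \<circ> w"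
      proof -
        show "word_perm u' = sw i \<circ> w" unfolding w_def word_perm_Cons by simp
        have "w = sw j \<circ> word_perm v'" unfolding w_def w by (rule word_perm_Cons)
        then show "word_perm v' = sw j \<circ> w" by simp
      qed
      have di: "f (Suc i) < f i" "f (Suc j) < f j"
        using red_Cons(4)[OF ru] red_Cons(4)[OF rv] unfolding u'p inv_sw[OF wp] f_def by simp_all
      have Pu': "P (word_perm u')" "P (word_perm v')" using Pc[OF ru Pw] Pc[OF rv] Pw w by auto
      have w1: "sw i \<circ> w permutes {1..n}" "sw j \<circ> w permutes {1..n}" using sw_comp_permutes wp r by auto
      show ?thesis
      proof (cases "Suc i < j")
        case True
        obtain x where x: "red n x" "word_perm x = sw j \<circ> (sw i \<circ> w)"
          using red_ex[OF sw_comp_permutes[OF w1(1) r(2)]] by auto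
        have fx: "pinv (word_perm x) = f \<circ> sw i \<circ> sw j" unfolding x inv_sw[OF w1(1)] inv_sw[OF wp] f_def by simp
        have rjx: "red n (j # x)" using di True by (intro red_ConsI x r) (simp add: fx)
        have rix: "red n (i # x)" using di True by (intro red_ConsI x r) (simp add: fx)
        have pjx: "word_perm (j # x) = sw i \<circ> w" by (simp add: word_perm_Cons x)
        have pix: "word_perm (i # x) = sw j \<circ> w" by (simp add: word_perm_Cons x sw_far[OF True])
        have rij: "red n (i # j # x)" using di by (intro red_ConsI rjx r) (simp add: pjx inv_sw[OF wp] f_def[symmetric])
        have rji: "red n (j # i # x)" using di by (intro red_ConsI rix r) (simp add: pix inv_sw[OF wp] f_def[symmetric])
        have "W (i # u') = W (i # j # x)"
          using red_Cons(2)[OF ru] rjx Pu' l by (intro cong IH) (auto simp: u'p pjx)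
        also have "\<dots> = W (j # i # x)"
          using rij rji Pw' True by (intro far) (simp_all only: word_perm_Cons[of i "j # x"] pjx sw_sw)
        also have "\<dots> = W (j # v')"
        proof -
          have "W v' = W (i # x)" using red_Cons(2)[OF rv] rix Pu' l by (intro IH) (auto simp: u'p pix)
          then show ?thesis by (intro cong) (simp_all add: u'p pix)
        qed
        finally show ?thesis .
      next
        case False
        then have j: "j = Suc i" using ij by simp
        \<comment> \<open>The permutation w with the braid of length three taken off; the descents
          of w at i and i + 1 make all the words that lead back to w reduced.\<close>
        define a where "a = sw i \<circ> (sw (Suc i) \<circ> (sw i \<circ> w))"
        have a2: "sw (Suc i) \<circ> (sw i \<circ> w) permutes {1..n}" "sw i \<circ> (sw (Suc i) \<circ> w) permutes {1..n}"
          using sw_comp_permutes w1 r j by auto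
        obtain x where x: "red n x" "word_perm x = a"
          using red_ex[OF sw_comp_permutes[OF a2(1) r(1)]] unfolding a_def by auto
        have fx: "pinv (word_perm x) = f \<circ> sw i \<circ> sw (Suc i) \<circ> sw i"
          unfolding x a_def inv_sw[OF a2(1)] inv_sw[OF w1(1)] inv_sw[OF wp] f_def by (simp add: comp_assoc)
        have d: "f (Suc (Suc i)) < f (Suc i)" "f (Suc i) < f i" using di j by auto
        have r': "Suc i \<in> {1..<n}" using r j by simp
        have a': "a = sw (Suc i) \<circ> (sw i \<circ> (sw (Suc i) \<circ> w))" unfolding a_def by (rule sw_braid)
        have "red n (i # x)" "red n (Suc i # x)"
          using d by (auto intro!: red_ConsI x r r' simp: fx transpose_def)
        moreover have p1: "word_perm (i # x) = sw (Suc i) \<circ> (sw i \<circ> w)" "word_perm (Suc i # x) = sw i \<circ> (sw (Suc i) \<circ> w)"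
          by (simp add: word_perm_Cons x a_def, simp add: word_perm_Cons x a')
        ultimately have "red n (Suc i # i # x)" "red n (i # Suc i # x)"
          using d r r' unfolding j by (auto intro!: red_ConsI simp: p1 inv_sw[OF w1(1)] inv_sw[OF w1(2)[unfolded j]] inv_sw[OF wp] f_def[symmetric] transpose_def)
        moreover have p2: "word_perm (Suc i # i # x) = sw i \<circ> w" "word_perm (i # Suc i # x) = sw (Suc i) \<circ> w"
          by (simp_all only: word_perm_Cons[of "Suc i" "i # x"] word_perm_Cons[of i "Suc i # x"] p1 sw_sw)
        ultimately have r3: "red n (i # Suc i # i # x)" "red n (Suc i # i # Suc i # x)"
          using d r r' unfolding j by (auto intro!: red_ConsI simp: p2 inv_sw[OF wp] f_def[symmetric])
        have p3: "word_perm (i # Suc i # i # x) = w" by (simp only: word_perm_Cons[of i "Suc i # i # x"] p2 sw_sw)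
        have "W (i # u') = W (i # Suc i # i # x)"
          using red_Cons(2)[OF ru] red_Cons(2)[OF r3(1)] Pu' l by (intro cong IH) (auto simp: u'p p2)
        also have "\<dots> = W (Suc i # i # Suc i # x)"
          using r3 Pw' by (intro br) (simp_all only: p3)
        also have "\<dots> = W (j # v')"
        proof -
          have "W v' = W (i # Suc i # x)" using red_Cons(2)[OF rv] red_Cons(2)[OF r3(2)] Pu' l by (intro IH) (auto simp: u'p p2 j)
          then show ?thesis unfolding j by (intro cong) (simp_all add: u'p p2 j)
        qed
        finally show ?thesis .
      qed
    qed
    consider "i < j" | "j < i" | "i = j" by linarith
    then show ?thesis
    proof cases
      case 1
      then show ?thesis using key[of i j u' v'] less.prems len unfolding u v by simp
    next
      case 2
      then show ?thesis using key[of j i v' u'] less.prems len unfolding u v by simp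
    next
      case 3
      have "word_perm u' = word_perm v'"
        using less.prems(3) unfolding u v 3 word_perm_Cons by (metis sw_sw)
      then show ?thesis using less.prems red_Cons(2) Pc unfolding u v 3
        by (intro cong IH) (auto simp: u)
    qed
  qed
qed

lemma red_rev:
  assumes "set ks \<subseteq> {1..<n}" shows "word_perm (rev ks) = pinv (word_perm ks)"
  using assms
proof (induction ks)
  case (Cons k ks)
  then have "word_perm ks permutes {1..n}" "word_perm (rev ks) = pinv (word_perm ks)" using word_perm_permutes by auto
  then show ?case unfolding rev.simps word_perm_append word_perm_Cons
    by (simp only: inv_sw word_perm_Nil comp_id)
qed simp

section \<open>Weight idempotents and intertwiners\<close>

locale hc_full = hc_params h n + hc_alg s T X Xi C n "heps h"
  for h :: "'k::alg_closed_field hc_datum" and n and s :: "'k \<Rightarrow> 'a::ring" and T X Xi C +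
  assumes base: "ev (X 1) (\<Prod>A \<in> addable (hbul h) (nstrict (hbul h) + length (hQ h)) {}.
    residues_sep.pol (hbul h) (\<lambda>A. qq h (bres h A)) (hc_params.zz h) A) = 0"
begin

sublocale weights s T X Xi C n "heps h" bb MM "\<lambda>A. cc A" zz
  by unfold_locales (use n base in auto)

text \<open>Every complete list contributes a divisor of this product by
  \<open>pol_dvd_Bset\<close>. Since the roots are simple, X_k is now diagonalisable with
  eigenvalues in B(k).\<close>

lemma X_annihilated: assumes k: "k \<in> {1..n}" shows "ev (X k) (\<Prod>b \<in> Bset h n k. lin b) = 0"
proof (rule kills_all[OF _ k])
  fix t v assume t: "path bb MM t" "length t = n" and v: "kills (X k) (pol (t ! (k - 1))) v" "v \<in> alg"
  show "kills (X k) (\<Prod>b \<in> Bset h n k. lin b) v"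
    using k algs by (intro kills_dvd[OF _ v(1) pol_dvd_Bset[OF t k]]) auto
qed

definition lag :: "nat \<Rightarrow> 'k \<Rightarrow> 'k poly" where
  "lag k c = (\<Prod>b \<in> Bset h n k - {c}. smult (inverse (c - b)) (lin b))"

lemma poly_lag: "k \<in> {1..n} \<Longrightarrow> poly (lag k c) c = 1"
proof -
  have "poly (smult (inverse (c - b)) (lin b)) c = 1" if "b \<noteq> c" for b
  proof -
    have "poly (smult (inverse (c - b)) (lin b)) c = inverse (c - b) * (c - b)" by (simp add: lin_def algebra_simps)
    then show ?thesis using that by simp
  qed
  then show ?thesis unfolding lag_def poly_prod by (intro prod.neutral) auto
qed

text \<open>Multiplying the Lagrange polynomial by its missing factor gives a multiple of the
  product over all of B(k), which vanishes at X_k.\<close>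

lemma lag_eig: assumes "k \<in> {1..n}" "c \<in> Bset h n k" shows "X k * ev (X k) (lag k c) = s c * ev (X k) (lag k c)"
proof -
  have X: "X k \<in> alg" using assms algs by auto
  have "(\<Prod>b \<in> Bset h n k. lin b) = lin c * (\<Prod>b \<in> Bset h n k - {c}. lin b)"
    using assms finite_Bset[OF assms(1)] by (intro prod.remove) auto
  moreover have "lag k c = smult (\<Prod>b \<in> Bset h n k - {c}. inverse (c - b)) (\<Prod>b \<in> Bset h n k - {c}. lin b)"
    unfolding lag_def by (rule prod_smult)
  ultimately have "(\<Prod>b \<in> Bset h n k. lin b) dvd lin c * lag k c" by (simp add: dvd_smult)
  then have "kills (X k) (lin c * lag k c) (s 1)"
    using X_annihilated[OF assms(1)] X by (rule_tac kills_dvd[of "X k" "\<Prod>b \<in> Bset h n k. lin b"]) (auto simp: kills_def)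
  then show ?thesis using X unfolding kills_def by (simp add: ev_mult ev_lin left_diff_distrib)
qed

lemma set_map_upt: "set (map f [1..<n+1]) = f ` {1..n}"
  by (simp add: atLeastLessThanSuc_atLeastAtMost del: upt_Suc)

definition lprod :: "'a list \<Rightarrow> 'a" where "lprod xs = foldr (*) xs (s 1)"

lemma lprod_simps [simp]: "lprod [] = s 1" "lprod (x # xs) = x * lprod xs"
  by (simp_all add: lprod_def)

lemma lprod_alg [simp]: "set xs \<subseteq> alg \<Longrightarrow> lprod xs \<in> alg"
  by (induction xs) auto

lemma lprod_append: "set ys \<subseteq> alg \<Longrightarrow> lprod (xs @ ys) = lprod xs * lprod ys"
  by (induction xs) (simp_all add: mult.assoc)

lemma lprod_comm: "M \<in> alg \<Longrightarrow> (\<And>x. x \<in> set xs \<Longrightarrow> M * x = x * M) \<Longrightarrow> M * lprod xs = lprod xs * M"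
proof (induction xs)
  case (Cons x xs)
  have "M * (x * lprod xs) = x * (M * lprod xs)" using Cons.prems(2)[of x] by (simp add: mult.assoc[symmetric])
  also have "M * lprod xs = lprod xs * M" using Cons by simp
  finally show ?case by (simp add: mult.assoc)
qed simp

lemma lprod_eig:
  assumes "x \<in> set xs" "M * x = s c * x" "set xs \<subseteq> alg" "\<And>y. y \<in> set xs \<Longrightarrow> M * y = y * M"
  shows "M * lprod xs = s c * lprod xs"
  using assms
proof (induction xs)
  case (Cons y ys)
  show ?case
  proof (cases "y = x")
    case True
    then show ?thesis using Cons.prems(2) by (simp add: mult.assoc[symmetric])
  next
    case False
    then have "M * (y * lprod ys) = y * (M * lprod ys)" using Cons.prems(4)[of y] by (simp add: mult.assoc[symmetric])
    then show ?thesis using Cons False by (simp add: alg_left)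
  qed
qed simp

lemma lprod_fix: "v \<in> alg \<Longrightarrow> (\<And>x. x \<in> set xs \<Longrightarrow> x * v = v) \<Longrightarrow> lprod xs * v = v"
  by (induction xs) (simp_all add: mult.assoc)

lemma lprod_fix_right: "v \<in> alg \<Longrightarrow> (\<And>x. x \<in> set xs \<Longrightarrow> v * x = v) \<Longrightarrow> v * lprod xs = v"
  by (induction xs) (simp_all add: mult.assoc[symmetric])

lemma lprod_swap: "M \<in> alg \<Longrightarrow> (\<And>k. k \<in> set ks \<Longrightarrow> M * f k = g k * M) \<Longrightarrow> M * lprod (map f ks) = lprod (map g ks) * M"
proof (induction ks)
  case (Cons k ks)
  have "M * (f k * lprod (map f ks)) = g k * (M * lprod (map f ks))" using Cons.prems(2)[of k] by (simp add: mult.assoc[symmetric])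
  then show ?case using Cons by (simp add: mult.assoc)
qed simp

end

section \<open>Weight idempotents of a fixed shape\<close>

locale hc_lam = hc_full h n s T X Xi C
  for h :: "'k::alg_closed_field hc_datum" and n and s :: "'k \<Rightarrow> 'a::ring" and T X Xi C +
  fixes lam :: mpart
  assumes lam: "lam \<in> mparts (hbul h) (length (hQ h)) n"
begin

definition bp :: "tableau \<Rightarrow> nat \<Rightarrow> 'k" where "bp u k = bplus h (res h lam u k)"
definition bm :: "tableau \<Rightarrow> nat \<Rightarrow> 'k" where "bm u k = bminus h (res h lam u k)"
definition cw :: "tableau \<Rightarrow> nat \<Rightarrow> 'k" where "cw u k = qq h (res h lam u k)"

text \<open>The exponent \<nu> of X_k becomes a choice between X_k and its inverse. \<open>E\<close>
  corresponds to \<beta> = 0, and conjugation by the Clifford monomial of \<beta> relates the two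
  (\<open>Cp_E\<close>).\<close>

definition Eb :: "tableau \<Rightarrow> zvec \<Rightarrow> 'a" where
  "Eb u \<beta> = lprod (map (\<lambda>k. ev (if \<beta> k = 1 then Xi k else X k) (lag k (bp u k))) [1..<n+1])"

definition E :: "tableau \<Rightarrow> 'a" where
  "E u = lprod (map (\<lambda>k. ev (X k) (lag k (bp u k))) [1..<n+1])"

lemma mp_size_lam [simp]: "mp_size lam = n"
  using lam by (simp add: mparts_def)

lemma bp_bm: "bp u k + bm u k = cw u k" "bp u k * bm u k = 1" "bp u k \<noteq> 0" "bm u k \<noteq> 0"
    "inverse (bp u k) = bm u k" "inverse (bm u k) = bp u k"
  unfolding bp_def bm_def cw_def using b_sum b_prod b_0 b_inv by auto

lemma bp_Bset: "u \<in> Std bb lam \<Longrightarrow> bp u k \<in> Bset h n k"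
  unfolding bp_def Bset_def using lam by blast

lemma E_alg [simp]: "E u \<in> alg"
proof -
  have "set (map (\<lambda>k. ev (X k) (lag k (bp u k))) [1..<n+1]) \<subseteq> alg" using algs by auto
  then show ?thesis unfolding E_def by (rule lprod_alg)
qed

lemma X_E: assumes u: "u \<in> Std bb lam" and k: "k \<in> {1..n}"
  shows "X k * E u = s (bp u k) * E u" "E u * X k = s (bp u k) * E u"
proof -
  let ?f = "\<lambda>k. ev (X k) (lag k (bp u k))"
  have c: "X k * y = y * X k" if y: "y \<in> set (map ?f [1..<n+1])" for y
  proof -
    obtain j where j: "j \<in> {1..n}" "y = ev (X j) (lag j (bp u j))" using y unfolding set_map_upt by blast
    then show ?thesis using k algs X_comm by (auto intro!: ev_swap)
  qed
  show 1: "X k * E u = s (bp u k) * E u"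
    unfolding E_def
  proof (rule lprod_eig[of "?f k"])
    show "?f k \<in> set (map ?f [1..<n+1])" unfolding set_map_upt using k by blast
    show "X k * ?f k = s (bp u k) * ?f k" by (rule lag_eig[OF k bp_Bset[OF u]])
    show "set (map ?f [1..<n+1]) \<subseteq> alg" using algs by auto
  qed (rule c)
  have "X k * E u = E u * X k"
    unfolding E_def using k algs by (intro lprod_comm c) auto
  then show "E u * X k = s (bp u k) * E u" using 1 by simp
qed

lemma Xi_E: assumes u: "u \<in> Std bb lam" and k: "k \<in> {1..n}"
  shows "Xi k * E u = s (bm u k) * E u" "E u * Xi k = s (bm u k) * E u"
proof -
  have a: "X k \<in> alg" "Xi k \<in> alg" using k algs by auto
  have "Xi k * (X k * E u) = E u" using Xi_X[OF k] by (simp add: mult.assoc[symmetric])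
  then have "s (bp u k) * (Xi k * E u) = E u" unfolding X_E[OF u k] using a by (simp add: alg_left)
  then have "s (bm u k) * (s (bp u k) * (Xi k * E u)) = s (bm u k) * E u" by simp
  then show "Xi k * E u = s (bm u k) * E u" using a bp_bm(2)[of u k] by (simp add: s_left mult.commute)
  have "E u * X k * Xi k = E u" using X_Xi[OF k] by (simp add: mult.assoc)
  then have "s (bp u k) * (E u * Xi k) = E u" unfolding X_E(2)[OF u k] by (simp add: mult.assoc)
  then have "s (bm u k) * (s (bp u k) * (E u * Xi k)) = s (bm u k) * E u" by simp
  then show "E u * Xi k = s (bm u k) * E u" using a bp_bm(2)[of u k] by (simp add: s_left mult.commute)
qed

lemma Z_E: assumes u: "u \<in> Std bb lam" and k: "k \<in> {1..n}"
  shows "Z k * E u = s (cw u k) * E u" "E u * Z k = s (cw u k) * E u"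
  unfolding Z_def bp_bm(1)[of u k, symmetric] using X_E[OF u k] Xi_E[OF u k]
  by (simp_all add: distrib_left distrib_right s_add)

lemma E_left: assumes "v \<in> alg" "\<And>k. k \<in> {1..n} \<Longrightarrow> X k * v = s (bp u k) * v" shows "E u * v = v"
  unfolding E_def
proof (rule lprod_fix[OF assms(1)])
  fix x assume "x \<in> set (map (\<lambda>k. ev (X k) (lag k (bp u k))) [1..<n+1])"
  then obtain k where k: "k \<in> {1..n}" "x = ev (X k) (lag k (bp u k))" unfolding set_map_upt by blast
  then show "x * v = v" using ev_eig[of "X k" v "bp u k"] assms algs poly_lag by simp
qed

lemma E_right: assumes "v \<in> alg" "\<And>k. k \<in> {1..n} \<Longrightarrow> v * X k = s (bp u k) * v" shows "v * E u = v"
  unfolding E_def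
proof (rule lprod_fix_right[OF assms(1)])
  fix x assume "x \<in> set (map (\<lambda>k. ev (X k) (lag k (bp u k))) [1..<n+1])"
  then obtain k where k: "k \<in> {1..n}" "x = ev (X k) (lag k (bp u k))" unfolding set_map_upt by blast
  then show "v * x = v" using ev_eig_right[of "X k" v "bp u k"] assms algs poly_lag by simp
qed

lemma E_E: "u \<in> Std bb lam \<Longrightarrow> E u * E u = E u"
  by (rule E_left) (auto simp: X_E)

text \<open>M preserves the eigenspaces of Z_j and therefore cannot connect two weights that differ
  at j. Using Z_j rather than X_j admits Clifford generators in M.\<close>

lemma E_vanish:
  assumes u: "u \<in> Std bb lam" "u' \<in> Std bb lam" and M: "M \<in> alg" and j: "j \<in> {1..n}"
    and c: "Z j * M = M * Z j" and ne: "cw u' j \<noteq> cw u j"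
  shows "E u' * (M * E u) = 0"
proof -
  have "E u' * (Z j * (M * E u)) = s (cw u' j) * (E u' * (M * E u))"
    using Z_E(2)[OF u(2) j] by (simp add: mult.assoc[symmetric])
  moreover have "E u' * (Z j * (M * E u)) = s (cw u j) * (E u' * (M * E u))"
  proof -
    have "Z j * (M * E u) = M * (Z j * E u)" using c by (simp add: mult.assoc[symmetric])
    then show ?thesis unfolding Z_E(1)[OF u(1) j] using M by (simp add: alg_left)
  qed
  ultimately have "s (cw u' j - cw u j) * (E u' * (M * E u)) = 0" by (simp add: s_diff left_diff_distrib)
  moreover have "E u' * (M * E u) \<in> alg" "cw u' j - cw u j \<noteq> 0" using ne M by auto
  ultimately show ?thesis using s_cancel by blast
qed

lemma diag_bp: assumes u: "u \<in> Std bb lam" and k: "k \<in> Dtab bb lam u"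
  shows "k \<in> {1..n}" "bp u k = bm u k"
proof -
  obtain A where A: "A \<in> diag_boxes bb lam" "k = u A" using k by (auto simp: Dtab_def)
  then have Ab: "A \<in> boxes bb lam" by (auto simp: diag_boxes_def)
  then show k1: "k \<in> {1..n}" using A Std_range[OF u] by auto
  have d: "diag bb A" using A by (auto simp: diag_boxes_def diag_def)
  have "res h lam u k = bres h A" using res_bres[OF lam u k1] Std_inj[OF u Ab] A by simp
  moreover have "(cc A)\<^sup>2 = 4" using c_of_diag[OF d] zz_sq by (simp add: power2_eq_square)
  ultimately show "bp u k = bm u k" unfolding bp_def bm_def using b_diag by metis
qed

text \<open>C_k inverts the eigenvalue of X_k, and at a diagonal entry this eigenvalue is its own
  inverse; so C_k preserves the weight space from both sides.\<close>

lemma C_E: assumes u: "u \<in> Std bb lam" and k: "k \<in> Dtab bb lam u"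
  shows "C k * E u = E u * C k"
proof -
  have k1: "k \<in> {1..n}" "bp u k = bm u k" using diag_bp[OF u k] by auto
  have a: "C k \<in> alg" using k1 algs by auto
  have XiC: "Xi k * C k = C k * X k"
  proof -
    have "Xi k * C k = Xi k * (C k * Xi k) * X k" using a Xi_X[OF k1(1)] by (simp add: mult.assoc)
    also have "\<dots> = Xi k * (X k * C k) * X k" using XC[OF k1(1)] by simp
    also have "\<dots> = (Xi k * X k) * C k * X k" by (simp only: mult.assoc)
    finally show ?thesis using a Xi_X[OF k1(1)] by simp
  qed
  have l: "X j * (C k * E u) = s (bp u j) * (C k * E u)" if j: "j \<in> {1..n}" for j
  proof (cases "j = k")
    case True
    have "X k * (C k * E u) = C k * (Xi k * E u)" using XC[OF k1(1)] by (simp add: mult.assoc[symmetric])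
    then show ?thesis using True Xi_E(1)[OF u k1(1)] k1 a by (simp add: alg_left)
  next
    case False
    have "X j * (C k * E u) = C k * (X j * E u)" using XC_comm[OF j k1(1) False] by (simp add: mult.assoc[symmetric])
    then show ?thesis using X_E(1)[OF u j] a by (simp add: alg_left)
  qed
  have r: "(E u * C k) * X j = s (bp u j) * (E u * C k)" if j: "j \<in> {1..n}" for j
  proof (cases "j = k")
    case True
    have "E u * C k * X k = E u * Xi k * C k" using XiC by (simp add: mult.assoc)
    then show ?thesis using True Xi_E(2)[OF u k1(1)] k1 by (simp add: mult.assoc)
  next
    case False
    have "E u * C k * X j = E u * X j * C k" using XC_comm[OF j k1(1) False] by (simp add: mult.assoc)
    then show ?thesis using X_E(2)[OF u j] by (simp add: mult.assoc)
  qed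
  have "E u * (C k * E u) = C k * E u" using l a by (intro E_left) auto
  moreover have "(E u * C k) * E u = E u * C k" using r a by (intro E_right) auto
  ultimately show ?thesis by (simp add: mult.assoc)
qed

definition su :: "nat \<Rightarrow> tableau \<Rightarrow> tableau" where "su k u = tab_act bb lam (sw k) u"

lemma tab_act_comp: "tab_act bb lam \<pi> (tab_act bb lam \<pi>' u) = tab_act bb lam (\<pi> \<circ> \<pi>') u"
  unfolding tab_act_def by (auto simp: fun_eq_iff restrict_def)

lemma tab_act_id: "u \<in> Std bb lam \<Longrightarrow> tab_act bb lam id u = u"
  unfolding tab_act_def Std_def by (auto simp: extensional_restrict)

lemma su_su: "u \<in> Std bb lam \<Longrightarrow> su k (su k u) = u"
  unfolding su_def tab_act_comp using tab_act_id[of u] by (simp add: transpose_comp_involutory)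

lemma inv_tab_act:
  assumes u: "u \<in> Std bb lam" and v: "tab_act bb lam \<pi> u \<in> Std bb lam" and j: "j \<in> {1..n}"
  shows "inv_into (boxes bb lam) (tab_act bb lam \<pi> u) (\<pi> j) = inv_into (boxes bb lam) u j"
proof -
  let ?A = "inv_into (boxes bb lam) u j"
  have A: "?A \<in> boxes bb lam" "u ?A = j" using Std_inv[OF u, of j] j by auto
  then have "tab_act bb lam \<pi> u ?A = \<pi> j" by (simp add: tab_act_def)
  then show ?thesis using Std_inj[OF v A(1)] by simp
qed

lemma res_tab_act:
  assumes u: "u \<in> Std bb lam" and v: "tab_act bb lam \<pi> u \<in> Std bb lam" and j: "j \<in> {1..n}"
  shows "res h lam (tab_act bb lam \<pi> u) (\<pi> j) = res h lam u j"
  unfolding res_def inv_tab_act[OF assms] ..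

lemma su_weights:
  assumes u: "u \<in> Std bb lam" and k: "k \<in> {1..<n}" and v: "su k u \<in> Std bb lam" and j: "j \<in> {1..n}"
  shows "bp (su k u) j = bp u (sw k j)" "bm (su k u) j = bm u (sw k j)" "cw (su k u) j = cw u (sw k j)"
proof -
  have "sw k j \<in> {1..n}" using permutes_in_image[OF sw_permutes[OF k]] j by blast
  then have "res h lam (su k u) j = res h lam u (sw k j)"
    using res_tab_act[OF u v[unfolded su_def], of "sw k j"] unfolding su_def by simp
  then show "bp (su k u) j = bp u (sw k j)" "bm (su k u) j = bm u (sw k j)" "cw (su k u) j = cw u (sw k j)"
    unfolding bp_def bm_def cw_def by simp_all
qed

lemma cw_consecutive: assumes u: "u \<in> Std bb lam" and k: "k \<in> {1..<n}" shows "cw u k \<noteq> cw u (Suc k)"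
proof -
  let ?t = "tpath bb lam u"
  have p: "path bb MM ?t" using tpath_path(1)[OF lam u] .
  have len: "length ?t = n" by simp
  have A: "?t ! (k - 1) \<in> addable bb MM (set (take (k - 1) ?t))" using p k len unfolding path_def by auto
  have "take k ?t = take (k - 1) ?t @ [?t ! (k - 1)]" using take_Suc_conv_app_nth[of "k - 1" ?t] k len by (cases k) auto
  then have "set (take k ?t) = insert (?t ! (k - 1)) (set (take (k - 1) ?t))" by simp
  moreover have "?t ! k \<in> addable bb MM (set (take k ?t))" using p k len unfolding path_def by auto
  ultimately have B: "?t ! k \<in> addable bb MM (insert (?t ! (k - 1)) (set (take (k - 1) ?t)))" by simp
  have "shape bb MM (set (take (k - 1) ?t))" "card (set (take (k - 1) ?t)) + 2 \<le> n + 1"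
    using path_shape[OF path_take[OF p, of "k - 1"]] distinct_card[of "take (k - 1) ?t"] len k by auto
  then have "cc (?t ! (k - 1)) \<noteq> cc (?t ! k)" using sep_path A B by blast
  moreover have "res h lam u k = bres h (?t ! (k - 1))" "res h lam u (Suc k) = bres h (?t ! k)"
    using res_tpath[OF lam u, of k] res_tpath[OF lam u, of "Suc k"] k by auto
  ultimately show ?thesis unfolding cw_def by simp
qed

definition PhiU :: "nat \<Rightarrow> 'k \<Rightarrow> 'k \<Rightarrow> 'a" where
  "PhiU i x y = T i + s (heps h / (inverse x * y - 1)) - s (heps h / (x * y - 1)) * (C i * C (Suc i))"

lemma PhiU_alg [simp]: "i \<in> {1..<n} \<Longrightarrow> PhiU i x y \<in> alg"
  unfolding PhiU_def using algs[of i] algs[of "Suc i"] by auto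

text \<open>The two coefficients in Phi are those for which the defects in the relations of T with
  X_k and X_{k+1} cancel (\<open>eA\<close>, \<open>eB\<close>). The resulting vector has the
  weights of the exchanged tableau, so its idempotent fixes it.\<close>

lemma PhiU_step:
  assumes u: "u \<in> Std bb lam" and k: "k \<in> {1..<n}" and v: "su k u \<in> Std bb lam"
  shows "PhiU k (bm u k) (bm u (Suc k)) * E u = E (su k u) * (PhiU k (bm u k) (bm u (Suc k)) * E u)"
proof -
  interpret R: rank2 s "T k" "X k" "Xi k" "X (Suc k)" "Xi (Suc k)" "C k" "C (Suc k)" "heps h" using k by (rule rank2)
  let ?x = "bm u k" and ?y = "bm u (Suc k)"
  have kk: "k \<in> {1..n}" "Suc k \<in> {1..n}" using k by auto
  have nz: "?x \<noteq> 0" "?y \<noteq> 0" using bp_bm by auto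
  have xy: "inverse ?x + ?x \<noteq> inverse ?y + ?y" using cw_consecutive[OF u k] unfolding bp_bm(1)[symmetric] bp_bm(6) .
  have ne: "?x \<noteq> ?y" "?x * ?y \<noteq> 1"
  proof -
    show "?x \<noteq> ?y" using xy by auto
    show "?x * ?y \<noteq> 1" using xy inverse_unique[of ?x ?y] inverse_unique[of ?y ?x] by (auto simp: mult.commute add.commute)
  qed
  define A where "A = heps h / (inverse ?x * ?y - 1)"
  define B where "B = heps h / (?x * ?y - 1)"
  have d: "inverse ?x * ?y - 1 \<noteq> 0" "?x * ?y - 1 \<noteq> 0" using ne nz by (auto simp: field_simps)
  have eA: "A * (inverse ?x - inverse ?y) = heps h * inverse ?y"
  proof -
    have "inverse ?x - inverse ?y = inverse ?y * (inverse ?x * ?y - 1)" using nz by (simp add: algebra_simps)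
    then show ?thesis unfolding A_def using d by simp
  qed
  have eB: "B * (?y - inverse ?x) = heps h * inverse ?x" "B * (?x - inverse ?y) = heps h * inverse ?y"
  proof -
    have "?y - inverse ?x = inverse ?x * (?x * ?y - 1)" "?x - inverse ?y = inverse ?y * (?x * ?y - 1)" using nz by (simp_all add: algebra_simps)
    then show "B * (?y - inverse ?x) = heps h * inverse ?x" "B * (?x - inverse ?y) = heps h * inverse ?y"
      unfolding B_def using d by simp_all
  qed
  let ?v = "PhiU k ?x ?y * E u" and ?e = "E u"
  have P: "?v = T k * ?e + s A * ?e - s B * (C k * (C (Suc k) * ?e))"
    unfolding PhiU_def A_def B_def by (simp add: distrib_right left_diff_distrib mult.assoc)
  note w = X_E(1)[OF u kk(1)] X_E(1)[OF u kk(2)] Xi_E(1)[OF u kk(1)] Xi_E(1)[OF u kk(2)]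
  \<comment> \<open>Phi is written with \<open>bm\<close>, whereas X acts by \<open>bp\<close>,
    hence by the inverses of \<open>?x\<close> and \<open>?y\<close>.\<close>
  have i: "bp u k = inverse ?x" "bp u (Suc k) = inverse ?y" using bp_bm(6) by auto
  have "X (Suc k) * ?v = s (inverse ?x) * ?v"
  proof -
    have t: "X (Suc k) * (T k * ?e) = s (inverse ?x) * (T k * ?e) + s (heps h * inverse ?y) * ?e + s (heps h * inverse ?x) * (C k * (C (Suc k) * ?e))"
      using R.TCl(4)[of ?e] by (simp add: w i alg_left s_left algebra_simps)
    have "X (Suc k) * ?v = X (Suc k) * (T k * ?e) + s (A * inverse ?y) * ?e - s (B * ?y) * (C k * (C (Suc k) * ?e))"
      unfolding P by (simp add: distrib_left right_diff_distrib R.XCl w i alg_left s_left)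
    also have "\<dots> = s (inverse ?x) * (T k * ?e) + s (heps h * inverse ?y + A * inverse ?y) * ?e - s (B * ?y - heps h * inverse ?x) * (C k * (C (Suc k) * ?e))"
      unfolding t by (simp add: s_add s_diff distrib_right left_diff_distrib)
    also have "heps h * inverse ?y + A * inverse ?y = inverse ?x * A" using eA by (simp add: algebra_simps)
    also have "B * ?y - heps h * inverse ?x = inverse ?x * B" using eB(1) by (simp add: algebra_simps)
    finally show ?thesis unfolding P by (simp add: distrib_left right_diff_distrib s_left)
  qed
  moreover have "X k * ?v = s (inverse ?y) * ?v"
  proof -
    have t: "X k * (T k * ?e) = s (inverse ?y) * (T k * ?e) - s (heps h * inverse ?y) * ?e + s (heps h * inverse ?y) * (C k * (C (Suc k) * ?e))"
      using R.TXl(1)[of ?e] by (simp add: w i alg_left s_left algebra_simps)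
    have "X k * ?v = X k * (T k * ?e) + s (A * inverse ?x) * ?e - s (B * ?x) * (C k * (C (Suc k) * ?e))"
      unfolding P by (simp add: distrib_left right_diff_distrib R.XCl w i alg_left s_left)
    also have "\<dots> = s (inverse ?y) * (T k * ?e) + s (A * inverse ?x - heps h * inverse ?y) * ?e - s (B * ?x - heps h * inverse ?y) * (C k * (C (Suc k) * ?e))"
      unfolding t by (simp add: s_add s_diff distrib_right left_diff_distrib)
    also have "A * inverse ?x - heps h * inverse ?y = inverse ?y * A" using eA by (simp add: algebra_simps)
    also have "B * ?x - heps h * inverse ?y = inverse ?y * B" using eB(2) by (simp add: algebra_simps)
    finally show ?thesis unfolding P by (simp add: distrib_left right_diff_distrib s_left)
  qed
  moreover have "X j * ?v = s (bp u j) * ?v" if j: "j \<in> {1..n}" "j \<noteq> k" "j \<noteq> Suc k" for j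
  proof -
    have "X j * (T k * ?e) = T k * (X j * ?e)" "X j * (C k * (C (Suc k) * ?e)) = C k * (C (Suc k) * (X j * ?e))"
      using TX_comm[OF k j] XC_comm[OF j(1) kk(1)] XC_comm[OF j(1) kk(2)] j
      by (simp_all add: mult.assoc[symmetric]) (simp add: mult.assoc)
    moreover have "X j \<in> alg" using j algs by auto
    ultimately show ?thesis unfolding P by (simp add: distrib_left right_diff_distrib X_E(1)[OF u j(1)] alg_left s_left mult.commute)
  qed
  ultimately have "X j * ?v = s (bp (su k u) j) * ?v" if "j \<in> {1..n}" for j
    unfolding su_weights(1)[OF u k v that] using that i by (cases "j = k"; cases "j = Suc k") auto
  then show ?thesis using k by (intro E_left[symmetric]) auto
qed

end

section \<open>Intertwiners between weight spaces\<close>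

context hc_lam
begin

lemma Z_C: assumes "i \<in> {1..n}" "j \<in> {1..n}" shows "Z i * C j = C j * Z i"
proof (cases "i = j")
  case True
  have XiC: "Xi i * C i = C i * X i"
  proof -
    have "Xi i * C i = Xi i * (C i * Xi i) * X i" using assms algs Xi_X by (simp add: mult.assoc)
    also have "\<dots> = (Xi i * X i) * C i * X i" using XC[OF assms(1)] by (simp add: mult.assoc)
    finally show ?thesis using assms algs Xi_X by simp
  qed
  show ?thesis unfolding True[symmetric] Z_def using XiC XC[OF assms(1)] by (simp add: distrib_left distrib_right)
next
  case False
  have "Xi i * C j = C j * Xi i"
  proof -
    have "Xi i * C j = Xi i * (C j * X i) * Xi i" using assms algs X_Xi by (simp add: mult.assoc)
    also have "\<dots> = (Xi i * X i) * C j * Xi i" using XC_comm[OF assms False] by (simp add: mult.assoc)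
    finally show ?thesis using assms algs Xi_X by simp
  qed
  then show ?thesis unfolding Z_def using XC_comm[OF assms False] by (simp add: distrib_left distrib_right)
qed

lemma Z_T: assumes "k \<in> {1..<n}" "j \<in> {1..n}" "j \<noteq> k" "j \<noteq> Suc k" shows "Z j * T k = T k * Z j"
proof -
  have "Xi j * T k = Xi j * (T k * X j) * Xi j" using assms algs X_Xi by (simp add: mult.assoc)
  also have "\<dots> = (Xi j * X j) * T k * Xi j" using TX_comm[OF assms] by (simp add: mult.assoc)
  finally have "Xi j * T k = T k * Xi j" using assms algs Xi_X by simp
  then show ?thesis unfolding Z_def using TX_comm[OF assms] by (simp add: distrib_left distrib_right)
qed

definition GG :: "nat \<Rightarrow> 'a" where
  "GG k = rank2.G s (X k) (Xi k) (X (Suc k)) (C k) (C (Suc k)) (heps h)"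

lemma Z_T_adj: assumes k: "k \<in> {1..<n}"
  shows "Z (Suc k) * T k = T k * Z k + - GG k" "Z k * T k = T k * Z (Suc k) + GG k" "GG k \<in> alg"
    "j \<in> {1..n} \<Longrightarrow> Z j * GG k = GG k * Z j"
proof -
  interpret R: rank2 s "T k" "X k" "Xi k" "X (Suc k)" "Xi (Suc k)" "C k" "C (Suc k)" "heps h" using k by (rule rank2)
  have e: "R.Z1 = Z k" "R.Z2 = Z (Suc k)" "GG k = R.G" unfolding R.Z1_def R.Z2_def Z_def GG_def by simp_all
  have za: "Z k \<in> alg" "Z (Suc k) \<in> alg" using k by (auto intro: Z_alg)
  show "Z (Suc k) * T k = T k * Z k + - GG k" "Z k * T k = T k * Z (Suc k) + GG k"
    using R.TZ1[of "s 1"] R.TZ2[of "s 1"] za unfolding e by simp_all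
  show "GG k \<in> alg" unfolding e by simp
  have kk: "k \<in> {1..n}" "Suc k \<in> {1..n}" using k by auto
  have XX: "Z j * X i = X i * Z j" if i: "i \<in> {1..n}" and j: "j \<in> {1..n}" for i j
  proof -
    have "Xi j * X i = Xi j * (X i * X j) * Xi j" using i j algs X_Xi by (simp add: mult.assoc)
    also have "\<dots> = (Xi j * X j) * X i * Xi j" using X_comm[OF i j] by (simp add: mult.assoc)
    finally have "Xi j * X i = X i * Xi j" using i j algs Xi_X by simp
    then show ?thesis unfolding Z_def using X_comm[OF i j] by (simp add: distrib_left distrib_right)
  qed
  have XXi: "Z j * Xi i = Xi i * Z j" if i: "i \<in> {1..n}" and j: "j \<in> {1..n}" for i j
  proof -
    have "Z j * Xi i = Xi i * (X i * Z j) * Xi i" using i j algs Xi_X Z_alg by (simp add: mult.assoc[symmetric])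
    also have "X i * Z j = Z j * X i" using XX[OF i j] by simp
    also have "Xi i * (Z j * X i) * Xi i = Xi i * Z j * (X i * Xi i)" by (simp add: mult.assoc)
    finally show ?thesis using i j algs X_Xi Z_alg by simp
  qed
  show "Z j * GG k = GG k * Z j" if j: "j \<in> {1..n}"
  proof -
    have l: "Z j * (C i * v) = C i * (Z j * v)" "Z j * (X i * v) = X i * (Z j * v)" "Z j * (Xi i * v) = Xi i * (Z j * v)" if "i \<in> {1..n}" for i v
      using Z_C[OF j that] XX[OF that j] XXi[OF that j] by (simp_all add: mult.assoc[symmetric])
    show ?thesis unfolding e(3) R.G_def
      by (simp add: distrib_left distrib_right left_diff_distrib right_diff_distrib mult.assoc alg_left[OF Z_alg[OF j]]
          l[OF kk(1)] l[OF kk(2)] XX[OF kk(1) j] XX[OF kk(2) j] XXi[OF kk(1) j])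
  qed
qed

lemma Z_CC: "k \<in> {1..<n} \<Longrightarrow> j \<in> {1..n} \<Longrightarrow> Z j * (C k * C (Suc k)) = (C k * C (Suc k)) * Z j"
proof -
  assume k: "k \<in> {1..<n}" and j: "j \<in> {1..n}"
  have "Z j * C k * C (Suc k) = C k * (Z j * C (Suc k))" using Z_C[OF j, of k] k by (simp add: mult.assoc)
  also have "\<dots> = C k * C (Suc k) * Z j" using Z_C[OF j, of "Suc k"] k by (simp add: mult.assoc)
  finally show ?thesis by (simp add: mult.assoc)
qed

definition psi :: "tableau \<Rightarrow> nat \<Rightarrow> 'a" where
  "psi u k = s (heps h / (inverse (bm u k) * bm u (Suc k) - 1)) - s (heps h / (bm u k * bm u (Suc k) - 1)) * (C k * C (Suc k))"

lemma PhiU_psi: "PhiU k (bm u k) (bm u (Suc k)) = T k + psi u k"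
  unfolding PhiU_def psi_def by simp

lemma psi_alg [simp]: "k \<in> {1..<n} \<Longrightarrow> psi u k \<in> alg"
  unfolding psi_def using algs[of k] algs[of "Suc k"] by auto

lemma Z_psi: "k \<in> {1..<n} \<Longrightarrow> j \<in> {1..n} \<Longrightarrow> Z j * psi u k = psi u k * Z j"
  unfolding psi_def using Z_CC[of k j] Z_alg[of j]
  by (simp add: distrib_left distrib_right left_diff_distrib right_diff_distrib alg_comm alg_left mult.assoc)

text \<open>The part of Phi besides T lies in the Clifford algebra and commutes with Z_k, whose
  values on the two tableaux differ. It vanishes between the idempotents, and the denominators
  vanish with it.\<close>

lemma E_psi:
  assumes u: "u \<in> Std bb lam" "su k u \<in> Std bb lam" and k: "k \<in> {1..<n}"
  shows "E (su k u) * (psi u k * E u) = 0" "E (su k u) * (C k * C (Suc k) * E u) = 0"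
    "PhiU k (bm u k) (bm u (Suc k)) * E u = E (su k u) * (T k * E u)"
proof -
  have ne: "cw (su k u) k \<noteq> cw u k" using su_weights(3)[OF u(1) k u(2)] cw_consecutive[OF u(1) k] k by auto
  have kk: "k \<in> {1..n}" "C k \<in> alg" "C (Suc k) \<in> alg" using k algs by auto
  show 1: "E (su k u) * (psi u k * E u) = 0"
    using k ne kk by (intro E_vanish[OF u(1,2) _ kk(1)] Z_psi) auto
  show "E (su k u) * (C k * C (Suc k) * E u) = 0"
    using k ne kk by (intro E_vanish[OF u(1,2) _ kk(1)] Z_CC) auto
  show "PhiU k (bm u k) (bm u (Suc k)) * E u = E (su k u) * (T k * E u)"
  proof -
    have "E (su k u) * (PhiU k (bm u k) (bm u (Suc k)) * E u) = E (su k u) * (T k * E u)"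
      unfolding PhiU_psi using 1 by (simp add: distrib_left distrib_right)
    then show ?thesis using PhiU_step[OF u(1) k u(2)] by metis
  qed
qed

text \<open>Replacing the inner factors by T + \<open>psi\<close> produces three error terms. Each
  vanishes between the outer idempotents: Z_m moves through it, turning into Z_{m'} at T_l, and the
  outer weights differ there. In both applications m is the one of the three strands that T_k leaves
  alone, and \<open>K\<close> is the correction from moving Z_m past T_l.\<close>

lemma braid_reduce:
  assumes x: "x0 \<in> Std bb lam" "su k x0 \<in> Std bb lam" "su l (su k x0) \<in> Std bb lam" "su k (su l (su k x0)) \<in> Std bb lam"
    and kl: "k \<in> {1..<n}" "l \<in> {1..<n}" and m: "m \<in> {1..n}" "m' \<in> {1..n}"
    and Zk: "Z m * T k = T k * Z m" and Zl: "Z m * T l = T l * Z m' + K" and K: "K \<in> alg" "Z m * K = K * Z m"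
    and ne: "cw (su k (su l (su k x0))) m \<noteq> cw x0 m" "cw (su k (su l (su k x0))) m \<noteq> cw x0 m'"
  shows "E (su k (su l (su k x0))) * (T k * (E (su l (su k x0)) * (T l * (E (su k x0) * (T k * E x0))))) =
    E (su k (su l (su k x0))) * (T k * (T l * (T k * E x0)))"
proof -
  let ?x1 = "su k x0" and ?x2 = "su l (su k x0)" and ?x3 = "su k (su l (su k x0))"
  have a: "T k \<in> alg" "T l \<in> alg" "Z m \<in> alg" using kl m algs Z_alg by auto
  have van: "E ?x3 * (M * E x0) = 0" if "M \<in> alg" "Z m * M = M * Z m" for M
    by (rule E_vanish[OF x(1,4) that(1) m(1) that(2) ne(1)])
  have p1: "PhiU k (bm x0 k) (bm x0 (Suc k)) * E x0 = E ?x1 * (T k * E x0)"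
    by (rule E_psi(3)[OF x(1,2) kl(1)])
  have p2: "PhiU l (bm ?x1 l) (bm ?x1 (Suc l)) * E ?x1 = E ?x2 * (T l * E ?x1)"
    by (rule E_psi(3)[OF x(2,3) kl(2)])
  have EE: "E ?x1 * (E ?x1 * v) = E ?x1 * v" for v using E_E[OF x(2)] by (simp add: mult.assoc[symmetric])
  have "E ?x2 * (T l * (E ?x1 * (T k * E x0))) = (E ?x2 * (T l * E ?x1)) * (E ?x1 * (T k * E x0))"
    by (simp add: mult.assoc EE)
  also have "\<dots> = PhiU l (bm ?x1 l) (bm ?x1 (Suc l)) * (PhiU k (bm x0 k) (bm x0 (Suc k)) * E x0)"
    unfolding p2[symmetric] p1 by (simp add: mult.assoc EE)
  also have "\<dots> = (T l * (T k * E x0) + T l * (psi x0 k * E x0)) + (psi ?x1 l * T k * E x0 + psi ?x1 l * psi x0 k * E x0)"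
    unfolding PhiU_psi by (simp add: distrib_left distrib_right mult.assoc)
  finally have "E ?x3 * (T k * (E ?x2 * (T l * (E ?x1 * (T k * E x0))))) =
     E ?x3 * (T k * (T l * (T k * E x0))) + E ?x3 * (T k * T l * psi x0 k * E x0)
     + E ?x3 * (T k * psi ?x1 l * T k * E x0) + E ?x3 * (T k * psi ?x1 l * psi x0 k * E x0)"
    by (simp add: distrib_left mult.assoc)
  moreover have Zp: "Z m * (psi u i * v) = psi u i * (Z m * v)" "Z m * (T k * v) = T k * (Z m * v)" "Z m * (K * v) = K * (Z m * v)"
    if "i \<in> {1..<n}" for u i v
    using Z_psi[OF that m(1), of u] Zk K(2) by (simp_all add: mult.assoc[symmetric])
  have "E ?x3 * (T k * psi ?x1 l * T k * E x0) = 0"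
    using kl a by (intro van) (simp_all add: mult.assoc Zp Zk)
  moreover have "E ?x3 * (T k * psi ?x1 l * psi x0 k * E x0) = 0"
    using kl a by (intro van) (simp_all add: mult.assoc Zp Z_psi[OF kl(1) m(1)])
  moreover have "E ?x3 * (T k * T l * psi x0 k * E x0) = 0"
  proof -
    let ?w = "E ?x3 * (T k * (T l * (psi x0 k * E x0)))"
    have "E ?x3 * (T k * K * psi x0 k * E x0) = 0"
      using kl a K by (intro van) (simp_all add: mult.assoc Zp Z_psi[OF kl(1) m(1)])
    then have z: "E ?x3 * (T k * (K * (psi x0 k * E x0))) = 0" by (simp add: mult.assoc)
    have "s (cw ?x3 m) * ?w = E ?x3 * Z m * (T k * (T l * (psi x0 k * E x0)))"
      unfolding Z_E(2)[OF x(4) m(1)] by (simp add: mult.assoc)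
    also have "\<dots> = E ?x3 * (T k * ((Z m * T l) * (psi x0 k * E x0)))"
      using Zp(2)[OF kl(1)] by (simp add: mult.assoc)
    also have "\<dots> = E ?x3 * (T k * (T l * (Z m' * (psi x0 k * E x0))))"
      unfolding Zl using z by (simp add: distrib_left distrib_right mult.assoc)
    also have "Z m' * (psi x0 k * E x0) = psi x0 k * (Z m' * E x0)"
      using Z_psi[OF kl(1) m(2), of x0] by (simp add: mult.assoc[symmetric])
    also have "\<dots> = s (cw x0 m') * (psi x0 k * E x0)"
      unfolding Z_E(1)[OF x(1) m(2)] using kl by (simp add: alg_left)
    finally have "s (cw ?x3 m) * ?w = s (cw x0 m') * ?w" using a by (simp add: alg_left)
    then have "s (cw ?x3 m - cw x0 m') * ?w = 0" by (simp add: s_diff left_diff_distrib)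
    moreover have "?w \<in> alg" "cw ?x3 m - cw x0 m' \<noteq> 0" using a kl ne(2) by auto
    ultimately have "?w = 0" using s_cancel by blast
    then show ?thesis by (simp add: mult.assoc)
  qed
  ultimately show ?thesis by simp
qed

lemma far_reduce:
  assumes x: "x0 \<in> Std bb lam" "su j x0 \<in> Std bb lam" "su i (su j x0) \<in> Std bb lam"
    and ij: "i \<in> {1..<n}" "j \<in> {1..<n}" "Suc i < j \<or> Suc j < i"
  shows "E (su i (su j x0)) * (T i * (E (su j x0) * (T j * E x0))) = E (su i (su j x0)) * (T i * (T j * E x0))"
proof -
  let ?x2 = "su i (su j x0)"
  have jj: "j \<in> {1..n}" "T i \<in> alg" using ij algs by auto
  have "cw ?x2 j = cw x0 (Suc j)"
  proof -
    have "sw i j = j" "sw j j = Suc j" using ij by (auto simp: transpose_def)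
    then show ?thesis
      using su_weights(3)[OF x(2) ij(1) x(3) jj(1)] su_weights(3)[OF x(1) ij(2) x(2) jj(1)] by simp
  qed
  then have ne: "cw ?x2 j \<noteq> cw x0 j" using cw_consecutive[OF x(1) ij(2)] by simp
  have Z: "Z j * T i = T i * Z j" using ij by (intro Z_T) auto
  have "Z j * (T i * psi x0 j) = T i * psi x0 j * Z j"
  proof -
    have "Z j * (T i * psi x0 j) = T i * (Z j * psi x0 j)" using Z by (simp add: mult.assoc[symmetric])
    then show ?thesis using Z_psi[OF ij(2) jj(1)] by (simp add: mult.assoc)
  qed
  then have "E ?x2 * ((T i * psi x0 j) * E x0) = 0"
    using jj ij ne by (intro E_vanish[OF x(1,3) _ jj(1)]) auto
  then show ?thesis
    unfolding E_psi(3)[OF x(1,2) ij(2), symmetric] PhiU_psi by (simp add: distrib_left distrib_right mult.assoc)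
qed

section \<open>Products along reduced words\<close>

definition act :: "nat list \<Rightarrow> tableau \<Rightarrow> tableau" where "act ks t = tab_act bb lam (word_perm ks) t"

lemma act_simps: "t \<in> Std bb lam \<Longrightarrow> act [] t = t" "act (k # ks) t = su k (act ks t)" "act (u @ v) t = act u (act v t)"
  unfolding act_def su_def by (simp_all add: tab_act_id tab_act_comp word_perm_Cons word_perm_append id_def[symmetric])

primrec PhiW :: "tableau \<Rightarrow> nat list \<Rightarrow> 'a" where
  "PhiW t [] = s 1"
| "PhiW t (k # ks) = PhiU k (bm (act ks t) k) (bm (act ks t) (Suc k)) * PhiW t ks"

primrec Wd :: "tableau \<Rightarrow> nat list \<Rightarrow> 'a" where
  "Wd t [] = E t"
| "Wd t (k # ks) = E (act (k # ks) t) * (T k * Wd t ks)"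

text \<open>Inversion sets grow along a reduced word. Two boxes that stand in the right order both
  in t and in the final tableau are thus never out of order in between, and the intermediate
  tableaux are standard.\<close>

lemma Std_between:
  assumes t: "t \<in> Std bb lam" and p: "\<pi> permutes {1..n}" "\<pi>' permutes {1..n}"
    and v: "tab_act bb lam \<pi> t \<in> Std bb lam" and le: "inv_pairs n \<pi>' \<subseteq> inv_pairs n \<pi>"
  shows "tab_act bb lam \<pi>' t \<in> Std bb lam"
proof -
  have key: "\<pi>' (t A) < \<pi>' (t B)" if "A \<in> boxes bb lam" "B \<in> boxes bb lam" "t A < t B" "\<pi> (t A) < \<pi> (t B)" for A B
  proof (rule ccontr)
    assume "\<not> ?thesis"
    moreover have "\<pi>' (t A) \<noteq> \<pi>' (t B)" using inj_eq[OF permutes_inj[OF p(2)]] that(3) by simp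
    ultimately have "(t A, t B) \<in> inv_pairs n \<pi>'"
      using that Std_range[OF t, of A] Std_range[OF t, of B] by (auto simp: inv_pairs_def)
    then have "(t A, t B) \<in> inv_pairs n \<pi>" using le by auto
    then show False using that(4) by (simp add: inv_pairs_def)
  qed
  have "bij_betw (\<pi>' \<circ> t) (boxes bb lam) {1..n}"
    using t permutes_imp_bij[OF p(2)] by (auto simp: Std_def intro: bij_betw_trans)
  then have b: "bij_betw (tab_act bb lam \<pi>' t) (boxes bb lam) {1..n}"
    unfolding tab_act_def by (subst bij_betw_cong[where g = "\<pi>' \<circ> t"]) auto
  have mono: "tab_act bb lam \<pi>' t A < tab_act bb lam \<pi>' t B"
    if "A \<in> boxes bb lam" "B \<in> boxes bb lam" "t A < t B" "tab_act bb lam \<pi> t A < tab_act bb lam \<pi> t B" for A B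
    using key[OF that(1-3)] that by (simp add: tab_act_def)
  show ?thesis
    using t v b unfolding Std_def by (auto intro!: mono) (auto simp: tab_act_def)
qed

definition good :: "nat list \<Rightarrow> tableau \<Rightarrow> bool" where
  "good ks t \<longleftrightarrow> red n ks \<and> t \<in> Std bb lam \<and> act ks t \<in> Std bb lam"

lemma good_Cons: assumes "good (k # ks) t" shows "good ks t" "k \<in> {1..<n}" "su k (act ks t) \<in> Std bb lam"
proof -
  have r: "red n (k # ks)" using assms by (simp add: good_def)
  have "word_perm (k # ks) permutes {1..n}" using r by (intro word_perm_permutes) (simp add: red_def)
  then have "act ks t \<in> Std bb lam"
    using Std_between[of t "word_perm (k # ks)" "word_perm ks"] red_Cons(3,5)[OF r] assms unfolding good_def act_def by auto
  then show "good ks t" "k \<in> {1..<n}" "su k (act ks t) \<in> Std bb lam"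
    using red_Cons(1,2)[OF r] assms by (auto simp: good_def act_simps(2))
qed

lemma goodD: "good ks t \<Longrightarrow> t \<in> Std bb lam" "good ks t \<Longrightarrow> act ks t \<in> Std bb lam" "good ks t \<Longrightarrow> set ks \<subseteq> {1..<n}"
  by (auto simp: good_def red_def)

lemma Wd_alg: "set ks \<subseteq> {1..<n} \<Longrightarrow> Wd t ks \<in> alg"
  by (induction ks) (auto simp: algs)

lemma E_Wd: "good ks t \<Longrightarrow> E (act ks t) * Wd t ks = Wd t ks"
  using E_E by (cases ks) (auto simp: goodD act_simps mult.assoc[symmetric] dest: goodD)

lemma Wd_E: "t \<in> Std bb lam \<Longrightarrow> Wd t ks * E t = Wd t ks"
  by (induction ks) (simp_all add: E_E mult.assoc)

lemma PhiW_E: "good ks t \<Longrightarrow> PhiW t ks * E t = Wd t ks"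
proof (induction ks)
  case Nil
  then show ?case by simp
next
  case (Cons k ks)
  note g = good_Cons[OF Cons.prems]
  have "PhiW t (k # ks) * E t = PhiU k (bm (act ks t) k) (bm (act ks t) (Suc k)) * (E (act ks t) * Wd t ks)"
    using Cons.IH[OF g(1)] E_Wd[OF g(1)] by (simp add: mult.assoc)
  also have "\<dots> = E (su k (act ks t)) * (T k * (E (act ks t) * Wd t ks))"
    using E_psi(3)[OF goodD(2)[OF g(1)] g(3,2)] by (simp add: mult.assoc[symmetric])
  finally show ?case using E_Wd[OF g(1)] by (simp add: act_simps(2))
qed

text \<open>Matsumoto's theorem, with standardness of the partial tableaux as the admissibility
  predicate. For a commutation or braid move both sides lose their inner idempotents, and the
  relation of the T is applied to what is left.\<close>

lemma Wd_unique:
  assumes u: "good u t" and v: "good v t" and e: "word_perm u = word_perm v"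
  shows "Wd t u = Wd t v"
proof -
  have t: "t \<in> Std bb lam" using u by (rule goodD)
  let ?P = "\<lambda>\<pi>. tab_act bb lam \<pi> t \<in> Std bb lam"
  have g: "red n w \<Longrightarrow> ?P (word_perm w) \<Longrightarrow> good w t" for w using t by (simp add: good_def act_def)
  show ?thesis
  proof (rule matsumoto[where n = n and W = "Wd t" and P = ?P])
    show "?P (word_perm u)" if "red n (k # u)" "?P (word_perm (k # u))" for k u
      using good_Cons(1)[OF g[OF that]] by (simp add: good_def act_def)
    show "Wd t (k # u) = Wd t (k # v)" if "word_perm u = word_perm v" "Wd t u = Wd t v" for k u v
      using that by (simp add: act_def word_perm_Cons)
    show "Wd t (i # j # u) = Wd t (j # i # u)"
      if r: "red n (i # j # u)" "red n (j # i # u)" and P: "?P (word_perm (i # j # u))" and ij: "Suc i < j" for i j u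
    proof -
      have e: "word_perm (j # i # u) = word_perm (i # j # u)" by (simp only: word_perm_Cons sw_far[OF ij])
      have g1: "good (i # j # u) t" "good (j # i # u) t" using g[OF r(1) P] g[OF r(2)] P by (simp_all add: e)
      have g2: "good (j # u) t" "good (i # u) t" "i \<in> {1..<n}" "j \<in> {1..<n}" "good u t"
        using good_Cons[OF g1(1)] good_Cons[OF g1(2)] good_Cons(1) by auto
      let ?x = "act u t"
      have St: "?x \<in> Std bb lam" "su j ?x \<in> Std bb lam" "su i ?x \<in> Std bb lam" "su i (su j ?x) \<in> Std bb lam" "su j (su i ?x) \<in> Std bb lam"
        using g1 g2 by (auto simp: good_def act_simps(2))
      have ee: "su j (su i ?x) = su i (su j ?x)"
      proof -
        have "act (j # i # u) t = act (i # j # u) t" unfolding act_def e ..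
        then show ?thesis by (simp only: act_simps(2))
      qed
      have W: "Wd t u = E ?x * Wd t u" using E_Wd[OF g2(5)] by simp
      have "Wd t (i # j # u) = (E (su i (su j ?x)) * (T i * (E (su j ?x) * (T j * E ?x)))) * Wd t u"
        using W by (simp add: act_simps(2) mult.assoc)
      also have "\<dots> = E (su i (su j ?x)) * (T i * T j) * E ?x * Wd t u"
        using far_reduce[OF St(1,2,4) g2(3,4)] ij by (simp add: mult.assoc)
      also have "T i * T j = T j * T i" using T_comm g2 ij by auto
      also have "E (su i (su j ?x)) * (T j * T i) * E ?x * Wd t u = (E (su j (su i ?x)) * (T j * (E (su i ?x) * (T i * E ?x)))) * Wd t u"
        using far_reduce[OF St(1,3,5) g2(4,3)] ij by (simp add: mult.assoc ee)
      also have "\<dots> = Wd t (j # i # u)" using W by (simp add: act_simps(2) mult.assoc)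
      finally show ?thesis .
    qed
    show "Wd t (i # Suc i # i # u) = Wd t (Suc i # i # Suc i # u)"
      if r: "red n (i # Suc i # i # u)" "red n (Suc i # i # Suc i # u)" and P: "?P (word_perm (i # Suc i # i # u))" for i u
    proof -
      let ?j = "Suc i"
      have e: "word_perm (?j # i # ?j # u) = word_perm (i # ?j # i # u)" by (simp only: word_perm_Cons sw_braid[of i "word_perm u"])
      have g1: "good (i # ?j # i # u) t" "good (?j # i # ?j # u) t" using g[OF r(1) P] g[OF r(2)] P by (simp_all add: e)
      have g2: "good (?j # i # u) t" "good (i # ?j # u) t" "i \<in> {1..<n}" "?j \<in> {1..<n}"
        using good_Cons[OF g1(1)] good_Cons[OF g1(2)] by auto
      have g3: "good (i # u) t" "good (?j # u) t" "good u t"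
        using good_Cons(1)[OF g2(1)] good_Cons(1)[OF g2(2)] good_Cons(1) by auto
      let ?x = "act u t"
      have St: "?x \<in> Std bb lam" "su i ?x \<in> Std bb lam" "su ?j (su i ?x) \<in> Std bb lam" "su i (su ?j (su i ?x)) \<in> Std bb lam"
        "su ?j ?x \<in> Std bb lam" "su i (su ?j ?x) \<in> Std bb lam" "su ?j (su i (su ?j ?x)) \<in> Std bb lam"
        using g1 g2 g3 by (auto simp: good_def act_simps(2))
      have ee: "su ?j (su i (su ?j ?x)) = su i (su ?j (su i ?x))"
      proof -
        have "act (?j # i # ?j # u) t = act (i # ?j # i # u) t" unfolding act_def e ..
        then show ?thesis by (simp only: act_simps(2))
      qed
      have W: "Wd t u = E ?x * Wd t u" using E_Wd[OF g3(3)] by simp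
      have rg: "i \<in> {1..n}" "?j \<in> {1..n}" "Suc ?j \<in> {1..n}" using g2 by auto
      have cw3: "cw (su i (su ?j (su i ?x))) i = cw ?x (Suc ?j)" "cw (su i (su ?j (su i ?x))) (Suc ?j) = cw ?x i"
        using su_weights(3)[OF St(3) g2(3) St(4)] su_weights(3)[OF St(2) g2(4) St(3)] su_weights(3)[OF St(1) g2(3) St(2)] rg
        by (simp_all add: transpose_def)
      have n1: "cw ?x i \<noteq> cw ?x ?j" "cw ?x ?j \<noteq> cw ?x (Suc ?j)" using cw_consecutive[OF St(1)] g2 by auto
      have n2: "cw ?x i \<noteq> cw ?x (Suc ?j)"
        using cw_consecutive[OF St(2) g2(4)] su_weights(3)[OF St(1) g2(3) St(2)] rg by (simp add: transpose_def)
      have b1: "E (su i (su ?j (su i ?x))) * (T i * (E (su ?j (su i ?x)) * (T ?j * (E (su i ?x) * (T i * E ?x))))) =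
        E (su i (su ?j (su i ?x))) * (T i * (T ?j * (T i * E ?x)))"
      proof (rule braid_reduce[OF St(1-4) g2(3,4) rg(3,2) _ Z_T_adj(1)[OF g2(4)]])
        show "Z (Suc ?j) * T i = T i * Z (Suc ?j)" using g2 rg by (intro Z_T) auto
        show "- GG ?j \<in> alg" "Z (Suc ?j) * - GG ?j = - GG ?j * Z (Suc ?j)"
          using Z_T_adj(3,4)[OF g2(4)] rg by auto
        show "cw (su i (su ?j (su i ?x))) (Suc ?j) \<noteq> cw ?x (Suc ?j)" "cw (su i (su ?j (su i ?x))) (Suc ?j) \<noteq> cw ?x ?j"
          unfolding cw3 using n1 n2 by auto
      qed
      have b2: "E (su ?j (su i (su ?j ?x))) * (T ?j * (E (su i (su ?j ?x)) * (T i * (E (su ?j ?x) * (T ?j * E ?x))))) =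
        E (su ?j (su i (su ?j ?x))) * (T ?j * (T i * (T ?j * E ?x)))"
      proof (rule braid_reduce[OF St(1,5,6,7) g2(4,3) rg(1,2) _ Z_T_adj(2)[OF g2(3)]])
        show "Z i * T ?j = T ?j * Z i" using g2 rg by (intro Z_T) auto
        show "GG i \<in> alg" "Z i * GG i = GG i * Z i"
          using Z_T_adj(3,4)[OF g2(3)] rg by auto
        show "cw (su ?j (su i (su ?j ?x))) i \<noteq> cw ?x i" "cw (su ?j (su i (su ?j ?x))) i \<noteq> cw ?x ?j"
          unfolding ee cw3 using n1 n2 by (metis, metis)
      qed
      have "Wd t (i # ?j # i # u) = (E (su i (su ?j (su i ?x))) * (T i * (E (su ?j (su i ?x)) * (T ?j * (E (su i ?x) * (T i * E ?x)))))) * Wd t u"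
        using W by (simp add: act_simps(2) mult.assoc)
      also have "\<dots> = E (su i (su ?j (su i ?x))) * (T i * T ?j * T i) * E ?x * Wd t u"
        unfolding b1 by (simp add: mult.assoc)
      also have "T i * T ?j * T i = T ?j * T i * T ?j" using braid[of i] g2 by simp
      also have "E (su i (su ?j (su i ?x))) * (T ?j * T i * T ?j) * E ?x * Wd t u =
        (E (su ?j (su i (su ?j ?x))) * (T ?j * (E (su i (su ?j ?x)) * (T i * (E (su ?j ?x) * (T ?j * E ?x)))))) * Wd t u"
        unfolding b2 by (simp add: mult.assoc ee)
      also have "\<dots> = Wd t (?j # i # ?j # u)" using W by (simp add: act_simps(2) mult.assoc)
      finally show ?thesis .
    qed
  qed (use u v e in \<open>auto simp: good_def act_def\<close>)
qed

lemma PhiW_alg: "set ks \<subseteq> {1..<n} \<Longrightarrow> PhiW t ks \<in> alg"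
  by (induction ks) auto

lemma Dtab_range: "u \<in> Std bb lam \<Longrightarrow> k \<in> Dtab bb lam u \<Longrightarrow> k \<in> {1..n}"
  using diag_bp(1) .

text \<open>A diagonal weight is its own inverse. For j = k the two coefficients of Phi then agree,
  for j = k + 1 their sum is -eps; these coincidences are what lets C_j pass in each case.\<close>

lemma PhiU_C:
  assumes u: "u \<in> Std bb lam" and k: "k \<in> {1..<n}" and j: "j \<in> Dtab bb lam u"
  shows "PhiU k (bm u k) (bm u (Suc k)) * C j = C (sw k j) * PhiU k (bm u k) (bm u (Suc k))"
proof -
  interpret R: rank2 s "T k" "X k" "Xi k" "X (Suc k)" "Xi (Suc k)" "C k" "C (Suc k)" "heps h" using k by (rule rank2)
  have j1: "j \<in> {1..n}" "inverse (bm u j) = bm u j" using diag_bp[OF u j] bp_bm by auto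
  define x where "x = bm u k"
  define y where "y = bm u (Suc k)"
  have nz: "x \<noteq> 0" "y \<noteq> 0" unfolding x_def y_def using bp_bm by auto
  have ne: "x * y \<noteq> 1" "inverse x * y \<noteq> 1"
  proof -
    have xy: "inverse x + x \<noteq> inverse y + y" using cw_consecutive[OF u k] unfolding bp_bm(1)[symmetric] bp_bm(6) x_def y_def .
    show "x * y \<noteq> 1" using xy inverse_unique[of x y] inverse_unique[of y x] by (auto simp: mult.commute add.commute)
    show "inverse x * y \<noteq> 1" using xy nz by (auto simp: field_simps)
  qed
  define A where "A = heps h / (inverse x * y - 1)"
  define B where "B = heps h / (x * y - 1)"
  have P: "PhiU k x y = T k + s A - s B * (C k * C (Suc k))" unfolding PhiU_def A_def B_def ..
  have DC: "C (Suc k) * C k = - (C k * C (Suc k))" using R.CD by simp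
  have "PhiU k x y * C j = C (sw k j) * PhiU k x y"
  proof -
    consider "j = k" | "j = Suc k" | "j \<noteq> k" "j \<noteq> Suc k" by blast
    then show ?thesis
    proof cases
      case 1
      then have "A = B" using j1 unfolding A_def B_def x_def by simp
      then show ?thesis unfolding P 1 by (simp add: R.scal R.TC R.CC DC R.CCl alg_comm)
    next
      case 2
      then have yy: "inverse y = y" using j1 unfolding y_def by simp
      have "A + heps h = - B"
      proof -
        have "y * y = 1" using yy nz by (metis left_inverse)
        moreover have "(inverse x * y) * (x * y) = (inverse x * x) * (y * y)" by (simp only: ac_simps)
        ultimately have "(inverse x * y) * (x * y) = 1" using nz by simp
        then have "(x * y) * (inverse x * y) = 1" by (simp only: mult.commute)
        then have "inverse x * y = inverse (x * y)" by (rule inverse_unique[symmetric])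
        then show ?thesis unfolding A_def B_def using ne nz by (simp add: field_simps)
      qed
      then have e: "heps h = - A - B" by (simp add: algebra_simps eq_neg_iff_add_eq_0)
      show ?thesis unfolding P 2 by (simp add: R.scal R.TD R.CC DC R.CCl alg_comm e)
    next
      case 3
      then have "sw k j = j" by (simp add: transpose_def)
      moreover have "T k * C j = C j * T k" using TC_comm[OF k j1(1)] 3 by simp
      moreover have "C k * C (Suc k) * C j = C j * (C k * C (Suc k))"
        using C_anti[of k j] C_anti[of "Suc k" j] 3 k j1(1) by (simp add: mult.assoc) (simp add: mult.assoc[symmetric])
      moreover have "C j \<in> alg" using j1 algs by auto
      ultimately show ?thesis unfolding P
        by (simp add: distrib_left distrib_right left_diff_distrib right_diff_distrib mult.assoc alg_comm alg_left)
    qed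
  qed
  then show ?thesis unfolding x_def y_def .
qed

lemma Dtab_act: "t \<in> Std bb lam \<Longrightarrow> Dtab bb lam (tab_act bb lam \<pi> t) = \<pi> ` Dtab bb lam t"
proof -
  have "tab_act bb lam \<pi> t A = \<pi> (t A)" if "A \<in> diag_boxes bb lam" for A
    using that by (auto simp: tab_act_def diag_boxes_def)
  then show ?thesis unfolding Dtab_def by (auto simp: image_iff)
qed

lemma PhiW_C: "good ks t \<Longrightarrow> j \<in> Dtab bb lam t \<Longrightarrow> PhiW t ks * C j = C (word_perm ks j) * PhiW t ks"
proof (induction ks)
  case Nil
  then have "C j \<in> alg" using Dtab_range goodD algs by blast
  then show ?case by simp
next
  case (Cons k ks)
  note g = good_Cons[OF Cons.prems(1)]
  have "word_perm ks j \<in> Dtab bb lam (act ks t)"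
    using Cons.prems Dtab_act[of t "word_perm ks"] unfolding act_def by (auto simp: good_def)
  from PhiU_C[OF goodD(2)[OF g(1)] g(2) this] Cons.IH[OF g(1) Cons.prems(2)] show ?case
    by (simp add: word_perm_Cons mult.assoc) (simp add: mult.assoc[symmetric])
qed

definition PhiS :: "tableau \<Rightarrow> tableau \<Rightarrow> 'a" where
  "PhiS u t = PhiW t (SOME ks. reduced_expr n (tab_perm bb lam u t) ks)"

lemma tab_perm_at: "t \<in> Std bb lam \<Longrightarrow> A \<in> boxes bb lam \<Longrightarrow> tab_perm bb lam u t (t A) = u A"
  using Std_range[of t bb lam A] Std_inj[of t bb lam A] by (simp add: tab_perm_def)

lemma tab_perm_permutes: assumes u: "u \<in> Std bb lam" and t: "t \<in> Std bb lam" shows "tab_perm bb lam u t permutes {1..n}"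
proof (rule bij_imp_permutes)
  have "bij_betw (u \<circ> inv_into (boxes bb lam) t) {1..n} {1..n}"
    using u t by (auto simp: Std_def intro: bij_betw_trans bij_betw_inv_into)
  then show "bij_betw (tab_perm bb lam u t) {1..n} {1..n}"
    by (subst bij_betw_cong[where g = "u \<circ> inv_into (boxes bb lam) t"]) (auto simp: tab_perm_def)
qed (auto simp: tab_perm_def)

lemma tab_act_perm: assumes u: "u \<in> Std bb lam" and t: "t \<in> Std bb lam" shows "tab_act bb lam (tab_perm bb lam u t) t = u"
proof
  fix A
  show "tab_act bb lam (tab_perm bb lam u t) t A = u A"
  proof (cases "A \<in> boxes bb lam")
    case True
    then show ?thesis using tab_perm_at[OF t True, of u] by (simp add: tab_act_def)
  next
    case False
    have "u \<in> extensional (boxes bb lam)" using u by (simp add: Std_def)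
    then have "u A = undefined" using False by (rule extensional_arb)
    then show ?thesis using False by (simp add: tab_act_def)
  qed
qed

lemma tab_perm_comp:
  assumes u: "u \<in> Std bb lam" and v: "v \<in> Std bb lam" and t: "t \<in> Std bb lam" and k: "k \<in> {1..n}"
  shows "tab_perm bb lam u v (tab_perm bb lam v t k) = tab_perm bb lam u t k"
proof -
  let ?A = "inv_into (boxes bb lam) t k"
  have A: "?A \<in> boxes bb lam" "t ?A = k" using Std_inv[OF t, of k] k by auto
  then have "tab_perm bb lam v t k = v ?A" "tab_perm bb lam u t k = u ?A" using tab_perm_at[OF t A(1)] by auto
  then show ?thesis using tab_perm_at[OF v A(1)] by simp
qed

lemma tab_perm_inv: assumes u: "u \<in> Std bb lam" and t: "t \<in> Std bb lam"
  shows "pinv (tab_perm bb lam u t) = tab_perm bb lam t u"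
proof (rule inv_unique_comp)
  have "tab_perm bb lam w w k = k" if "w \<in> Std bb lam" "k \<in> {1..n}" for w k
    using that Std_inv[OF that(1), of k] by (simp add: tab_perm_def)
  then have c: "tab_perm bb lam v w (tab_perm bb lam w v k) = k" if "v \<in> Std bb lam" "w \<in> Std bb lam" for v w k
    using tab_perm_comp[OF that(1,2,1), of k] that by (cases "k \<in> {1..n}") (auto simp: tab_perm_def)
  show "tab_perm bb lam u t \<circ> tab_perm bb lam t u = id" "tab_perm bb lam t u \<circ> tab_perm bb lam u t = id"
    using c[OF u t] c[OF t u] by auto
qed

lemma PhiS_word:
  assumes u: "u \<in> Std bb lam" and t: "t \<in> Std bb lam"
  shows "\<exists>ks. good ks t \<and> act ks t = u \<and> word_perm ks = tab_perm bb lam u t \<and> PhiS u t = PhiW t ks"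
proof -
  let ?ks = "SOME ks. reduced_expr n (tab_perm bb lam u t) ks"
  have r: "red n ?ks" "word_perm ?ks = tab_perm bb lam u t"
    using reduced_expr_red[OF reduced_expr_ex[OF tab_perm_permutes[OF u t]]] by auto
  have a: "act ?ks t = u" unfolding act_def r(2) by (rule tab_act_perm[OF u t])
  then have "good ?ks t" using r u t by (simp add: good_def)
  then show ?thesis using r a unfolding PhiS_def by blast
qed

lemma PhiS_E: assumes "u \<in> Std bb lam" "t \<in> Std bb lam" shows "E u * (PhiS u t * E t) = PhiS u t * E t"
  using PhiS_word[OF assms] PhiW_E E_Wd by metis

lemma PhiS_C: assumes "u \<in> Std bb lam" "t \<in> Std bb lam" "j \<in> Dtab bb lam t"
  shows "PhiS u t * C j = C (tab_perm bb lam u t j) * PhiS u t"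
  using PhiS_word[OF assms(1,2)] PhiW_C assms(3) by metis

lemma PhiS_alg: assumes "u \<in> Std bb lam" "t \<in> Std bb lam" shows "PhiS u t \<in> alg"
  using PhiS_word[OF assms] PhiW_alg goodD(3) by metis

text \<open>The reversed word spells the inverse permutation, and its length bounds the number of
  inversions.\<close>

lemma card_inv_pairs_inv:
  assumes "\<pi> permutes {1..n}" shows "card (inv_pairs n (pinv \<pi>)) \<le> card (inv_pairs n \<pi>)"
proof -
  obtain ks where ks: "red n ks" "word_perm ks = \<pi>" using red_ex[OF assms] by blast
  then have s: "set ks \<subseteq> {1..<n}" by (simp add: red_def)
  have "card (inv_pairs n (word_perm (rev ks))) \<le> length (rev ks)" using s by (intro card_inv_le) simp
  then show ?thesis using ks unfolding red_rev[OF s] by (simp add: red_def)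
qed

lemma good_rev: assumes g: "good ks t" shows "good (rev ks) (act ks t)" "act (rev ks) (act ks t) = t"
proof -
  have s: "set ks \<subseteq> {1..<n}" and t: "t \<in> Std bb lam" using goodD g by auto
  have p: "word_perm ks permutes {1..n}" by (rule word_perm_permutes[OF s])
  show a: "act (rev ks) (act ks t) = t"
    unfolding act_def red_rev[OF s] tab_act_comp using tab_act_id[OF t] permutes_inv_o(2)[OF p] by simp
  have "card (inv_pairs n (pinv (word_perm ks))) = card (inv_pairs n (word_perm ks))"
    using card_inv_pairs_inv[OF p] card_inv_pairs_inv[OF permutes_inv[OF p]] permutes_inv_inv[OF p] by simp
  then have "red n (rev ks)" using g s unfolding red_def good_def by (simp add: red_rev[OF s])
  then show "good (rev ks) (act ks t)" using g t by (simp add: good_def a)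
qed

end

section \<open>The involution on idempotents and intertwiners\<close>

locale hc_star_lam = hc_lam h n s T X Xi C lam
  for h :: "'k::alg_closed_field hc_datum" and n and s :: "'k \<Rightarrow> 'a::ring" and T X Xi C and lam +
  fixes st :: "'a \<Rightarrow> 'a"
  assumes st_alg [simp]: "x \<in> alg \<Longrightarrow> st x \<in> alg"
    and st_add: "x \<in> alg \<Longrightarrow> y \<in> alg \<Longrightarrow> st (x + y) = st x + st y"
    and st_mult: "x \<in> alg \<Longrightarrow> y \<in> alg \<Longrightarrow> st (x * y) = st y * st x"
    and st_s [simp]: "st (s c) = s c"
    and st_st: "x \<in> alg \<Longrightarrow> st (st x) = x"
    and st_T: "i \<in> {1..<n} \<Longrightarrow> st (T i) = T i + s (heps h) * (C i * C (Suc i))"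
    and st_C: "j \<in> {1..n} \<Longrightarrow> st (C j) = C j"
    and st_X: "j \<in> {1..n} \<Longrightarrow> st (X j) = X j"
begin

text \<open>\<open>st\<close> fixes the X_k and reverses products, so st(E) is a joint eigenvector
  from the left and E st(E) = st(E). The left side is invariant under \<open>st\<close>, while the
  right side becomes E.\<close>

lemma st_E: assumes u: "u \<in> Std bb lam" shows "st (E u) = E u"
proof -
  have "E u * st (E u) = st (E u)"
  proof (rule E_left)
    fix k assume k: "k \<in> {1..n}"
    have a: "X k \<in> alg" using k algs by auto
    have "X k * st (E u) = st (E u * X k)" using a st_X[OF k] by (simp add: st_mult)
    then show "X k * st (E u) = s (bp u k) * st (E u)" unfolding X_E(2)[OF u k] by (simp add: st_mult alg_comm)
  qed simp
  then have "st (E u * st (E u)) = st (st (E u))" by simp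
  then have "E u * st (E u) = E u" by (simp add: st_mult st_st)
  then show ?thesis using \<open>E u * st (E u) = st (E u)\<close> by simp
qed

lemma Wd_snoc: "t \<in> Std bb lam \<Longrightarrow> su k t \<in> Std bb lam \<Longrightarrow> Wd t (ks @ [k]) = Wd (su k t) ks * (T k * E t)"
  by (induction ks) (simp_all add: act_simps mult.assoc)

text \<open>The extra term of st(T_k) drops out by \<open>E_psi\<close>, so the reversed product is
  again of the form \<open>Wd\<close>, now starting from the final tableau.\<close>

lemma st_Wd: "good ks t \<Longrightarrow> st (Wd t ks) = Wd (act ks t) (rev ks)"
proof (induction ks)
  case Nil
  then show ?case using st_E goodD by (simp add: act_simps)
next
  case (Cons k ks)
  note g = good_Cons[OF Cons.prems]
  let ?u = "act ks t"
  have u: "?u \<in> Std bb lam" using goodD g by blast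
  have a: "T k \<in> alg" "Wd t ks \<in> alg" "C k * C (Suc k) \<in> alg"
    using g algs[of k] algs[of "Suc k"] Wd_alg goodD(3)[OF g(1)] by auto
  have z: "E ?u * (C k * C (Suc k) * E (su k ?u)) = 0"
    using E_psi(2)[of "su k ?u" k] su_su[OF u, of k] u g by simp
  have "st (Wd t (k # ks)) = Wd ?u (rev ks) * (T k + s (heps h) * (C k * C (Suc k))) * E (su k ?u)"
    using a g Cons.IH[OF g(1)] by (simp add: st_mult st_E st_T act_simps(2))
  also have "\<dots> = Wd ?u (rev ks) * (E ?u * ((T k + s (heps h) * (C k * C (Suc k))) * E (su k ?u)))"
    using Wd_E[OF u, of "rev ks"] by (simp add: mult.assoc[symmetric])
  also have "\<dots> = Wd ?u (rev ks) * (E ?u * (T k * E (su k ?u)))"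
    using z by (simp add: distrib_left distrib_right mult.assoc alg_left)
  also have "\<dots> = Wd (su k (su k ?u)) (rev ks) * (T k * E (su k ?u))"
    using Wd_E[OF u, of "rev ks"] su_su[OF u] by (simp add: mult.assoc[symmetric])
  also have "\<dots> = Wd (su k ?u) (rev ks @ [k])"
    using Wd_snoc[OF g(3)] su_su[OF u, of k] u by simp
  finally show ?case by (simp add: act_simps(2))
qed

text \<open>The reversed word need not be the reduced expression chosen in \<open>PhiS\<close>;
  independence of the word closes this gap.\<close>

lemma st_PhiS: assumes u: "u \<in> Std bb lam" and t: "t \<in> Std bb lam"
  shows "st (PhiS u t * E t) = PhiS t u * E u"
proof -
  obtain ks where ks: "good ks t" "act ks t = u" "word_perm ks = tab_perm bb lam u t" "PhiS u t = PhiW t ks"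
    using PhiS_word[OF u t] by blast
  obtain ks' where ks': "good ks' u" "act ks' u = t" "word_perm ks' = tab_perm bb lam t u" "PhiS t u = PhiW u ks'"
    using PhiS_word[OF t u] by blast
  have "st (PhiS u t * E t) = Wd u (rev ks)" using st_Wd[OF ks(1)] PhiW_E[OF ks(1)] ks by simp
  also have "\<dots> = Wd u ks'"
    using good_rev[OF ks(1)] ks' red_rev[OF goodD(3)[OF ks(1)]] tab_perm_inv[OF u t] ks
    by (intro Wd_unique) auto
  also have "\<dots> = PhiS t u * E u" using PhiW_E[OF ks'(1)] ks' by simp
  finally show ?thesis .
qed

end

section \<open>Clifford monomials\<close>

text \<open>The sign collected by C_x on its way from the right end of the monomial C^\<gamma> to
  its place.\<close>

definition sgz :: "zvec \<Rightarrow> nat \<Rightarrow> 'k::field" where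
  "sgz \<gamma> x = (-1) ^ zcount_gt \<gamma> x"

definition flip :: "zvec \<Rightarrow> nat \<Rightarrow> zvec" where
  "flip \<gamma> x = \<gamma>(x := \<gamma> x + 1)"

lemma zsupp_flip: "zsupp (flip \<gamma> x) = (if x \<in> zsupp \<gamma> then zsupp \<gamma> - {x} else insert x (zsupp \<gamma>))"
  unfolding zsupp_def flip_def by (auto simp: bit_not_one_iff)

lemma sgz_sq [simp]: "sgz \<gamma> x * sgz \<gamma> x = (1::'k::field)"
  unfolding sgz_def by (simp flip: power_mult_distrib)

lemma sgz_flip:
  assumes "finite (zsupp \<gamma>)"
  shows "sgz (flip \<gamma> y) x = (if x < y then - sgz \<gamma> x else (sgz \<gamma> x :: 'k::field))"
proof -
  let ?A = "{k \<in> zsupp \<gamma>. x < k}"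
  have f: "finite ?A" using assms by auto
  have s: "{k \<in> zsupp (flip \<gamma> y). x < k} = (if x < y then if y \<in> zsupp \<gamma> then ?A - {y} else insert y ?A else ?A)"
    unfolding zsupp_flip by auto
  have c: "(-1::'k) ^ card ?A = - ((-1) ^ card (?A - {y}))" if "x < y" "y \<in> zsupp \<gamma>"
  proof -
    have "card ?A = Suc (card (?A - {y}))" using f that by (intro card_Suc_Diff1[symmetric]) auto
    then show ?thesis by (metis power_Suc mult_minus1)
  qed
  show ?thesis
  proof (cases "x < y \<and> y \<in> zsupp \<gamma>")
    case True
    then show ?thesis unfolding sgz_def zcount_gt_def s using c by simp
  next
    case False
    then have "x < y \<Longrightarrow> y \<notin> ?A" by auto
    then show ?thesis unfolding sgz_def zcount_gt_def s using False f by auto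
  qed
qed

lemma rank_bij:
  assumes fin: "finite S" and refl: "\<And>x. lexle x x" and trans: "\<And>x y z. lexle x y \<Longrightarrow> lexle y z \<Longrightarrow> lexle x z"
    and antisym: "\<And>x y. lexle x y \<Longrightarrow> lexle y x \<Longrightarrow> x = y" and total: "\<And>x y. lexle x y \<or> lexle y x"
  shows "x \<in> S \<Longrightarrow> y \<in> S \<Longrightarrow> lexle x y \<Longrightarrow> x \<noteq> y \<Longrightarrow> card {z \<in> S. lexle z x} < card {z \<in> S. lexle z y}"
    and "bij_betw (\<lambda>x. card {z \<in> S. lexle z x}) S {1..card S}"
proof -
  let ?r = "\<lambda>x. card {z \<in> S. lexle z x}"
  show mono: "?r x < ?r y" if "x \<in> S" "y \<in> S" "lexle x y" "x \<noteq> y" for x y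
  proof (rule psubset_card_mono)
    show "{z \<in> S. lexle z x} \<subset> {z \<in> S. lexle z y}" using that refl trans antisym by blast
  qed (use fin in auto)
  have inj: "inj_on ?r S"
  proof (rule inj_onI)
    fix x y assume "x \<in> S" "y \<in> S" "?r x = ?r y"
    then show "x = y" using mono[of x y] mono[of y x] total[of x y] by auto
  qed
  have "1 \<le> ?r x" "?r x \<le> card S" if "x \<in> S" for x
  proof -
    have "card {x} \<le> ?r x" using that refl fin by (intro card_mono) auto
    then show "1 \<le> ?r x" by simp
    show "?r x \<le> card S" using fin by (intro card_mono) auto
  qed
  then have "?r ` S \<subseteq> {1..card S}" by auto
  moreover have "card (?r ` S) = card {1..card S}" using card_image[OF inj] by simp
  ultimately have "?r ` S = {1..card S}" by (intro card_subset_eq) auto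
  then show "bij_betw ?r S {1..card S}" using inj by (simp add: bij_betw_def)
qed

text \<open>\<open>tab_init\<close> counts the boxes up to a given one in reading order, so it is
  the rank function of a finite total order that extends the order along rows and columns. The
  tableau w identifies \<open>mp_size\<close> with the number of boxes.\<close>

lemma tab_init_Std: assumes w: "w \<in> Std b lam" shows "tab_init b lam \<in> Std b lam"
proof -
  let ?S = "boxes b lam"
  define lexle :: "box \<Rightarrow> box \<Rightarrow> bool" where
    "lexle = (\<lambda>(i', j', l') (i, j, l). l' < l \<or> l' = l \<and> (i' < i \<or> i' = i \<and> j' \<le> j))"
  have bij: "bij_betw w ?S {1..mp_size lam}" using w by (simp add: Std_def)
  have fin: "finite ?S" using bij_betw_finite[OF bij] by simp
  have card: "mp_size lam = card ?S" using bij_betw_same_card[OF bij] by simp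
  have init: "tab_init b lam A = card {B \<in> ?S. lexle B A}" if "A \<in> ?S" for A
  proof (cases A)
    case (fields i j l)
    have "{(i', j', l') \<in> ?S. l' < l \<or> l' = l \<and> (i' < i \<or> i' = i \<and> j' \<le> j)} = {B \<in> ?S. lexle B A}"
      unfolding lexle_def fields by auto
    then show ?thesis using that unfolding tab_init_def fields by simp
  qed
  have o: "lexle x x" "lexle x y \<Longrightarrow> lexle y z \<Longrightarrow> lexle x z" "lexle x y \<Longrightarrow> lexle y x \<Longrightarrow> x = y" "lexle x y \<or> lexle y x" for x y z
    unfolding lexle_def by (auto split: prod.splits)
  have rank1: "card {z \<in> ?S. lexle z A} < card {z \<in> ?S. lexle z B}" if "A \<in> ?S" "B \<in> ?S" "lexle A B" "A \<noteq> B" for A B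
    by (rule rank_bij(1)[OF fin, where lexle = lexle]) (use o that in blast)+
  have rank2: "bij_betw (\<lambda>A. card {z \<in> ?S. lexle z A}) ?S {1..card ?S}"
    by (rule rank_bij(2)[OF fin, where lexle = lexle]) (use o in blast)+
  have "bij_betw (tab_init b lam) ?S {1..mp_size lam}"
    using rank2 unfolding card by (subst bij_betw_cong[OF init]) auto
  moreover have "tab_init b lam A < tab_init b lam B" if "A \<in> ?S" "B \<in> ?S" "lexle A B" "A \<noteq> B" for A B
    using rank1[OF that] init that by simp
  ultimately show ?thesis
    unfolding Std_def by (auto simp: lexle_def) (auto simp: tab_init_def)
qed

section \<open>Positions of the diagonal entries\<close>

context hc_lam
begin

lemma xs_at:
  assumes t: "t \<in> Std bb lam" and p: "p \<in> {1..tnum bb lam}"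
  obtains A where "A \<in> diag_boxes bb lam" "xs_tab bb lam t p = t A" "tab_init bb lam A = sorted_list_of_set (Dtab bb lam (tab_init bb lam)) ! (p - 1)"
    "length (sorted_list_of_set (Dtab bb lam (tab_init bb lam))) = tnum bb lam"
proof -
  let ?i = "tab_init bb lam" and ?D = "Dtab bb lam (tab_init bb lam)"
  have i: "?i \<in> Std bb lam" by (rule tab_init_Std[OF t])
  have bij: "bij_betw ?i (boxes bb lam) {1..n}" using i by (simp add: Std_def)
  have sub: "diag_boxes bb lam \<subseteq> boxes bb lam" by (auto simp: diag_boxes_def)
  then have inj: "inj_on ?i (diag_boxes bb lam)" using bij inj_on_subset by (auto simp: bij_betw_def)
  have fin: "finite ?D" using Dtab_range[OF i] by (metis finite_subset finite_atLeastAtMost subsetI)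
  have len: "length (sorted_list_of_set ?D) = tnum bb lam"
    using card_image[OF inj] by (simp add: Dtab_def tnum_def)
  then have "sorted_list_of_set ?D ! (p - 1) \<in> ?D"
    using p nth_mem[of "p - 1" "sorted_list_of_set ?D"] fin by auto
  then obtain A where A: "A \<in> diag_boxes bb lam" "?i A = sorted_list_of_set ?D ! (p - 1)" by (auto simp: Dtab_def)
  then have "xs_tab bb lam t p = t A" using tab_perm_at[OF i, of A t] sub by (auto simp: xs_tab_def)
  then show ?thesis using that A len by blast
qed

lemma xs_diag: assumes "t \<in> Std bb lam" "p \<in> {1..tnum bb lam}" shows "xs_tab bb lam t p \<in> Dtab bb lam t"
proof -
  obtain A where "A \<in> diag_boxes bb lam" "xs_tab bb lam t p = t A" by (rule xs_at[OF assms])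
  then show ?thesis by (auto simp: Dtab_def)
qed

lemma xs_range: "t \<in> Std bb lam \<Longrightarrow> p \<in> {1..tnum bb lam} \<Longrightarrow> xs_tab bb lam t p \<in> {1..n}"
  using xs_diag Dtab_range by blast

lemma xs_inj:
  assumes t: "t \<in> Std bb lam" and p: "p \<in> {1..tnum bb lam}" "p' \<in> {1..tnum bb lam}" and e: "xs_tab bb lam t p = xs_tab bb lam t p'"
  shows "p = p'"
proof -
  let ?L = "sorted_list_of_set (Dtab bb lam (tab_init bb lam))"
  obtain A where A: "A \<in> diag_boxes bb lam" "xs_tab bb lam t p = t A" "tab_init bb lam A = ?L ! (p - 1)" "length ?L = tnum bb lam"
    by (rule xs_at[OF t p(1)])
  obtain B where B: "B \<in> diag_boxes bb lam" "xs_tab bb lam t p' = t B" "tab_init bb lam B = ?L ! (p' - 1)"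
    by (rule xs_at[OF t p(2)])
  have "A \<in> boxes bb lam" "B \<in> boxes bb lam" using A B by (auto simp: diag_boxes_def)
  then have "A = B" using e A B Std_inj[OF t] by metis
  then have "?L ! (p - 1) = ?L ! (p' - 1)" using A B by simp
  then have "p - 1 = p' - 1" using p A(4) by (subst (asm) nth_eq_iff_index_eq) auto
  then show ?thesis using p by auto
qed

text \<open>x_p is the entry of one and the same diagonal box in every tableau. Hence d(u, t)
  matches these positions, and by \<open>PhiS_C\<close> the intertwiner matches the Clifford
  generators sitting there.\<close>

lemma xs_perm:
  assumes u: "u \<in> Std bb lam" and t: "t \<in> Std bb lam" and p: "p \<in> {1..tnum bb lam}"
  shows "tab_perm bb lam u t (xs_tab bb lam t p) = xs_tab bb lam u p"
proof -
  let ?L = "sorted_list_of_set (Dtab bb lam (tab_init bb lam))"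
  obtain A where A: "A \<in> diag_boxes bb lam" "xs_tab bb lam t p = t A" "tab_init bb lam A = ?L ! (p - 1)"
    by (rule xs_at[OF t p])
  then have Ab: "A \<in> boxes bb lam" by (auto simp: diag_boxes_def)
  have "xs_tab bb lam u p = tab_perm bb lam u (tab_init bb lam) (tab_init bb lam A)" unfolding xs_tab_def A(3) ..
  then show ?thesis using tab_perm_at[OF tab_init_Std[OF t] Ab] tab_perm_at[OF t Ab] A by simp
qed

end

context hc_star_lam
begin

definition Cp :: "zvec \<Rightarrow> 'a" where
  "Cp \<beta> = lprod (map (\<lambda>k. if \<beta> k = 1 then C k else s 1) [1..<n+1])"

lemma st_lprod: "set xs \<subseteq> alg \<Longrightarrow> st (lprod xs) = lprod (rev (map st xs))"
proof (induction xs)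
  case (Cons x xs)
  have "st (lprod (x # xs)) = lprod (rev (map st xs)) * st x"
    using Cons by (simp add: st_mult)
  also have "\<dots> = lprod (rev (map st xs) @ [st x])"
    using Cons.prems by (subst lprod_append) auto
  finally show ?case by simp
qed simp

text \<open>The factors are involutions fixed by \<open>st\<close>, so \<open>st\<close> of the
  product is its inverse. This lets st(C^\<beta>) stand for the inverse of C^\<beta> from here
  on.\<close>

lemma lprod_invol:
  assumes "set xs \<subseteq> alg" "\<And>x. x \<in> set xs \<Longrightarrow> x * x = s 1 \<and> st x = x"
  shows "lprod xs * st (lprod xs) = s 1" "st (lprod xs) * lprod xs = s 1"
proof -
  show "lprod xs * st (lprod xs) = s 1" using assms
  proof (induction xs)
    case (Cons x xs)
    have "lprod (x # xs) * st (lprod (x # xs)) = x * (lprod xs * st (lprod xs)) * x"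
      using Cons.prems by (simp add: st_mult mult.assoc)
    then show ?case using Cons by simp
  qed simp
  show "st (lprod xs) * lprod xs = s 1" using assms
  proof (induction xs)
    case (Cons x xs)
    have "st (lprod (x # xs)) * lprod (x # xs) = st (lprod xs) * ((x * x) * lprod xs)"
    proof -
      have "st x = x" "x \<in> alg" "set xs \<subseteq> alg" using Cons.prems by auto
      then show ?thesis by (simp only: lprod_simps st_mult lprod_alg mult.assoc)
    qed
    also have "(x * x) * lprod xs = lprod xs" using Cons.prems by simp
    finally show ?case using Cons by simp
  qed simp
qed

lemma C_facts: "j \<in> {1..n} \<Longrightarrow> C j \<in> alg" "j \<in> {1..n} \<Longrightarrow> C j * C j = s 1" "j \<in> {1..n} \<Longrightarrow> st (C j) = C j"
  using algs CC st_C by auto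

lemma Cp_list: "set (map (\<lambda>k. if \<beta> k = 1 then C k else s 1) [1..<n+1]) \<subseteq> alg"
  "x \<in> set (map (\<lambda>k. if \<beta> k = 1 then C k else s 1) [1..<n+1]) \<Longrightarrow> x * x = s 1 \<and> st x = x"
  unfolding set_map_upt using C_facts by (auto simp flip: s_mult)

lemma Cp_alg [simp]: "Cp \<beta> \<in> alg"
  unfolding Cp_def by (rule lprod_alg[OF Cp_list(1)])

lemma Cp_inv: "Cp \<beta> * st (Cp \<beta>) = s 1" "st (Cp \<beta>) * Cp \<beta> = s 1"
  unfolding Cp_def by (rule lprod_invol[OF Cp_list(1)[of \<beta>] Cp_list(2)[of _ \<beta>]], assumption)+

lemma Cp_invl: "Cp \<beta> * (st (Cp \<beta>) * v) = s 1 * v" "st (Cp \<beta>) * (Cp \<beta> * v) = s 1 * v"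
  using Cp_inv by (simp_all add: mult.assoc[symmetric])

lemma C_swap: "i \<in> {1..n} \<Longrightarrow> j \<in> {1..n} \<Longrightarrow> i \<noteq> j \<Longrightarrow> C i * C j = s (-1) * (C j * C i)"
  using C_anti[of i j] C_facts by (simp add: s_uminus mult.assoc[symmetric])

lemma lprod_C_pass:
  assumes "set ks \<subseteq> {1..n}" "distinct ks" "x \<in> {1..n}" "x \<notin> set ks"
  shows "lprod (map (\<lambda>k. if \<gamma> k = 1 then C k else s 1) ks) * C x =
    s ((-1) ^ card {k \<in> set ks. \<gamma> k = 1}) * (C x * lprod (map (\<lambda>k. if \<gamma> k = 1 then C k else s 1) ks))"
  using assms
proof (induction ks)
  case Nil
  then show ?case using C_facts by simp
next
  case (Cons k ks)
  let ?L = "lprod (map (\<lambda>k. if \<gamma> k = 1 then C k else s 1) ks)" and ?e = "(-1::'k) ^ card {k \<in> set ks. \<gamma> k = 1}"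
  have IH: "?L * C x = s ?e * (C x * ?L)" using Cons by simp
  have L: "?L \<in> alg" using Cons.prems C_facts by (intro lprod_alg) auto
  have c: "C x \<in> alg" "C k \<in> alg" using Cons.prems C_facts by auto
  show ?case
  proof (cases "\<gamma> k = 1")
    case True
    have e: "{j. (j = k \<or> j \<in> set ks) \<and> \<gamma> j = 1} = insert k {j \<in> set ks. \<gamma> j = 1}" using True by auto
    have "card {j \<in> set (k # ks). \<gamma> j = 1} = Suc (card {j \<in> set ks. \<gamma> j = 1})"
      using Cons.prems(2) by (simp add: e)
    then have p: "(-1::'k) ^ card {j \<in> set (k # ks). \<gamma> j = 1} = ?e * (-1)" by simp
    have "C k * (C x * ?L) = s (-1) * (C x * (C k * ?L))"
      using C_swap[of k x] Cons.prems by (simp add: mult.assoc[symmetric])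
    then have "C k * (?L * C x) = s (?e * (-1)) * (C x * (C k * ?L))"
      unfolding IH using c by (simp only: alg_left s_left)
    then show ?thesis unfolding p using True by (simp add: mult.assoc)
  next
    case False
    have "{j. (j = k \<or> j \<in> set ks) \<and> \<gamma> j = 1} = {j \<in> set ks. \<gamma> j = 1}" using False by auto
    then show ?thesis using False IH c L by (simp add: mult.assoc[symmetric])
  qed
qed

text \<open>C_x passes the generators of larger index, each with a sign, and is then inserted or
  cancelled at its own place.\<close>

lemma Cp_C:
  assumes x: "x \<in> {1..n}" and g: "zsupp \<gamma> \<subseteq> {1..n}"
  shows "Cp \<gamma> * C x = s (sgz \<gamma> x) * Cp (flip \<gamma> x)"
proof -
  let ?f = "\<lambda>(\<gamma>::zvec) k. if \<gamma> k = 1 then C k else s 1"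
  have ls: "[1..<n+1] = [1..<x] @ [x] @ [Suc x..<n+1]"
  proof -
    have "[1..<n+1] = [1..<x] @ [x..<n+1]" using x upt_add_eq_append[of 1 x "n + 1 - x"] by (simp del: upt_Suc)
    moreover have "[x..<n+1] = x # [Suc x..<n+1]" using x by (intro upt_conv_Cons) auto
    ultimately show ?thesis by simp
  qed
  let ?A = "lprod (map (?f \<gamma>) [1..<x])" and ?B = "lprod (map (?f \<gamma>) [Suc x..<n+1])"
  have al: "set (map (?f \<gamma>') ks) \<subseteq> alg" if "set ks \<subseteq> {1..n}" for ks \<gamma>' using that C_facts by auto
  have r: "set [Suc x..<n+1] \<subseteq> {1..n}" "set ([x] @ [Suc x..<n+1]) \<subseteq> {1..n}" using x unfolding set_append set_upt by auto
  note B = al[OF r(1)] and xB = al[OF r(2)]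
  have split: "Cp \<gamma>' = lprod (map (?f \<gamma>') [1..<x]) * (?f \<gamma>' x * lprod (map (?f \<gamma>') [Suc x..<n+1]))" for \<gamma>'
  proof -
    have "Cp \<gamma>' = lprod (map (?f \<gamma>') [1..<x] @ map (?f \<gamma>') ([x] @ [Suc x..<n+1]))"
      by (simp only: Cp_def ls map_append append_assoc)
    also have "\<dots> = lprod (map (?f \<gamma>') [1..<x]) * lprod (map (?f \<gamma>') ([x] @ [Suc x..<n+1]))"
      by (rule lprod_append[OF xB])
    finally show ?thesis by (simp only: map_append list.map append.simps lprod_simps)
  qed
  have same: "map (?f (flip \<gamma> x)) [1..<x] = map (?f \<gamma>) [1..<x]" "map (?f (flip \<gamma> x)) [Suc x..<n+1] = map (?f \<gamma>) [Suc x..<n+1]"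
  proof -
    have fl: "flip \<gamma> x k = \<gamma> k" if "k \<noteq> x" for k using that by (simp add: flip_def)
    have m: "map (?f (flip \<gamma> x)) ks = map (?f \<gamma>) ks" if "x \<notin> set ks" for ks
      using that fl by (induction ks) auto
    show "map (?f (flip \<gamma> x)) [1..<x] = map (?f \<gamma>) [1..<x]" by (rule m) simp
    show "map (?f (flip \<gamma> x)) [Suc x..<n+1] = map (?f \<gamma>) [Suc x..<n+1]" by (rule m) (simp only: set_upt atLeastLessThan_iff, simp)
  qed
  have pass: "?B * C x = s (sgz \<gamma> x) * (C x * ?B)"
  proof -
    have "{k \<in> set [Suc x..<n+1]. \<gamma> k = 1} = {k \<in> zsupp \<gamma>. x < k}"
      using g unfolding set_upt zsupp_def by fastforce
    moreover have "x \<notin> set [Suc x..<n+1]" unfolding set_upt by simp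
    ultimately show ?thesis using lprod_C_pass[OF r(1) distinct_upt x, of \<gamma>] by (simp only: sgz_def zcount_gt_def not_False_eq_True simp_thms)
  qed
  have c: "C x \<in> alg" "?A \<in> alg" "?B \<in> alg"
  proof -
    have "set [1..<x] \<subseteq> {1..n}" using x unfolding set_upt by auto
    then show "?A \<in> alg" by (intro lprod_alg al)
  qed (rule C_facts[OF x], rule lprod_alg[OF B])
  have "?f \<gamma> x * C x = ?f (flip \<gamma> x) x"
    using C_facts[OF x] by (cases "\<gamma> x = 1") (auto simp: flip_def bit_not_one_iff)
  then have fx: "?f \<gamma> x * (C x * ?B) = ?f (flip \<gamma> x) x * ?B" by (simp only: mult.assoc[symmetric])
  have fa: "?f \<gamma> x \<in> alg" using c(1) by simp
  have "Cp \<gamma> * C x = ?A * (?f \<gamma> x * (?B * C x))" unfolding split[of \<gamma>] by (simp only: mult.assoc)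
  also have "\<dots> = s (sgz \<gamma> x) * (?A * (?f \<gamma> x * (C x * ?B)))"
    unfolding pass using c fa by (simp only: alg_left)
  also have "\<dots> = s (sgz \<gamma> x) * Cp (flip \<gamma> x)" unfolding fx split[of "flip \<gamma> x"] same ..
  finally show ?thesis .
qed

lemma lprod_sgn:
  assumes "\<And>x. x \<in> set xs \<Longrightarrow> \<exists>c. c * c = 1 \<and> x * M = s c * (M * x)" "set xs \<subseteq> alg" "M \<in> alg"
  shows "\<exists>c. c * c = 1 \<and> lprod xs * M = s c * (M * lprod xs)"
  using assms(1,2)
proof (induction xs)
  case Nil
  then show ?case using assms(3) by (intro exI[of _ 1]) simp
next
  case (Cons x xs)
  obtain c where c: "c * c = 1" "lprod xs * M = s c * (M * lprod xs)" using Cons by auto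
  obtain d where d: "d * d = 1" "x * M = s d * (M * x)" using Cons.prems by auto
  have x: "x \<in> alg" using Cons.prems by simp
  have "x * lprod xs * M = s c * ((x * M) * lprod xs)" using x c(2) by (simp add: mult.assoc alg_left)
  then have "lprod (x # xs) * M = s (c * d) * (M * lprod (x # xs))" unfolding d(2) by (simp add: mult.assoc s_left)
  moreover have "(c * d) * (c * d) = (c * c) * (d * d)" by (simp only: ac_simps)
  ultimately show ?case using c d by (intro exI[of _ "c * d"]) simp
qed

text \<open>Only c^2 = 1 is recorded, since the sign will appear once for a monomial and once for
  its inverse.\<close>

lemma Cp_sgn: assumes j: "j \<in> {1..n}"
  shows "\<exists>c. c * c = 1 \<and> Cp \<alpha> * C j = s c * (C j * Cp \<alpha>)"
  unfolding Cp_def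
proof (rule lprod_sgn)
  fix x assume "x \<in> set (map (\<lambda>k. if \<alpha> k = 1 then C k else s 1) [1..<n+1])"
  then obtain k where k: "k \<in> {1..n}" "x = (if \<alpha> k = 1 then C k else s 1)" unfolding set_map_upt by blast
  show "\<exists>c. c * c = 1 \<and> x * C j = s c * (C j * x)"
  proof (cases "x = C k \<and> j \<noteq> k")
    case True
    then show ?thesis using C_swap[OF k(1) j] by (intro exI[of _ "-1"]) auto
  next
    case False
    then show ?thesis using k C_facts[OF j] by (intro exI[of _ 1]) (auto split: if_splits)
  qed
qed (use C_facts[OF j] Cp_list(1) in auto)

lemma Cp_comm:
  assumes "M \<in> alg" "\<And>k. k \<in> {1..n} \<Longrightarrow> k \<in> zsupp \<beta> \<Longrightarrow> M * C k = C k * M"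
  shows "M * Cp \<beta> = Cp \<beta> * M" "M * st (Cp \<beta>) = st (Cp \<beta>) * M"
proof -
  show 1: "M * Cp \<beta> = Cp \<beta> * M"
    unfolding Cp_def
  proof (rule lprod_comm[OF assms(1)])
    fix x assume "x \<in> set (map (\<lambda>k. if \<beta> k = 1 then C k else s 1) [1..<n+1])"
    then obtain k where "k \<in> {1..n}" "x = (if \<beta> k = 1 then C k else s 1)" unfolding set_map_upt by blast
    then show "M * x = x * M" using assms by (auto simp: zsupp_def alg_comm)
  qed
  have "st (Cp \<beta>) * (M * Cp \<beta>) * st (Cp \<beta>) = st (Cp \<beta>) * (Cp \<beta> * M) * st (Cp \<beta>)" unfolding 1 ..
  moreover have "st (Cp \<beta>) * (M * Cp \<beta>) * st (Cp \<beta>) = st (Cp \<beta>) * M"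
    using assms(1) Cp_inv[of \<beta>] by (simp add: mult.assoc)
  moreover have "st (Cp \<beta>) * (Cp \<beta> * M) * st (Cp \<beta>) = M * st (Cp \<beta>)"
    using assms(1) by (simp only: Cp_invl mult.assoc) (simp add: mult.assoc[symmetric])
  ultimately show "M * st (Cp \<beta>) = st (Cp \<beta>) * M" by simp
qed

lemma XiC: assumes k: "k \<in> {1..n}" shows "Xi k * C k = C k * X k"
proof -
  have a: "C k \<in> alg" using k algs by auto
  have "Xi k * C k = Xi k * (C k * Xi k) * X k" using a Xi_X[OF k] by (simp add: mult.assoc)
  also have "\<dots> = Xi k * (X k * C k) * X k" using XC[OF k] by simp
  also have "\<dots> = (Xi k * X k) * C k * X k" by (simp only: mult.assoc)
  finally show ?thesis using a Xi_X[OF k] by simp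
qed

lemma lprod_C_X:
  assumes "set ks \<subseteq> {1..n}" "distinct ks" "x \<in> {1..n}"
  shows "lprod (map (\<lambda>k. if \<gamma> k = 1 then C k else s 1) ks) * X x =
    (if x \<in> set ks \<and> \<gamma> x = 1 then Xi x else X x) * lprod (map (\<lambda>k. if \<gamma> k = 1 then C k else s 1) ks)"
  using assms
proof (induction ks)
  case Nil
  then have "X x \<in> alg" using algs by blast
  then show ?case by simp
next
  case (Cons k ks)
  let ?L = "lprod (map (\<lambda>k. if \<gamma> k = 1 then C k else s 1) ks)"
  have IH: "?L * X x = (if x \<in> set ks \<and> \<gamma> x = 1 then Xi x else X x) * ?L" using Cons by simp
  have a: "X x \<in> alg" "Xi x \<in> alg" "C k \<in> alg" using Cons.prems algs by auto
  have comm: "C k * X x = X x * C k" "C k * Xi x = Xi x * C k" if "k \<noteq> x"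
  proof -
    show 1: "C k * X x = X x * C k" using that XC_comm[of x k] Cons.prems by simp
    have "Xi x * (C k * X x) * Xi x = Xi x * (X x * C k) * Xi x" unfolding 1 ..
    moreover have "Xi x * (C k * X x) * Xi x = Xi x * C k" using a X_Xi[of x] Cons.prems by (simp add: mult.assoc)
    moreover have "Xi x * (X x * C k) * Xi x = (Xi x * X x) * C k * Xi x" by (simp only: mult.assoc)
    ultimately show "C k * Xi x = Xi x * C k" using a Xi_X[of x] Cons.prems by simp
  qed
  show ?case
  proof (cases "\<gamma> k = 1")
    case False
    then have "(x \<in> set (k # ks) \<and> \<gamma> x = 1) = (x \<in> set ks \<and> \<gamma> x = 1)" by auto
    moreover have "lprod (map (\<lambda>k. if \<gamma> k = 1 then C k else s 1) (k # ks)) = ?L"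
    proof -
      have "set (map (\<lambda>k. if \<gamma> k = 1 then C k else s 1) ks) \<subseteq> alg" using Cons.prems C_facts by auto
      then show ?thesis using False by simp
    qed
    ultimately show ?thesis using IH by simp
  next
    case True
    show ?thesis
    proof (cases "k = x")
      case True
      then have "x \<notin> set ks" using Cons.prems by simp
      then have "C x * (?L * X x) = Xi x * (C x * ?L)"
        using IH XiC[of x] Cons.prems by (simp add: mult.assoc[symmetric])
      then show ?thesis using True \<open>\<gamma> k = 1\<close> by (simp add: mult.assoc)
    next
      case False
      let ?Y = "if x \<in> set ks \<and> \<gamma> x = 1 then Xi x else X x"
      have "C k * (?Y * ?L) = ?Y * (C k * ?L)" using comm[OF False] by (simp add: mult.assoc[symmetric])
      then show ?thesis using True False IH by (simp add: mult.assoc)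
    qed
  qed
qed

lemma Eb_alg [simp]: "Eb u \<beta> \<in> alg"
proof -
  have "set (map (\<lambda>k. ev (if \<beta> k = 1 then Xi k else X k) (lag k (bp u k))) [1..<n+1]) \<subseteq> alg" using algs by auto
  then show ?thesis unfolding Eb_def by (rule lprod_alg)
qed

text \<open>C^\<beta> turns X_k into its inverse exactly where \<beta> is 1, and so carries the
  idempotent with all exponents 1 to the one with exponents given by \<nu>.\<close>

lemma Cp_E: "Eb u \<beta> * Cp \<beta> = Cp \<beta> * E u" "st (Cp \<beta>) * Eb u \<beta> = E u * st (Cp \<beta>)"
proof -
  have X: "Cp \<beta> * X k = (if \<beta> k = 1 then Xi k else X k) * Cp \<beta>" if "k \<in> {1..n}" for k
    using lprod_C_X[of "[1..<n+1]" k \<beta>] that unfolding Cp_def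
    by (simp add: atLeastLessThanSuc_atLeastAtMost del: upt_Suc)
  show 1: "Eb u \<beta> * Cp \<beta> = Cp \<beta> * E u"
    unfolding Eb_def E_def
  proof (rule lprod_swap[symmetric])
    fix k assume "k \<in> set [1..<n+1]"
    then have k: "k \<in> {1..n}" by auto
    then show "Cp \<beta> * ev (X k) (lag k (bp u k)) = ev (if \<beta> k = 1 then Xi k else X k) (lag k (bp u k)) * Cp \<beta>"
      using algs X[OF k] by (intro ev_swap) auto
  qed simp
  have "st (Cp \<beta>) * (Eb u \<beta> * Cp \<beta>) * st (Cp \<beta>) = st (Cp \<beta>) * (Cp \<beta> * E u) * st (Cp \<beta>)" unfolding 1 ..
  then show "st (Cp \<beta>) * Eb u \<beta> = E u * st (Cp \<beta>)"
    using Eb_alg Cp_inv[of \<beta>] by (simp add: Cp_invl mult.assoc)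
qed

end

section \<open>The signs\<close>

context hc_star_lam
begin

lemma Ceq_C: "i \<in> {1..n} \<Longrightarrow> j \<in> {1..n} \<Longrightarrow> l \<in> {1..n} \<Longrightarrow> l \<noteq> i \<Longrightarrow> l \<noteq> j \<Longrightarrow> C l * (C i * C j) = C i * C j * C l"
proof -
  assume a: "i \<in> {1..n}" "j \<in> {1..n}" "l \<in> {1..n}" "l \<noteq> i" "l \<noteq> j"
  have "C l * (C i * C j) = - (C i * (C l * C j))" using C_anti[of l i] a by (simp add: mult.assoc[symmetric])
  also have "C l * C j = - (C j * C l)" using C_anti[of l j] a by simp
  finally show ?thesis by (simp add: mult.assoc)
qed

abbreviation xt :: "tableau \<Rightarrow> nat \<Rightarrow> nat" where "xt t p \<equiv> xs_tab bb lam t p"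
abbreviation hr :: nat where "hr \<equiv> tnum bb lam div 2"

definition ef :: "tableau \<Rightarrow> nat \<Rightarrow> 'a" where "ef t k = C (xt t (2*k - 1)) * C (xt t (2*k))"
definition gf :: "tableau \<Rightarrow> nat \<Rightarrow> 'a" where "gf t k = s 1 + s (hsqrt h (-1)) * ef t k"
definition gm :: "tableau \<Rightarrow> 'a" where "gm t = s (inverse (2 ^ hr)) * lprod (map (gf t) [1..<hr+1])"
text \<open>The element \<Theta>, cut off after m factors so that its properties can be proved by
  induction.\<close>

definition TH :: "tableau \<Rightarrow> nat \<Rightarrow> 'a" where "TH t m = lprod (map (\<lambda>j. C (xt t (2*j - 1))) [1..<m+1])"

lemma hr_idx: "k \<in> {1..hr} \<Longrightarrow> 2*k - 1 \<in> {1..tnum bb lam} \<and> 2*k \<in> {1..tnum bb lam}"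
  by auto

lemma set_map_upto: "set (map f [1..<m+1]) = f ` {1..m}"
  by (simp add: atLeastLessThanSuc_atLeastAtMost del: upt_Suc)

lemma upt_snoc: "[1..<Suc m + 1] = [1..<m+1] @ [Suc m]"
  by simp

context
  fixes t assumes t: "t \<in> Std bb lam"
begin

lemma odd_range: "k \<in> {1..hr} \<Longrightarrow> xt t (2*k - 1) \<in> {1..n}" "k \<in> {1..hr} \<Longrightarrow> xt t (2*k) \<in> {1..n}"
  using xs_range[OF t] hr_idx by blast+

lemma odd_alg [simp]: "k \<in> {1..hr} \<Longrightarrow> C (xt t (2*k - 1)) \<in> alg" "k \<in> {1..hr} \<Longrightarrow> C (xt t (2*k)) \<in> alg"
  using odd_range C_facts by blast+

lemma ef_alg [simp]: "k \<in> {1..hr} \<Longrightarrow> ef t k \<in> alg"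
  unfolding ef_def by (intro alg_mult odd_alg)

lemma gf_alg [simp]: "k \<in> {1..hr} \<Longrightarrow> gf t k \<in> alg"
  unfolding gf_def by simp

lemma gfs_alg: "m \<le> hr \<Longrightarrow> set (map (gf t) [1..<m+1]) \<subseteq> alg"
  by (auto simp del: upt_Suc)

lemma gm_alg [simp]: "gm t \<in> alg"
  unfolding gm_def using lprod_alg[OF gfs_alg[of hr]] by simp

lemma TH_alg [simp]: "m \<le> hr \<Longrightarrow> TH t m \<in> alg"
  unfolding TH_def by (rule lprod_alg) (auto simp del: upt_Suc One_nat_def)

lemma TH_Suc: "Suc m \<le> hr \<Longrightarrow> TH t (Suc m) = TH t m * C (xt t (2 * Suc m - 1))"
proof -
  assume m: "Suc m \<le> hr"
  then have c: "C (xt t (2 * Suc m - 1)) \<in> alg" by (intro odd_alg) simp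
  have "TH t (Suc m) = lprod (map (\<lambda>j. C (xt t (2*j - 1))) [1..<m+1] @ [C (xt t (2 * Suc m - 1))])"
    unfolding TH_def upt_snoc by (simp only: map_append list.map)
  then show ?thesis using c by (simp only: lprod_append TH_def set_simps insert_subset empty_subsetI lprod_simps alg_one_right simp_thms)
qed

lemma TH_0: "TH t 0 = s 1"
  by (simp add: TH_def)

lemma xt_ne: "k \<in> {1..hr} \<Longrightarrow> j \<in> {1..hr} \<Longrightarrow> j \<noteq> k \<Longrightarrow>
  xt t (2*j - 1) \<noteq> xt t (2*k - 1) \<and> xt t (2*j - 1) \<noteq> xt t (2*k) \<and> xt t (2*j) \<noteq> xt t (2*k - 1) \<and> xt t (2*j) \<noteq> xt t (2*k)"
proof -
  assume a: "k \<in> {1..hr}" "j \<in> {1..hr}" "j \<noteq> k"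
  note i = xs_inj[OF t]
  have "2*j - 1 \<noteq> 2*k - 1" "2*j-1 \<noteq> 2*k" "2*j \<noteq> 2*k-1" "2*j\<noteq>2*k"
    using a unfolding atLeastAtMost_iff by presburger+
  then show ?thesis using i hr_idx[OF a(1)] hr_idx[OF a(2)] by blast
qed

lemma xt_ne': "k \<in> {1..hr} \<Longrightarrow> xt t (2*k - 1) \<noteq> xt t (2*k)"
proof -
  assume a: "k \<in> {1..hr}"
  have "2*k - 1 \<noteq> 2*k" using a by auto
  then show ?thesis using xs_inj[OF t] hr_idx[OF a] by blast
qed

lemma C_gf: assumes "k \<in> {1..hr}" "j \<in> {1..n}" "j \<noteq> xt t (2*k - 1)" "j \<noteq> xt t (2*k)"
  shows "C j * gf t k = gf t k * C j" "C j * st (gf t k) = st (gf t k) * C j"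
proof -
  have c: "C j \<in> alg" using assms C_facts by blast
  show 1: "C j * gf t k = gf t k * C j"
    unfolding gf_def ef_def using Ceq_C[OF odd_range(1)[OF assms(1)] odd_range(2)[OF assms(1)] assms(2-4)] c
    by (simp add: distrib_left distrib_right alg_left mult.assoc)
  have "st (C j * gf t k) = st (gf t k * C j)" unfolding 1 ..
  then show "C j * st (gf t k) = st (gf t k) * C j"
    using c assms by (simp add: st_mult C_facts(3)[OF assms(2)])
qed

lemma st_gf: assumes k: "k \<in> {1..hr}"
  shows "st (gf t k) = s 1 - s (hsqrt h (-1)) * ef t k"
proof -
  have "st (ef t k) = - ef t k"
    unfolding ef_def using k st_C[OF odd_range(1)[OF k]] st_C[OF odd_range(2)[OF k]]
      C_anti[OF odd_range(2)[OF k] odd_range(1)[OF k]] xt_ne'[OF k]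
    by (simp del: One_nat_def add: st_mult)
  then show ?thesis unfolding gf_def using k by (simp add: st_add st_mult alg_comm)
qed

text \<open>Conjugation by one of the two generators changes the sign of their product, and so does
  \<open>st\<close>; the two effects cancel.\<close>

lemma C_gf_flip: assumes k: "k \<in> {1..hr}"
  shows "C (xt t (2*k - 1)) * st (gf t k) = gf t k * C (xt t (2*k - 1))"
proof -
  let ?a = "C (xt t (2*k - 1))" and ?b = "C (xt t (2*k))"
  have a: "?a \<in> alg" by (rule odd_alg[OF k])
  have "?a * ef t k = - (ef t k * ?a)"
  proof -
    have "?a * (?a * ?b) = ?a * - (?b * ?a)" using C_anti[OF odd_range(1)[OF k] odd_range(2)[OF k] xt_ne'[OF k]] by simp
    then show ?thesis unfolding ef_def by (simp only: mult.assoc mult_minus_right)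
  qed
  then show ?thesis unfolding st_gf[OF k] unfolding gf_def using a
    by (simp add: left_diff_distrib right_diff_distrib distrib_left distrib_right alg_left mult.assoc)
qed

text \<open>The factors of \<Theta> belonging to other pairs commute with the k-th factor of
  \<gamma>; passing the one with index k removes the star.\<close>

lemma TH_gf: assumes k: "k \<in> {1..hr}" shows "m \<le> hr \<Longrightarrow> TH t m * st (gf t k) = (if k \<le> m then gf t k else st (gf t k)) * TH t m"
proof (induction m)
  case 0
  then show ?case using k by (simp add: TH_0)
next
  case (Suc m)
  let ?c = "C (xt t (2 * Suc m - 1))"
  have m: "Suc m \<in> {1..hr}" using Suc by simp
  note TH = TH_Suc[OF Suc.prems]
  show ?case
  proof (cases "k = Suc m")
    case True
    have "TH t m * gf t k = gf t k * TH t m"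
    proof -
      show ?thesis unfolding TH_def
      proof (rule lprod_comm[symmetric])
        fix x assume "x \<in> set (map (\<lambda>j. C (xt t (2*j - 1))) [1..<m+1])"
        then obtain j where j: "j \<in> {1..m}" "x = C (xt t (2*j - 1))" unfolding set_map_upto by blast
        then have j': "j \<in> {1..hr}" "j \<noteq> k" using True m by auto
        then show "gf t k * x = x * gf t k" unfolding j(2)
          using xt_ne[OF k j'] by (intro C_gf(1)[OF k odd_range(1)[OF j'(1)], symmetric]) auto
      qed (use k in simp)
    qed
    then have "TH t m * (gf t k * ?c) = gf t k * (TH t m * ?c)" by (simp add: mult.assoc[symmetric])
    then show ?thesis unfolding TH using C_gf_flip[OF m] True by (simp add: mult.assoc)
  next
    case False
    have "?c * st (gf t k) = st (gf t k) * ?c"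
      using xt_ne[OF k m] False by (intro C_gf(2)[OF k odd_range(1)[OF m]]) auto
    then have "TH t (Suc m) * st (gf t k) = (TH t m * st (gf t k)) * ?c" unfolding TH by (simp add: mult.assoc)
    then show ?thesis using Suc False TH by (simp add: mult.assoc)
  qed
qed

lemma gf_comm: assumes "k \<in> {1..hr}" "j \<in> {1..hr}" shows "gf t j * gf t k = gf t k * gf t j"
proof (cases "j = k")
  case False
  have "ef t j * gf t k = gf t k * ef t j"
    unfolding ef_def using C_gf(1)[OF assms(1) odd_range(1)[OF assms(2)]] C_gf(1)[OF assms(1) odd_range(2)[OF assms(2)]]
      xt_ne[OF assms False] by (simp add: mult.assoc) (simp add: mult.assoc[symmetric])
  then show ?thesis unfolding gf_def[of _ j] using assms by (simp add: distrib_left distrib_right alg_left mult.assoc)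
qed simp

lemma lprod_rev_comm:
  "set xs \<subseteq> alg \<Longrightarrow> (\<And>x y. x \<in> set xs \<Longrightarrow> y \<in> set xs \<Longrightarrow> x * y = y * x) \<Longrightarrow> lprod (rev xs) = lprod xs"
proof (induction xs)
  case (Cons x xs)
  have x: "x \<in> alg" using Cons.prems by simp
  then have "lprod (rev (x # xs)) = lprod xs * x" using Cons by (simp add: lprod_append)
  also have "\<dots> = x * lprod xs" using Cons.prems x by (intro lprod_comm[symmetric]) auto
  finally show ?case by simp
qed simp

lemma TH_gm: "TH t hr * st (gm t) = gm t * TH t hr"
proof -
  let ?ks = "[1..<hr+1]"
  have L: "lprod (map (gf t) ?ks) \<in> alg" by (rule lprod_alg[OF gfs_alg[of hr]]) simp
  have "st (lprod (map (gf t) ?ks)) = lprod (rev (map st (map (gf t) ?ks)))" by (rule st_lprod[OF gfs_alg[of hr]]) simp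
  also have "\<dots> = lprod (map (\<lambda>k. st (gf t k)) (rev ?ks))" by (simp only: rev_map map_map o_def)
  finally have st: "st (lprod (map (gf t) ?ks)) = lprod (map (\<lambda>k. st (gf t k)) (rev ?ks))" .
  have "TH t hr * lprod (map (\<lambda>k. st (gf t k)) (rev ?ks)) = lprod (map (gf t) (rev ?ks)) * TH t hr"
  proof (rule lprod_swap)
    fix k assume "k \<in> set (rev ?ks)"
    then have "k \<in> {1..hr}" by auto
    then show "TH t hr * st (gf t k) = gf t k * TH t hr" using TH_gf[of k hr] by simp
  qed simp
  also have "lprod (map (gf t) (rev ?ks)) = lprod (map (gf t) ?ks)"
    unfolding rev_map[symmetric]
  proof (rule lprod_rev_comm[OF gfs_alg[of hr]])
    fix x y assume "x \<in> set (map (gf t) ?ks)" "y \<in> set (map (gf t) ?ks)"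
    then show "x * y = y * x" unfolding set_map_upto using gf_comm by auto
  qed simp
  finally have *: "TH t hr * st (lprod (map (gf t) ?ks)) = lprod (map (gf t) ?ks) * TH t hr" unfolding st .
  have "st (gm t) = s (inverse (2 ^ hr)) * st (lprod (map (gf t) ?ks))"
    unfolding gm_def using L by (simp add: st_mult alg_comm del: upt_Suc)
  then show ?thesis using * unfolding gm_def by (simp add: alg_left mult.assoc del: upt_Suc)
qed

lemma TH_inv: "m \<le> hr \<Longrightarrow> TH t m * st (TH t m) = s 1" "m \<le> hr \<Longrightarrow> st (TH t m) * TH t m = s 1"
proof -
  assume m: "m \<le> hr"
  let ?xs = "map (\<lambda>j. C (xt t (2*j - 1))) [1..<m+1]"
  have x: "x \<in> alg \<and> x * x = s 1 \<and> st x = x" if x: "x \<in> set ?xs" for x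
  proof -
    obtain j where "j \<in> {1..m}" "x = C (xt t (2*j - 1))" using x unfolding set_map_upto by auto
    then show ?thesis using C_facts[OF odd_range(1)[of j]] m by auto
  qed
  then show "TH t m * st (TH t m) = s 1" "st (TH t m) * TH t m = s 1"
    unfolding TH_def by (intro lprod_invol, blast, blast)+
qed

lemma st_gm_TH: "st (gm t) * st (TH t hr) = st (TH t hr) * gm t"
proof -
  have "st (TH t hr) * (TH t hr * st (gm t)) * st (TH t hr) = st (TH t hr) * (gm t * TH t hr) * st (TH t hr)" unfolding TH_gm ..
  then show ?thesis using TH_inv[of hr] by (simp add: mult.assoc) (simp add: mult.assoc[symmetric])
qed

text \<open>\<gamma> is built from the paired diagonal entries. For odd t the last one, x_t, has no
  partner, so it behaves like an entry off the diagonal.\<close>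

lemma C_gm:
  assumes j: "j \<in> {1..n}" and nj: "j \<notin> Dtab bb lam t \<or> odd (tnum bb lam) \<and> j = xt t (tnum bb lam)"
  shows "C j * gm t = gm t * C j" "C j * st (gm t) = st (gm t) * C j"
proof -
  have c: "C j \<in> alg" using j C_facts by blast
  have ne: "j \<noteq> xt t p" if p: "p \<in> {1..2*hr}" for p
  proof -
    have p1: "p \<in> {1..tnum bb lam}" using p by auto
    show ?thesis
    proof (cases "j \<in> Dtab bb lam t")
      case True
      then have o: "odd (tnum bb lam)" "j = xt t (tnum bb lam)" using nj by auto
      then have "p \<noteq> tnum bb lam" "tnum bb lam \<in> {1..tnum bb lam}" using p by (auto elim!: oddE)
      then show ?thesis using o xs_inj[OF t p1] by blast
    next
      case False
      then show ?thesis using xs_diag[OF t p1] by auto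
    qed
  qed
  have "C j * lprod (map (gf t) [1..<hr+1]) = lprod (map (gf t) [1..<hr+1]) * C j"
  proof (rule lprod_comm[OF c])
    fix x assume "x \<in> set (map (gf t) [1..<hr+1])"
    then obtain k where k: "k \<in> {1..hr}" "x = gf t k" unfolding set_map_upto by blast
    then have "2*k - 1 \<in> {1..2*hr}" "2*k \<in> {1..2*hr}" by auto
    then show "C j * x = x * C j" unfolding k(2) by (intro C_gf(1)[OF k(1) j] ne)
  qed
  then show 1: "C j * gm t = gm t * C j" unfolding gm_def using c by (simp add: alg_left mult.assoc del: upt_Suc)
  have "st (C j * gm t) = st (gm t * C j)" unfolding 1 ..
  then show "C j * st (gm t) = st (gm t) * C j" using c by (simp add: st_mult C_facts(3)[OF j])
qed

lemma gm_E: "gm t * E t = E t * gm t"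
proof -
  have "E t * lprod (map (gf t) [1..<hr+1]) = lprod (map (gf t) [1..<hr+1]) * E t"
  proof (rule lprod_comm[OF E_alg])
    fix x assume "x \<in> set (map (gf t) [1..<hr+1])"
    then obtain k where k: "k \<in> {1..hr}" "x = gf t k" unfolding set_map_upto by blast
    have "C (xt t (2*k-1)) * E t = E t * C (xt t (2*k-1))" "C (xt t (2*k)) * E t = E t * C (xt t (2*k))"
      using C_E[OF t] xs_diag[OF t] hr_idx[OF k(1)] by blast+
    then have "E t * ef t k = ef t k * E t" unfolding ef_def by (simp only: mult.assoc) (simp only: mult.assoc[symmetric])
    then show "E t * x = x * E t" unfolding k(2) gf_def using k by (simp add: distrib_left distrib_right alg_left mult.assoc)
  qed
  then show ?thesis unfolding gm_def by (simp add: alg_left mult.assoc del: upt_Suc)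
qed

end

end

context hc_star_lam
begin

definition zfl :: "tableau \<Rightarrow> nat \<Rightarrow> zvec \<Rightarrow> zvec" where
  "zfl t m \<gamma> = (\<lambda>k. if k \<in> {xt t (2*j - 1) | j. j \<in> {1..m}} then \<gamma> k + 1 else \<gamma> k)"

text \<open>The even sign of the statement with its sum and its count of pairs cut off at m; the
  full one is m = \<open>hr\<close> (\<open>sgn_even_eq\<close>).\<close>

definition sgnp :: "tableau \<Rightarrow> nat \<Rightarrow> zvec \<Rightarrow> 'k" where
  "sgnp t m \<gamma> = (\<Prod>j = 1..m. sgz \<gamma> (xt t (2*j - 1))) * (-1) ^ Nr bb lam t m"

lemma flip_insert: "x \<notin> S \<Longrightarrow> (\<lambda>k. if k \<in> insert x S then \<gamma> k + 1 else \<gamma> k) = flip (\<lambda>k. if k \<in> S then \<gamma> k + 1 else \<gamma> k) x"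
  unfolding flip_def by auto

lemma zhat_zfl: "zhat bb lam t \<gamma> = zfl t hr \<gamma>"
  unfolding zhat_def zfl_def ..

lemma zfl_zfl [simp]: "zfl t m (zfl t m \<gamma>) = \<gamma>"
  unfolding zfl_def by (auto simp: fun_eq_iff)

lemma zfl_0: "zfl t 0 \<gamma> = \<gamma>"
  unfolding zfl_def by auto

lemma sgnp_sq [simp]: "sgnp t m \<gamma> * sgnp t m \<gamma> = 1"
proof -
  have "(\<Prod>j = 1..m. sgz \<gamma> (xt t (2*j - 1)) :: 'k) * (\<Prod>j = 1..m. sgz \<gamma> (xt t (2*j - 1))) = 1"
    unfolding prod.distrib[symmetric] by simp
  moreover have "((-1::'k) ^ Nr bb lam t m) * (-1) ^ Nr bb lam t m = 1" by (simp flip: power_mult_distrib)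
  ultimately show ?thesis unfolding sgnp_def
    by (simp only: mult.assoc mult.left_commute[of "(-1) ^ Nr bb lam t m"] mult_1_right)
qed

lemma Nr_Suc: "Nr bb lam t (Suc m) = Nr bb lam t m + card {j \<in> {1..m}. xt t (2 * Suc m - 1) < xt t (2*j - 1)}"
proof -
  let ?P = "\<lambda>r. {(j', j). 1 \<le> j' \<and> j' < j \<and> j \<le> r \<and> xt t (2*j - 1) < xt t (2*j' - 1)}"
  let ?Q = "{j \<in> {1..m}. xt t (2 * Suc m - 1) < xt t (2*j - 1)}"
  have "?P (Suc m) = ?P m \<union> (\<lambda>j. (j, Suc m)) ` ?Q" by (auto simp: le_Suc_eq)
  moreover have "finite (?P m)" by (rule finite_subset[of _ "{1..m} \<times> {1..m}"]) auto
  moreover have "?P m \<inter> (\<lambda>j. (j, Suc m)) ` ?Q = {}" by auto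
  moreover have "card ((\<lambda>j. (j, Suc m)) ` ?Q) = card ?Q" by (intro card_image inj_onI) auto
  ultimately show ?thesis unfolding Nr_def by (simp add: card_Un_disjoint)
qed

lemma card_Suc_filter:
  "card {j \<in> {1..Suc m}. P j} = card {j \<in> {1..m}. P j} + (if P (Suc m) then 1 else (0::nat))"
proof -
  have "{j \<in> {1..Suc m}. P j} = (if P (Suc m) then insert (Suc m) {j \<in> {1..m}. P j} else {j \<in> {1..m}. P j})"
    by (auto simp: le_Suc_eq)
  then show ?thesis by auto
qed

context
  fixes t assumes t: "t \<in> Std bb lam"
begin

lemma zfl_Suc: assumes "Suc m \<le> hr" shows "zfl t (Suc m) \<gamma> = flip (zfl t m \<gamma>) (xt t (2 * Suc m - 1))"
proof -
  have ne: "xt t (2 * Suc m - 1) \<notin> {xt t (2*j - 1) | j. j \<in> {1..m}}"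
  proof
    assume "xt t (2 * Suc m - 1) \<in> {xt t (2*j - 1) | j. j \<in> {1..m}}"
    then obtain j where j: "xt t (2 * Suc m - 1) = xt t (2*j - 1)" "j \<in> {1..m}" by blast
    then have "Suc m \<in> {1..hr}" "j \<in> {1..hr}" "j \<noteq> Suc m" using assms by auto
    from xt_ne[OF t this] show False using j(1) by simp
  qed
  have "{xt t (2*j - 1) | j. j \<in> {1..Suc m}} = insert (xt t (2 * Suc m - 1)) {xt t (2*j - 1) | j. j \<in> {1..m}}"
  proof -
    have "{1..Suc m} = insert (Suc m) {1..m}" by auto
    moreover have F: "{F j | j. j \<in> insert a A} = insert (F a) {F j | j. j \<in> A}" for F :: "nat \<Rightarrow> nat" and a A by blast
    ultimately show ?thesis using F[of "\<lambda>j. xt t (2*j - 1)" "Suc m" "{1..m}"] by (simp only:)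
  qed
  then show "zfl t (Suc m) \<gamma> = flip (zfl t m \<gamma>) (xt t (2 * Suc m - 1))"
    unfolding zfl_def by (simp only: flip_insert[OF ne])
qed

lemma zfl_supp: "zsupp \<gamma> \<subseteq> Dtab bb lam t \<Longrightarrow> m \<le> hr \<Longrightarrow> zsupp (zfl t m \<gamma>) \<subseteq> Dtab bb lam t"
proof
  fix k assume s: "zsupp \<gamma> \<subseteq> Dtab bb lam t" "m \<le> hr" and k: "k \<in> zsupp (zfl t m \<gamma>)"
  show "k \<in> Dtab bb lam t"
  proof (cases "k \<in> {xt t (2*j - 1) | j. j \<in> {1..m}}")
    case True
    then obtain j where j: "k = xt t (2*j - 1)" "j \<in> {1..m}" by blast
    then have "j \<in> {1..hr}" using s by auto
    then show ?thesis unfolding j(1) using xs_diag[OF t] hr_idx by blast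
  next
    case False
    then have "zfl t m \<gamma> k = \<gamma> k" unfolding zfl_def by (rule if_not_P)
    then show ?thesis using s k by (auto simp: zsupp_def)
  qed
qed

lemma D_sub: "zsupp \<gamma> \<subseteq> Dtab bb lam t \<Longrightarrow> zsupp \<gamma> \<subseteq> {1..n}"
  using Dtab_range[OF t] by blast

lemma sgz_zfl:
  assumes g: "zsupp \<gamma> \<subseteq> Dtab bb lam t"
  shows "m \<le> hr \<Longrightarrow> sgz (zfl t m \<gamma>) y = (-1::'k) ^ card {j \<in> {1..m}. y < xt t (2*j - 1)} * sgz \<gamma> y"
proof (induction m)
  case (Suc m)
  have fin: "finite (zsupp (zfl t m \<gamma>))"
    using D_sub[OF zfl_supp[OF g]] Suc.prems by (meson Suc_leD finite_atLeastAtMost finite_subset)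
  show ?case unfolding zfl_Suc[OF Suc.prems] sgz_flip[OF fin] card_Suc_filter using Suc by simp
qed (simp add: zfl_0)

text \<open>The factors of \<Theta> are absorbed one by one. At each stage the vector has already
  been flipped at the earlier odd positions; those lying to the right of the new one contribute
  exactly the pairs counted by \<open>Nr\<close>.\<close>

lemma Cp_TH:
  assumes g: "zsupp \<gamma> \<subseteq> Dtab bb lam t"
  shows "m \<le> hr \<Longrightarrow> Cp \<gamma> * TH t m = s (sgnp t m \<gamma>) * Cp (zfl t m \<gamma>)"
proof (induction m)
  case 0
  have "{(j', j). 1 \<le> j' \<and> j' < j \<and> j \<le> 0 \<and> xt t (2*j - 1) < xt t (2*j' - 1)} = {}" by auto
  then have "Nr bb lam t 0 = 0" unfolding Nr_def by (metis card.empty)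
  then show ?case by (simp add: TH_0[OF t] zfl_0 sgnp_def)
next
  case (Suc m)
  let ?x = "xt t (2 * Suc m - 1)"
  have m: "Suc m \<in> {1..hr}" using Suc by simp
  have x: "?x \<in> {1..n}" by (rule odd_range(1)[OF t m])
  have sub: "zsupp (zfl t m \<gamma>) \<subseteq> {1..n}" using D_sub[OF zfl_supp[OF g]] Suc.prems by simp
  have "Cp \<gamma> * TH t (Suc m) = s (sgnp t m \<gamma>) * (Cp (zfl t m \<gamma>) * C ?x)"
    unfolding TH_Suc[OF t Suc.prems] using Suc by (simp add: mult.assoc[symmetric])
  also have "\<dots> = s (sgnp t m \<gamma> * sgz (zfl t m \<gamma>) ?x) * Cp (zfl t (Suc m) \<gamma>)"
    unfolding Cp_C[OF x sub] zfl_Suc[OF Suc.prems] by (rule s_left)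
  also have "sgnp t m \<gamma> * sgz (zfl t m \<gamma>) ?x = sgnp t (Suc m) \<gamma>"
    unfolding sgz_zfl[OF g Suc_leD[OF Suc.prems]] sgnp_def Nr_Suc by (simp add: power_add mult_ac)
  finally show ?case .
qed

lemma Cp_hat:
  assumes g: "zsupp \<alpha> \<subseteq> Dtab bb lam t"
  shows "Cp \<alpha> = s (sgnp t hr (zhat bb lam t \<alpha>)) * (Cp (zhat bb lam t \<alpha>) * TH t hr)"
proof -
  have g': "zsupp (zhat bb lam t \<alpha>) \<subseteq> Dtab bb lam t" unfolding zhat_zfl by (rule zfl_supp[OF g]) simp
  show ?thesis unfolding Cp_TH[OF g' le_refl] s_left sgnp_sq by (simp add: zhat_zfl)
qed

definition Ga :: "zvec \<Rightarrow> 'a" where "Ga \<alpha> = Cp \<alpha> * (gm t * st (Cp \<alpha>))"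

lemma Ga_alg [simp]: "Ga \<alpha> \<in> alg"
  unfolding Ga_def using gm_alg[OF t] by simp

text \<open>C_j passes the monomial and its inverse with the same sign, and these signs cancel;
  \<gamma> itself involves diagonal entries only.\<close>

lemma C_Ga: assumes j: "j \<in> {1..n}" "j \<notin> Dtab bb lam t" shows "Ga \<alpha> * C j = C j * Ga \<alpha>"
proof -
  obtain c where c: "c * c = 1" "Cp \<alpha> * C j = s c * (C j * Cp \<alpha>)" using Cp_sgn[OF j(1)] by blast
  have a: "C j \<in> alg" "st (C j) = C j" using C_facts j by auto
  have "st (Cp \<alpha> * C j) = st (s c * (C j * Cp \<alpha>))" unfolding c(2) ..
  then have "C j * st (Cp \<alpha>) = s c * (st (Cp \<alpha>) * C j)" using a by (simp add: st_mult alg_comm)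
  then have d: "st (Cp \<alpha>) * C j = s c * (C j * st (Cp \<alpha>))" using c(1) a by (simp add: s_left)
  have "Ga \<alpha> * C j = s c * (Cp \<alpha> * ((gm t * C j) * st (Cp \<alpha>)))"
    unfolding Ga_def using d gm_alg[OF t] by (simp add: mult.assoc alg_left)
  also have "gm t * C j = C j * gm t" using C_gm(1)[OF t j(1)] j by simp
  also have "s c * (Cp \<alpha> * (C j * gm t * st (Cp \<alpha>))) = s c * ((Cp \<alpha> * C j) * (gm t * st (Cp \<alpha>)))" by (simp add: mult.assoc)
  also have "\<dots> = C j * Ga \<alpha>" unfolding c(2) Ga_def using c(1) a by (simp add: s_left mult.assoc)
  finally show ?thesis .
qed

lemma Ga_Cp: assumes "zsupp \<beta> \<subseteq> {1..n} - Dtab bb lam t"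
  shows "Ga \<alpha> * Cp \<beta> = Cp \<beta> * Ga \<alpha>" "Ga \<alpha> * st (Cp \<beta>) = st (Cp \<beta>) * Ga \<alpha>"
  by (rule Cp_comm; use assms C_Ga in auto)+

lemma E_Cp: assumes "zsupp \<alpha> \<subseteq> Dtab bb lam t"
  shows "E t * Cp \<alpha> = Cp \<alpha> * E t" "E t * st (Cp \<alpha>) = st (Cp \<alpha>) * E t"
  by (rule Cp_comm; use assms C_E[OF t] in auto)+

lemma E_Ga: assumes "zsupp \<alpha> \<subseteq> Dtab bb lam t" shows "E t * Ga \<alpha> = Ga \<alpha> * E t"
  unfolding Ga_def
  by (simp only: mult.assoc[symmetric] E_Cp[OF assms]) (simp only: mult.assoc E_Cp[OF assms] gm_E[OF t, symmetric])

definition FU :: "zvec \<Rightarrow> zvec \<Rightarrow> 'a" where "FU \<alpha> \<beta> = Ga \<alpha> * Eb t \<beta>"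

text \<open>The conjugations inside the idempotent are undone by the monomials next to it: C^\<beta>
  turns the weight part back into \<open>E\<close>, and C^\<alpha> cancels against its inverse,
  leaving the bare \<gamma>.\<close>

lemma FU_left:
  assumes "zsupp \<alpha> \<subseteq> Dtab bb lam t" "zsupp \<beta> \<subseteq> {1..n} - Dtab bb lam t"
  shows "FU \<alpha> \<beta> * (Cp \<beta> * (Cp \<alpha> * v)) = Cp \<beta> * (Cp \<alpha> * (gm t * (E t * v)))"
proof -
  have "FU \<alpha> \<beta> * (Cp \<beta> * (Cp \<alpha> * v)) = Ga \<alpha> * ((Eb t \<beta> * Cp \<beta>) * (Cp \<alpha> * v))" unfolding FU_def by (simp only: mult.assoc)
  also have "\<dots> = (Ga \<alpha> * Cp \<beta>) * ((E t * Cp \<alpha>) * v)" unfolding Cp_E by (simp only: mult.assoc)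
  also have "\<dots> = Cp \<beta> * (Ga \<alpha> * Cp \<alpha> * (E t * v))" unfolding Ga_Cp[OF assms(2)] E_Cp[OF assms(1)] by (simp only: mult.assoc)
  also have "Ga \<alpha> * Cp \<alpha> = Cp \<alpha> * gm t" unfolding Ga_def using gm_alg[OF t] Cp_inv(2)[of \<alpha>] by (simp add: mult.assoc)
  finally show ?thesis by (simp only: mult.assoc)
qed

lemma FU_right:
  assumes "zsupp \<alpha> \<subseteq> Dtab bb lam t" "zsupp \<beta> \<subseteq> {1..n} - Dtab bb lam t"
  shows "st (Cp \<beta>) * FU \<alpha> \<beta> = E t * (Cp \<alpha> * (gm t * (st (Cp \<alpha>) * st (Cp \<beta>))))"
proof -
  have "st (Cp \<beta>) * FU \<alpha> \<beta> = (st (Cp \<beta>) * Ga \<alpha>) * Eb t \<beta>" unfolding FU_def by (simp only: mult.assoc)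
  also have "\<dots> = Ga \<alpha> * (st (Cp \<beta>) * Eb t \<beta>)" unfolding Ga_Cp(2)[OF assms(2), symmetric] by (simp only: mult.assoc)
  also have "\<dots> = (Ga \<alpha> * E t) * st (Cp \<beta>)" unfolding Cp_E by (simp only: mult.assoc)
  also have "\<dots> = E t * (Ga \<alpha> * st (Cp \<beta>))" unfolding E_Ga[OF assms(1), symmetric] by (simp only: mult.assoc)
  finally show ?thesis unfolding Ga_def by (simp only: mult.assoc)
qed

text \<open>\<open>cyp\<close> and \<open>syp\<close> measure the difference between C^\<alpha> and
  the monomial of \<alpha>_a: a generator at x_t and a sign. Both are trivial for a = 0, which
  allows even and odd t to be treated together.\<close>

definition cyp :: "bit \<Rightarrow> 'a" where "cyp a = (if a = 1 then C (xt t (tnum bb lam)) else s 1)"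
definition syp :: "zvec \<Rightarrow> bit \<Rightarrow> 'k" where "syp \<alpha> a = (if a = 1 then sgz \<alpha> (xt t (tnum bb lam)) else 1)"

lemma zext_Cp:
  assumes "zsupp \<alpha> \<subseteq> Dtab bb lam t" "a = 1 \<longrightarrow> odd (tnum bb lam)"
  shows "st (Cp (zext bb lam t \<alpha> a)) * Cp \<alpha> = s (syp \<alpha> a) * cyp a" "E t * cyp a = cyp a * E t" "cyp a \<in> alg"
    "st (cyp a) = cyp a"
proof -
  have "st (Cp (zext bb lam t \<alpha> a)) * Cp \<alpha> = s (syp \<alpha> a) * cyp a \<and> E t * cyp a = cyp a * E t \<and> cyp a \<in> alg \<and> st (cyp a) = cyp a"
  proof (cases "a = 1")
    case False
    then have "a = 0" by simp
    moreover have "zext bb lam t \<alpha> 0 = \<alpha>" unfolding zext_def Let_def add_0_right fun_upd_triv ..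
    ultimately show ?thesis using Cp_inv(2)[of \<alpha>] by (simp add: cyp_def syp_def)
  next
    case True
    let ?y = "xt t (tnum bb lam)"
    have p: "tnum bb lam \<in> {1..tnum bb lam}" using assms(2) True by (auto elim: oddE)
    have y: "?y \<in> {1..n}" by (rule xs_range[OF t p])
    note c = C_facts[OF y]
    have "Cp \<alpha> * C ?y = s (sgz \<alpha> ?y) * Cp (flip \<alpha> ?y)" by (rule Cp_C[OF y D_sub[OF assms(1)]])
    then have "s (sgz \<alpha> ?y) * (Cp \<alpha> * C ?y) = s (sgz \<alpha> ?y) * (s (sgz \<alpha> ?y) * Cp (flip \<alpha> ?y))" by simp
    then have "Cp (flip \<alpha> ?y) = s (sgz \<alpha> ?y) * (Cp \<alpha> * C ?y)" by (simp add: s_left)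
    then have "st (Cp (flip \<alpha> ?y)) = s (sgz \<alpha> ?y) * (C ?y * st (Cp \<alpha>))" using c by (simp add: st_mult alg_comm)
    then have "st (Cp (flip \<alpha> ?y)) * Cp \<alpha> = s (sgz \<alpha> ?y) * C ?y" using c Cp_inv(2)[of \<alpha>] by (simp add: mult.assoc)
    moreover have "zext bb lam t \<alpha> a = flip \<alpha> ?y" unfolding zext_def flip_def True by (simp add: Let_def)
    ultimately show ?thesis using True c C_E[OF t xs_diag[OF t p]] by (simp add: cyp_def syp_def)
  qed
  then show "st (Cp (zext bb lam t \<alpha> a)) * Cp \<alpha> = s (syp \<alpha> a) * cyp a" "E t * cyp a = cyp a * E t" "cyp a \<in> alg"
    "st (cyp a) = cyp a" by auto
qed

end

section \<open>Sandwiched elements under the involution\<close>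

definition sandU :: "tableau \<Rightarrow> zvec \<Rightarrow> zvec \<Rightarrow> 'a \<Rightarrow> zvec \<Rightarrow> tableau \<Rightarrow> zvec \<Rightarrow> zvec \<Rightarrow> 'a" where
  "sandU u \<alpha>' \<beta>' M \<alpha>1 t \<alpha> \<beta> =
    lprod [FU u \<alpha>' \<beta>', Cp \<beta>', Cp \<alpha>', M, st (Cp \<alpha>1), st (Cp \<beta>), FU t \<alpha> \<beta>]"

text \<open>What remains of a sandwich when the weight idempotents have been moved inwards and
  absorbed into N, and the monomials around the right \<gamma> have been reduced to
  \<open>cyp\<close>.\<close>

definition core :: "tableau \<Rightarrow> zvec \<Rightarrow> zvec \<Rightarrow> 'a \<Rightarrow> bit \<Rightarrow> tableau \<Rightarrow> zvec \<Rightarrow> zvec \<Rightarrow> 'a" where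
  "core u \<alpha>' \<beta>' N a t \<alpha> \<beta> = Cp \<beta>' * (Cp \<alpha>' * (gm u * (N * (cyp t a * (gm t * (st (Cp \<alpha>) * st (Cp \<beta>)))))))"

lemma sandU_core:
  assumes u: "u \<in> Std bb lam" and t: "t \<in> Std bb lam"
    and al: "zsupp \<alpha>' \<subseteq> Dtab bb lam u" "zsupp \<alpha> \<subseteq> Dtab bb lam t"
    and be: "zsupp \<beta>' \<subseteq> {1..n} - Dtab bb lam u" "zsupp \<beta> \<subseteq> {1..n} - Dtab bb lam t"
    and M: "M \<in> alg" "E u * (M * E t) = M * E t" and a: "a = 1 \<longrightarrow> odd (tnum bb lam)"
  shows "sandU u \<alpha>' \<beta>' M (zext bb lam t \<alpha> a) t \<alpha> \<beta> = s (syp t \<alpha> a) * core u \<alpha>' \<beta>' (M * E t) a t \<alpha> \<beta>"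
proof -
  let ?z = "Cp (zext bb lam t \<alpha> a)" and ?r = "gm t * (st (Cp \<alpha>) * st (Cp \<beta>))"
  note z = zext_Cp[OF t al(2) a]
  have FU: "FU t \<alpha> \<beta> \<in> alg" unfolding FU_def[OF t] using Ga_alg[OF t] Eb_alg by simp
  have zE: "E t * st ?z = st ?z * E t"
  proof -
    have "s (syp t \<alpha> a) * cyp t a * st (Cp \<alpha>) = st ?z" unfolding z(1)[symmetric] using Cp_inv(1)[of \<alpha>] by (simp add: mult.assoc)
    then have e: "st ?z = s (syp t \<alpha> a) * (cyp t a * st (Cp \<alpha>))" by (simp add: mult.assoc)
    have "E t * (cyp t a * st (Cp \<alpha>)) = cyp t a * st (Cp \<alpha>) * E t"
      by (simp only: mult.assoc[symmetric] z(2)) (simp only: mult.assoc E_Cp(2)[OF t al(2)])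
    then show ?thesis unfolding e by (simp add: alg_left mult.assoc)
  qed
  have "sandU u \<alpha>' \<beta>' M (zext bb lam t \<alpha> a) t \<alpha> \<beta> =
      FU u \<alpha>' \<beta>' * (Cp \<beta>' * (Cp \<alpha>' * (M * (st ?z * (st (Cp \<beta>) * FU t \<alpha> \<beta>)))))"
    unfolding sandU_def using FU by (simp add: mult.assoc)
  also have "\<dots> = Cp \<beta>' * (Cp \<alpha>' * (gm u * (E u * (M * (st ?z * (E t * (Cp \<alpha> * ?r)))))))"
    unfolding FU_right[OF t al(2) be(2)] FU_left[OF u al(1) be(1)] ..
  also have "st ?z * (E t * (Cp \<alpha> * ?r)) = E t * ((st ?z * Cp \<alpha>) * ?r)"
    by (simp only: mult.assoc[symmetric] zE)
  also have "E u * (M * (E t * ((st ?z * Cp \<alpha>) * ?r))) = E u * (M * E t) * ((st ?z * Cp \<alpha>) * ?r)"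
    by (simp only: mult.assoc)
  also have "\<dots> = s (syp t \<alpha> a) * (M * E t * (cyp t a * ?r))" unfolding M(2) z(1) using M by (simp add: alg_left mult.assoc)
  finally show ?thesis unfolding core_def using gm_alg[OF u] by (simp add: alg_left)
qed

text \<open>\<open>st\<close> reverses the product and puts a star on both \<gamma>. Writing each
  C^\<alpha> as its hatted version times \<Theta> removes these stars and leaves the \<Theta> of t
  on the left of N' and the inverse \<Theta> of u on its right; since N' intertwines the two, they
  cancel. For a = 1 the \<Theta> also passes the generator at x_t, which anticommutes with each of
  its \<open>hr\<close> factors.\<close>

lemma core_star:
  assumes u: "u \<in> Std bb lam" and t: "t \<in> Std bb lam"
    and al: "zsupp \<alpha>' \<subseteq> Dtab bb lam u" "zsupp \<alpha> \<subseteq> Dtab bb lam t"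
    and N: "N \<in> alg" "N' = st N" "\<forall>p \<in> {1..tnum bb lam}. C (xt t p) * N' = N' * C (xt u p)"
    and a: "a = 1 \<longrightarrow> odd (tnum bb lam)"
  shows "st (core u \<alpha>' \<beta>' N a t \<alpha> \<beta>) =
    s (sgnp u hr (zhat bb lam u \<alpha>') * sgnp t hr (zhat bb lam t \<alpha>) * (if a = 1 then (-1) ^ hr else 1)) *
    core t (zhat bb lam t \<alpha>) \<beta> N' a u (zhat bb lam u \<alpha>') \<beta>'"
proof -
  let ?A = "zhat bb lam t \<alpha>" and ?A' = "zhat bb lam u \<alpha>'"
  let ?o = "sgnp t hr ?A" and ?o' = "sgnp u hr ?A'" and ?m = "if a = 1 then (-1) ^ hr else (1::'k)"
  note z = zext_Cp[OF t al(2) a] and zu = zext_Cp[OF u al(1) a]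
  have ag: "gm t \<in> alg" "gm u \<in> alg" "TH t hr \<in> alg" "TH u hr \<in> alg" "cyp t a \<in> alg" "cyp u a \<in> alg" "N \<in> alg" "N' \<in> alg"
    using gm_alg t u TH_alg N z zu by auto
  note al_l = alg_left[OF Cp_alg] alg_left[OF ag(1)] alg_left[OF ag(3)] alg_left[OF ag(5)] alg_left[OF ag(8)]
    alg_left[OF st_alg[OF ag(4)]]
  have N'TH: "m \<le> hr \<Longrightarrow> TH t m * N' = N' * TH u m" for m
  proof (induction m)
    case 0
    then show ?case using TH_0[OF t] TH_0[OF u] ag by simp
  next
    case (Suc m)
    then have "Suc m \<in> {1..hr}" by simp
    then have "C (xt t (2 * Suc m - 1)) * N' = N' * C (xt u (2 * Suc m - 1))" using hr_idx N(3) by blast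
    then have "TH t (Suc m) * N' = (TH t m * N') * C (xt u (2 * Suc m - 1))" unfolding TH_Suc[OF t Suc.prems] by (simp only: mult.assoc)
    then show ?case using Suc unfolding TH_Suc[OF u Suc.prems] by (simp add: mult.assoc)
  qed
  have cyN: "cyp t a * N' = N' * cyp u a"
  proof (cases "a = 1")
    case True
    then have "tnum bb lam \<in> {1..tnum bb lam}" using a by (auto elim: oddE)
    then show ?thesis using N(3) True t u by (simp add: cyp_def)
  qed (use t u ag in \<open>simp add: cyp_def\<close>)
  have THc: "m \<le> hr \<Longrightarrow> TH t m * cyp t a = s (if a = 1 then (-1) ^ m else 1) * (cyp t a * TH t m)" for m
  proof (induction m)
    case 0
    have "(if a = 1 then (-1) ^ 0 else (1::'k)) = 1" by simp
    then show ?case using alg_one[OF ag(5)] alg_one_right[OF ag(5)] by (simp only: TH_0[OF t])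
  next
    case (Suc m)
    let ?c = "C (xt t (2 * Suc m - 1))" and ?e = "if a = 1 then -1 else (1::'k)"
    have m: "Suc m \<in> {1..hr}" using Suc by simp
    have c: "?c \<in> alg" using C_facts odd_range(1)[OF t m] by blast
    have "?c * cyp t a = s ?e * (cyp t a * ?c)"
    proof (cases "a = 1")
      case True
      have p: "tnum bb lam \<in> {1..tnum bb lam}" "2 * Suc m - 1 \<in> {1..tnum bb lam}" "2 * Suc m - 1 \<noteq> tnum bb lam"
        using a True m by (auto elim!: oddE)
      then have "xt t (2 * Suc m - 1) \<noteq> xt t (tnum bb lam)" using xs_inj[OF t] by blast
      then have "?c * C (xt t (tnum bb lam)) = s (-1) * (C (xt t (tnum bb lam)) * ?c)"
        by (rule C_swap[OF xs_range[OF t p(2)] xs_range[OF t p(1)]])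
      then show ?thesis using True t by (simp add: cyp_def)
    qed (use t c in \<open>simp add: cyp_def\<close>)
    then have "TH t (Suc m) * cyp t a = s ?e * ((TH t m * cyp t a) * ?c)"
      unfolding TH_Suc[OF t Suc.prems] using TH_alg[OF t Suc_leD[OF Suc.prems]] by (simp add: mult.assoc alg_left)
    then show ?case using Suc unfolding TH_Suc[OF t Suc.prems] by (auto simp: mult.assoc s_left)
  qed
  have e1: "Cp \<alpha> * (st (gm t) * v) = s ?o * (Cp ?A * (gm t * (TH t hr * v)))" for v
  proof -
    have "Cp \<alpha> * (st (gm t) * v) = s ?o * (Cp ?A * ((TH t hr * st (gm t)) * v))"
      by (subst Cp_hat[OF t al(2)]) (simp only: mult.assoc)
    then show ?thesis unfolding TH_gm[OF t] by (simp only: mult.assoc)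
  qed
  have e2: "st (gm u) * (st (Cp \<alpha>') * v) = s ?o' * (st (TH u hr) * (gm u * (st (Cp ?A') * v)))" for v
  proof -
    have "st (Cp \<alpha>') = s ?o' * (st (TH u hr) * st (Cp ?A'))"
      by (subst Cp_hat[OF u al(1)]) (use ag in \<open>simp add: st_mult alg_comm\<close>)
    then have "st (gm u) * (st (Cp \<alpha>') * v) = s ?o' * ((st (gm u) * st (TH u hr)) * (st (Cp ?A') * v))"
      using ag by (simp add: alg_left mult.assoc)
    then show ?thesis unfolding st_gm_TH[OF u] by (simp only: mult.assoc)
  qed
  have e3: "TH t hr * (cyp t a * (N' * (st (TH u hr) * v))) = s ?m * (N' * (cyp u a * v))" if v: "v \<in> alg" for v
  proof -
    have "TH t hr * (cyp t a * (N' * (st (TH u hr) * v))) = (TH t hr * cyp t a) * (N' * (st (TH u hr) * v))" by (simp only: mult.assoc)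
    also have "\<dots> = s ?m * (cyp t a * (TH t hr * N') * (st (TH u hr) * v))" unfolding THc[OF le_refl] by (simp only: mult.assoc)
    also have "\<dots> = s ?m * ((cyp t a * N') * ((TH u hr * st (TH u hr)) * v))" unfolding N'TH[OF le_refl] by (simp only: mult.assoc)
    also have "(TH u hr * st (TH u hr)) * v = v" using TH_inv(1)[OF u le_refl] v by simp
    finally show ?thesis unfolding cyN by (simp only: mult.assoc)
  qed
  have "st (core u \<alpha>' \<beta>' N a t \<alpha> \<beta>) = Cp \<beta> * (Cp \<alpha> * (st (gm t) * (cyp t a * (N' * (st (gm u) * (st (Cp \<alpha>') * st (Cp \<beta>')))))))"
    unfolding core_def using ag z(4) N(2) by (simp add: st_mult st_st mult.assoc)
  also have "\<dots> = s ?o * (s ?o' * (Cp \<beta> * (Cp ?A * (gm t * (TH t hr * (cyp t a * (N' * (st (TH u hr) * (gm u * (st (Cp ?A') * st (Cp \<beta>')))))))))))"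
    unfolding e1 e2 by (simp only: al_l)
  also have "\<dots> = s ?o * (s ?o' * (s ?m * (Cp \<beta> * (Cp ?A * (gm t * (N' * (cyp u a * (gm u * (st (Cp ?A') * st (Cp \<beta>'))))))))))"
    using ag by (subst e3) (simp_all only: al_l alg_mult st_alg Cp_alg)
  also have "\<dots> = s (?o * (?o' * ?m)) * core t ?A \<beta> N' a u ?A' \<beta>'"
    unfolding core_def s_left mult.assoc ..
  also have "?o * (?o' * ?m) = ?o' * ?o * ?m" by (simp only: ac_simps)
  finally show ?thesis .
qed

text \<open>What the star computation uses of an intertwiner M and its partner M'. The relation is
  closed under composition, so it also covers the products through w.\<close>

definition inter :: "tableau \<Rightarrow> tableau \<Rightarrow> 'a \<Rightarrow> 'a \<Rightarrow> bool" where
  "inter u t M M' \<longleftrightarrow> M \<in> alg \<and> M' \<in> alg \<and> E u * (M * E t) = M * E t \<and> st (M * E t) = M' * E u \<and>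
     (\<forall>p \<in> {1..tnum bb lam}. C (xt t p) * M' = M' * C (xt u p))"

lemma inter_PhiS: assumes u: "u \<in> Std bb lam" and t: "t \<in> Std bb lam"
  shows "inter u t (PhiS u t) (PhiS t u)"
  unfolding inter_def using PhiS_alg[OF u t] PhiS_alg[OF t u] PhiS_E[OF u t] st_PhiS[OF u t]
    PhiS_C[OF t u xs_diag[OF u]] xs_perm[OF t u] by simp

lemma inter_comp:
  assumes w: "w \<in> Std bb lam" and i: "inter u w M M'" "inter w t N N'"
  shows "inter u t (M * N) (N' * M')"
proof -
  note i = i[unfolded inter_def]
  have e: "M * N * E t = (M * E w) * (N * E t)" using i by (simp add: mult.assoc)
  have "C (xt t p) * (N' * M') = N' * M' * C (xt u p)" if p: "p \<in> {1..tnum bb lam}" for p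
  proof -
    have "C (xt t p) * N' = N' * C (xt w p)" "C (xt w p) * M' = M' * C (xt u p)" using i p by auto
    then show ?thesis by (metis mult.assoc)
  qed
  moreover have "E u * (M * N * E t) = M * N * E t" unfolding e using i by (simp add: mult.assoc[symmetric])
  moreover have "st (M * N * E t) = N' * M' * E u"
  proof -
    have "E w * st (M * E w) = st (M * E w * E w)" using i st_E[OF w] by (simp add: st_mult)
    then have "E w * (M' * E u) = M' * E u" using i E_E[OF w] by (simp add: mult.assoc)
    moreover have "st ((M * E w) * (N * E t)) = N' * E w * (M' * E u)" using i by (subst st_mult) auto
    ultimately show ?thesis unfolding e by (simp add: mult.assoc)
  qed
  ultimately show ?thesis unfolding inter_def using i by simp
qed

lemma inter_N:
  assumes u: "u \<in> Std bb lam" and t: "t \<in> Std bb lam" and i: "inter u t M M'"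
  shows "M * E t \<in> alg" "M' * E u = st (M * E t)" "E t * (M' * E u) = M' * E u"
    "\<forall>p \<in> {1..tnum bb lam}. C (xt t p) * (M' * E u) = (M' * E u) * C (xt u p)"
proof -
  note i = i[unfolded inter_def]
  show "M * E t \<in> alg" "M' * E u = st (M * E t)" using i by auto
  have "E t * st (M * E t) = st (M * E t * E t)" using i st_E[OF t] by (simp add: st_mult)
  then show "E t * (M' * E u) = M' * E u" using i E_E[OF t] by (simp add: mult.assoc)
  show "\<forall>p \<in> {1..tnum bb lam}. C (xt t p) * (M' * E u) = (M' * E u) * C (xt u p)"
  proof
    fix p assume p: "p \<in> {1..tnum bb lam}"
    then have "C (xt t p) * M' = M' * C (xt u p)" using i by blast
    then show "C (xt t p) * (M' * E u) = (M' * E u) * C (xt u p)"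
      by (simp only: mult.assoc[symmetric]) (simp only: mult.assoc C_E[OF u xs_diag[OF u p]])
  qed
qed

lemma sandU_star:
  assumes u: "u \<in> Std bb lam" and t: "t \<in> Std bb lam"
    and al: "zsupp \<alpha>' \<subseteq> Dtab bb lam u" "zsupp \<alpha> \<subseteq> Dtab bb lam t"
    and be: "zsupp \<beta>' \<subseteq> {1..n} - Dtab bb lam u" "zsupp \<beta> \<subseteq> {1..n} - Dtab bb lam t"
    and i: "inter u t M M'" and a: "a = 1 \<longrightarrow> odd (tnum bb lam)"
  shows "s (syp t \<alpha> a) * st (sandU u \<alpha>' \<beta>' M (zext bb lam t \<alpha> a) t \<alpha> \<beta>) =
    s (sgnp u hr (zhat bb lam u \<alpha>') * sgnp t hr (zhat bb lam t \<alpha>) * (if a = 1 then (-1) ^ hr else 1) * syp u (zhat bb lam u \<alpha>') a) *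
    sandU t (zhat bb lam t \<alpha>) \<beta> M' (zext bb lam u (zhat bb lam u \<alpha>') a) u (zhat bb lam u \<alpha>') \<beta>'"
proof -
  note i' = i[unfolded inter_def] and iN = inter_N[OF u t i]
  have h: "zsupp (zhat bb lam u \<alpha>') \<subseteq> Dtab bb lam u" "zsupp (zhat bb lam t \<alpha>) \<subseteq> Dtab bb lam t"
    unfolding zhat_zfl using zfl_supp[OF u al(1)] zfl_supp[OF t al(2)] by auto
  have sq: "syp t \<gamma> a * syp t \<gamma> a = 1" if "t \<in> Std bb lam" for t \<gamma>
    unfolding syp_def[OF that] by simp
  have c: "core u \<alpha>' \<beta>' (M * E t) a t \<alpha> \<beta> \<in> alg"
    unfolding core_def using gm_alg[OF u] gm_alg[OF t] iN zext_Cp(3)[OF t al(2) a] by simp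
  have 1: "st (sandU u \<alpha>' \<beta>' M (zext bb lam t \<alpha> a) t \<alpha> \<beta>) = s (syp t \<alpha> a) * st (core u \<alpha>' \<beta>' (M * E t) a t \<alpha> \<beta>)"
    using sandU_core[OF u t al be _ _ a] i' c by (simp add: st_mult alg_comm)
  have 2: "sandU t (zhat bb lam t \<alpha>) \<beta> M' (zext bb lam u (zhat bb lam u \<alpha>') a) u (zhat bb lam u \<alpha>') \<beta>' =
      s (syp u (zhat bb lam u \<alpha>') a) * core t (zhat bb lam t \<alpha>) \<beta> (M' * E u) a u (zhat bb lam u \<alpha>') \<beta>'"
    using i' iN by (intro sandU_core[OF t u h(2,1) be(2,1) _ _ a]) auto
  have k: "syp t \<alpha> a * (syp t \<alpha> a * x) = x" for x using sq[OF t, of \<alpha>] by (simp only: mult.assoc[symmetric] mult_1_left)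
  show ?thesis
    unfolding 1 2 core_star[OF u t al iN(1,2,4) a] by (simp only: s_left mult.assoc k sq[OF u] mult_1_right)
qed

lemma sgn_even_eq: "sgn_even bb lam t \<gamma> = sgnp t hr \<gamma>"
  unfolding sgn_even_def sgnp_def sgz_def by (simp add: power_add power_sum)

lemma zhat_flip:
  assumes t: "t \<in> Std bb lam" and o: "odd (tnum bb lam)"
  shows "zhat bb lam t (flip \<alpha> (xt t (tnum bb lam))) = flip (zhat bb lam t \<alpha>) (xt t (tnum bb lam))"
proof -
  let ?y = "xt t (tnum bb lam)"
  have "?y \<noteq> xt t (2*j - 1)" if j: "j \<in> {1..hr}" for j
  proof -
    have "2*j - 1 \<in> {1..tnum bb lam}" "tnum bb lam \<in> {1..tnum bb lam}" "2*j - 1 \<noteq> tnum bb lam" using o j by (auto elim!: oddE)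
    then show ?thesis using xs_inj[OF t] by metis
  qed
  then have "?y \<notin> {xt t (2*j - 1) | j. j \<in> {1..hr}}" by blast
  then show ?thesis unfolding zhat_def flip_def by (auto simp: fun_eq_iff)
qed

text \<open>For odd t the last odd position is x_t itself. The sum over j therefore has one term
  more, and for a = 1 the count of pairs also includes those ending at x_t.\<close>

lemma sgn_odd_eq:
  assumes o: "odd (tnum bb lam)"
  shows "sgn_odd bb lam t \<gamma> a = sgnp t hr \<gamma> * sgz \<gamma> (xt t (tnum bb lam)) *
    (if a = 0 then 1 else (-1) ^ card {j \<in> {1..hr}. xt t (tnum bb lam) < xt t (2*j - 1)})"
proof -
  have h: "(tnum bb lam + 1) div 2 = Suc hr" "2 * Suc hr - 1 = tnum bb lam" using o by (auto elim!: oddE)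
  have sum: "(\<Sum>j = 1..Suc hr. zcount_gt \<gamma> (xt t (2*j - 1))) = zcount_gt \<gamma> (xt t (tnum bb lam)) + (\<Sum>j = 1..hr. zcount_gt \<gamma> (xt t (2*j - 1)))"
  proof -
    have "(\<Sum>j = 1..Suc hr. zcount_gt \<gamma> (xt t (2*j - 1))) = zcount_gt \<gamma> (xt t (2 * Suc hr - 1)) + (\<Sum>j = 1..hr. zcount_gt \<gamma> (xt t (2*j - 1)))"
      by simp
    then show ?thesis unfolding h(2) .
  qed
  have nr: "Nr bb lam t (Suc hr) = Nr bb lam t hr + card {j \<in> {1..hr}. xt t (tnum bb lam) < xt t (2*j - 1)}"
    unfolding Nr_Suc h(2) ..
  have b: "(if a = 0 then tnum bb lam div 2 else (tnum bb lam + 1) div 2) = (if a = 0 then hr else Suc hr)" unfolding h(1) ..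
  show ?thesis
    unfolding sgn_odd_def b unfolding h(1) sum sgnp_def sgz_def
    by (cases "a = 0") (simp_all only: if_True if_False nr power_add power_sum mult_1_right refl, simp_all only: ac_simps)
qed

text \<open>Flipping at y = x_t changes one sign for each odd position left of y. Those right of y
  enter through \<open>Nr\<close> or through comparing \<alpha> with its hat at y. As y is none of
  the first \<open>hr\<close> odd positions, the two numbers add up to \<open>hr\<close>.\<close>

lemma sgn_odd_signs:
  fixes \<alpha> :: zvec
  assumes t: "t \<in> Std bb lam" and o: "odd (tnum bb lam)" and al: "zsupp \<alpha> \<subseteq> Dtab bb lam t"
  defines "\<gamma> \<equiv> zhat bb lam t \<alpha>" and "y \<equiv> xt t (tnum bb lam)"
  shows "sgn_odd bb lam t (zhat bb lam t (zext bb lam t \<alpha> 1)) 0 = sgnp t hr \<gamma> * (-1) ^ hr * sgz \<alpha> y"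
    "sgn_odd bb lam t (zhat bb lam t (zext bb lam t \<alpha> 1)) 1 = sgnp t hr \<gamma> * (-1) ^ hr * sgz \<gamma> y"
    "sgn_odd bb lam t (zhat bb lam t (zext bb lam t \<alpha> 0)) 0 = sgnp t hr \<gamma> * sgz \<gamma> y"
proof -
  let ?g = "card {j \<in> {1..hr}. y < xt t (2*j - 1)}" and ?l = "card {j \<in> {1..hr}. xt t (2*j - 1) < y}"
  have z1: "zext bb lam t \<alpha> 1 = flip \<alpha> y" unfolding zext_def flip_def y_def Let_def ..
  have z0: "zext bb lam t \<alpha> 0 = \<alpha>" unfolding zext_def Let_def add_0_right fun_upd_triv ..
  have zf: "zhat bb lam t (flip \<alpha> y) = flip \<gamma> y" unfolding y_def \<gamma>_def by (rule zhat_flip[OF t o])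
  have g: "zsupp \<gamma> \<subseteq> Dtab bb lam t" unfolding \<gamma>_def zhat_zfl by (rule zfl_supp[OF t al]) simp
  have fin: "finite (zsupp \<gamma>)" using D_sub[OF t g] finite_subset by blast
  have ne: "y \<noteq> xt t (2*j - 1)" if j: "j \<in> {1..hr}" for j
  proof -
    have "2*j - 1 \<in> {1..tnum bb lam}" "tnum bb lam \<in> {1..tnum bb lam}" "2*j - 1 \<noteq> tnum bb lam" using o j by (auto elim!: oddE)
    then show ?thesis unfolding y_def using xs_inj[OF t] by metis
  qed
  have gl: "?g + ?l = hr"
  proof -
    let ?G = "{j \<in> {1..hr}. y < xt t (2*j - 1)}" and ?L = "{j \<in> {1..hr}. xt t (2*j - 1) < y}"
    have "hr = card {1..hr}" by simp
    also have "{1..hr} = ?G \<union> ?L" using ne by force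
    also have "card (?G \<union> ?L) = ?g + ?l" by (intro card_Un_disjoint) auto
    finally show ?thesis by (rule sym)
  qed
  have prod: "(\<Prod>j = 1..m. sgz (flip \<gamma> y) (xt t (2*j - 1)) :: 'k) = (-1) ^ card {j \<in> {1..m}. xt t (2*j - 1) < y} * (\<Prod>j = 1..m. sgz \<gamma> (xt t (2*j - 1)))" for m
  proof -
    have "(\<Prod>j = 1..m. sgz (flip \<gamma> y) (xt t (2*j - 1)) :: 'k) = (\<Prod>j = 1..m. (if xt t (2*j - 1) < y then -1 else 1) * sgz \<gamma> (xt t (2*j - 1)))"
      by (intro prod.cong) (simp_all add: sgz_flip[OF fin])
    then show ?thesis unfolding prod.distrib prod.inter_filter[OF finite_atLeastAtMost, symmetric] by simp
  qed
  have p: "sgnp t hr (flip \<gamma> y) = (-1) ^ ?l * sgnp t hr \<gamma>" unfolding sgnp_def prod by (simp only: mult.assoc)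
  have sy: "sgz (flip \<gamma> y) y = (sgz \<gamma> y :: 'k)" unfolding sgz_flip[OF fin] by simp
  have hat: "sgz \<gamma> y = (-1) ^ ?g * (sgz \<alpha> y :: 'k)" unfolding \<gamma>_def zhat_zfl by (rule sgz_zfl[OF t al le_refl])
  have hr: "(-1::'k) ^ hr = (-1) ^ ?g * (-1) ^ ?l" unfolding power_add[symmetric] gl ..
  show "sgn_odd bb lam t (zhat bb lam t (zext bb lam t \<alpha> 1)) 0 = sgnp t hr \<gamma> * (-1) ^ hr * sgz \<alpha> y"
    unfolding z1 zf sgn_odd_eq[OF o] y_def[symmetric] p sy hat hr by (simp add: mult_ac)
  show "sgn_odd bb lam t (zhat bb lam t (zext bb lam t \<alpha> 1)) 1 = sgnp t hr \<gamma> * (-1) ^ hr * sgz \<gamma> y"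
    unfolding z1 zf sgn_odd_eq[OF o] y_def[symmetric] p sy hr by (simp add: mult_ac)
  show "sgn_odd bb lam t (zhat bb lam t (zext bb lam t \<alpha> 0)) 0 = sgnp t hr \<gamma> * sgz \<gamma> y"
    unfolding z0 \<gamma>_def[symmetric] sgn_odd_eq[OF o] y_def[symmetric] by simp
qed

end

section \<open>The cyclotomic Hecke-Clifford algebra as a ring\<close>

abbreviation hcF :: "nat \<Rightarrow> 'k::field hc_free set" where "hcF n \<equiv> carrier (hc_free_ring n)"

lemma hc_free_ops:
  "mult (hc_free_ring n) = (*)" "one (hc_free_ring n) = 1" "zero (hc_free_ring n) = 0" "add (hc_free_ring n) = (+)"
  unfolding hc_free_ring_def by simp_all

lemma hcF_add: "x \<in> hcF n \<Longrightarrow> y \<in> hcF n \<Longrightarrow> x + y \<in> hcF n"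
  using ring.ring_simprules(1)[OF hc_free_ring_is_ring, of x n y] by (simp add: hc_free_ops)

lemma hcF_mult: "x \<in> hcF n \<Longrightarrow> y \<in> hcF n \<Longrightarrow> x * y \<in> hcF n"
  using ring.ring_simprules(5)[OF hc_free_ring_is_ring, of x n y] by (simp add: hc_free_ops)

lemma hcF_one: "1 \<in> hcF n"
  using ring.ring_simprules(6)[OF hc_free_ring_is_ring, of n] by (simp add: hc_free_ops)

lemma hcF_uminus: "x \<in> hcF n \<Longrightarrow> - x \<in> hcF n"
  unfolding hc_free_ring_def by (simp add: in_keys_iff)

lemma hcF_diff: "x \<in> hcF n \<Longrightarrow> y \<in> hcF n \<Longrightarrow> x - y \<in> hcF n"
  using hcF_add[of x n "- y"] hcF_uminus[of y n] by simp

lemma hcF_gen: "g \<in> hc_gens n \<Longrightarrow> fgen g \<in> hcF n"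
  unfolding hc_free_ring_def fgen_def by simp

lemma hcF_scal: "fscal c \<in> hcF n"
  unfolding hc_free_ring_def fscal_def by (simp add: zero_fword_def)

lemmas hcF_closed = hcF_add hcF_mult hcF_one hcF_uminus hcF_diff hcF_scal

lemma hc_gens_mem [simp]: "GT i \<in> hc_gens n \<longleftrightarrow> i \<in> {1..<n}" "GX i \<in> hc_gens n \<longleftrightarrow> i \<in> {1..n}"
  "GXinv i \<in> hc_gens n \<longleftrightarrow> i \<in> {1..n}" "GC i \<in> hc_gens n \<longleftrightarrow> i \<in> {1..n}"
  unfolding hc_gens_def by auto

lemma hc_rel_carrier: "hc_rel n \<epsilon> x y \<Longrightarrow> x \<in> hcF n \<and> y \<in> hcF n"
  by (induction rule: hc_rel.induct) (auto intro!: hcF_closed hcF_gen)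

text \<open>Scalars sit on the empty word, which is neutral on both sides; so they are central
  although words do not commute.\<close>

lemma fscal_comm: "fscal c * p = p * fscal (c :: 'k::field)"
proof -
  have "Poly_Mapping.single (0 :: hc_gen fword) c * p = p * Poly_Mapping.single 0 c"
  proof (induction p rule: update_induct)
    case (update f a b)
    have "Poly_Mapping.update a b f = f + Poly_Mapping.single a b"
      using update(1) by (intro poly_mapping_eqI) (auto simp: lookup_update lookup_add lookup_single in_keys_iff when_def)
    then show ?case using update by (simp add: distrib_left distrib_right mult_single mult.commute)
  qed simp
  then show ?thesis by (simp add: fscal_def)
qed

lemma fscal_hom: "fscal (a + b) = fscal a + fscal b" "fscal (a * b) = fscal a * fscal b" "fscal 1 = 1"
  unfolding fscal_def by (simp_all add: single_add mult_single)

lemma hc_ideal_ideal: "ideal (hc_ideal h n) (hc_free_ring n)"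
  unfolding hc_ideal_def by (rule ring.genideal_ideal[OF hc_free_ring_is_ring]) (use hc_rel_carrier hcF_diff in blast)

lemma hc_affine_ring: "ring (hc_affine h n)"
  unfolding hc_affine_def by (rule ideal.quotient_is_ring[OF hc_ideal_ideal])

lemma hc_cls_hom: "hc_cls h n \<in> ring_hom (hc_free_ring n) (hc_affine h n)"
proof -
  have "(+>\<^bsub>hc_free_ring n\<^esub>) (hc_ideal h n) \<in> ring_hom (hc_free_ring n) (hc_affine h n)"
    unfolding hc_affine_def by (rule ideal.rcos_ring_hom[OF hc_ideal_ideal])
  moreover have "hc_cls h n = (+>\<^bsub>hc_free_ring n\<^esub>) (hc_ideal h n)" unfolding hc_cls_def by (rule ext) simp
  ultimately show ?thesis by simp
qed

definition hc_fpoly :: "'k::field hc_datum \<Rightarrow> 'k hc_free" where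
  "hc_fpoly h = hc_g (hbul h) * prod_list (map (\<lambda>c. fX 1 + fXi 1 - fscal (qq h c)) (hQ h))"

lemma hc_fpoly_carrier: assumes "1 \<le> n" shows "hc_fpoly h \<in> hcF n"
proof -
  have "prod_list (map (\<lambda>c. fX 1 + fXi 1 - fscal (f c)) Q) \<in> hcF n" for Q :: "'a list" and f :: "'a \<Rightarrow> 'a"
    using assms by (induction Q) (auto intro!: hcF_closed hcF_gen)
  moreover have "hc_g (hbul h) \<in> hcF n"
    using assms unfolding hc_g_def by (cases "hbul h") (auto intro!: hcF_closed hcF_gen)
  ultimately show ?thesis unfolding hc_fpoly_def by (intro hcF_mult)
qed

text \<open>f involves X_1 and its inverse, which are among the generators as soon as n is at least
  1.\<close>

lemma hcf_ideal_ideal: assumes "1 \<le> n" shows "ideal (hcf_ideal h n) (hc_affine h n)"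
  unfolding hcf_ideal_def
proof (rule ring.genideal_ideal[OF hc_affine_ring])
  show "{hc_f h n} \<subseteq> carrier (hc_affine h n)"
    using ring_hom_closed[OF hc_cls_hom hc_fpoly_carrier[OF assms], of h h] unfolding hc_f_def hc_fpoly_def by simp
qed

lemma hcf_ring: "1 \<le> n \<Longrightarrow> ring (hcf h n)"
  unfolding hcf_def by (rule ideal.quotient_is_ring[OF hcf_ideal_ideal])

lemma hcf_cls_hom: assumes "1 \<le> n" shows "hcf_cls h n \<in> ring_hom (hc_free_ring n) (hcf h n)"
proof -
  have "(+>\<^bsub>hc_affine h n\<^esub>) (hcf_ideal h n) \<in> ring_hom (hc_affine h n) (hcf h n)"
    unfolding hcf_def by (rule ideal.rcos_ring_hom[OF hcf_ideal_ideal[OF assms]])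
  then have "(+>\<^bsub>hc_affine h n\<^esub>) (hcf_ideal h n) \<circ> hc_cls h n \<in> ring_hom (hc_free_ring n) (hcf h n)"
    using ring_hom_trans[OF hc_cls_hom] by blast
  moreover have "hcf_cls h n = (+>\<^bsub>hc_affine h n\<^esub>) (hcf_ideal h n) \<circ> hc_cls h n" unfolding hcf_cls_def by (rule ext) simp
  ultimately show ?thesis by simp
qed

context
  fixes h :: "'k::field hc_datum" and n :: nat assumes n: "1 \<le> n"
begin

interpretation H: ring "hcf h n" by (rule hcf_ring[OF n])

lemma cls_closed: "x \<in> hcF n \<Longrightarrow> hcf_cls h n x \<in> carrier (hcf h n)"
  by (rule ring_hom_closed[OF hcf_cls_hom[OF n]])

lemma cls_add: "x \<in> hcF n \<Longrightarrow> y \<in> hcF n \<Longrightarrow> hcf_cls h n (x + y) = hcf_cls h n x \<oplus>\<^bsub>hcf h n\<^esub> hcf_cls h n y"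
  using ring_hom_add[OF hcf_cls_hom[OF n]] by (simp add: hc_free_ops)

lemma cls_mult: "x \<in> hcF n \<Longrightarrow> y \<in> hcF n \<Longrightarrow> hcf_cls h n (x * y) = hcf_cls h n x \<otimes>\<^bsub>hcf h n\<^esub> hcf_cls h n y"
  using ring_hom_mult[OF hcf_cls_hom[OF n]] by (simp add: hc_free_ops)

lemma cls_one: "hcf_cls h n 1 = \<one>\<^bsub>hcf h n\<^esub>"
  using ring_hom_one[OF hcf_cls_hom[OF n]] by (simp add: hc_free_ops)

lemma cls_zero: "hcf_cls h n 0 = \<zero>\<^bsub>hcf h n\<^esub>"
  using ring_hom_zero[OF hcf_cls_hom[OF n] hc_free_ring_is_ring hcf_ring[OF n]] by (simp add: hc_free_ops)

lemma cls_uminus: assumes x: "x \<in> hcF n" shows "hcf_cls h n (- x) = \<ominus>\<^bsub>hcf h n\<^esub> hcf_cls h n x"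
proof -
  have "hcf_cls h n (- x) \<oplus>\<^bsub>hcf h n\<^esub> hcf_cls h n x = \<zero>\<^bsub>hcf h n\<^esub>"
    using cls_add[OF hcF_uminus[OF x] x] cls_zero by simp
  then show ?thesis using H.minus_equality cls_closed x hcF_uminus by metis
qed

lemma cls_diff: "x \<in> hcF n \<Longrightarrow> y \<in> hcF n \<Longrightarrow> hcf_cls h n (x - y) = hcf_cls h n x \<ominus>\<^bsub>hcf h n\<^esub> hcf_cls h n y"
  using cls_add[of x "- y"] cls_uminus[of y] hcF_uminus[of y n] by (simp add: a_minus_def)

lemma cls_surj: assumes "x \<in> carrier (hcf h n)" shows "\<exists>p \<in> hcF n. x = hcf_cls h n p"
proof -
  obtain y where y: "y \<in> carrier (hc_affine h n)" "x = hcf_ideal h n +>\<^bsub>hc_affine h n\<^esub> y"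
    using assms unfolding hcf_def FactRing_simps by auto
  then obtain p where "p \<in> hcF n" "y = hc_ideal h n +>\<^bsub>hc_free_ring n\<^esub> p"
    unfolding hc_affine_def FactRing_simps by auto
  then show ?thesis using y unfolding hcf_cls_def hc_cls_def by blast
qed

lemma cls_rel: assumes r: "hc_rel n (heps h) x y" shows "hcf_cls h n x = hcf_cls h n y"
proof -
  interpret F: ring "hc_free_ring n :: 'k hc_free ring" by (rule hc_free_ring_is_ring)
  interpret I: ideal "hc_ideal h n" "hc_free_ring n" by (rule hc_ideal_ideal)
  have xy: "x \<in> hcF n" "y \<in> hcF n" using hc_rel_carrier[OF r] by auto
  have sub: "{x - y |x y. hc_rel n (heps h) x y} \<subseteq> hcF n" using hc_rel_carrier hcF_diff by blast
  have mem: "x - y \<in> hc_ideal h n" unfolding hc_ideal_def using F.genideal_self[OF sub] r by blast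
  have "x = (x - y) \<oplus>\<^bsub>hc_free_ring n\<^esub> y" by (simp add: hc_free_ops)
  then have "x \<in> hc_ideal h n +>\<^bsub>hc_free_ring n\<^esub> y" using mem unfolding a_r_coset_def r_coset_def by auto
  then have "hc_ideal h n +>\<^bsub>hc_free_ring n\<^esub> x = hc_ideal h n +>\<^bsub>hc_free_ring n\<^esub> y"
    using F.a_repr_independence[of x "hc_ideal h n" y] xy I.a_subgroup by (simp add: I.additive_subgroup_axioms)
  then show ?thesis unfolding hcf_cls_def hc_cls_def by simp
qed

lemma cls_f: "hcf_cls h n (hc_fpoly h) = \<zero>\<^bsub>hcf h n\<^esub>"
proof -
  interpret A: ring "hc_affine h n" by (rule hc_affine_ring)
  interpret J: ideal "hcf_ideal h n" "hc_affine h n" by (rule hcf_ideal_ideal[OF n])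
  have c: "hc_f h n \<in> carrier (hc_affine h n)"
    using ring_hom_closed[OF hc_cls_hom hc_fpoly_carrier[OF n], of h h] unfolding hc_f_def hc_fpoly_def by simp
  then have "hc_f h n \<in> hcf_ideal h n" unfolding hcf_ideal_def by (rule A.genideal_self')
  then have "hcf_ideal h n +>\<^bsub>hc_affine h n\<^esub> hc_f h n = hcf_ideal h n" by (rule J.a_rcos_const)
  then show ?thesis unfolding hcf_cls_def hc_f_def hc_fpoly_def hcf_def FactRing_def by simp
qed

lemma hS_hom: "hS h n (a + b) = hS h n a \<oplus>\<^bsub>hcf h n\<^esub> hS h n b" "hS h n (a * b) = hS h n a \<otimes>\<^bsub>hcf h n\<^esub> hS h n b"
  "hS h n 1 = \<one>\<^bsub>hcf h n\<^esub>" "hS h n a \<in> carrier (hcf h n)"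
  unfolding hS_def fscal_hom
  by (rule cls_add[OF hcF_scal hcF_scal] cls_mult[OF hcF_scal hcF_scal] cls_one cls_closed[OF hcF_scal])+

lemma hgen_closed:
  "i \<in> {1..<n} \<Longrightarrow> hT h n i \<in> carrier (hcf h n)" "i \<in> {1..n} \<Longrightarrow> hX h n i \<in> carrier (hcf h n)"
  "i \<in> {1..n} \<Longrightarrow> hXi h n i \<in> carrier (hcf h n)" "i \<in> {1..n} \<Longrightarrow> hC h n i \<in> carrier (hcf h n)"
  unfolding hT_def hX_def hXi_def hC_def by (auto intro!: cls_closed hcF_gen)

end

section \<open>A ring containing all the algebras\<close>

text \<open>The quotients are rings on a carrier set, whereas the preceding sections live in a type of class
  \<open>ring\<close>. Their product is such a type. The index \<open>(h, m)\<close> stands for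
  \<open>hcf h (m + 1)\<close>: for zero generators the ideal of relations is not defined.\<close>

abbreviation hcp :: "'k::field hc_datum \<times> nat \<Rightarrow> 'k hcf_elem ring" where "hcp p \<equiv> hcf (fst p) (Suc (snd p))"

lemma hcp_ring: "ring (hcp p)"
  by (rule hcf_ring) simp

typedef (overloaded) 'k hc_prod = "{f :: 'k::field hc_datum \<times> nat \<Rightarrow> 'k hcf_elem. \<forall>p. f p \<in> carrier (hcf (fst p) (Suc (snd p)))}"
proof
  show "(\<lambda>p. \<zero>\<^bsub>hcf (fst p) (Suc (snd p))\<^esub>) \<in> {f. \<forall>p. f p \<in> carrier (hcf (fst p) (Suc (snd p)))}"
    using ring.ring_simprules(2)[OF hcp_ring] by blast
qed

setup_lifting type_definition_hc_prod

instantiation hc_prod :: (field) ring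
begin

lift_definition zero_hc_prod :: "'a hc_prod" is "\<lambda>p. \<zero>\<^bsub>hcp p\<^esub>"
  by (rule ring.ring_simprules(2)[OF hcp_ring])
lift_definition plus_hc_prod :: "'a hc_prod \<Rightarrow> 'a hc_prod \<Rightarrow> 'a hc_prod" is "\<lambda>f g p. f p \<oplus>\<^bsub>hcp p\<^esub> g p"
  by (rule ring.ring_simprules(1)[OF hcp_ring])
lift_definition uminus_hc_prod :: "'a hc_prod \<Rightarrow> 'a hc_prod" is "\<lambda>f p. \<ominus>\<^bsub>hcp p\<^esub> f p"
  by (rule ring.ring_simprules(3)[OF hcp_ring])
lift_definition minus_hc_prod :: "'a hc_prod \<Rightarrow> 'a hc_prod \<Rightarrow> 'a hc_prod" is "\<lambda>f g p. f p \<ominus>\<^bsub>hcp p\<^esub> g p"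
  by (rule ring.ring_simprules(4)[OF hcp_ring])
lift_definition times_hc_prod :: "'a hc_prod \<Rightarrow> 'a hc_prod \<Rightarrow> 'a hc_prod" is "\<lambda>f g p. f p \<otimes>\<^bsub>hcp p\<^esub> g p"
  by (rule ring.ring_simprules(5)[OF hcp_ring])

instance
proof
  fix a b c :: "'a hc_prod"
  note r = ring.ring_simprules[OF hcp_ring]
  show "a + b + c = a + (b + c)" by transfer (intro ext r(7); blast)
  show "a + b = b + a" by transfer (intro ext r(10); blast)
  show "0 + a = a" by transfer (intro ext r(8); blast)
  show "- a + a = 0" by transfer (intro ext r(9); blast)
  show "a - b = a + - b" by transfer (simp add: a_minus_def)
  show "a * b * c = a * (b * c)" by transfer (intro ext r(11); blast)
  show "(a + b) * c = a * c + b * c" by transfer (intro ext r(13); blast)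
  show "a * (b + c) = a * b + a * c" by transfer (intro ext r(23); blast)
qed

end

text \<open>The index n - 1 belongs to \<open>hcf h n\<close> because the factors are numbered from
  one generator on. The embedding is additive and multiplicative but sends the unit to a mere
  idempotent, which is the \<open>s 1\<close> of the abstract sections.\<close>

definition iota :: "'k::field hc_datum \<Rightarrow> nat \<Rightarrow> 'k hcf_elem \<Rightarrow> 'k hc_prod" where
  "iota h n x = Abs_hc_prod (\<lambda>p. if p = (h, n - 1) then x else \<zero>\<^bsub>hcp p\<^esub>)"

definition cmp :: "'k::field hc_datum \<Rightarrow> nat \<Rightarrow> 'k hc_prod \<Rightarrow> 'k hcf_elem" where
  "cmp h n u = Rep_hc_prod u (h, n - 1)"

context
  fixes h :: "'k::field hc_datum" and n :: nat assumes n: "1 \<le> n"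
begin

interpretation H: ring "hcf h n" by (rule hcf_ring[OF n])

lemmas hcp_zero = ring.ring_simprules(2)[OF hcp_ring]
lemmas hcp_l_zero = ring.ring_simprules(8)[OF hcp_ring hcp_zero] and hcp_l_null = ring.ring_simprules(24)[OF hcp_ring]

lemma cmp_closed: "cmp h n u \<in> carrier (hcf h n)"
  using Rep_hc_prod[of u] n unfolding cmp_def by (auto simp del: split_paired_All dest!: spec[of _ "(h, n - 1)"])

lemma Rep_iota:
  assumes "x \<in> carrier (hcf h n)" shows "Rep_hc_prod (iota h n x) p = (if p = (h, n - 1) then x else \<zero>\<^bsub>hcp p\<^esub>)"
proof -
  have "(if p = (h, n - 1) then x else \<zero>\<^bsub>hcp p\<^esub>) \<in> carrier (hcp p)" for p
  proof (cases "p = (h, n - 1)")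
    case True
    then show ?thesis using assms n by simp
  next
    case False
    then show ?thesis using hcp_zero by simp
  qed
  then have "(\<lambda>p. if p = (h, n - 1) then x else \<zero>\<^bsub>hcp p\<^esub>) \<in> {f. \<forall>p. f p \<in> carrier (hcp p)}" by blast
  then show ?thesis unfolding iota_def by (simp only: Abs_hc_prod_inverse)
qed

lemma hcp_here: "hcp (h, n - 1) = hcf h n"
  using n by simp

lemma cmp_iota: "x \<in> carrier (hcf h n) \<Longrightarrow> cmp h n (iota h n x) = x"
  unfolding cmp_def by (simp add: Rep_iota)

lemma hc_prod_eqI: "(\<And>p. Rep_hc_prod u p = Rep_hc_prod v p) \<Longrightarrow> u = v"
  by (metis Rep_hc_prod_inject ext)

lemma iota_add: "x \<in> carrier (hcf h n) \<Longrightarrow> y \<in> carrier (hcf h n) \<Longrightarrow> iota h n (x \<oplus>\<^bsub>hcf h n\<^esub> y) = iota h n x + iota h n y"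
  using hcp_here by (intro hc_prod_eqI) (simp add: plus_hc_prod.rep_eq Rep_iota hcp_l_zero)

lemma iota_mult: "x \<in> carrier (hcf h n) \<Longrightarrow> y \<in> carrier (hcf h n) \<Longrightarrow> iota h n (x \<otimes>\<^bsub>hcf h n\<^esub> y) = iota h n x * iota h n y"
  using hcp_here by (intro hc_prod_eqI) (simp add: times_hc_prod.rep_eq Rep_iota hcp_l_null hcp_zero)

lemma iota_zero: "iota h n \<zero>\<^bsub>hcf h n\<^esub> = 0"
  using iota_add[of "\<zero>\<^bsub>hcf h n\<^esub>" "\<zero>\<^bsub>hcf h n\<^esub>"] by simp

lemma iota_uminus: "x \<in> carrier (hcf h n) \<Longrightarrow> iota h n (\<ominus>\<^bsub>hcf h n\<^esub> x) = - iota h n x"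
  using iota_add[of "\<ominus>\<^bsub>hcf h n\<^esub> x" x] iota_zero H.l_neg[of x] by (simp add: eq_neg_iff_add_eq_0)

lemma iota_diff: "x \<in> carrier (hcf h n) \<Longrightarrow> y \<in> carrier (hcf h n) \<Longrightarrow> iota h n (x \<ominus>\<^bsub>hcf h n\<^esub> y) = iota h n x - iota h n y"
  unfolding a_minus_def using iota_add[of x "\<ominus>\<^bsub>hcf h n\<^esub> y"] iota_uminus by simp

text \<open>The idempotent of one factor is zero in all the others, so an element fixed by it lives
  in that factor alone.\<close>

lemma iota_cmp: assumes "iota h n \<one>\<^bsub>hcf h n\<^esub> * u = u" shows "iota h n (cmp h n u) = u"
proof (rule hc_prod_eqI)
  fix p
  have "Rep_hc_prod u p = Rep_hc_prod (iota h n \<one>\<^bsub>hcf h n\<^esub>) p \<otimes>\<^bsub>hcp p\<^esub> Rep_hc_prod u p"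
    using assms by (metis times_hc_prod.rep_eq)
  moreover have "Rep_hc_prod u p \<in> carrier (hcp p)" using Rep_hc_prod[of u] by blast
  ultimately have "p \<noteq> (h, n - 1) \<Longrightarrow> Rep_hc_prod u p = \<zero>\<^bsub>hcp p\<^esub>"
    by (simp add: Rep_iota hcp_l_null)
  then show "Rep_hc_prod (iota h n (cmp h n u)) p = Rep_hc_prod u p"
    unfolding Rep_iota[OF cmp_closed] by (auto simp: cmp_def)
qed

definition J :: "'k hc_free \<Rightarrow> 'k hc_prod" where "J p = iota h n (hcf_cls h n p)"

lemma J_simps:
  "x \<in> hcF n \<Longrightarrow> y \<in> hcF n \<Longrightarrow> J (x + y) = J x + J y" "x \<in> hcF n \<Longrightarrow> y \<in> hcF n \<Longrightarrow> J (x * y) = J x * J y"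
  "x \<in> hcF n \<Longrightarrow> J (- x) = - J x" "x \<in> hcF n \<Longrightarrow> y \<in> hcF n \<Longrightarrow> J (x - y) = J x - J y" "J 1 = J (fscal 1)"
  unfolding J_def fscal_hom
  by (simp_all add: cls_add[OF n] cls_mult[OF n] cls_uminus[OF n] cls_diff[OF n] iota_add iota_mult iota_uminus iota_diff cls_closed[OF n])

lemma J_rel: "hc_rel n (heps h) x y \<Longrightarrow> J x = J y"
  unfolding J_def by (simp add: cls_rel[OF n])

lemma J_f: "J (hc_fpoly h) = 0"
  unfolding J_def cls_f[OF n] by (rule iota_zero)

lemma J_scalars: "scalars (\<lambda>c. J (fscal c))"
  by unfold_locales (simp_all add: fscal_hom J_simps hcF_scal)

lemma J_alg: "x \<in> hcF n \<Longrightarrow> J x \<in> scalars.alg (\<lambda>c. J (fscal c))"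
  unfolding scalars.alg_def[OF J_scalars]
  by (simp add: J_simps(2)[symmetric] hcF_scal hcF_one fscal_hom(3) fscal_comm)

text \<open>The corner \<open>alg\<close> is precisely the embedded copy of \<open>hcf h n\<close>,
  so equations proved in it can be pulled back.\<close>

lemma alg_iff: "u \<in> scalars.alg (\<lambda>c. J (fscal c)) \<longleftrightarrow> (\<exists>x \<in> carrier (hcf h n). u = iota h n x)"
proof
  assume "u \<in> scalars.alg (\<lambda>c. J (fscal c))"
  then have "iota h n \<one>\<^bsub>hcf h n\<^esub> * u = u"
    unfolding scalars.alg_def[OF J_scalars] by (simp add: J_def fscal_hom(3) cls_one[OF n])
  then show "\<exists>x \<in> carrier (hcf h n). u = iota h n x" using iota_cmp cmp_closed by metis
next
  assume "\<exists>x \<in> carrier (hcf h n). u = iota h n x"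
  then obtain x where x: "x \<in> carrier (hcf h n)" "u = iota h n x" by blast
  then obtain p where "p \<in> hcF n" "x = hcf_cls h n p" using cls_surj[OF n] by blast
  then show "u \<in> scalars.alg (\<lambda>c. J (fscal c))" using J_alg x by (simp add: J_def)
qed

lemma J_hc_alg: "hc_alg (\<lambda>c. J (fscal c)) (\<lambda>i. J (fT i)) (\<lambda>i. J (fX i)) (\<lambda>i. J (fXi i)) (\<lambda>i. J (fC i)) n (heps h)"
proof -
  interpret scalars "\<lambda>c. J (fscal c)" by (rule J_scalars)
  note J = J_simps hcF_closed hcF_gen
  show ?thesis
  proof
    fix i j
    show "i \<in> {1..<n} \<Longrightarrow> J (fT i) \<in> alg" "i \<in> {1..n} \<Longrightarrow> J (fX i) \<in> alg" "i \<in> {1..n} \<Longrightarrow> J (fXi i) \<in> alg"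
      "i \<in> {1..n} \<Longrightarrow> J (fC i) \<in> alg" by (auto intro!: J_alg hcF_gen)
    show "J (fT i) * J (fT i) = J (fscal (heps h)) * J (fT i) + J (fscal 1)" if "i \<in> {1..<n}"
      using J_rel[OF hc_rel.TT[OF that]] that by (simp add: J)
    show "J (fT i) * J (fT j) = J (fT j) * J (fT i)" if "i \<in> {1..<n}" "j \<in> {1..<n}" "i + 1 < j \<or> j + 1 < i"
      using J_rel[OF hc_rel.T_comm[OF that]] that by (simp add: J)
    show "J (fT i) * J (fT (Suc i)) * J (fT i) = J (fT (Suc i)) * J (fT i) * J (fT (Suc i))" if "1 \<le> i" "Suc i < n"
      using J_rel[OF hc_rel.braid[of i n]] that by (simp add: J)
    show "J (fX i) * J (fX j) = J (fX j) * J (fX i)" if "i \<in> {1..n}" "j \<in> {1..n}"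
      using J_rel[OF hc_rel.X_comm[OF that]] that by (simp add: J)
    show "J (fX i) * J (fXi i) = J (fscal 1)" if "i \<in> {1..n}" using J_rel[OF hc_rel.X_Xi[OF that]] that by (simp add: J)
    show "J (fXi i) * J (fX i) = J (fscal 1)" if "i \<in> {1..n}" using J_rel[OF hc_rel.Xi_X[OF that]] that by (simp add: J)
    show "J (fC i) * J (fC i) = J (fscal 1)" if "i \<in> {1..n}" using J_rel[OF hc_rel.CC[OF that]] that by (simp add: J)
    show "J (fC i) * J (fC j) = - (J (fC j) * J (fC i))" if "i \<in> {1..n}" "j \<in> {1..n}" "i \<noteq> j"
      using J_rel[OF hc_rel.C_anti[OF that]] that by (simp add: J)
    show "J (fT i) * J (fX i) = J (fX (Suc i)) * J (fT i) - J (fscal (heps h)) * (J (fX (Suc i)) + J (fC i) * J (fC (Suc i)) * J (fX i))"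
      if "i \<in> {1..<n}" using J_rel[OF hc_rel.TX[OF that]] that by (simp add: J)
    show "J (fT i) * J (fX j) = J (fX j) * J (fT i)" if "i \<in> {1..<n}" "j \<in> {1..n}" "j \<noteq> i" "j \<noteq> Suc i"
      using J_rel[OF hc_rel.TX_comm[OF that(1-3)]] that by (simp add: J)
    show "J (fT i) * J (fC i) = J (fC (Suc i)) * J (fT i)" if "i \<in> {1..<n}"
      using J_rel[OF hc_rel.TC[OF that]] that by (simp add: J)
    show "J (fT i) * J (fC (Suc i)) = J (fC i) * J (fT i) - J (fscal (heps h)) * (J (fC i) - J (fC (Suc i)))" if "i \<in> {1..<n}"
      using J_rel[OF hc_rel.TC'[OF that]] that by (simp add: J)
    show "J (fT i) * J (fC j) = J (fC j) * J (fT i)" if "i \<in> {1..<n}" "j \<in> {1..n}" "j \<noteq> i" "j \<noteq> Suc i"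
      using J_rel[OF hc_rel.TC_comm[OF that(1-3)]] that by (simp add: J)
    show "J (fX i) * J (fC i) = J (fC i) * J (fXi i)" if "i \<in> {1..n}" using J_rel[OF hc_rel.XC[OF that]] that by (simp add: J)
    show "J (fX i) * J (fC j) = J (fC j) * J (fX i)" if "i \<in> {1..n}" "j \<in> {1..n}" "i \<noteq> j"
      using J_rel[OF hc_rel.XC_comm[OF that]] that by (simp add: J)
  qed
qed

end

section \<open>The cyclotomic relation as base case\<close>

lemma addable_empty: "addable b M {} = (\<lambda>l. (1, 1, l)) ` {..<M}"
proof
  show "addable b M {} \<subseteq> (\<lambda>l. (1, 1, l)) ` {..<M}"
  proof
    fix A assume A: "A \<in> addable b M {}"
    obtain i j l where f: "A = (i, j, l)" by (cases A)
    have v: "vbox b M (i, j, l)" and p: "prv b M (i, j, l) = {}" using A unfolding f addable_def by auto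
    have l: "l < M" "1 \<le> i" "1 \<le> j" using v unfolding vbox_def by (auto split: if_splits)
    have "i = 1"
    proof (rule ccontr)
      assume "i \<noteq> 1"
      then have "(i - 1, j, l) \<in> prv b M (i, j, l)" using v l unfolding prv_def vbox_def by (auto split: if_splits)
      then show False using p by blast
    qed
    moreover have "j = 1"
    proof (rule ccontr)
      assume "j \<noteq> 1"
      then have "(i, j - 1, l) \<in> prv b M (i, j, l)" using v l \<open>i = 1\<close> unfolding prv_def vbox_def by (auto split: if_splits)
      then show False using p by blast
    qed
    ultimately show "A \<in> (\<lambda>l. (1, 1, l)) ` {..<M}" using f l by blast
  qed
  show "(\<lambda>l. (1, 1, l)) ` {..<M} \<subseteq> addable b M {}"
    unfolding addable_def vbox_def prv_def by auto
qed

lemma prod_lessThan_add: "(\<Prod>l < a + b. f l) = (\<Prod>l < a. f l) * (\<Prod>l < b. f (a + l :: nat) :: 'c::comm_monoid_mult)"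
  by (induction b) (simp_all add: mult_ac)

context hc_params
begin

definition gpoly :: "'k poly" where
  "gpoly = (case bb of B0 \<Rightarrow> 1 | Bs \<Rightarrow> lin 1 | Bss \<Rightarrow> lin (-1) * lin 1)"

text \<open>The first box of a strict component is diagonal and contributes a linear factor of g;
  each remaining component contributes the quadratic factor of its parameter.\<close>

lemma base_poly: "(\<Prod>A \<in> addable bb MM {}. pol A) = gpoly * prod_list (map (\<lambda>c. quad (qq h c)) (hQ h))"
proof -
  have "(\<Prod>A \<in> addable bb MM {}. pol A) = (\<Prod>l < MM. pol (1, 1, l))"
    unfolding addable_empty by (subst prod.reindex) (auto simp: inj_on_def)
  also have "\<dots> = (\<Prod>l < nstrict bb. pol (1, 1, l)) * (\<Prod>l < length (hQ h). pol (1, 1, nstrict bb + l))"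
    by (rule prod_lessThan_add)
  also have "(\<Prod>l < nstrict bb. pol (1, 1, l)) = gpoly"
    unfolding gpoly_def nstrict_def pol_def diag_def zz_def Qext_def
    by (cases bb) (simp_all add: nstrict_def numeral_2_eq_2)
  also have "(\<Prod>l < length (hQ h). pol (1, 1, nstrict bb + l)) = (\<Prod>l < length (hQ h). quad (qq h (hQ h ! l)))"
  proof (rule prod.cong[OF refl])
    fix l assume l: "l \<in> {..<length (hQ h)}"
    have "Qext h ! (nstrict bb + l) = hQ h ! l" unfolding Qext_def nstrict_def by (cases bb) (simp_all add: numeral_2_eq_2)
    then have "bres h (1, 1, nstrict bb + l) = hQ h ! l" unfolding bres_def length_Qext using l by simp
    then show "pol (1, 1, nstrict bb + l) = quad (qq h (hQ h ! l))" unfolding pol_def diag_def by simp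
  qed
  also have "\<dots> = prod_list (map (\<lambda>c. quad (qq h c)) (hQ h))"
    by (subst prod.list_conv_set_nth) (simp add: lessThan_atLeast0)
  finally show ?thesis .
qed

text \<open>f is a product of X_1 + X_1^{-1} minus constants, whereas \<open>quad\<close> at X_1 is
  X_1 times such a factor. The two differ by a power of X_1, the element W, which commutes with X_1
  and its inverse and can be collected in front.\<close>

lemma J_base: "scalars.ev (\<lambda>c. J h n (fscal c)) (J h n (fX 1)) (\<Prod>A \<in> addable bb MM {}. pol A) = 0"
proof -
  interpret A: hc_alg "\<lambda>c. J h n (fscal c)" "\<lambda>i. J h n (fT i)" "\<lambda>i. J h n (fX i)" "\<lambda>i. J h n (fXi i)" "\<lambda>i. J h n (fC i)" n "heps h"
    by (rule J_hc_alg[OF n])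
  let ?X = "J h n (fX 1)" and ?Xi = "J h n (fXi 1)" and ?s = "\<lambda>c. J h n (fscal c)"
  let ?P = "\<lambda>Q. prod_list (map (\<lambda>c. fX 1 + fXi 1 - fscal (qq h c)) Q) :: 'k hc_free"
  have 1: "1 \<in> {1..n}" using n by simp
  have a: "?X \<in> A.alg" "?Xi \<in> A.alg" using A.algs 1 by auto
  have P: "?P Q \<in> hcF n" for Q using 1 by (induction Q) (auto intro!: hcF_closed hcF_gen)
  have quad: "A.ev ?X (quad c) = ?X * (?X + ?Xi - ?s c)" for c
    using a A.X_Xi[OF 1] unfolding quad_def
    by (simp add: A.ev_pCons A.s_uminus distrib_left right_diff_distrib A.alg_comm)
  have "\<exists>W \<in> A.alg. W * ?X = ?X * W \<and> W * ?Xi = ?Xi * W \<and> A.ev ?X (prod_list (map (\<lambda>c. quad (qq h c)) Q)) = W * J h n (?P Q)" for Q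
  proof (induction Q)
    case Nil
    have "J h n 1 = ?s 1" by (rule J_simps(5)[OF n])
    then show ?case using a by (intro bexI[of _ "?s 1"]) (simp_all add: A.alg_comm flip: A.s_mult)
  next
    case (Cons c Q)
    then obtain W where W: "W \<in> A.alg" "W * ?X = ?X * W" "W * ?Xi = ?Xi * W"
      "A.ev ?X (prod_list (map (\<lambda>c. quad (qq h c)) Q)) = W * J h n (?P Q)" by blast
    let ?z = "?X + ?Xi - ?s (qq h c)"
    have z: "?z * W = W * ?z" using W by (simp add: distrib_left distrib_right left_diff_distrib right_diff_distrib A.alg_comm)
    have "J h n (fX 1 + fXi 1 - fscal (qq h c)) = ?z" using 1 by (simp add: J_simps[OF n] hcF_closed hcF_gen)
    then have "J h n (?P (c # Q)) = ?z * J h n (?P Q)"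
      using J_simps(2)[OF n _ P, of "fX 1 + fXi 1 - fscal (qq h c)" h Q] 1 by (simp add: hcF_closed hcF_gen)
    moreover have "A.ev ?X (prod_list (map (\<lambda>c. quad (qq h c)) (c # Q))) = ?X * (?z * (W * J h n (?P Q)))"
      using a W(4) by (simp add: A.ev_mult quad mult.assoc del: One_nat_def)
    moreover have "?z * (W * J h n (?P Q)) = W * (?z * J h n (?P Q))" using z by (simp only: mult.assoc[symmetric])
    moreover have "?X * W * ?X = ?X * (?X * W)" "?X * W * ?Xi = ?Xi * (?X * W)"
      using W A.X_Xi[OF 1] A.Xi_X[OF 1] by (simp_all add: mult.assoc) (simp_all add: mult.assoc[symmetric])
    ultimately show ?case using a W(1) by (intro bexI[of _ "?X * W"]) (simp_all add: mult.assoc)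
  qed
  then obtain W where W: "W \<in> A.alg" "W * ?X = ?X * W"
    "A.ev ?X (prod_list (map (\<lambda>c. quad (qq h c)) (hQ h))) = W * J h n (?P (hQ h))" by blast
  have lin: "A.ev ?X (lin 1) = ?X - ?s 1" "A.ev ?X (lin (-1)) = ?X + ?s 1"
    unfolding lin_def using a by (simp_all add: A.ev_pCons A.s_uminus)
  have g: "A.ev ?X gpoly = J h n (hc_g bb)"
    unfolding gpoly_def hc_g_def using a 1 A.ev_comm[of ?X "lin 1" "lin (-1)"]
    by (cases bb) (simp_all add: A.ev_mult lin J_simps[OF n] hcF_closed hcF_gen del: One_nat_def)
  have gF: "hc_g bb \<in> hcF n" using 1 unfolding hc_g_def by (cases bb) (auto intro!: hcF_closed hcF_gen)
  have "A.ev ?X gpoly * W = W * A.ev ?X gpoly" by (rule A.ev_swap[OF a(1) a(1) W(1,2), symmetric])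
  then have "A.ev ?X (gpoly * prod_list (map (\<lambda>c. quad (qq h c)) (hQ h))) = W * (A.ev ?X gpoly * J h n (?P (hQ h)))"
    using a W by (simp add: A.ev_mult mult.assoc[symmetric])
  also have "A.ev ?X gpoly * J h n (?P (hQ h)) = J h n (hc_fpoly h)"
    unfolding g hc_fpoly_def using J_simps(2)[OF n gF P] by simp
  finally show ?thesis unfolding base_poly J_f[OF n] by simp
qed

lemma J_hc_full: "hc_full h n (\<lambda>c. J h n (fscal c)) (\<lambda>i. J h n (fT i)) (\<lambda>i. J h n (fX i)) (\<lambda>i. J h n (fXi i)) (\<lambda>i. J h n (fC i))"
  by (intro hc_full.intro J_hc_alg[OF n] hc_params_axioms hc_full_axioms.intro J_base)

end

section \<open>The sign formulas for even and odd t\<close>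

context hc_star_lam
begin

lemma sandU_alg:
  assumes "u \<in> Std bb lam" "t \<in> Std bb lam" "M \<in> alg"
  shows "sandU u \<alpha>' \<beta>' M \<alpha>1 t \<alpha> \<beta> \<in> alg"
  unfolding sandU_def FU_def[OF assms(1)] FU_def[OF assms(2)] using Ga_alg assms by simp

lemma even_star:
  assumes u: "u \<in> Std bb lam" and t: "t \<in> Std bb lam"
    and al: "zsupp \<alpha>' \<subseteq> Dtab bb lam u" "zsupp \<alpha> \<subseteq> Dtab bb lam t"
    and be: "zsupp \<beta>' \<subseteq> {1..n} - Dtab bb lam u" "zsupp \<beta> \<subseteq> {1..n} - Dtab bb lam t"
    and i: "inter u t M M'"
  shows "st (sandU u \<alpha>' \<beta>' M \<alpha> t \<alpha> \<beta>) =
    s (sgn_even bb lam u (zhat bb lam u \<alpha>') * sgn_even bb lam t (zhat bb lam t \<alpha>)) *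
    sandU t (zhat bb lam t \<alpha>) \<beta> M' (zhat bb lam u \<alpha>') u (zhat bb lam u \<alpha>') \<beta>'"
proof -
  have z: "zext bb lam t \<gamma> 0 = \<gamma>" for t \<gamma> unfolding zext_def Let_def add_0_right fun_upd_triv ..
  have "sandU u \<alpha>' \<beta>' M \<alpha> t \<alpha> \<beta> \<in> alg" using i by (intro sandU_alg u t) (simp add: inter_def)
  then show ?thesis
    using sandU_star[OF u t al be i, of 0] by (simp add: z sgn_even_eq syp_def[OF t] syp_def[OF u])
qed

text \<open>Each \<eta> contains a sign at the x_t of its left triple that \<open>sandU_star\<close>
  does not produce. These two signs make up for the difference between \<open>sgnp\<close> and the
  odd signs of the statement.\<close>

lemma odd_star:
  assumes u: "u \<in> Std bb lam" and t: "t \<in> Std bb lam" and o: "odd (tnum bb lam)"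
    and al: "zsupp \<alpha>' \<subseteq> Dtab bb lam u" "zsupp \<alpha> \<subseteq> Dtab bb lam t"
    and be: "zsupp \<beta>' \<subseteq> {1..n} - Dtab bb lam u" "zsupp \<beta> \<subseteq> {1..n} - Dtab bb lam t"
    and i: "inter u t M M'"
  shows "st (s (eta bb lam (u, \<alpha>', \<beta>') (t, \<alpha>, \<beta>) a) * sandU u \<alpha>' \<beta>' M (zext bb lam t \<alpha> a) t \<alpha> \<beta>) =
    s (sgn_odd bb lam u (zhat bb lam u (zext bb lam u \<alpha>' 1)) 0 *
       sgn_odd bb lam t (zhat bb lam t (zext bb lam t \<alpha> (a + 1))) (a + 1)) *
    (s (eta bb lam (t, zhat bb lam t \<alpha>, \<beta>) (u, zhat bb lam u \<alpha>', \<beta>') a) *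
     sandU t (zhat bb lam t \<alpha>) \<beta> M' (zext bb lam u (zhat bb lam u \<alpha>') a) u (zhat bb lam u \<alpha>') \<beta>')"
proof -
  let ?yu = "xt u (tnum bb lam)" and ?yt = "xt t (tnum bb lam)"
  let ?g = "sgz \<alpha>' ?yu :: 'k" and ?g' = "sgz (zhat bb lam t \<alpha>) ?yt :: 'k"
  let ?K = "sgnp u hr (zhat bb lam u \<alpha>') * sgnp t hr (zhat bb lam t \<alpha>) * (if a = 1 then (-1) ^ hr else 1) * syp u (zhat bb lam u \<alpha>') a"
  let ?V = "sandU u \<alpha>' \<beta>' M (zext bb lam t \<alpha> a) t \<alpha> \<beta>"
    and ?W = "sandU t (zhat bb lam t \<alpha>) \<beta> M' (zext bb lam u (zhat bb lam u \<alpha>') a) u (zhat bb lam u \<alpha>') \<beta>'"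
  have V: "?V \<in> alg" using i by (intro sandU_alg u t) (simp add: inter_def)
  have e1: "eta bb lam (u, \<alpha>', \<beta>') (t, \<alpha>, \<beta>) a = ?g * syp t \<alpha> a"
    unfolding eta_def sgz_def syp_def[OF t] by (simp add: power_add)
  have e2: "eta bb lam (t, zhat bb lam t \<alpha>, \<beta>) (u, zhat bb lam u \<alpha>', \<beta>') a = ?g' * syp u (zhat bb lam u \<alpha>') a"
    unfolding eta_def sgz_def syp_def[OF u] by (simp add: power_add)
  have "st (s (?g * syp t \<alpha> a) * ?V) = s (?g * syp t \<alpha> a) * st ?V"
    using V by (simp add: st_mult alg_comm)
  also have "\<dots> = s ?g * (s (syp t \<alpha> a) * st ?V)" by (simp only: s_left)
  also have "s (syp t \<alpha> a) * st ?V = s ?K * ?W" using o by (intro sandU_star[OF u t al be i]) simp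
  also have "s ?g * (s ?K * ?W) = s (?g * ?K) * ?W" by (rule s_left)
  \<comment> \<open>For a = 1 one factor (-1)^hr occurs on each side; for a = 0 there is none on the
    left, and the two on the right cancel.\<close>
  also have "?g * ?K = sgn_odd bb lam u (zhat bb lam u (zext bb lam u \<alpha>' 1)) 0 *
       sgn_odd bb lam t (zhat bb lam t (zext bb lam t \<alpha> (a + 1))) (a + 1) * (?g' * syp u (zhat bb lam u \<alpha>') a)"
  proof -
    have gg: "?g' * (?g' * v) = v" for v by (simp only: mult.assoc[symmetric] sgz_sq mult_1_left)
    have mm: "(-1) ^ hr * ((-1) ^ hr * v) = v" for v :: 'k
      by (simp only: mult.assoc[symmetric] power_mult_distrib[symmetric]) simp
    show ?thesis
    proof (cases "a = 1")
      case True
      have a: "a + 1 = 0" using True by simp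
      show ?thesis unfolding a sgn_odd_signs[OF u o al(1)] sgn_odd_signs[OF t o al(2)] using True
        by (simp only: simp_thms if_True mult_ac gg)
    next
      case False
      then have a: "a + 1 = 1" "a = 0" by simp_all
      show ?thesis unfolding a(1) sgn_odd_signs[OF u o al(1)] sgn_odd_signs[OF t o al(2)] using False
        by (simp only: if_False mult_ac gg mm mult_1_left mult_1_right)
    qed
  qed
  finally show ?thesis unfolding e1 e2 by (simp only: s_left)
qed

end

section \<open>Transfer to the cyclotomic algebra\<close>

locale hc_rep = hc_params h n for h :: "'k::alg_closed_field hc_datum" and n +
  fixes lam :: mpart and star :: "'k hcf_elem \<Rightarrow> 'k hcf_elem"
  assumes star: "hc_star h n star" and lam: "lam \<in> mparts (hbul h) (length (hQ h)) n"
begin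

abbreviation "H \<equiv> hcf h n"
abbreviation "io \<equiv> iota h n"
abbreviation "stU u \<equiv> io (star (cmp h n u))"

sublocale H: ring H by (rule hcf_ring[OF n])

lemma star_facts:
  shows star_closed: "x \<in> carrier H \<Longrightarrow> star x \<in> carrier H"
    and star_add: "x \<in> carrier H \<Longrightarrow> y \<in> carrier H \<Longrightarrow> star (x \<oplus>\<^bsub>H\<^esub> y) = star x \<oplus>\<^bsub>H\<^esub> star y"
    and star_scal: "x \<in> carrier H \<Longrightarrow> star (hS h n c \<otimes>\<^bsub>H\<^esub> x) = hS h n c \<otimes>\<^bsub>H\<^esub> star x"
    and star_mult: "x \<in> carrier H \<Longrightarrow> y \<in> carrier H \<Longrightarrow> star (x \<otimes>\<^bsub>H\<^esub> y) = star y \<otimes>\<^bsub>H\<^esub> star x"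
    and star_star: "x \<in> carrier H \<Longrightarrow> star (star x) = x"
    and star_T: "i \<in> {1..<n} \<Longrightarrow> star (hT h n i) = hT h n i \<oplus>\<^bsub>H\<^esub> hS h n (heps h) \<otimes>\<^bsub>H\<^esub> (hC h n i \<otimes>\<^bsub>H\<^esub> hC h n (Suc i))"
    and star_C: "j \<in> {1..n} \<Longrightarrow> star (hC h n j) = hC h n j" and star_X: "j \<in> {1..n} \<Longrightarrow> star (hX h n j) = hX h n j"
  using star unfolding hc_star_def Let_def by auto

lemmas [simp] = hS_hom(4)[OF n] hgen_closed[OF n] star_closed cmp_closed[OF n]

lemma J_eqs: "J h n (fscal c) = io (hS h n c)" "J h n (fT i) = io (hT h n i)" "J h n (fX i) = io (hX h n i)"
  "J h n (fXi i) = io (hXi h n i)" "J h n (fC i) = io (hC h n i)"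
  unfolding J_def[OF n] hS_def hT_def hX_def hXi_def hC_def by (rule refl)+

lemmas io_hom = iota_add[OF n] iota_mult[OF n] iota_diff[OF n] cmp_iota[OF n]

lemma star_one: "star \<one>\<^bsub>H\<^esub> = \<one>\<^bsub>H\<^esub>"
proof -
  have "star (star \<one>\<^bsub>H\<^esub> \<otimes>\<^bsub>H\<^esub> \<one>\<^bsub>H\<^esub>) = star \<one>\<^bsub>H\<^esub> \<otimes>\<^bsub>H\<^esub> star (star \<one>\<^bsub>H\<^esub>)" by (rule star_mult) simp_all
  then show ?thesis by (simp add: star_star)
qed

lemma star_S: "star (hS h n c) = hS h n c"
  using star_scal[of "\<one>\<^bsub>H\<^esub>" c] star_one by simp

text \<open>The abstract \<open>st\<close> is \<open>star\<close> applied to one component. Its laws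
  hold on \<open>alg\<close>, the image of the embedding, and are required there.\<close>

sublocale hc_star_lam h n "\<lambda>c. io (hS h n c)" "\<lambda>i. io (hT h n i)" "\<lambda>i. io (hX h n i)" "\<lambda>i. io (hXi h n i)" "\<lambda>i. io (hC h n i)" lam stU
proof (intro hc_star_lam.intro hc_lam.intro hc_lam_axioms.intro lam)
  show full: "hc_full h n (\<lambda>c. io (hS h n c)) (\<lambda>i. io (hT h n i)) (\<lambda>i. io (hX h n i)) (\<lambda>i. io (hXi h n i)) (\<lambda>i. io (hC h n i))"
    using J_hc_full unfolding J_eqs .
  have alg: "u \<in> scalars.alg (\<lambda>c. io (hS h n c)) \<longleftrightarrow> (\<exists>x \<in> carrier H. u = io x)" for u
    using alg_iff[OF n, of u h] unfolding J_eqs .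
  show "hc_star_lam_axioms h n (\<lambda>c. io (hS h n c)) (\<lambda>i. io (hT h n i)) (\<lambda>i. io (hX h n i)) (\<lambda>i. io (hC h n i)) stU"
    by unfold_locales
      (auto simp: alg io_hom star_add star_mult star_star star_S star_T star_C star_X simp flip: iota_add[OF n] iota_mult[OF n])
qed

lemma alg_io: "u \<in> alg \<longleftrightarrow> (\<exists>x \<in> carrier H. u = io x)"
  using alg_iff[OF n, of u h] unfolding J_eqs .

lemma io_alg [simp]: "x \<in> carrier H \<Longrightarrow> io x \<in> alg"
  using alg_io by blast

lemma io_inj: "x \<in> carrier H \<Longrightarrow> y \<in> carrier H \<Longrightarrow> io x = io y \<longleftrightarrow> x = y"
  using io_hom(4) by metis

lemma io_one: "io \<one>\<^bsub>H\<^esub> = io (hS h n 1)"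
  by (simp only: hS_hom(3)[OF n])

lemma io_rprod: "set xs \<subseteq> carrier H \<Longrightarrow> rprod H xs \<in> carrier H \<and> io (rprod H xs) = lprod (map io xs)"
  by (induction xs) (auto simp: rprod_def io_one io_hom)

lemma io_map: "(\<And>k. k \<in> set ks \<Longrightarrow> f k \<in> carrier H \<and> io (f k) = g k) \<Longrightarrow>
  rprod H (map f ks) \<in> carrier H \<and> io (rprod H (map f ks)) = lprod (map g ks)"
  using io_rprod[of "map f ks"] by (auto simp: comp_def cong: map_cong)

lemma io_Cpow: "Cpow h n \<beta> \<in> carrier H" "io (Cpow h n \<beta>) = Cp \<beta>"
proof -
  have "Cpow h n \<beta> \<in> carrier H \<and> io (Cpow h n \<beta>) = Cp \<beta>"
    unfolding Cpow_def Cp_def by (rule io_map) (auto simp: io_one)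
  then show "Cpow h n \<beta> \<in> carrier H" "io (Cpow h n \<beta>) = Cp \<beta>" by auto
qed

text \<open>The star of the monomial is a two-sided inverse, and two-sided inverses are unique; this
  identifies the inverse taken in the unit group of \<open>hcf\<close>.\<close>

lemma io_inv: "m_inv H (Cpow h n \<beta>) \<in> carrier H" "io (m_inv H (Cpow h n \<beta>)) = stU (Cp \<beta>)"
proof -
  let ?y = "star (cmp h n (Cp \<beta>))"
  have "io (Cpow h n \<beta> \<otimes>\<^bsub>H\<^esub> ?y) = io \<one>\<^bsub>H\<^esub>" "io (?y \<otimes>\<^bsub>H\<^esub> Cpow h n \<beta>) = io \<one>\<^bsub>H\<^esub>"
    using Cp_inv[of \<beta>] by (simp_all add: io_hom io_one io_Cpow)
  then have "m_inv H (Cpow h n \<beta>) = ?y"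
    using io_Cpow(1) by (intro H.inv_char) (simp_all add: io_inj)
  then show "m_inv H (Cpow h n \<beta>) \<in> carrier H" "io (m_inv H (Cpow h n \<beta>)) = stU (Cp \<beta>)" by simp_all
qed

lemma io_gam: assumes t: "t \<in> Std bb lam" shows "gam h n lam t \<in> carrier H" "io (gam h n lam t) = gm t"
proof -
  let ?L = "rprod H (map (\<lambda>k. \<one>\<^bsub>H\<^esub> \<oplus>\<^bsub>H\<^esub> hS h n (hsqrt h (-1)) \<otimes>\<^bsub>H\<^esub> (hC h n (xt t (2*k - 1)) \<otimes>\<^bsub>H\<^esub> hC h n (xt t (2*k)))) [1..<hr+1])"
  have L: "?L \<in> carrier H \<and> io ?L = lprod (map (gf t) [1..<hr+1])"
  proof (rule io_map)
    fix k assume "k \<in> set [1..<hr+1]"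
    then have "k \<in> {1..hr}" by (simp only: set_upt) auto
    then show "\<one>\<^bsub>H\<^esub> \<oplus>\<^bsub>H\<^esub> hS h n (hsqrt h (-1)) \<otimes>\<^bsub>H\<^esub> (hC h n (xt t (2*k - 1)) \<otimes>\<^bsub>H\<^esub> hC h n (xt t (2*k))) \<in> carrier H \<and>
      io (\<one>\<^bsub>H\<^esub> \<oplus>\<^bsub>H\<^esub> hS h n (hsqrt h (-1)) \<otimes>\<^bsub>H\<^esub> (hC h n (xt t (2*k - 1)) \<otimes>\<^bsub>H\<^esub> hC h n (xt t (2*k)))) = gf t k"
      using odd_range[OF t] unfolding gf_def ef_def by (simp add: io_hom io_one del: One_nat_def)
  qed
  then show "gam h n lam t \<in> carrier H" "io (gam h n lam t) = gm t"
    unfolding gam_def gm_def Let_def by (simp_all add: io_hom del: upt_Suc)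
qed

text \<open>The factors are values of polynomials at one element W, so the product is the value of
  the product polynomial, whatever enumeration was chosen.\<close>

lemma io_rprod_set:
  assumes A: "finite A" and W: "W \<in> alg" and F: "\<And>b. b \<in> A \<Longrightarrow> F b \<in> carrier H \<and> io (F b) = ev W (G b)"
  shows "rprod_set H F A \<in> carrier H \<and> io (rprod_set H F A) = ev W (prod G A)"
proof -
  define xs where "xs = (SOME xs. distinct xs \<and> set xs = A)"
  have xs: "distinct xs" "set xs = A"
    unfolding xs_def using someI_ex[of "\<lambda>xs. distinct xs \<and> set xs = A"] finite_distinct_list[OF A] by blast+
  have "rprod H (map F xs) \<in> carrier H \<and> io (rprod H (map F xs)) = lprod (map (\<lambda>b. ev W (G b)) xs)"
    by (rule io_map) (use F xs in blast)
  moreover have "lprod (map (\<lambda>b. ev W (G b)) ys) = ev W (prod_list (map G ys))" for ys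
    using W by (induction ys) (simp_all add: ev_mult)
  moreover have "prod_list (map G xs) = prod G A" using prod.distinct_set_conv_list[OF xs(1), of G] xs by simp
  ultimately show ?thesis unfolding rprod_set_def xs_def[symmetric] by simp
qed

lemma io_Fid: assumes t: "t \<in> Std bb lam" shows "Fid h n lam (t, \<alpha>, \<beta>) \<in> carrier H" "io (Fid h n lam (t, \<alpha>, \<beta>)) = FU t \<alpha> \<beta>"
proof -
  let ?W = "\<lambda>k. if \<beta> k = 1 then hXi h n k else hX h n k"
  let ?F = "\<lambda>k. let c = bplus h (res h lam t k) in rprod_set H (\<lambda>b. hS h n (inverse (c - b)) \<otimes>\<^bsub>H\<^esub> (?W k \<ominus>\<^bsub>H\<^esub> hS h n b)) (Bset h n k - {c})"
  let ?L = "rprod H (map ?F [1..<n+1])"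
  have L: "?L \<in> carrier H \<and> io ?L = Eb t \<beta>"
    unfolding Eb_def
  proof (rule io_map)
    fix k assume "k \<in> set [1..<n+1]"
    then have k: "k \<in> {1..n}" by (simp only: set_upt) auto
    let ?c = "bplus h (res h lam t k)" and ?V = "if \<beta> k = 1 then io (hXi h n k) else io (hX h n k)"
    have W: "?W k \<in> carrier H" "io (?W k) = ?V" using k by auto
    then have V: "?V \<in> alg" by (metis io_alg)
    have "rprod_set H (\<lambda>b. hS h n (inverse (?c - b)) \<otimes>\<^bsub>H\<^esub> (?W k \<ominus>\<^bsub>H\<^esub> hS h n b)) (Bset h n k - {?c}) \<in> carrier H \<and>
      io (rprod_set H (\<lambda>b. hS h n (inverse (?c - b)) \<otimes>\<^bsub>H\<^esub> (?W k \<ominus>\<^bsub>H\<^esub> hS h n b)) (Bset h n k - {?c})) = ev ?V (lag k ?c)"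
      unfolding lag_def
    proof (rule io_rprod_set[OF _ V])
      show "finite (Bset h n k - {?c})" using finite_Bset[OF k] by simp
      fix b
      show "hS h n (inverse (?c - b)) \<otimes>\<^bsub>H\<^esub> (?W k \<ominus>\<^bsub>H\<^esub> hS h n b) \<in> carrier H \<and>
        io (hS h n (inverse (?c - b)) \<otimes>\<^bsub>H\<^esub> (?W k \<ominus>\<^bsub>H\<^esub> hS h n b)) = ev ?V (smult (inverse (?c - b)) (lin b))"
        unfolding ev_smult[OF V] ev_lin[OF V] unfolding W(2)[symmetric] using W(1) by (simp only: io_hom H.minus_closed H.m_closed hS_hom(4)[OF n] simp_thms)
    qed
    then show "?F k \<in> carrier H \<and> io (?F k) = ev ?V (lag k (bp t k))" unfolding Let_def bp_def .
  qed
  have "Fid h n lam (t, \<alpha>, \<beta>) = (Cpow h n \<alpha> \<otimes>\<^bsub>H\<^esub> gam h n lam t \<otimes>\<^bsub>H\<^esub> m_inv H (Cpow h n \<alpha>)) \<otimes>\<^bsub>H\<^esub> ?L"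
    unfolding Fid_def by (simp only: prod.case Let_def)
  then show "Fid h n lam (t, \<alpha>, \<beta>) \<in> carrier H" "io (Fid h n lam (t, \<alpha>, \<beta>)) = FU t \<alpha> \<beta>"
    unfolding FU_def[OF t] Ga_def[OF t] using L io_Cpow io_inv io_gam[OF t] by (simp_all only: io_hom H.m_closed mult.assoc)
qed

lemma io_Phi_i: "i \<in> {1..<n} \<Longrightarrow> Phi_i h n i x y \<in> carrier H" "i \<in> {1..<n} \<Longrightarrow> io (Phi_i h n i x y) = PhiU i x y"
  unfolding Phi_i_def PhiU_def Let_def by (simp_all add: io_hom)

lemma io_Phi_word: "set ks \<subseteq> {1..<n} \<Longrightarrow> Phi_word h n lam t ks \<in> carrier H \<and> io (Phi_word h n lam t ks) = PhiW t ks"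
  by (induction ks) (simp_all add: io_one io_hom io_Phi_i bm_def act_def Let_def)

lemma io_Phi:
  assumes "u \<in> Std bb lam" "t \<in> Std bb lam"
  shows "Phi h n lam u t \<in> carrier H" "io (Phi h n lam u t) = PhiS u t"
proof -
  have "reduced_expr n (tab_perm bb lam u t) (SOME ks. reduced_expr n (tab_perm bb lam u t) ks)"
    using someI_ex reduced_expr_ex[OF tab_perm_permutes[OF assms]] by metis
  then have "set (SOME ks. reduced_expr n (tab_perm bb lam u t) ks) \<subseteq> {1..<n}" by (simp add: reduced_expr_def)
  from io_Phi_word[OF this] show "Phi h n lam u t \<in> carrier H" "io (Phi h n lam u t) = PhiS u t"
    unfolding Phi_def PhiS_def by auto
qed

lemma io_sandwich:
  assumes "u \<in> Std bb lam" "t \<in> Std bb lam" "M \<in> carrier H"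
  shows "sandwich h n lam (u, \<alpha>', \<beta>') M \<alpha>1 (t, \<alpha>, \<beta>) \<in> carrier H \<and>
    io (sandwich h n lam (u, \<alpha>', \<beta>') M \<alpha>1 (t, \<alpha>, \<beta>)) = sandU u \<alpha>' \<beta>' (io M) \<alpha>1 t \<alpha> \<beta>"
proof -
  let ?xs = "[Fid h n lam (u, \<alpha>', \<beta>'), Cpow h n \<beta>', Cpow h n \<alpha>', M, m_inv H (Cpow h n \<alpha>1), m_inv H (Cpow h n \<beta>), Fid h n lam (t, \<alpha>, \<beta>)]"
  have "set ?xs \<subseteq> carrier H" using assms io_Fid io_Cpow io_inv by simp
  from io_rprod[OF this] show ?thesis
    unfolding sandwich_def sandU_def prod.case Let_def
    using assms by (simp only: list.map io_Cpow io_inv io_Fid)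
qed

lemma io_star: "x \<in> carrier H \<Longrightarrow> io (star x) = stU (io x)"
  by (simp add: io_hom)

text \<open>Both equations are checked after the injective map \<open>io\<close>. They are stated
  for any pair in the relation \<open>inter\<close>, which covers the two families of seminormal
  elements at once.\<close>

lemma f_stars:
  assumes t: "t \<in> Std bb lam" and u: "u \<in> Std bb lam" and i: "inter u t (io M) (io M')" "M \<in> carrier H" "M' \<in> carrier H"
    and al: "zsupp \<alpha>' \<subseteq> Dtab bb lam u" "zsupp \<alpha> \<subseteq> Dtab bb lam t"
    and be: "zsupp \<beta>' \<subseteq> {1..n} - Dtab bb lam u" "zsupp \<beta> \<subseteq> {1..n} - Dtab bb lam t"
  shows "star (sandwich h n lam (u, \<alpha>', \<beta>') M \<alpha> (t, \<alpha>, \<beta>)) =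
      hS h n (sgn_even bb lam u (zhat bb lam u \<alpha>') * sgn_even bb lam t (zhat bb lam t \<alpha>)) \<otimes>\<^bsub>H\<^esub>
      sandwich h n lam (t, zhat bb lam t \<alpha>, \<beta>) M' (zhat bb lam u \<alpha>') (u, zhat bb lam u \<alpha>', \<beta>')"
    and "odd (tnum bb lam) \<Longrightarrow>
      star (hS h n (eta bb lam (u, \<alpha>', \<beta>') (t, \<alpha>, \<beta>) a) \<otimes>\<^bsub>H\<^esub> sandwich h n lam (u, \<alpha>', \<beta>') M (zext bb lam t \<alpha> a) (t, \<alpha>, \<beta>)) =
      hS h n (sgn_odd bb lam u (zhat bb lam u (zext bb lam u \<alpha>' 1)) 0 * sgn_odd bb lam t (zhat bb lam t (zext bb lam t \<alpha> (a + 1))) (a + 1)) \<otimes>\<^bsub>H\<^esub>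
      (hS h n (eta bb lam (t, zhat bb lam t \<alpha>, \<beta>) (u, zhat bb lam u \<alpha>', \<beta>') a) \<otimes>\<^bsub>H\<^esub>
       sandwich h n lam (t, zhat bb lam t \<alpha>, \<beta>) M' (zext bb lam u (zhat bb lam u \<alpha>') a) (u, zhat bb lam u \<alpha>', \<beta>'))"
proof -
  note s1 = io_sandwich[OF u t i(2)] and s2 = io_sandwich[OF t u i(3)]
  have eqI: "x = y" if "x \<in> carrier H" "y \<in> carrier H" "io x = io y" for x y using that io_inj by blast
  show "star (sandwich h n lam (u, \<alpha>', \<beta>') M \<alpha> (t, \<alpha>, \<beta>)) =
      hS h n (sgn_even bb lam u (zhat bb lam u \<alpha>') * sgn_even bb lam t (zhat bb lam t \<alpha>)) \<otimes>\<^bsub>H\<^esub>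
      sandwich h n lam (t, zhat bb lam t \<alpha>, \<beta>) M' (zhat bb lam u \<alpha>') (u, zhat bb lam u \<alpha>', \<beta>')"
    using s1 s2 even_star[OF u t al be i(1)] by (intro eqI) (simp_all only: io_star io_hom(2) H.m_closed hS_hom(4)[OF n] star_closed)
  show "star (hS h n (eta bb lam (u, \<alpha>', \<beta>') (t, \<alpha>, \<beta>) a) \<otimes>\<^bsub>H\<^esub> sandwich h n lam (u, \<alpha>', \<beta>') M (zext bb lam t \<alpha> a) (t, \<alpha>, \<beta>)) =
      hS h n (sgn_odd bb lam u (zhat bb lam u (zext bb lam u \<alpha>' 1)) 0 * sgn_odd bb lam t (zhat bb lam t (zext bb lam t \<alpha> (a + 1))) (a + 1)) \<otimes>\<^bsub>H\<^esub>
      (hS h n (eta bb lam (t, zhat bb lam t \<alpha>, \<beta>) (u, zhat bb lam u \<alpha>', \<beta>') a) \<otimes>\<^bsub>H\<^esub>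
       sandwich h n lam (t, zhat bb lam t \<alpha>, \<beta>) M' (zext bb lam u (zhat bb lam u \<alpha>') a) (u, zhat bb lam u \<alpha>', \<beta>'))"
    if o: "odd (tnum bb lam)"
    using s1 s2 odd_star[OF u t o al be i(1), of a] by (intro eqI) (simp_all only: io_star io_hom(2) H.m_closed hS_hom(4)[OF n] star_closed)
qed

lemma inter_Phi:
  assumes t: "t \<in> Std bb lam" and u: "u \<in> Std bb lam" and w: "w \<in> Std bb lam"
  shows "inter u t (io (Phi h n lam u t)) (io (Phi h n lam t u))"
    "inter u t (io (Phi h n lam u w \<otimes>\<^bsub>H\<^esub> Phi h n lam w t)) (io (Phi h n lam t w \<otimes>\<^bsub>H\<^esub> Phi h n lam w u))"
  using inter_PhiS[OF u t] inter_comp[OF w inter_PhiS[OF u w] inter_PhiS[OF w t]] t u w by (simp_all add: io_Phi io_hom(2))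

lemma Z2OD_supp: assumes "t \<in> Std bb lam" "\<alpha> \<in> Z2OD bb lam t a" shows "zsupp \<alpha> \<subseteq> Dtab bb lam t"
proof -
  have "zsupp \<alpha> \<subseteq> ODtab bb lam t" using assms by (simp add: Z2OD_def Z2_def)
  also have "\<dots> \<subseteq> Dtab bb lam t" unfolding ODtab_def using xs_diag[OF assms(1)] by blast
  finally show ?thesis .
qed

lemma Tri_parD:
  assumes "(t, \<alpha>, \<beta>) \<in> Tri_par bb lam a"
  shows "t \<in> Std bb lam" "zsupp \<alpha> \<subseteq> Dtab bb lam t" "zsupp \<beta> \<subseteq> {1..n} - Dtab bb lam t"
  using assms Z2OD_supp[of t \<alpha> a] by (auto simp: Tri_par_def Z2_def)

lemma TriD:
  assumes "(t, \<alpha>, \<beta>) \<in> Tri bb lam"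
  shows "t \<in> Std bb lam" "zsupp \<alpha> \<subseteq> Dtab bb lam t" "zsupp \<beta> \<subseteq> {1..n} - Dtab bb lam t"
  using assms Tri_parD[of t \<alpha> \<beta>] unfolding Tri_def by blast+

end

theorem proposition4p32:
  fixes h :: "'k::alg_closed_field hc_datum" and n :: nat
    and star :: "'k hcf_elem \<Rightarrow> 'k hcf_elem" and lam :: mpart and w :: tableau
  assumes "CHAR('k) \<noteq> 2" and "n \<ge> 1"
    and "hq h \<noteq> 0" and "(hq h)\<^sup>2 \<noteq> 1" and "(hq h)\<^sup>2 \<noteq> -1"
    and "\<forall>c \<in> set (hQ h). c \<noteq> 0"
    and "\<forall>a. (hsqrt h a)\<^sup>2 = a"
    and "hc_star h n star"
    and "\<forall>mu \<in> mparts (hbul h) (length (hQ h)) (n + 1). separate h mu"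
    and "lam \<in> mparts (hbul h) (length (hQ h)) n"
    and "w \<in> Std (hbul h) lam"
  shows
    "(dlam (hbul h) lam = 0 \<longrightarrow>
       (\<forall>S \<in> Tri (hbul h) lam. \<forall>T \<in> Tri (hbul h) lam. \<forall>s \<alpha>' \<beta>' t \<alpha> \<beta>.
          S = (s, \<alpha>', \<beta>') \<and> T = (t, \<alpha>, \<beta>) \<longrightarrow>
          (let c = sgn_even (hbul h) lam s (zhat (hbul h) lam s \<alpha>')
                   * sgn_even (hbul h) lam t (zhat (hbul h) lam t \<alpha>)
           in star (f_even h n lam S T) = hS h n c \<otimes>\<^bsub>hcf h n\<^esub>
                f_even h n lam (tri_hat (hbul h) lam T) (tri_hat (hbul h) lam S) \<and>
              star (fw_even h n lam w S T) = hS h n c \<otimes>\<^bsub>hcf h n\<^esub>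
                fw_even h n lam w (tri_hat (hbul h) lam T) (tri_hat (hbul h) lam S))))
     \<and>
     (dlam (hbul h) lam = 1 \<longrightarrow>
       (\<forall>a. \<forall>S \<in> Tri_par (hbul h) lam 0. \<forall>T \<in> Tri_par (hbul h) lam 0. \<forall>s \<alpha>' \<beta>' t \<alpha> \<beta>.
          S = (s, \<alpha>', \<beta>') \<and> T = (t, \<alpha>, \<beta>) \<longrightarrow>
          (let c = sgn_odd (hbul h) lam s (zhat (hbul h) lam s (zext (hbul h) lam s \<alpha>' 1)) 0
                   * sgn_odd (hbul h) lam t
                       (zhat (hbul h) lam t (zext (hbul h) lam t \<alpha> (a + 1))) (a + 1)
           in star (f_odd h n lam S T a) = hS h n c \<otimes>\<^bsub>hcf h n\<^esub>
                f_odd h n lam (tri_hat (hbul h) lam T) (tri_hat (hbul h) lam S) a \<and>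
              star (fw_odd h n lam w S T a) = hS h n c \<otimes>\<^bsub>hcf h n\<^esub>
                fw_odd h n lam w (tri_hat (hbul h) lam T) (tri_hat (hbul h) lam S) a)))"
proof -
  interpret hc_rep h n lam star using assms by unfold_locales auto
  have w: "w \<in> Std bb lam" by fact
  have closed: "Phi h n lam u t \<in> carrier H" "Phi h n lam u w \<otimes>\<^bsub>H\<^esub> Phi h n lam w t \<in> carrier H"
    if "u \<in> Std bb lam" "t \<in> Std bb lam" for u t using io_Phi that w by auto
  show ?thesis
  proof (intro conjI impI allI ballI, unfold Let_def, goal_cases)
    case (1 S T s \<alpha>' \<beta>' t \<alpha> \<beta>)
    then have S: "(s, \<alpha>', \<beta>') \<in> Tri bb lam" and T: "(t, \<alpha>, \<beta>) \<in> Tri bb lam" and e: "S = (s, \<alpha>', \<beta>')" "T = (t, \<alpha>, \<beta>)" by auto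
    note S = TriD[OF S] and T = TriD[OF T]
    \<comment> \<open>The two formulas are instances of the same one, for the intertwiner from t to
      s and for the product of intertwiners through w.\<close>
    show ?case
      unfolding e f_even_def fw_even_def tri_hat_def prod.case
      by (intro conjI f_stars(1)[OF T(1) S(1) inter_Phi(1)[OF T(1) S(1) w] closed(1)[OF S(1) T(1)] closed(1)[OF T(1) S(1)] S(2) T(2) S(3) T(3)]
        f_stars(1)[OF T(1) S(1) inter_Phi(2)[OF T(1) S(1) w] closed(2)[OF S(1) T(1)] closed(2)[OF T(1) S(1)] S(2) T(2) S(3) T(3)])
  next
    case (2 a S T s \<alpha>' \<beta>' t \<alpha> \<beta>)
    then have S: "(s, \<alpha>', \<beta>') \<in> Tri_par bb lam 0" and T: "(t, \<alpha>, \<beta>) \<in> Tri_par bb lam 0" and e: "S = (s, \<alpha>', \<beta>')" "T = (t, \<alpha>, \<beta>)"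
      and o: "odd (tnum bb lam)" by (auto simp: dlam_def odd_iff_mod_2_eq_one)
    note S = Tri_parD[OF S] and T = Tri_parD[OF T]
    show ?case
      unfolding e f_odd_def fw_odd_def tri_hat_def prod.case
      by (intro conjI f_stars(2)[OF T(1) S(1) inter_Phi(1)[OF T(1) S(1) w] closed(1)[OF S(1) T(1)] closed(1)[OF T(1) S(1)] S(2) T(2) S(3) T(3) o]
        f_stars(2)[OF T(1) S(1) inter_Phi(2)[OF T(1) S(1) w] closed(2)[OF S(1) T(1)] closed(2)[OF T(1) S(1)] S(2) T(2) S(3) T(3) o])
  qed
qed

end
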